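(* There exist a family $\mathcal{W}$ of graphons, finite graphs $H_1,\ldots,H_\ell$ and reals $d_1,\ldots,d_\ell$ such that: (i) a graphon $W$ is weakly isomorphic to a graphon contained in $\mathcal{W}$ if and only if $d(H_i,W)=d_i$ for every $i\in[\ell]$; (ii) all graphons in $\mathcal{W}$ have the same non-zero entropy; and (iii) no graphon in $\mathcal{W}$ is finitely forcible.
   Context: A graphon is a symmetric measurable function $W:[0,1)^2\to[0,1]$. For a finite graph $H$, a $W$-random graph of order $|H|$ is obtained by sampling $|H|$ points of $[0,1)$ independently and uniformly, one per vertex, and joining two vertices with probability $W(x,y)$ where $x,y$ are their points; $d(H,W)$ is the probability that this random graph is isomorphic to $H$. Two graphons $W_1,W_2$ are weakly isomorphic if $d(H,W_1)=d(H,W_2)$ for every finite graph $H$. A graphon $W$ is finitely forcible if there exist finite graphs $F_1,\ldots,F_m$ such that every graphon $W'$ with $d(F_i,W')=d(F_i,W)$ for all $i\in[m]$ is weakly isomorphic to $W$. The entropy of a graphon $W$ is $H(W)=\int_{[0,1]^2} W(x,y)\log W(x,y)+(1-W(x,y))\log(1-W(x,y))\,dx\,dy$ (with $0\log 0=0$). *)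

theory Defs
  imports "HOL-Probability.Probability"
begin

text \<open>Finite simple graphs, as pairs of a vertex set and a set of two-element edges. Up to
  isomorphism every finite graph has natural numbers as vertices.\<close>

type_synonym fgraph = "nat set \<times> nat set set"

abbreviation verts :: "fgraph \<Rightarrow> nat set" where "verts \<equiv> fst"
abbreviation edges :: "fgraph \<Rightarrow> nat set set" where "edges \<equiv> snd"

definition finite_graph :: "fgraph \<Rightarrow> bool" where
  "finite_graph G \<longleftrightarrow> finite (verts G) \<and> (\<forall>e\<in>edges G. e \<subseteq> verts G \<and> card e = 2)"

definition graph_iso :: "fgraph \<Rightarrow> fgraph \<Rightarrow> bool" where
  "graph_iso G H \<longleftrightarrow> (\<exists>f. bij_betw f (verts G) (verts H) \<and>
     (\<forall>u\<in>verts G. \<forall>v\<in>verts G. {u, v} \<in> edges G \<longleftrightarrow> {f u, f v} \<in> edges H))"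

abbreviation unit_space :: "real measure" where
  "unit_space \<equiv> restrict_space lborel {0..<1}"

text \<open>Only the values on \<open>[0,1)\<^sup>2\<close> matter; measurability is Borel measurability there.\<close>

definition graphon :: "(real \<Rightarrow> real \<Rightarrow> real) \<Rightarrow> bool" where
  "graphon W \<longleftrightarrow>
     (\<lambda>(x, y). W x y) \<in> borel_measurable (unit_space \<Otimes>\<^sub>M unit_space) \<and>
     (\<forall>x\<in>{0..<1}. \<forall>y\<in>{0..<1}. W x y \<in> {0..1} \<and> W x y = W y x)"

text \<open>The random graph on \<open>{..<n}\<close> for given points \<open>x 0, \<dots>, x (n - 1)\<close>: each pair \<open>u < v\<close> is
  joined independently with probability \<open>W (x u) (x v)\<close>.\<close>

definition sampled_graph_pmf ::
  "nat \<Rightarrow> (real \<Rightarrow> real \<Rightarrow> real) \<Rightarrow> (nat \<Rightarrow> real) \<Rightarrow> fgraph pmf" where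
  "sampled_graph_pmf n W x =
     map_pmf (\<lambda>\<omega>. ({..<n}, {{u, v} | u v. u < v \<and> v < n \<and> \<omega> (u, v)}))
       (Pi_pmf {(u, v). u < v \<and> v < n} False (\<lambda>(u, v). bernoulli_pmf (W (x u) (x v))))"

definition random_graph :: "nat \<Rightarrow> (real \<Rightarrow> real \<Rightarrow> real) \<Rightarrow> fgraph measure" where
  "random_graph n W =
     (\<Pi>\<^sub>M i\<in>{..<n}. unit_space) \<bind> (\<lambda>x. measure_pmf (sampled_graph_pmf n W x))"

definition graph_density :: "fgraph \<Rightarrow> (real \<Rightarrow> real \<Rightarrow> real) \<Rightarrow> real" where
  "graph_density H W = measure (random_graph (card (verts H)) W) {G. graph_iso G H}"

lemma prob_space_unit_space: "prob_space unit_space"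
  by (rule prob_spaceI) (simp add: emeasure_restrict_space space_restrict_space)

lemma sampled_graph_measurable:
  assumes "graphon W"
  shows "(\<lambda>x. measure_pmf (sampled_graph_pmf n W x))
           \<in> (\<Pi>\<^sub>M i\<in>{..<n}. unit_space) \<rightarrow>\<^sub>M subprob_algebra (count_space UNIV)"
proof (rule measurable_subprob_algebra)
  fix A :: "fgraph set"
  let ?M = "\<Pi>\<^sub>M i\<in>{..<n}. unit_space"
  define I where "I = {(u, v). u < v \<and> v < n}"
  define g where "g = (\<lambda>\<omega>. ({..<n}, {{u, v} | u v. u < v \<and> v < n \<and> \<omega> (u, v)}))"
  define S where "S = PiE_dflt I False (\<lambda>_. UNIV :: bool set)"
  have I: "finite I"
    by (rule finite_subset[of _ "{..<n} \<times> {..<n}"]) (auto simp: I_def)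
  have S: "finite S"
    unfolding S_def using I by (intro finite_PiE_dflt) auto
  have W[measurable]: "(\<lambda>p. W (fst p) (snd p)) \<in> borel_measurable (unit_space \<Otimes>\<^sub>M unit_space)"
    using assms by (simp add: graphon_def case_prod_unfold)
  have Wx: "(\<lambda>x. W (x u) (x v)) \<in> borel_measurable ?M" if "(u, v) \<in> I" for u v
  proof -
    have [measurable]: "(\<lambda>x. x u) \<in> ?M \<rightarrow>\<^sub>M unit_space" "(\<lambda>x. x v) \<in> ?M \<rightarrow>\<^sub>M unit_space"
      using that by (auto simp: I_def intro!: measurable_component_singleton)
    have "(\<lambda>x. (x u, x v)) \<in> ?M \<rightarrow>\<^sub>M unit_space \<Otimes>\<^sub>M unit_space" by measurable
    from measurable_compose[OF this W] show ?thesis by simp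
  qed
  have W01: "W (x u) (x v) \<in> {0..1}" if "x \<in> space ?M" "(u, v) \<in> I" for x u v
  proof -
    from that have "x u \<in> {0..<1}" "x v \<in> {0..<1}"
      by (auto simp: space_PiM I_def space_restrict_space PiE_iff)
    with assms show ?thesis by (auto simp: graphon_def)
  qed
  have eq: "emeasure (measure_pmf (sampled_graph_pmf n W x)) A =
      (\<Sum>\<omega>\<in>S \<inter> g -` A. ennreal (\<Prod>(u, v)\<in>I. if \<omega> (u, v) then W (x u) (x v) else 1 - W (x u) (x v)))"
    if x: "x \<in> space ?M" for x
  proof -
    let ?P = "Pi_pmf I False (\<lambda>(u, v). bernoulli_pmf (W (x u) (x v)))"
    have "emeasure (measure_pmf (sampled_graph_pmf n W x)) A = emeasure (measure_pmf ?P) (g -` A)"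
      by (simp add: sampled_graph_pmf_def I_def g_def)
    also have "\<dots> = emeasure (measure_pmf ?P) (S \<inter> g -` A)"
    proof -
      have "set_pmf ?P \<subseteq> S"
        using set_Pi_pmf_subset[OF I, of False "\<lambda>(u, v). bernoulli_pmf (W (x u) (x v))"]
        unfolding S_def PiE_dflt_def by simp
      then show ?thesis
        by (intro emeasure_eq_AE) (auto simp: AE_measure_pmf_iff)
    qed
    also have "\<dots> = (\<Sum>\<omega>\<in>S \<inter> g -` A. ennreal (pmf ?P \<omega>))"
      using S by (simp add: emeasure_measure_pmf_finite)
    also have "\<dots> = (\<Sum>\<omega>\<in>S \<inter> g -` A. ennreal (\<Prod>(u, v)\<in>I.
        if \<omega> (u, v) then W (x u) (x v) else 1 - W (x u) (x v)))"
    proof (intro sum.cong refl arg_cong[where f = ennreal])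
      fix \<omega> assume "\<omega> \<in> S \<inter> g -` A"
      then have "pmf ?P \<omega> = (\<Prod>e\<in>I. pmf (case e of (u, v) \<Rightarrow> bernoulli_pmf (W (x u) (x v))) (\<omega> e))"
        by (intro pmf_Pi') (auto simp: I S_def PiE_dflt_def)
      also have "\<dots> = (\<Prod>(u, v)\<in>I. if \<omega> (u, v) then W (x u) (x v) else 1 - W (x u) (x v))"
        using W01[OF x] by (intro prod.cong) auto
      finally show "pmf ?P \<omega> = \<dots>" .
    qed
    finally show ?thesis .
  qed
  have "(\<lambda>x. \<Sum>\<omega>\<in>S \<inter> g -` A. ennreal (\<Prod>e\<in>I.
      if \<omega> e then W (x (fst e)) (x (snd e)) else 1 - W (x (fst e)) (x (snd e)))) \<in> borel_measurable ?M"
  proof (intro borel_measurable_sum measurable_compose[OF _ measurable_ennreal] borel_measurable_prod)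
    fix \<omega> e assume "e \<in> I"
    then have "(\<lambda>x. W (x (fst e)) (x (snd e))) \<in> borel_measurable ?M"
      by (intro Wx) simp
    then show "(\<lambda>x. if \<omega> e then W (x (fst e)) (x (snd e)) else 1 - W (x (fst e)) (x (snd e)))
        \<in> borel_measurable ?M"
      by (cases "\<omega> e") auto
  qed
  then show "(\<lambda>x. emeasure (measure_pmf (sampled_graph_pmf n W x)) A) \<in> borel_measurable ?M"
    by (subst measurable_cong[OF eq]) (simp_all add: case_prod_unfold)
qed (auto intro: measure_pmf.subprob_space_axioms)

lemma prob_space_random_graph:
  assumes "graphon W"
  shows "prob_space (random_graph n W)"
proof -
  interpret product_prob_space "\<lambda>_. unit_space" "{..<n}"
    by (intro product_prob_spaceI prob_space_unit_space)
  show ?thesis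
    unfolding random_graph_def
    by (rule prob_space_bind[OF _ sampled_graph_measurable[OF assms]])
       (simp add: measure_pmf.prob_space_axioms)
qed

lemma graph_density_eq:
  assumes "graphon W"
  shows "graph_density H W =
    (\<integral>x. measure_pmf.prob (sampled_graph_pmf (card (verts H)) W x) {G. graph_iso G H}
       \<partial>(\<Pi>\<^sub>M i\<in>{..<card (verts H)}. unit_space))"
proof -
  interpret product_prob_space "\<lambda>_. unit_space" "{..<card (verts H)}"
    by (intro product_prob_spaceI prob_space_unit_space)
  show ?thesis
    unfolding graph_density_def random_graph_def
    by (rule measure_bind[OF sampled_graph_measurable[OF assms]]) simp
qed

definition weakly_isomorphic ::
  "(real \<Rightarrow> real \<Rightarrow> real) \<Rightarrow> (real \<Rightarrow> real \<Rightarrow> real) \<Rightarrow> bool" where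
  "weakly_isomorphic W1 W2 \<longleftrightarrow> (\<forall>H. finite_graph H \<longrightarrow> graph_density H W1 = graph_density H W2)"

definition finitely_forcible :: "(real \<Rightarrow> real \<Rightarrow> real) \<Rightarrow> bool" where
  "finitely_forcible W \<longleftrightarrow> (\<exists>\<F>. finite \<F> \<and> (\<forall>F\<in>\<F>. finite_graph F) \<and>
     (\<forall>W'. graphon W' \<longrightarrow> (\<forall>F\<in>\<F>. graph_density F W' = graph_density F W) \<longrightarrow> weakly_isomorphic W' W))"

text \<open>Since \<open>ln 0 = 0\<close>, the convention \<open>0 log 0 = 0\<close> is built in.\<close>

definition graphon_entropy :: "(real \<Rightarrow> real \<Rightarrow> real) \<Rightarrow> real" where
  "graphon_entropy W =
     (\<integral>(x, y). W x y * ln (W x y) + (1 - W x y) * ln (1 - W x y) \<partial>(unit_space \<Otimes>\<^sub>M unit_space))"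

end

theory Submission
  imports Defs
begin

text \<open>
  The family consists of all graphons having the same densities as a suitable step graphon \<open>W\<^sub>0\<close> for all
  graphs with at most \<open>N\<close> vertices. Integrals of polynomials in degrees and codegrees along a fixed
  edge pattern are determined by finitely many densities, so such polynomials, when nonnegative, can
  be prescribed to vanish. The prescribed identities force a block of measure \<open>1/2\<close> on which
  the graphon is constantly \<open>1/2\<close>, and make every other row one of at most countably many; the latter
  form a weighted graph with \<open>0/1\<close> entries and all degrees at most two. Hence the entropy is always
  \<open>- ln 2 / 4\<close>.

  A local condition on the weights of four consecutive vertices forces the paths of this graph to
  contain long stretches of weights \<open>25 w\<^sup>2 5\<^sup>i\<close> and \<open>w / 8 / 2\<^sup>i\<close>, of a length governed by
  \<open>w = 10\<^sup>-\<^sup>h\<close>, that occur with different continuations at both ends. One further density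
  is irrational whereas each single occurrence contributes a rational amount, so there are infinitely many
  occurrences and arbitrarily long stretches. Crossing over two stretches with equal weights changes
  the graphon, but this is visible only to subgraphs meeting every position of the stretch.
\<close>

text \<open>The conclusion concerns every graphon with the prescribed densities, so no shape of the
  components of the weighted graph may be assumed; only rules readable by polynomials are available.
  Masses are readable: if \<open>z\<close> has exactly the neighbours \<open>x\<close> and
  \<open>y\<close>, it is their only common neighbour, so its mass is their codegree, and the mass
  of \<open>x\<close> is the degree of \<open>z\<close> minus the mass of \<open>y\<close>. All
  entropy sits in the constant block, all freedom in the 0/1 part. Along a path the weights at even
  and at odd positions are geometric progressions, one growing by 5 while the other falls by 2.
  Comparing them at the places where they turn gives w * 10^(h+3) = 1: the scale \<open>w\<close> is
  a power of 1/10, which makes single contributions rational and ties the length of a stretch to its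
  scale. Around one left turn the same stretch of weights occurs three times, and two of the
  occurrences differ at both ends; these are crossed over. Irrationality is obtained by counting:
  uncountably many nested sets of cycles give pairwise different values.\<close>

section \<open>Labelled induced densities and homomorphism densities\<close>

definition vpairs :: "nat \<Rightarrow> (nat \<times> nat) set" where
  "vpairs n = {(u, v). u < v \<and> v < n}"

abbreviation points :: "nat \<Rightarrow> (nat \<Rightarrow> real) measure" where
  "points n \<equiv> \<Pi>\<^sub>M i\<in>{..<n}. unit_space"

definition std_graph :: "nat \<Rightarrow> (nat \<times> nat) set \<Rightarrow> fgraph" where
  "std_graph n E = ({..<n}, {{u, v} | u v. (u, v) \<in> E})"

text \<open>The conditional probability, given the points \<open>x\<close>, that the random graph
  has exactly the edge set \<open>E\<close>.\<close>

definition ind_weight :: "nat \<Rightarrow> (real \<Rightarrow> real \<Rightarrow> real) \<Rightarrow> (nat \<times> nat) set \<Rightarrow> (nat \<Rightarrow> real) \<Rightarrow> real" where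
  "ind_weight n W E x = (\<Prod>(u, v)\<in>vpairs n. if (u, v) \<in> E then W (x u) (x v) else 1 - W (x u) (x v))"

definition hom_density :: "nat \<Rightarrow> (nat \<times> nat) set \<Rightarrow> (real \<Rightarrow> real \<Rightarrow> real) \<Rightarrow> real" where
  "hom_density n F W = (\<integral>x. (\<Prod>(u, v)\<in>F. W (x u) (x v)) \<partial>points n)"

text \<open>Edge sets on \<open>{..<n}\<close> represent all graphs with at most \<open>N\<close>
  vertices up to isomorphism, and there are only finitely many of them.\<close>

definition agree :: "nat \<Rightarrow> (real \<Rightarrow> real \<Rightarrow> real) \<Rightarrow> (real \<Rightarrow> real \<Rightarrow> real) \<Rightarrow> bool" where
  "agree N W W' \<longleftrightarrow> (\<forall>n\<le>N. \<forall>E\<in>Pow (vpairs n).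
     graph_density (std_graph n E) W = graph_density (std_graph n E) W')"

lemma finite_vpairs [simp]: "finite (vpairs n)"
  by (rule finite_subset[of _ "{..<n} \<times> {..<n}"]) (auto simp: vpairs_def)

lemma prob_space_points: "prob_space (points n)"
  by (intro prob_space_PiM prob_space_unit_space)

lemma space_unit [simp]: "space unit_space = {0..<1}"
  by (simp add: space_restrict_space)

lemma space_pointsD: "x \<in> space (points n) \<Longrightarrow> u < n \<Longrightarrow> x u \<in> {0..<1}"
  by (auto simp: space_PiM PiE_iff)

lemma graphon_range:
  assumes "graphon W" "a \<in> {0..<1}" "b \<in> {0..<1}"
  shows "0 \<le> W a b" "W a b \<le> 1" "W a b = W b a"
  using assms unfolding graphon_def by auto

lemma graphon_measurable:
  assumes "graphon W"
  shows "(\<lambda>p. W (fst p) (snd p)) \<in> borel_measurable (unit_space \<Otimes>\<^sub>M unit_space)"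
  using assms by (simp add: graphon_def case_prod_unfold)

lemma graphon_measurable_comp:
  assumes "graphon W" "f \<in> N \<rightarrow>\<^sub>M unit_space" "g \<in> N \<rightarrow>\<^sub>M unit_space"
  shows "(\<lambda>x. W (f x) (g x)) \<in> borel_measurable N"
proof -
  have "(\<lambda>x. (f x, g x)) \<in> N \<rightarrow>\<^sub>M unit_space \<Otimes>\<^sub>M unit_space" using assms by measurable
  from measurable_compose[OF this graphon_measurable[OF assms(1)]] show ?thesis by simp
qed

lemma measurable_coord: "u < n \<Longrightarrow> (\<lambda>x. x u) \<in> points n \<rightarrow>\<^sub>M unit_space"
  by (intro measurable_component_singleton) auto

lemma graphon_measurable_points:
  assumes "graphon W" "u < n" "v < n"
  shows "(\<lambda>x. W (x u) (x v)) \<in> borel_measurable (points n)"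
  by (intro graphon_measurable_comp assms(1) measurable_coord assms)

lemma ind_weight_measurable:
  assumes "graphon W"
  shows "ind_weight n W E \<in> borel_measurable (points n)"
proof -
  have "(\<lambda>x. if e \<in> E then W (x (fst e)) (x (snd e)) else 1 - W (x (fst e)) (x (snd e)))
     \<in> borel_measurable (points n)" if "e \<in> vpairs n" for e
  proof -
    have "fst e < n" "snd e < n" using that by (auto simp: vpairs_def)
    then have "(\<lambda>x. W (x (fst e)) (x (snd e))) \<in> borel_measurable (points n)"
      by (rule graphon_measurable_points[OF assms])
    then show ?thesis by (cases "e \<in> E") auto
  qed
  then show ?thesis unfolding ind_weight_def[abs_def] case_prod_unfold
    by (intro borel_measurable_prod) auto
qed

lemma ind_weight_bounds:
  assumes "graphon W" "x \<in> space (points n)"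
  shows "0 \<le> ind_weight n W E x" "ind_weight n W E x \<le> 1"
proof -
  have *: "0 \<le> (case e of (u, v) \<Rightarrow> if (u, v) \<in> E then W (x u) (x v) else 1 - W (x u) (x v)) \<and>
     (case e of (u, v) \<Rightarrow> if (u, v) \<in> E then W (x u) (x v) else 1 - W (x u) (x v)) \<le> 1"
    if "e \<in> vpairs n" for e
  proof (cases e)
    case (Pair u v)
    then have "u < n" "v < n" using that by (auto simp: vpairs_def)
    then show ?thesis
      using graphon_range[OF assms(1) space_pointsD[OF assms(2), of u] space_pointsD[OF assms(2), of v]] Pair
      by auto
  qed
  show "0 \<le> ind_weight n W E x" unfolding ind_weight_def by (rule prod_nonneg) (use * in blast)
  show "ind_weight n W E x \<le> 1" unfolding ind_weight_def by (rule prod_le_1) (use * in blast)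
qed

lemma integrable_points:
  fixes f :: "(nat \<Rightarrow> real) \<Rightarrow> real"
  assumes "f \<in> borel_measurable (points n)" "\<And>x. x \<in> space (points n) \<Longrightarrow> \<bar>f x\<bar> \<le> B"
  shows "integrable (points n) f"
proof -
  interpret prob_space "points n" by (rule prob_space_points)
  show ?thesis by (rule integrable_const_bound[of _ B]) (use assms in auto)
qed

lemma integrable_ind_weight: "graphon W \<Longrightarrow> integrable (points n) (ind_weight n W E)"
  by (rule integrable_points[of _ _ 1]) (auto simp: ind_weight_measurable ind_weight_bounds abs_le_iff
     intro: order_trans[OF _ ind_weight_bounds(1)])

lemma std_graph_inj:
  assumes "E \<in> Pow (vpairs n)" "(u, v) \<in> vpairs n"
  shows "{u, v} \<in> edges (std_graph n E) \<longleftrightarrow> (u, v) \<in> E"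
  using assms by (auto simp: std_graph_def vpairs_def doubleton_eq_iff)

lemma prob_sampled_graph:
  assumes "graphon W" and x: "x \<in> space (points n)"
  shows "measure_pmf.prob (sampled_graph_pmf n W x) S =
    (\<Sum>E\<in>{E\<in>Pow (vpairs n). std_graph n E \<in> S}. ind_weight n W E x)"
proof -
  let ?I = "vpairs n"
  let ?P = "Pi_pmf ?I False (\<lambda>(u, v). bernoulli_pmf (W (x u) (x v)))"
  define D where "D = PiE_dflt ?I False (\<lambda>_. UNIV :: bool set)"
  define g where "g = (\<lambda>\<omega>. ({..<n}, {{u, v} | u v. u < v \<and> v < n \<and> \<omega> (u, v)}))"
  define s where "s = (\<lambda>\<omega>::nat\<times>nat\<Rightarrow>bool. {e\<in>?I. \<omega> e})"
  have fD: "finite D" unfolding D_def by (intro finite_PiE_dflt) auto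
  have gs: "g \<omega> = std_graph n (s \<omega>)" for \<omega>
    by (auto simp: g_def s_def std_graph_def vpairs_def)
  have bij: "bij_betw s D (Pow ?I)"
    by (rule bij_betwI[of _ _ _ "\<lambda>E e. e \<in> E"]) (auto simp: s_def D_def PiE_dflt_def fun_eq_iff)
  have "measure_pmf.prob (sampled_graph_pmf n W x) S = measure_pmf.prob ?P (g -` S)"
    by (simp add: sampled_graph_pmf_def g_def vpairs_def)
  also have "\<dots> = measure_pmf.prob ?P (D \<inter> g -` S)"
  proof -
    have "set_pmf ?P \<subseteq> D"
      using set_Pi_pmf_subset[OF finite_vpairs, of n False "\<lambda>(u, v). bernoulli_pmf (W (x u) (x v))"]
      unfolding D_def PiE_dflt_def by simp
    then show ?thesis
      by (intro measure_pmf.finite_measure_eq_AE) (auto simp: AE_measure_pmf_iff)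
  qed
  also have "\<dots> = (\<Sum>\<omega>\<in>D \<inter> g -` S. pmf ?P \<omega>)"
    using fD by (simp add: measure_measure_pmf_finite)
  also have "\<dots> = (\<Sum>\<omega>\<in>D \<inter> g -` S. ind_weight n W (s \<omega>) x)"
  proof (intro sum.cong refl)
    fix \<omega> assume w: "\<omega> \<in> D \<inter> g -` S"
    then have "pmf ?P \<omega> = (\<Prod>e\<in>?I. pmf (case e of (u, v) \<Rightarrow> bernoulli_pmf (W (x u) (x v))) (\<omega> e))"
      by (intro pmf_Pi') (auto simp: D_def PiE_dflt_def)
    also have "\<dots> = ind_weight n W (s \<omega>) x"
      unfolding ind_weight_def
    proof (intro prod.cong refl)
      fix e assume e: "e \<in> ?I"
      obtain u v where uv: "e = (u, v)" by force
      have "u < n" "v < n" using e uv by (auto simp: vpairs_def)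
      then have "W (x u) (x v) \<in> {0..1}"
        using graphon_range[OF assms(1) space_pointsD[OF x, of u] space_pointsD[OF x, of v]] by auto
      then show "pmf (case e of (u, v) \<Rightarrow> bernoulli_pmf (W (x u) (x v))) (\<omega> e) =
        (case e of (u, v) \<Rightarrow> if (u, v) \<in> s \<omega> then W (x u) (x v) else 1 - W (x u) (x v))"
        using e uv by (cases "\<omega> (u, v)") (auto simp: s_def)
    qed
    finally show "pmf ?P \<omega> = \<dots>" .
  qed
  also have "\<dots> = (\<Sum>E\<in>{E\<in>Pow ?I. std_graph n E \<in> S}. ind_weight n W E x)"
  proof (rule sum.reindex_bij_betw)
    have "s ` (D \<inter> g -` S) = {E\<in>Pow ?I. std_graph n E \<in> S}"
    proof
      show "s ` (D \<inter> g -` S) \<subseteq> {E\<in>Pow ?I. std_graph n E \<in> S}"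
        using bij by (auto simp: bij_betw_def gs)
      show "{E\<in>Pow ?I. std_graph n E \<in> S} \<subseteq> s ` (D \<inter> g -` S)"
      proof
        fix E assume E: "E \<in> {E\<in>Pow ?I. std_graph n E \<in> S}"
        then obtain \<omega> where "\<omega> \<in> D" "E = s \<omega>" using bij unfolding bij_betw_def by blast
        then show "E \<in> s ` (D \<inter> g -` S)" using E by (auto simp: gs)
      qed
    qed
    then show "bij_betw s (D \<inter> g -` S) {E\<in>Pow ?I. std_graph n E \<in> S}"
      using bij by (auto simp: bij_betw_def inj_on_def)
  qed
  finally show ?thesis .
qed

lemma graph_density_sum:
  assumes "graphon W"
  shows "graph_density H W =
    (\<Sum>E\<in>{E\<in>Pow (vpairs (card (verts H))). graph_iso (std_graph (card (verts H)) E) H}.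
       \<integral>x. ind_weight (card (verts H)) W E x \<partial>points (card (verts H)))"
proof -
  let ?n = "card (verts H)"
  have "graph_density H W = (\<integral>x. (\<Sum>E\<in>{E\<in>Pow (vpairs ?n). graph_iso (std_graph ?n E) H}. ind_weight ?n W E x) \<partial>points ?n)"
    unfolding graph_density_eq[OF assms]
    by (intro Bochner_Integration.integral_cong refl) (simp add: prob_sampled_graph[OF assms])
  also have "\<dots> = (\<Sum>E\<in>{E\<in>Pow (vpairs ?n). graph_iso (std_graph ?n E) H}. \<integral>x. ind_weight ?n W E x \<partial>points ?n)"
    by (intro Bochner_Integration.integral_sum integrable_ind_weight assms)
  finally show ?thesis .
qed

text \<open>A vertex permutation acts on unordered pairs; these are encoded as increasing ordered
  pairs, so its action is the minimum and maximum of the images.\<close>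

lemma prod_vpairs_permute:
  fixes h :: "nat \<Rightarrow> nat \<Rightarrow> real"
  assumes f: "bij_betw f {..<n} {..<n}" and sym: "\<And>u v. h u v = h v u"
  shows "(\<Prod>(u, v)\<in>vpairs n. h (f u) (f v)) = (\<Prod>(u, v)\<in>vpairs n. h u v)"
proof -
  define g where "g = (\<lambda>(u, v). (min (f u) (f v), max (f u) (f v)))"
  have ran: "f u < n" if "u < n" for u using f that by (auto simp: bij_betw_def)
  have inj: "f u = f v \<longleftrightarrow> u = v" if "u < n" "v < n" for u v
    using f that by (auto simp: bij_betw_def inj_on_def)
  have ginj: "inj_on g (vpairs n)"
  proof (rule inj_onI)
    fix a b assume ab: "a \<in> vpairs n" "b \<in> vpairs n" "g a = g b"
    obtain u v u' v' where e: "a = (u, v)" "b = (u', v')" by force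
    have l: "u < v" "v < n" "u' < v'" "v' < n" using ab e by (auto simp: vpairs_def)
    have "{f u, f v} = {f u', f v'}" using ab(3) e unfolding g_def
      by (auto simp: min_def max_def split: if_splits)
    then have "{u, v} = {u', v'}" using l inj by (auto simp: doubleton_eq_iff)
    then show "a = b" using l e by (auto simp: doubleton_eq_iff)
  qed
  have gim: "g ` vpairs n \<subseteq> vpairs n"
  proof
    fix y assume "y \<in> g ` vpairs n"
    then obtain u v where *: "u < v" "v < n" "y = g (u, v)" by (auto simp: vpairs_def)
    have "f u \<noteq> f v" using inj[of u v] * by simp
    then show "y \<in> vpairs n" using * ran[of u] ran[of v]
      by (auto simp: g_def vpairs_def min_def max_def)
  qed
  have bij: "bij_betw g (vpairs n) (vpairs n)"
    unfolding bij_betw_def using ginj gim endo_inj_surj[OF finite_vpairs gim ginj] by simp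
  have "(\<Prod>(u, v)\<in>vpairs n. h u v) = (\<Prod>e\<in>vpairs n. case g e of (u, v) \<Rightarrow> h u v)"
    by (rule prod.reindex_bij_betw[OF bij, symmetric])
  also have "\<dots> = (\<Prod>(u, v)\<in>vpairs n. h (f u) (f v))"
    by (intro prod.cong refl) (auto simp: g_def min_def max_def sym)
  finally show ?thesis by simp
qed

lemma integral_points_permute:
  fixes G :: "(nat \<Rightarrow> real) \<Rightarrow> real"
  assumes f: "bij_betw f {..<n} {..<n}" and G: "G \<in> borel_measurable (points n)"
  shows "(\<integral>x. G (\<lambda>i\<in>{..<n}. x (f i)) \<partial>points n) = (\<integral>x. G x \<partial>points n)"
proof -
  have d: "distr (points n) (points n) (\<lambda>\<omega>. \<lambda>i\<in>{..<n}. \<omega> (f i)) = points n"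
    using f by (intro distr_PiM_reindex prob_space_unit_space) (auto simp: bij_betw_def)
  have m: "(\<lambda>\<omega>. \<lambda>i\<in>{..<n}. \<omega> (f i)) \<in> points n \<rightarrow>\<^sub>M points n"
    using f by (intro measurable_restrict measurable_component_singleton) (auto simp: bij_betw_def)
  have "(\<integral>x. G x \<partial>points n) = (\<integral>x. G x \<partial>distr (points n) (points n) (\<lambda>\<omega>. \<lambda>i\<in>{..<n}. \<omega> (f i)))"
    by (simp only: d)
  also have "\<dots> = (\<integral>x. G (\<lambda>i\<in>{..<n}. x (f i)) \<partial>points n)"
    by (rule integral_distr[OF m G])
  finally show ?thesis by simp
qed

text \<open>The points are exchangeable: an isomorphism of the edge sets is moved to the
  coordinates, where it preserves the product measure.\<close>

lemma ind_weight_iso: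
  assumes W: "graphon W" and E: "E \<in> Pow (vpairs n)" "E' \<in> Pow (vpairs n)"
    and iso: "graph_iso (std_graph n E) (std_graph n E')"
  shows "(\<integral>x. ind_weight n W E x \<partial>points n) = (\<integral>x. ind_weight n W E' x \<partial>points n)"
proof -
  from iso obtain f where f: "bij_betw f {..<n} {..<n}"
    and fe: "\<And>u v. u < n \<Longrightarrow> v < n \<Longrightarrow> {u, v} \<in> edges (std_graph n E) \<longleftrightarrow> {f u, f v} \<in> edges (std_graph n E')"
    unfolding graph_iso_def by (auto simp: std_graph_def)
  have ran: "f u < n" if "u < n" for u using f that by (auto simp: bij_betw_def)
  \<comment> \<open>The minimum over both orders makes \<open>h\<close> symmetric for all
    \<open>u\<close> and \<open>v\<close>; \<open>W\<close> itself is symmetric only on the unit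
    interval.\<close>
  define h where "h D x u v = (if {u, v} \<in> edges (std_graph n D) then min (W (x u) (x v)) (W (x v) (x u))
     else 1 - min (W (x u) (x v)) (W (x v) (x u)))" for D x u v
  have h: "ind_weight n W D x = (\<Prod>(u, v)\<in>vpairs n. h D x u v)"
    if "D \<in> Pow (vpairs n)" "x \<in> space (points n)" for D x
    unfolding ind_weight_def
  proof (intro prod.cong refl)
    fix e assume e: "e \<in> vpairs n"
    obtain u v where uv: "e = (u, v)" by force
    have "u < n" "v < n" using e uv by (auto simp: vpairs_def)
    then have "W (x u) (x v) = W (x v) (x u)"
      using graphon_range(3)[OF W space_pointsD[OF that(2), of u] space_pointsD[OF that(2), of v]] by auto
    then show "(case e of (u, v) \<Rightarrow> if (u, v) \<in> D then W (x u) (x v) else 1 - W (x u) (x v)) =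
       (case e of (u, v) \<Rightarrow> h D x u v)"
      using std_graph_inj[OF that(1), of u v] e uv by (simp add: h_def)
  qed
  have "(\<integral>x. ind_weight n W E' x \<partial>points n) = (\<integral>x. ind_weight n W E (\<lambda>i\<in>{..<n}. x (f i)) \<partial>points n)"
  proof (intro Bochner_Integration.integral_cong refl)
    fix x assume x: "x \<in> space (points n)"
    let ?y = "\<lambda>i\<in>{..<n}. x (f i)"
    have y: "?y \<in> space (points n)" using x ran by (auto simp: space_PiM PiE_iff)
    have "ind_weight n W E' x = (\<Prod>(u, v)\<in>vpairs n. h E' x (f u) (f v))"
      unfolding h[OF E(2) x]
      by (rule prod_vpairs_permute[OF f, symmetric]) (simp add: h_def insert_commute min.commute)
    also have "\<dots> = (\<Prod>(u, v)\<in>vpairs n. h E ?y u v)"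
      by (intro prod.cong refl) (auto simp: h_def vpairs_def fe)
    finally show "ind_weight n W E' x = ind_weight n W E ?y" by (simp add: h[OF E(1) y])
  qed
  then show ?thesis using integral_points_permute[OF f ind_weight_measurable[OF W]] by simp
qed

text \<open>A density sums over all labelled copies of a graph, whose integrals are equal. Dividing
  by their number, which does not depend on the graphon, isolates one labelled copy.\<close>

lemma agree_ind_weight:
  assumes W: "graphon W" "graphon W'" and ag: "agree N W W'" "n \<le> N" and E: "E \<in> Pow (vpairs n)"
  shows "(\<integral>x. ind_weight n W E x \<partial>points n) = (\<integral>x. ind_weight n W' E x \<partial>points n)"
proof -
  define C where "C = {E'\<in>Pow (vpairs n). graph_iso (std_graph n E') (std_graph n E)}"
  have fC: "finite C" by (simp add: C_def)
  have "E \<in> C" using E unfolding C_def graph_iso_def by (auto intro!: exI[of _ id])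
  then have cC: "card C > 0" using fC by (auto simp: card_gt_0_iff)
  have [simp]: "card (verts (std_graph n E)) = n" by (simp add: std_graph_def)
  have *: "graph_density (std_graph n E) V = card C * (\<integral>x. ind_weight n V E x \<partial>points n)" if V: "graphon V" for V
  proof -
    have "graph_density (std_graph n E) V = (\<Sum>E'\<in>C. \<integral>x. ind_weight n V E' x \<partial>points n)"
      using graph_density_sum[OF V, of "std_graph n E"] by (simp add: C_def)
    also have "\<dots> = (\<Sum>E'\<in>C. \<integral>x. ind_weight n V E x \<partial>points n)"
      by (intro sum.cong refl ind_weight_iso[OF V]) (use E in \<open>auto simp: C_def\<close>)
    finally show ?thesis by simp
  qed
  have "graph_density (std_graph n E) W = graph_density (std_graph n E) W'"
    using ag E by (auto simp: agree_def)
  then show ?thesis using *[OF W(1)] *[OF W(2)] cC by simp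
qed

text \<open>Expand 1 as the product of \<open>W + (1 - W)\<close> over the pairs outside
  \<open>F\<close>.\<close>

lemma hom_density_ind:
  assumes W: "graphon W" and F: "F \<subseteq> vpairs n"
  shows "hom_density n F W = (\<Sum>X\<in>Pow (vpairs n - F). \<integral>x. ind_weight n W (F \<union> X) x \<partial>points n)"
proof -
  have "(\<Prod>(u, v)\<in>F. W (x u) (x v)) = (\<Sum>X\<in>Pow (vpairs n - F). ind_weight n W (F \<union> X) x)" for x
  proof -
    let ?f = "\<lambda>e. W (x (fst e)) (x (snd e))"
    let ?R = "vpairs n - F"
    have fF: "finite F" using F finite_subset finite_vpairs by blast
    have "1 = (\<Prod>e\<in>?R. ?f e + (1 - ?f e))" by simp
    also have "\<dots> = (\<Sum>X\<in>Pow ?R. (\<Prod>e\<in>X. ?f e) * (\<Prod>e\<in>?R - X. 1 - ?f e))"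
      by (rule prod_add) simp
    finally have "(\<Prod>e\<in>F. ?f e) = (\<Sum>X\<in>Pow ?R. (\<Prod>e\<in>F. ?f e) * ((\<Prod>e\<in>X. ?f e) * (\<Prod>e\<in>?R - X. 1 - ?f e)))"
      by (simp add: sum_distrib_left[symmetric])
    also have "\<dots> = (\<Sum>X\<in>Pow ?R. ind_weight n W (F \<union> X) x)"
    proof (intro sum.cong refl)
      fix X assume X: "X \<in> Pow ?R"
      have fX: "finite X" using X finite_subset[of X "vpairs n"] by auto
      have dec: "vpairs n = (F \<union> X) \<union> (?R - X)" using F X by auto
      let ?g = "\<lambda>e. if e \<in> F \<union> X then ?f e else 1 - ?f e"
      have "ind_weight n W (F \<union> X) x = (\<Prod>e\<in>(F \<union> X) \<union> (?R - X). ?g e)"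
        unfolding ind_weight_def case_prod_unfold using dec by simp
      also have "\<dots> = (\<Prod>e\<in>F \<union> X. ?g e) * (\<Prod>e\<in>?R - X. ?g e)"
        by (rule prod.union_disjoint) (use fF fX X F in auto)
      also have "(\<Prod>e\<in>F \<union> X. ?g e) = (\<Prod>e\<in>F. ?f e) * (\<Prod>e\<in>X. ?f e)"
        by (subst prod.union_disjoint[symmetric]) (use fF fX X in \<open>auto intro!: prod.cong\<close>)
      also have "(\<Prod>e\<in>?R - X. ?g e) = (\<Prod>e\<in>?R - X. 1 - ?f e)"
        by (intro prod.cong) auto
      finally show "(\<Prod>e\<in>F. ?f e) * ((\<Prod>e\<in>X. ?f e) * (\<Prod>e\<in>?R - X. 1 - ?f e)) = ind_weight n W (F \<union> X) x"
        by (simp add: mult.assoc)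
    qed
    finally show ?thesis by (simp add: case_prod_unfold)
  qed
  then show ?thesis unfolding hom_density_def
    by (simp add: Bochner_Integration.integral_sum integrable_ind_weight[OF W])
qed

lemma agree_hom_density:
  assumes "graphon W" "graphon W'" "agree N W W'" "n \<le> N" "F \<subseteq> vpairs n"
  shows "hom_density n F W = hom_density n F W'"
  unfolding hom_density_ind[OF assms(1,5)] hom_density_ind[OF assms(2,5)]
  by (intro sum.cong refl agree_ind_weight[OF assms(1-4)]) (use assms(5) in auto)

section \<open>Densities and polynomials in degrees\<close>

text \<open>The joint codegree of the points with index in \<open>N\<close>, that is, a rooted star
  with its centre integrated out. One and two leaves give \<open>deg\<close> and
  \<open>cod\<close>.\<close>

definition star :: "(real \<Rightarrow> real \<Rightarrow> real) \<Rightarrow> nat set \<Rightarrow> (nat \<Rightarrow> real) \<Rightarrow> real" where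
  "star W N x = (\<integral>z. (\<Prod>j\<in>N. W (x j) z) \<partial>unit_space)"

definition deg :: "(real \<Rightarrow> real \<Rightarrow> real) \<Rightarrow> real \<Rightarrow> real" where
  "deg W a = (\<integral>z. W a z \<partial>unit_space)"

definition cod :: "(real \<Rightarrow> real \<Rightarrow> real) \<Rightarrow> real \<Rightarrow> real \<Rightarrow> real" where
  "cod W a b = (\<integral>z. W a z * W b z \<partial>unit_space)"

text \<open>The functionals are built uniformly in \<open>W\<close>, so the number of vertices
  needed to express one depends on its construction alone.\<close>

inductive star_poly :: "nat \<Rightarrow> ((real \<Rightarrow> real \<Rightarrow> real) \<Rightarrow> (nat \<Rightarrow> real) \<Rightarrow> real) \<Rightarrow> bool" for m where
  const: "star_poly m (\<lambda>W x. c)"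
| star: "N \<subseteq> {..<m} \<Longrightarrow> star_poly m (\<lambda>W x. star W N x)"
| add: "star_poly m f \<Longrightarrow> star_poly m g \<Longrightarrow> star_poly m (\<lambda>W x. f W x + g W x)"
| mult: "star_poly m f \<Longrightarrow> star_poly m g \<Longrightarrow> star_poly m (\<lambda>W x. f W x * g W x)"

definition stat :: "nat \<Rightarrow> (nat \<times> nat) set \<Rightarrow> ((real \<Rightarrow> real \<Rightarrow> real) \<Rightarrow> (nat \<Rightarrow> real) \<Rightarrow> real) \<Rightarrow>
    (real \<Rightarrow> real \<Rightarrow> real) \<Rightarrow> real" where
  "stat m E f W = (\<integral>x. (\<Prod>(u, v)\<in>E. W (x u) (x v)) * f W x \<partial>points m)"

lemma star_poly_diff: "star_poly m f \<Longrightarrow> star_poly m g \<Longrightarrow> star_poly m (\<lambda>W x. f W x - g W x)"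
  using star_poly.add[of m f "\<lambda>W x. -1 * g W x"] star_poly.mult[OF star_poly.const[of m "-1"], of g] by simp

lemma star_poly_power: "star_poly m f \<Longrightarrow> star_poly m (\<lambda>W x. f W x ^ k)"
  by (induction k) (auto intro: star_poly.const[of m 1, simplified] star_poly.mult)

lemma star_poly_prod_list:
  "(\<And>a. a \<in> set as \<Longrightarrow> star_poly m (f a)) \<Longrightarrow> star_poly m (\<lambda>W x. \<Prod>a\<leftarrow>as. f a W x)"
  by (induction as) (auto intro: star_poly.const[of m 1, simplified] star_poly.mult)

lemma star_poly_prod:
  "finite S \<Longrightarrow> (\<And>a. a \<in> S \<Longrightarrow> star_poly m (f a)) \<Longrightarrow> star_poly m (\<lambda>W x. \<Prod>a\<in>S. f a W x)"
  by (induction S rule: finite_induct) (auto intro: star_poly.const[of m 1, simplified] star_poly.mult)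

lemma star_poly_deg: "j < m \<Longrightarrow> star_poly m (\<lambda>W x. deg W (x j))"
  using star_poly.star[of "{j}" m] by (simp add: star_def deg_def)

lemma star_poly_cod: "i < m \<Longrightarrow> j < m \<Longrightarrow> i \<noteq> j \<Longrightarrow> star_poly m (\<lambda>W x. cod W (x i) (x j))"
  using star_poly.star[of "{i, j}" m] by (simp add: star_def cod_def)

lemmas star_poly_intros = star_poly.const star_poly.add star_poly.mult star_poly_diff star_poly_power
  star_poly_deg star_poly_cod

lemma sum_list_mult_product:
  fixes f g :: "_ \<Rightarrow> real"
  shows "(\<Sum>a\<leftarrow>xs. f a) * (\<Sum>b\<leftarrow>ys. g b) = (\<Sum>p\<leftarrow>List.product xs ys. f (fst p) * g (snd p))"
  by (induction xs) (auto simp: distrib_right sum_list_const_mult comp_def)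

text \<open>Sum-of-products form: a coefficient together with the list of stars to be multiplied.
  Each product can be turned into a single homomorphism density.\<close>

definition star_terms :: "nat \<Rightarrow> ((real \<Rightarrow> real \<Rightarrow> real) \<Rightarrow> (nat \<Rightarrow> real) \<Rightarrow> real) \<Rightarrow>
    (real \<times> nat set list) list \<Rightarrow> bool" where
  "star_terms m f T \<longleftrightarrow> (\<forall>p\<in>set T. \<forall>N\<in>set (snd p). N \<subseteq> {..<m}) \<and>
    f = (\<lambda>W x. \<Sum>p\<leftarrow>T. fst p * (\<Prod>N\<leftarrow>snd p. star W N x))"

lemma star_terms_add:
  assumes "star_terms m f T1" "star_terms m g T2"
  shows "star_terms m (\<lambda>W x. f W x + g W x) (T1 @ T2)"
  using assms unfolding star_terms_def by (simp add: ball_Un)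

lemma star_terms_mult:
  assumes "star_terms m f T1" "star_terms m g T2"
  shows "star_terms m (\<lambda>W x. f W x * g W x)
    (map (\<lambda>q. (fst (fst q) * fst (snd q), snd (fst q) @ snd (snd q))) (List.product T1 T2))"
    (is "star_terms m _ ?T")
  unfolding star_terms_def
proof (intro conjI ballI ext)
  fix p N assume "p \<in> set ?T" "N \<in> set (snd p)"
  then obtain q where q: "q \<in> set T1 \<times> set T2" "N \<in> set (snd (fst q)) \<union> set (snd (snd q))"
    by (simp only: set_map set_product) (elim imageE, simp)
  then show "N \<subseteq> {..<m}" using assms unfolding star_terms_def by (metis UnE mem_Times_iff)
next
  fix W x
  define A where "A p = fst p * (\<Prod>N\<leftarrow>snd p. star W N x)" for p :: "real \<times> nat set list"
  have AA: "A (fst p * fst q, snd p @ snd q) = A p * A q" for p q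
    by (simp add: A_def mult_ac)
  have "f W x * g W x = (\<Sum>p\<leftarrow>T1. A p) * (\<Sum>p\<leftarrow>T2. A p)"
    using assms by (simp only: star_terms_def A_def)
  also have "\<dots> = (\<Sum>p\<leftarrow>List.product T1 T2. A (fst p) * A (snd p))"
    by (rule sum_list_mult_product)
  also have "\<dots> = (\<Sum>p\<leftarrow>?T. A p)"
    by (simp only: map_map comp_def AA)
  finally show "f W x * g W x = (\<Sum>p\<leftarrow>?T. fst p * (\<Prod>N\<leftarrow>snd p. star W N x))"
    by (simp only: A_def)
qed

lemma star_poly_normal_form:
  assumes "star_poly m f"
  shows "\<exists>T. star_terms m f T"
  using assms
proof induction
  case (const c)
  have "star_terms m (\<lambda>W x. c) [(c, [])]" by (simp add: star_terms_def)
  then show ?case ..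
next
  case (star N)
  then have "star_terms m (\<lambda>W x. star W N x) [(1, [N])]" by (simp add: star_terms_def)
  then show ?case ..
next
  case (add f g)
  then show ?case by (elim exE) (rule exI, rule star_terms_add)
next
  case (mult f g)
  then show ?case by (elim exE) (rule exI, rule star_terms_mult)
qed

lemma sigma_finite_unit: "sigma_finite_measure unit_space"
  using prob_space_unit_space by (simp add: prob_space_imp_sigma_finite)

lemma prod_graphon_bounds:
  assumes "graphon W" "\<And>u v. (u, v) \<in> E \<Longrightarrow> a u \<in> {0..<1} \<and> a v \<in> {0..<1}"
  shows "0 \<le> (\<Prod>(u, v)\<in>E. W (a u) (a v))" "(\<Prod>(u, v)\<in>E. W (a u) (a v)) \<le> 1"
proof -
  have *: "0 \<le> (case e of (u, v) \<Rightarrow> W (a u) (a v)) \<and> (case e of (u, v) \<Rightarrow> W (a u) (a v)) \<le> 1"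
    if "e \<in> E" for e
    using assms(2)[of "fst e" "snd e"] that graphon_range(1,2)[OF assms(1), of "a (fst e)" "a (snd e)"]
    by (simp add: case_prod_unfold)
  show "0 \<le> (\<Prod>(u, v)\<in>E. W (a u) (a v))" by (rule prod_nonneg) (use * in blast)
  show "(\<Prod>(u, v)\<in>E. W (a u) (a v)) \<le> 1" by (rule prod_le_1) (use * in blast)
qed

lemma prod_graphon_bounds':
  assumes "graphon W" "z \<in> {0..<1}" "\<And>j. j \<in> N \<Longrightarrow> a j \<in> {0..<1}"
  shows "0 \<le> (\<Prod>j\<in>N. W (a j) z)" "(\<Prod>j\<in>N. W (a j) z) \<le> 1"
proof -
  have *: "0 \<le> W (a j) z \<and> W (a j) z \<le> 1" if "j \<in> N" for j
    using graphon_range(1,2)[OF assms(1) assms(3)[OF that] assms(2)] by simp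
  show "0 \<le> (\<Prod>j\<in>N. W (a j) z)" by (rule prod_nonneg) (use * in blast)
  show "(\<Prod>j\<in>N. W (a j) z) \<le> 1" by (rule prod_le_1) (use * in blast)
qed

lemma integrable_unit:
  fixes f :: "real \<Rightarrow> real"
  assumes "f \<in> borel_measurable unit_space" "\<And>x. x \<in> {0..<1} \<Longrightarrow> \<bar>f x\<bar> \<le> B"
  shows "integrable unit_space f"
proof -
  interpret prob_space unit_space by (rule prob_space_unit_space)
  show ?thesis by (rule integrable_const_bound[of _ B]) (use assms in auto)
qed

lemma integral_unit_bounds:
  fixes f :: "real \<Rightarrow> real"
  assumes "\<And>x. x \<in> {0..<1} \<Longrightarrow> 0 \<le> f x \<and> f x \<le> 1"
  shows "0 \<le> (\<integral>z. f z \<partial>unit_space)" "(\<integral>z. f z \<partial>unit_space) \<le> 1"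
proof -
  interpret prob_space unit_space by (rule prob_space_unit_space)
  show "0 \<le> (\<integral>z. f z \<partial>unit_space)"
    by (rule Bochner_Integration.integral_nonneg_AE) (rule AE_I2, use assms in auto)
  show "(\<integral>z. f z \<partial>unit_space) \<le> 1"
  proof (cases "integrable unit_space f")
    case True
    then show ?thesis by (rule integral_le_const) (rule AE_I2, use assms in auto)
  qed (simp add: not_integrable_integral_eq)
qed

lemma star_bounds:
  assumes "graphon W" "\<And>j. j \<in> N \<Longrightarrow> x j \<in> {0..<1}"
  shows "0 \<le> star W N x" "star W N x \<le> 1"
proof -
  have *: "0 \<le> (\<Prod>j\<in>N. W (x j) z) \<and> (\<Prod>j\<in>N. W (x j) z) \<le> 1" if "z \<in> {0..<1}" for z
    by (intro conjI prod_graphon_bounds'[OF assms(1) that]) (erule assms(2))+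
  show "0 \<le> star W N x" "star W N x \<le> 1"
    unfolding star_def by (rule integral_unit_bounds, erule *)+
qed

lemma graphon_sections:
  assumes "graphon W" "a \<in> {0..<1}"
  shows "W a \<in> borel_measurable unit_space"
  by (rule graphon_measurable_comp[OF assms(1)]) (use assms(2) in \<open>auto intro!: measurable_const\<close>)

lemma star_measurable:
  assumes "graphon W" "N \<subseteq> {..<n}"
  shows "star W N \<in> borel_measurable (points n)"
proof -
  interpret sigma_finite_measure unit_space by (rule sigma_finite_unit)
  have "(\<lambda>p. \<Prod>j\<in>N. W (fst p j) (snd p)) \<in> borel_measurable (points n \<Otimes>\<^sub>M unit_space)"
  proof (intro borel_measurable_prod graphon_measurable_comp[OF assms(1)])
    fix j assume "j \<in> N"
    then have "j < n" using assms(2) by auto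
    from measurable_compose[OF measurable_fst measurable_coord[OF this]]
    show "(\<lambda>p. fst p j) \<in> points n \<Otimes>\<^sub>M unit_space \<rightarrow>\<^sub>M unit_space" .
  qed (rule measurable_snd)
  then have "(\<lambda>(x, z). \<Prod>j\<in>N. W (x j) z) \<in> borel_measurable (points n \<Otimes>\<^sub>M unit_space)"
    unfolding case_prod_unfold .
  from borel_measurable_lebesgue_integral[OF this]
  show ?thesis unfolding star_def[abs_def] .
qed

lemma star_poly_measurable:
  assumes "star_poly m f" "graphon W"
  shows "f W \<in> borel_measurable (points m)"
  using assms(1) by induction (auto intro: star_measurable[OF assms(2)])

lemma star_poly_bounded:
  assumes "star_poly m f" "graphon W"
  shows "\<exists>B\<ge>0. \<forall>x\<in>space (points m). \<bar>f W x\<bar> \<le> B"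
  using assms(1)
proof induction
  case (const c)
  show ?case by (rule exI[of _ "\<bar>c\<bar>"]) auto
next
  case (star N)
  show ?case
  proof (intro exI[of _ 1] conjI ballI)
    fix x assume x: "x \<in> space (points m)"
    have xj: "x j \<in> {0..<1}" if "j \<in> N" for j
      by (rule space_pointsD[OF x]) (use star that in auto)
    have "0 \<le> star W N x" "star W N x \<le> 1" by (rule star_bounds[OF assms(2)], erule xj)+
    then show "\<bar>star W N x\<bar> \<le> 1" by simp
  qed simp
next
  case (add f g)
  from add.IH(1) obtain B where B: "B \<ge> 0" "\<forall>x\<in>space (points m). \<bar>f W x\<bar> \<le> B" by (elim exE conjE)
  from add.IH(2) obtain C where C: "C \<ge> 0" "\<forall>x\<in>space (points m). \<bar>g W x\<bar> \<le> C" by (elim exE conjE)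
  show ?case
    by (intro exI[of _ "B + C"] conjI ballI)
       (use B C in \<open>auto intro: order_trans[OF abs_triangle_ineq add_mono]\<close>)
next
  case (mult f g)
  from mult.IH(1) obtain B where B: "B \<ge> 0" "\<forall>x\<in>space (points m). \<bar>f W x\<bar> \<le> B" by (elim exE conjE)
  from mult.IH(2) obtain C where C: "C \<ge> 0" "\<forall>x\<in>space (points m). \<bar>g W x\<bar> \<le> C" by (elim exE conjE)
  show ?case
    by (intro exI[of _ "B * C"] conjI ballI) (use B C in \<open>auto simp: abs_mult intro: mult_mono\<close>)
qed

lemma edge_prod_measurable:
  assumes "graphon W" "E \<subseteq> vpairs n"
  shows "(\<lambda>x. \<Prod>(u, v)\<in>E. W (x u) (x v)) \<in> borel_measurable (points n)"
  unfolding case_prod_unfold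
proof (rule borel_measurable_prod)
  fix e assume "e \<in> E"
  then have "fst e < n" "snd e < n" using assms(2) by (auto simp: vpairs_def)
  then show "(\<lambda>x. W (x (fst e)) (x (snd e))) \<in> borel_measurable (points n)"
    by (rule graphon_measurable_points[OF assms(1)])
qed

lemma edge_prod_bounds:
  assumes "graphon W" "E \<subseteq> vpairs n" "x \<in> space (points n)"
  shows "0 \<le> (\<Prod>(u, v)\<in>E. W (x u) (x v))" "(\<Prod>(u, v)\<in>E. W (x u) (x v)) \<le> 1"
proof -
  have *: "x u \<in> {0..<1} \<and> x v \<in> {0..<1}" if "(u, v) \<in> E" for u v
    using that assms(2) space_pointsD[OF assms(3), of u] space_pointsD[OF assms(3), of v]
    by (auto simp: vpairs_def)
  show "0 \<le> (\<Prod>(u, v)\<in>E. W (x u) (x v))" "(\<Prod>(u, v)\<in>E. W (x u) (x v)) \<le> 1"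
    by (rule prod_graphon_bounds[OF assms(1)], erule *)+
qed

lemma stat_integrable:
  assumes "star_poly m f" "graphon W" "E \<subseteq> vpairs m"
  shows "integrable (points m) (\<lambda>x. (\<Prod>(u, v)\<in>E. W (x u) (x v)) * f W x)"
proof -
  from star_poly_bounded[OF assms(1,2)] obtain B where B: "\<forall>x\<in>space (points m). \<bar>f W x\<bar> \<le> B"
    by (elim exE conjE)
  show ?thesis
  proof (rule integrable_points[of _ _ B])
    show "(\<lambda>x. (\<Prod>(u, v)\<in>E. W (x u) (x v)) * f W x) \<in> borel_measurable (points m)"
      by (rule borel_measurable_times[OF edge_prod_measurable[OF assms(2,3)] star_poly_measurable[OF assms(1,2)]])
    fix x assume x: "x \<in> space (points m)"
    have "\<bar>\<Prod>(u, v)\<in>E. W (x u) (x v)\<bar> \<le> 1" using edge_prod_bounds[OF assms(2,3) x] by linarith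
    moreover have "\<bar>f W x\<bar> \<le> B" using B x by (rule bspec)
    ultimately have "\<bar>\<Prod>(u, v)\<in>E. W (x u) (x v)\<bar> * \<bar>f W x\<bar> \<le> 1 * B"
      by (intro mult_mono) auto
    then show "\<bar>(\<Prod>(u, v)\<in>E. W (x u) (x v)) * f W x\<bar> \<le> B" by (simp add: abs_mult)
  qed
qed

lemma integral_points_Suc:
  fixes G :: "(nat \<Rightarrow> real) \<Rightarrow> real"
  assumes "integrable (points (Suc n)) G"
  shows "(\<integral>x. G x \<partial>points (Suc n)) = (\<integral>x. (\<integral>y. G (x(n := y)) \<partial>unit_space) \<partial>points n)"
proof -
  interpret product_sigma_finite "\<lambda>_::nat. unit_space"
    by (simp add: product_sigma_finite_def sigma_finite_unit)
  show ?thesis unfolding lessThan_Suc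
    by (rule product_integral_insert) (use assms in \<open>auto simp: lessThan_Suc\<close>)
qed

text \<open>Every star factor contributes one new vertex, its centre, joined to the roots in
  \<open>N\<close>; by Fubini it can be integrated last. The roots stay below \<open>m\<close>, so
  the remaining factors do not see the new coordinate.\<close>

lemma star_product_hom:
  assumes "m \<le> n" "F \<subseteq> vpairs n" "\<forall>N\<in>set Ls. N \<subseteq> {..<m}"
  shows "\<exists>F'\<subseteq>vpairs (n + length Ls). \<forall>W. graphon W \<longrightarrow>
    (\<integral>x. (\<Prod>(u, v)\<in>F. W (x u) (x v)) * (\<Prod>N\<leftarrow>Ls. star W N x) \<partial>points n) = hom_density (n + length Ls) F' W"
  using assms
proof (induction Ls arbitrary: n F)
  case Nil
  then show ?case by (auto simp: hom_density_def)
next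
  case (Cons N Ls)
  have N: "N \<subseteq> {..<m}" "finite N" using Cons.prems finite_subset by auto
  define F1 where "F1 = F \<union> (\<lambda>j. (j, n)) ` N"
  have F1: "F1 \<subseteq> vpairs (Suc n)" using Cons.prems N by (auto simp: F1_def vpairs_def)
  have fF: "finite F" using Cons.prems(2) finite_subset finite_vpairs by blast
  obtain F' where F': "F' \<subseteq> vpairs (Suc n + length Ls)" and eq: "\<And>W. graphon W \<Longrightarrow>
    (\<integral>x. (\<Prod>(u, v)\<in>F1. W (x u) (x v)) * (\<Prod>N\<leftarrow>Ls. star W N x) \<partial>points (Suc n)) = hom_density (Suc n + length Ls) F' W"
    using Cons.IH[of "Suc n" F1] Cons.prems F1 by auto
  have "(\<integral>x. (\<Prod>(u, v)\<in>F. W (x u) (x v)) * (\<Prod>N\<leftarrow>N # Ls. star W N x) \<partial>points n) =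
      (\<integral>x. (\<Prod>(u, v)\<in>F1. W (x u) (x v)) * (\<Prod>N\<leftarrow>Ls. star W N x) \<partial>points (Suc n))" if W: "graphon W" for W
  proof -
    let ?G = "\<lambda>x. (\<Prod>(u, v)\<in>F1. W (x u) (x v)) * (\<Prod>N\<leftarrow>Ls. star W N x)"
    have sp: "star_poly (Suc n) (\<lambda>W x. \<Prod>N\<leftarrow>Ls. star W N x)"
    proof (intro star_poly_prod_list star_poly.star)
      fix K assume "K \<in> set Ls"
      then have "K \<subseteq> {..<m}" using Cons.prems(3) by simp
      then show "K \<subseteq> {..<Suc n}" using Cons.prems(1) by auto
    qed
    have int: "integrable (points (Suc n)) ?G" using stat_integrable[OF sp W F1] .
    have "(\<integral>y. ?G (x(n := y)) \<partial>unit_space) = (\<Prod>(u, v)\<in>F. W (x u) (x v)) * (\<Prod>N\<leftarrow>N # Ls. star W N x)"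
      for x
    proof -
      have st: "star W K (x(n := y)) = star W K x" if "K \<in> set Ls" for K y
      proof -
        have "K \<subseteq> {..<m}" using that Cons.prems(3) by simp
        then have "n \<notin> K" using Cons.prems(1) by auto
        then show ?thesis unfolding star_def
          by (intro Bochner_Integration.integral_cong refl prod.cong) auto
      qed
      have "(\<Prod>(u, v)\<in>F1. W ((x(n := y)) u) ((x(n := y)) v)) =
        (\<Prod>(u, v)\<in>F. W (x u) (x v)) * (\<Prod>j\<in>N. W (x j) y)" for y
      proof -
        have "(\<Prod>(u, v)\<in>F1. W ((x(n := y)) u) ((x(n := y)) v)) =
          (\<Prod>(u, v)\<in>F. W ((x(n := y)) u) ((x(n := y)) v)) * (\<Prod>(u, v)\<in>(\<lambda>j. (j, n)) ` N. W ((x(n := y)) u) ((x(n := y)) v))"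
          unfolding F1_def using Cons.prems(2) N fF by (intro prod.union_disjoint) (auto simp: vpairs_def)
        also have "(\<Prod>(u, v)\<in>F. W ((x(n := y)) u) ((x(n := y)) v)) = (\<Prod>(u, v)\<in>F. W (x u) (x v))"
          using Cons.prems(2) by (intro prod.cong) (auto simp: vpairs_def)
        also have "(\<Prod>(u, v)\<in>(\<lambda>j. (j, n)) ` N. W ((x(n := y)) u) ((x(n := y)) v)) = (\<Prod>j\<in>N. W (x j) y)"
          using N Cons.prems(1) by (subst prod.reindex) (auto simp: inj_on_def intro!: prod.cong)
        finally show ?thesis .
      qed
      moreover have "(\<Prod>N\<leftarrow>Ls. star W N (x(n := y))) = (\<Prod>N\<leftarrow>Ls. star W N x)" for y
        using st by (metis (no_types, lifting) map_cong)
      ultimately show ?thesis by (simp add: star_def mult_ac)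
    qed
    then show ?thesis using integral_points_Suc[OF int] by simp
  qed
  then show ?case using F' eq by (intro exI[of _ F']) auto
qed

theorem stat_determined:
  assumes f: "star_poly m f" and E: "E \<subseteq> vpairs m"
  shows "\<exists>N. \<forall>W W'. graphon W \<longrightarrow> graphon W' \<longrightarrow> agree N W W' \<longrightarrow> stat m E f W = stat m E f W'"
proof -
  obtain T :: "(real \<times> nat set list) list" where T: "\<forall>p\<in>set T. \<forall>N\<in>set (snd p). N \<subseteq> {..<m}"
    "\<And>W x. f W x = (\<Sum>p\<leftarrow>T. fst p * (\<Prod>N\<leftarrow>snd p. star W N x))"
    using star_poly_normal_form[OF f] by (auto simp: star_terms_def)
  have "\<forall>p. \<exists>F. p \<in> set T \<longrightarrow> F \<subseteq> vpairs (m + length (snd p)) \<and> (\<forall>W. graphon W \<longrightarrow>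
    stat m E (\<lambda>W x. \<Prod>N\<leftarrow>snd p. star W N x) W = hom_density (m + length (snd p)) F W)"
    using star_product_hom[OF order_refl E] T(1) unfolding stat_def by blast
  then obtain F where F: "\<And>p. p \<in> set T \<Longrightarrow> F p \<subseteq> vpairs (m + length (snd p))"
    "\<And>p W. p \<in> set T \<Longrightarrow> graphon W \<Longrightarrow>
      stat m E (\<lambda>W x. \<Prod>N\<leftarrow>snd p. star W N x) W = hom_density (m + length (snd p)) (F p) W" by metis
  \<comment> \<open>A crude common bound for the number of vertices used by any single term.\<close>
  define N where "N = (\<Sum>p\<leftarrow>T. m + length (snd p))"
  have N: "m + length (snd p) \<le> N" if "p \<in> set T" for p
    unfolding N_def using that by (intro member_le_sum_list) auto
  have sp: "star_poly m (\<lambda>W x. \<Prod>N\<leftarrow>snd p. star W N x)" if "p \<in> set T" for p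
    using T(1) that by (intro star_poly_prod_list star_poly.star) auto
  have *: "stat m E f W = (\<Sum>p\<leftarrow>T. fst p * hom_density (m + length (snd p)) (F p) W)" if W: "graphon W" for W
  proof -
    let ?P = "\<lambda>x. \<Prod>(u, v)\<in>E. W (x u) (x v)"
    have "stat m E f W = (\<integral>x. (\<Sum>p\<leftarrow>T. fst p * (?P x * (\<Prod>N\<leftarrow>snd p. star W N x))) \<partial>points m)"
      unfolding stat_def T(2) by (simp add: sum_list_const_mult[symmetric] mult_ac)
    also have "\<dots> = (\<Sum>p\<leftarrow>T. fst p * stat m E (\<lambda>W x. \<Prod>N\<leftarrow>snd p. star W N x) W)"
      using sp
    proof (induction T)
      case (Cons p T)
      have i: "integrable (points m) (\<lambda>x. ?P x * (\<Prod>N\<leftarrow>snd q. star W N x))" if "q \<in> set (p # T)" for q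
        using stat_integrable[OF Cons.prems[OF that] W E] .
      have j: "integrable (points m) (\<lambda>x. \<Sum>p\<leftarrow>T'. fst p * (?P x * (\<Prod>N\<leftarrow>snd p. star W N x)))"
        if "set T' \<subseteq> set (p # T)" for T'
        using that by (induction T') (auto intro!: Bochner_Integration.integrable_add integrable_mult_right i)
      have ip: "integrable (points m) (\<lambda>x. fst p * (?P x * (\<Prod>N\<leftarrow>snd p. star W N x)))"
        by (rule integrable_mult_right[OF i]) simp
      have IH: "(\<integral>x. (\<Sum>p\<leftarrow>T. fst p * (?P x * (\<Prod>N\<leftarrow>snd p. star W N x))) \<partial>points m) =
        (\<Sum>p\<leftarrow>T. fst p * stat m E (\<lambda>W x. \<Prod>N\<leftarrow>snd p. star W N x) W)"
        by (rule Cons.IH) (rule Cons.prems, simp)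
      show ?case
        unfolding list.map sum_list.Cons
          Bochner_Integration.integral_add[OF ip j[OF set_subset_Cons]] IH
        by (simp add: stat_def)
    qed simp
    also have "\<dots> = (\<Sum>p\<leftarrow>T. fst p * hom_density (m + length (snd p)) (F p) W)"
      using F(2)[OF _ W] by (metis (no_types, lifting) map_cong)
    finally show ?thesis .
  qed
  show ?thesis
  proof (intro exI[of _ N] allI impI)
    fix W W' assume a: "graphon W" "graphon W'" "agree N W W'"
    have "hom_density (m + length (snd p)) (F p) W = hom_density (m + length (snd p)) (F p) W'" if "p \<in> set T" for p
      by (rule agree_hom_density[OF a N[OF that] F(1)[OF that]])
    then have "map (\<lambda>p. fst p * hom_density (m + length (snd p)) (F p) W) T =
      map (\<lambda>p. fst p * hom_density (m + length (snd p)) (F p) W') T" by auto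
    then show "stat m E f W = stat m E f W'"
      unfolding *[OF a(1)] *[OF a(2)] by (rule arg_cong)
  qed
qed

lemma stat_zero_AE:
  assumes f: "star_poly m f" and W: "graphon W" and E: "E \<subseteq> vpairs m" and z: "stat m E f W = 0"
    and nn: "\<And>x. x \<in> space (points m) \<Longrightarrow> 0 \<le> f W x"
  shows "AE x in points m. (\<Prod>(u, v)\<in>E. W (x u) (x v)) * f W x = 0"
proof -
  have "AE x in points m. 0 \<le> (\<Prod>(u, v)\<in>E. W (x u) (x v)) * f W x"
    by (rule AE_I2) (use edge_prod_bounds[OF W E] nn in auto)
  from integral_nonneg_eq_0_iff_AE[OF stat_integrable[OF f W E] this] z
  show ?thesis by (simp add: stat_def)
qed

lemma weakly_isomorphic_agree: "weakly_isomorphic W W' \<Longrightarrow> agree N W W'"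
  unfolding weakly_isomorphic_def agree_def
proof (intro allI ballI impI)
  fix n E assume a: "\<forall>H. finite_graph H \<longrightarrow> graph_density H W = graph_density H W'" "E \<in> Pow (vpairs n)"
  have "finite_graph (std_graph n E)" using a(2) by (auto simp: finite_graph_def std_graph_def vpairs_def)
  then show "graph_density (std_graph n E) W = graph_density (std_graph n E) W'" using a(1) by blast
qed

text \<open>The powers of \<open>f\<close> tend to the indicator of the set where \<open>f\<close>
  equals 1. Each power is again a star polynomial, hence determined by densities, and dominated
  convergence carries the equality to the limit. Thus weak isomorphism preserves statistics that
  depend on exact values of degrees.\<close>

lemma weakly_isomorphic_level_set:
  assumes W: "graphon W" "graphon W'" and iso: "weakly_isomorphic W W'"
    and f: "star_poly m f" and E: "E \<subseteq> vpairs m"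
    and f01: "\<And>V x. graphon V \<Longrightarrow> x \<in> space (points m) \<Longrightarrow> 0 \<le> f V x \<and> f V x \<le> 1"
  shows "(\<integral>x. (\<Prod>(u, v)\<in>E. W (x u) (x v)) * (if f W x = 1 then 1 else 0) \<partial>points m) =
         (\<integral>x. (\<Prod>(u, v)\<in>E. W' (x u) (x v)) * (if f W' x = 1 then 1 else 0) \<partial>points m)"
proof -
  have eq: "stat m E (\<lambda>W x. f W x ^ k) W = stat m E (\<lambda>W x. f W x ^ k) W'" for k
    using stat_determined[OF star_poly_power[OF f] E, of k] weakly_isomorphic_agree[OF iso] W by blast
  have lim: "(\<lambda>k. stat m E (\<lambda>W x. f W x ^ k) V) \<longlonglongrightarrow>
      (\<integral>x. (\<Prod>(u, v)\<in>E. V (x u) (x v)) * (if f V x = 1 then 1 else 0) \<partial>points m)" if V: "graphon V" for V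
    unfolding stat_def
  proof (rule integral_dominated_convergence[where w = "\<lambda>_. 1"])
    interpret prob_space "points m" by (rule prob_space_points)
    have fm: "f V \<in> borel_measurable (points m)" by (rule star_poly_measurable[OF f V])
    show "(\<lambda>x. (\<Prod>(u, v)\<in>E. V (x u) (x v)) * (if f V x = 1 then 1 else 0)) \<in> borel_measurable (points m)"
      using edge_prod_measurable[OF V E] fm by measurable
    show "(\<lambda>x. (\<Prod>(u, v)\<in>E. V (x u) (x v)) * f V x ^ k) \<in> borel_measurable (points m)" for k
      using edge_prod_measurable[OF V E] fm by measurable
    show "integrable (points m) (\<lambda>_. 1 :: real)" by simp
    show "AE x in points m. (\<lambda>k. (\<Prod>(u, v)\<in>E. V (x u) (x v)) * f V x ^ k)
        \<longlonglongrightarrow> (\<Prod>(u, v)\<in>E. V (x u) (x v)) * (if f V x = 1 then 1 else 0)"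
    proof (rule AE_I2)
      fix x assume x: "x \<in> space (points m)"
      have "(\<lambda>k. f V x ^ k) \<longlonglongrightarrow> (if f V x = 1 then 1 else 0)"
        using f01[OF V x] by (auto intro!: LIMSEQ_power_zero)
      then show "(\<lambda>k. (\<Prod>(u, v)\<in>E. V (x u) (x v)) * f V x ^ k)
        \<longlonglongrightarrow> (\<Prod>(u, v)\<in>E. V (x u) (x v)) * (if f V x = 1 then 1 else 0)"
        by (intro tendsto_mult tendsto_const)
    qed
    show "AE x in points m. norm ((\<Prod>(u, v)\<in>E. V (x u) (x v)) * f V x ^ k) \<le> 1" for k
    proof (rule AE_I2)
      fix x assume x: "x \<in> space (points m)"
      show "norm ((\<Prod>(u, v)\<in>E. V (x u) (x v)) * f V x ^ k) \<le> 1"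
        using edge_prod_bounds[OF V E x] f01[OF V x]
        by (auto simp: abs_mult intro!: mult_le_one power_le_one)
    qed
  qed
  show ?thesis using LIMSEQ_unique[OF lim[OF W(1)]] lim[OF W(2)] eq by simp
qed

section \<open>Pairs of points, degrees and codegrees on the unit square\<close>

interpretation unit: prob_space unit_space by (rule prob_space_unit_space)
interpretation unit2: pair_prob_space unit_space unit_space ..

abbreviation usq :: "(real \<times> real) measure" where "usq \<equiv> unit_space \<Otimes>\<^sub>M unit_space"

lemma distr_points_pair:
  assumes "u < n" "v < n" "u \<noteq> v"
  shows "distr (points n) usq (\<lambda>x. (x u, x v)) = usq"
proof -
  interpret product_prob_space "\<lambda>_. unit_space" "{..<n}"
    by (intro product_prob_spaceI prob_space_unit_space)
  have [measurable]: "(\<lambda>x. x u) \<in> points n \<rightarrow>\<^sub>M unit_space" "(\<lambda>x. x v) \<in> points n \<rightarrow>\<^sub>M unit_space"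
    using assms by (auto intro: measurable_coord)
  have m: "(\<lambda>x. (x u, x v)) \<in> points n \<rightarrow>\<^sub>M usq" by measurable
  have "usq = distr (points n) usq (\<lambda>x. (x u, x v))"
  proof (rule pair_measure_eqI)
    show "sigma_finite_measure unit_space" "sigma_finite_measure unit_space" by (rule sigma_finite_unit)+
    show "sets usq = sets (distr (points n) usq (\<lambda>x. (x u, x v)))" by simp
    fix A B assume A: "A \<in> sets unit_space" "B \<in> sets unit_space"
    define X where "X i = (if i = u then A else B)" for i
    have "emeasure (distr (points n) usq (\<lambda>x. (x u, x v))) (A \<times> B) =
        emeasure (points n) ((\<lambda>x. (x u, x v)) -` (A \<times> B) \<inter> space (points n))"
      using A by (intro emeasure_distr m) auto
    also have "(\<lambda>x. (x u, x v)) -` (A \<times> B) \<inter> space (points n) = {x\<in>space (points n). \<forall>i\<in>{u, v}. x i \<in> X i}"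
      using assms by (auto simp: X_def)
    also have "emeasure (points n) \<dots> = (\<Prod>i\<in>{u, v}. emeasure unit_space (X i))"
      using assms A by (intro emeasure_PiM_Collect) (auto simp: X_def)
    also have "\<dots> = emeasure unit_space A * emeasure unit_space B"
      using assms by (simp add: X_def)
    finally show "emeasure unit_space A * emeasure unit_space B =
      emeasure (distr (points n) usq (\<lambda>x. (x u, x v))) (A \<times> B)" by simp
  qed
  then show ?thesis by simp
qed

lemma AE_points_pair:
  assumes "u < n" "v < n" "u \<noteq> v" and P: "Measurable.pred usq P"
  shows "(AE x in points n. P (x u, x v)) \<longleftrightarrow> (AE p in usq. P p)"
proof -
  have [measurable]: "(\<lambda>x. x u) \<in> points n \<rightarrow>\<^sub>M unit_space" "(\<lambda>x. x v) \<in> points n \<rightarrow>\<^sub>M unit_space"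
    using assms by (auto intro: measurable_coord)
  have m: "(\<lambda>x. (x u, x v)) \<in> points n \<rightarrow>\<^sub>M usq" by measurable
  have "(AE p in distr (points n) usq (\<lambda>x. (x u, x v)). P p) \<longleftrightarrow> (AE x in points n. P (x u, x v))"
    by (rule AE_distr_iff[OF m]) (use P in measurable)
  then show ?thesis by (simp only: distr_points_pair[OF assms(1-3)])
qed

lemma AE_points_pairI:
  assumes "u < n" "v < n" "u \<noteq> v" and "AE p in usq. P p"
  shows "AE x in points n. P (x u, x v)"
proof -
  have [measurable]: "(\<lambda>x. x u) \<in> points n \<rightarrow>\<^sub>M unit_space" "(\<lambda>x. x v) \<in> points n \<rightarrow>\<^sub>M unit_space"
    using assms by (auto intro: measurable_coord)
  have m: "(\<lambda>x. (x u, x v)) \<in> points n \<rightarrow>\<^sub>M usq" by measurable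
  have "AE p in distr (points n) usq (\<lambda>x. (x u, x v)). P p"
    using assms(4) by (simp only: distr_points_pair[OF assms(1-3)])
  from AE_distrD[OF m this] show ?thesis .
qed

lemma integral_points_pair:
  fixes g :: "real \<times> real \<Rightarrow> real"
  assumes "u < n" "v < n" "u \<noteq> v" and g: "g \<in> borel_measurable usq"
  shows "(\<integral>x. g (x u, x v) \<partial>points n) = (\<integral>p. g p \<partial>usq)"
proof -
  have [measurable]: "(\<lambda>x. x u) \<in> points n \<rightarrow>\<^sub>M unit_space" "(\<lambda>x. x v) \<in> points n \<rightarrow>\<^sub>M unit_space"
    using assms by (auto intro: measurable_coord)
  have m: "(\<lambda>x. (x u, x v)) \<in> points n \<rightarrow>\<^sub>M usq" by measurable
  from integral_distr[OF m g] show ?thesis by (simp only: distr_points_pair[OF assms(1-3)])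
qed

lemma distr_points_coord:
  assumes "u < n"
  shows "distr (points n) unit_space (\<lambda>x. x u) = unit_space"
proof -
  interpret product_prob_space "\<lambda>_. unit_space" "{..<n}"
    by (intro product_prob_spaceI prob_space_unit_space)
  show ?thesis by (rule PiM_component) (use assms in auto)
qed

lemma deg_measurable:
  assumes "graphon W"
  shows "deg W \<in> borel_measurable unit_space"
proof -
  have "(\<lambda>(a, z). W a z) \<in> borel_measurable usq" using assms by (simp add: graphon_def)
  from unit.borel_measurable_lebesgue_integral[OF this] show ?thesis unfolding deg_def[abs_def] .
qed

lemma cod_measurable:
  assumes "graphon W"
  shows "(\<lambda>p. cod W (fst p) (snd p)) \<in> borel_measurable usq"
proof -
  have "(\<lambda>q. W (fst (fst q)) (snd q) * W (snd (fst q)) (snd q)) \<in> borel_measurable (usq \<Otimes>\<^sub>M unit_space)"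
    by (intro borel_measurable_times graphon_measurable_comp[OF assms]) measurable
  then have "(\<lambda>(p, z). W (fst p) z * W (snd p) z) \<in> borel_measurable (usq \<Otimes>\<^sub>M unit_space)"
    unfolding case_prod_unfold .
  from unit.borel_measurable_lebesgue_integral[OF this] show ?thesis unfolding cod_def[abs_def] .
qed

lemma deg_bounds: "graphon W \<Longrightarrow> a \<in> {0..<1} \<Longrightarrow> 0 \<le> deg W a \<and> deg W a \<le> 1"
  unfolding deg_def using integral_unit_bounds[of "W a"] graphon_range(1,2)[of W a] by simp

lemma cod_sym: "cod W a b = cod W b a"
  unfolding cod_def by (simp add: mult.commute)

lemma integrable_section: "graphon W \<Longrightarrow> a \<in> {0..<1} \<Longrightarrow> integrable unit_space (W a)"
  by (rule integrable_unit[of _ 1]) (auto simp: graphon_sections graphon_range(1,2))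

lemma integrable_section_mult:
  assumes "graphon W" "a \<in> {0..<1}" "b \<in> {0..<1}"
  shows "integrable unit_space (\<lambda>z. W a z * W b z)"
proof (rule integrable_unit[of _ 1])
  show "(\<lambda>z. W a z * W b z) \<in> borel_measurable unit_space"
    by (intro borel_measurable_times graphon_sections assms)
  fix z :: real assume z: "z \<in> {0..<1}"
  show "\<bar>W a z * W b z\<bar> \<le> 1"
    using graphon_range(1,2)[OF assms(1,2) z] graphon_range(1,2)[OF assms(1,3) z]
    by (simp add: abs_mult mult_le_one)
qed

section \<open>Twin points and constant codegrees\<close>

definition cls :: "(real \<Rightarrow> real \<Rightarrow> real) \<Rightarrow> real \<Rightarrow> real set" where
  "cls W a = {b\<in>{0..<1}. AE z in unit_space. W a z = W b z}"

text \<open>The difference of degree and codegree is the integral of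
  \<open>W a z * (1 - W b z)\<close>, whose integrand is nonnegative. If both such products vanish,
  the two values are equal and lie in {0, 1}.\<close>

lemma twin_rows:
  assumes W: "graphon W" and ab: "a \<in> {0..<1}" "b \<in> {0..<1}"
    and e: "cod W a b = deg W a" "cod W a b = deg W b"
  shows "AE z in unit_space. W a z = W b z \<and> (W a z = 0 \<or> W a z = 1)"
proof -
  have *: "AE z in unit_space. W c z * (1 - W d z) = 0"
    if cd: "c \<in> {0..<1}" "d \<in> {0..<1}" "cod W c d = deg W c" for c d
  proof -
    have eq: "(\<lambda>z. W c z * (1 - W d z)) = (\<lambda>z. W c z - W c z * W d z)" by (auto simp: algebra_simps)
    have i: "integrable unit_space (\<lambda>z. W c z * (1 - W d z))" unfolding eq
      by (rule Bochner_Integration.integrable_diff[OF integrable_section[OF W cd(1)] integrable_section_mult[OF W cd(1,2)]])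
    have "(\<integral>z. W c z * (1 - W d z) \<partial>unit_space) = deg W c - cod W c d"
      unfolding eq deg_def cod_def
      by (rule Bochner_Integration.integral_diff[OF integrable_section[OF W cd(1)] integrable_section_mult[OF W cd(1,2)]])
    moreover have "AE z in unit_space. 0 \<le> W c z * (1 - W d z)"
      by (rule AE_I2) (simp add: graphon_range(1,2)[OF W cd(1)] graphon_range(1,2)[OF W cd(2)])
    ultimately show ?thesis using integral_nonneg_eq_0_iff_AE[OF i] cd(3) by simp
  qed
  have "AE z in unit_space. W a z * (1 - W b z) = 0" "AE z in unit_space. W b z * (1 - W a z) = 0"
    using *[OF ab e(1)] *[OF ab(2,1)] e(2) cod_sym[of W a b] by simp_all
  then show ?thesis by eventually_elim auto
qed

text \<open>The class is the zero set of the L1 distance between rows, a measurable function by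
  Fubini.\<close>

lemma cls_measurable:
  assumes W: "graphon W" and a: "a \<in> {0..<1}"
  shows "cls W a \<in> sets unit_space"
proof -
  have m: "(\<lambda>(b, z). \<bar>W a z - W b z\<bar>) \<in> borel_measurable usq"
    unfolding case_prod_unfold
    by (intro borel_measurable_abs borel_measurable_diff graphon_measurable_comp[OF W])
       (use a in \<open>auto intro!: measurable_const\<close>)
  have M: "(\<lambda>b. \<integral>z. \<bar>W a z - W b z\<bar> \<partial>unit_space) \<in> borel_measurable unit_space"
    by (rule unit.borel_measurable_lebesgue_integral[OF m])
  have "cls W a = {b\<in>space unit_space. (\<integral>z. \<bar>W a z - W b z\<bar> \<partial>unit_space) = 0}"
  proof -
    have "(AE z in unit_space. W a z = W b z) \<longleftrightarrow> (\<integral>z. \<bar>W a z - W b z\<bar> \<partial>unit_space) = 0"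
      if b: "b \<in> {0..<1}" for b
    proof -
      have i: "integrable unit_space (\<lambda>z. \<bar>W a z - W b z\<bar>)"
        by (intro integrable_abs Bochner_Integration.integrable_diff integrable_section W a b)
      show ?thesis using integral_nonneg_eq_0_iff_AE[OF i] by simp
    qed
    then show ?thesis unfolding cls_def by auto
  qed
  also have "\<dots> \<in> sets unit_space" using M by measurable
  finally show ?thesis .
qed

lemma integrable_usq:
  fixes f :: "real \<times> real \<Rightarrow> real"
  assumes "f \<in> borel_measurable usq" "\<And>a b. a \<in> {0..<1} \<Longrightarrow> b \<in> {0..<1} \<Longrightarrow> \<bar>f (a, b)\<bar> \<le> B"
  shows "integrable usq f"
  by (rule unit2.P.integrable_const_bound[of _ B]) (use assms in \<open>auto simp: space_pair_measure\<close>)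

definition mass_to :: "(real \<Rightarrow> real \<Rightarrow> real) \<Rightarrow> real set \<Rightarrow> real \<Rightarrow> real" where
  "mass_to W A z = (\<integral>a. indicator A a * W a z \<partial>unit_space)"

lemma mass_to_measurable:
  assumes W: "graphon W" and A: "A \<in> sets unit_space"
  shows "mass_to W A \<in> borel_measurable unit_space"
proof -
  have "(\<lambda>(z, a). indicator A a * W a z) \<in> borel_measurable usq"
    unfolding case_prod_unfold
    by (intro borel_measurable_times graphon_measurable_comp[OF W] measurable_compose[OF measurable_snd borel_measurable_indicator[OF A]])
       measurable
  from unit.borel_measurable_lebesgue_integral[OF this] show ?thesis unfolding mass_to_def[abs_def] .
qed

lemma mass_to_bounds:
  assumes W: "graphon W" and z: "z \<in> {0..<1}"
  shows "0 \<le> mass_to W A z \<and> mass_to W A z \<le> 1"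
proof -
  have "0 \<le> indicator A a * W a z \<and> indicator A a * W a z \<le> 1" if a: "a \<in> {0..<1}" for a
    using graphon_range(1,2)[OF W a z] by (simp add: indicator_def)
  then show ?thesis unfolding mass_to_def
    using integral_unit_bounds[of "\<lambda>a. indicator A a * W a z"] by simp
qed

text \<open>Fubini turns integrals of codegrees over rectangles into inner products.\<close>

lemma cod_rectangle:
  assumes W: "graphon W" and A: "A \<in> sets unit_space" and B: "B \<in> sets unit_space"
  shows "(\<integral>z. mass_to W A z * mass_to W B z \<partial>unit_space) =
    (\<integral>p. indicator (A \<times> B) p * cod W (fst p) (snd p) \<partial>usq)"
proof -
  interpret T: pair_sigma_finite usq unit_space ..
  let ?f = "\<lambda>p z. indicator A (fst p) * W (fst p) z * (indicator B (snd p) * W (snd p) z)"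
  have iA: "indicator A \<in> borel_measurable unit_space" "(indicator B :: real \<Rightarrow> real) \<in> borel_measurable unit_space"
    using A B by auto
  have m: "(\<lambda>(p, z). ?f p z) \<in> borel_measurable (usq \<Otimes>\<^sub>M unit_space)"
    unfolding case_prod_unfold
    by (intro borel_measurable_times graphon_measurable_comp[OF W] measurable_compose[OF _ iA(1)] measurable_compose[OF _ iA(2)])
       measurable
  have bd: "\<bar>?f p z\<bar> \<le> 1" if "p \<in> space usq" "z \<in> {0..<1}" for p z
  proof -
    have p: "fst p \<in> {0..<1}" "snd p \<in> {0..<1}" using that(1) by (auto simp: space_pair_measure)
    show ?thesis
      using graphon_range(1,2)[OF W p(1) that(2)] graphon_range(1,2)[OF W p(2) that(2)]
      by (simp add: indicator_def abs_mult mult_le_one)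
  qed
  interpret TT: pair_prob_space usq unit_space ..
  have int: "integrable (usq \<Otimes>\<^sub>M unit_space) (\<lambda>(p, z). ?f p z)"
    by (rule TT.P.integrable_const_bound[of _ 1, OF _ m]) (auto simp: space_pair_measure intro!: bd)
  have "(\<integral>z. (\<integral>p. ?f p z \<partial>usq) \<partial>unit_space) = (\<integral>p. (\<integral>z. ?f p z \<partial>unit_space) \<partial>usq)"
    by (rule T.Fubini_integral[OF int])
  moreover have "(\<integral>p. ?f p z \<partial>usq) = mass_to W A z * mass_to W B z" if z: "z \<in> {0..<1}" for z
  proof -
    have mm: "(\<lambda>a. indicator C a * W a z) \<in> borel_measurable unit_space" if "C \<in> sets unit_space" for C
      using that z by (intro borel_measurable_times graphon_measurable_comp[OF W]) (auto intro!: measurable_const)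
    have fm: "(\<lambda>p. ?f p z) \<in> borel_measurable usq"
      by (rule borel_measurable_times[OF measurable_compose[OF measurable_fst mm[OF A]] measurable_compose[OF measurable_snd mm[OF B]]])
    have "integrable usq (\<lambda>p. ?f p z)"
      by (rule integrable_usq[of _ 1, OF fm]) (rule bd, use z in \<open>auto simp: space_pair_measure\<close>)
    from unit2.integral_fst'[OF this]
    have "(\<integral>p. ?f p z \<partial>usq) = (\<integral>a. (\<integral>b. ?f (a, b) z \<partial>unit_space) \<partial>unit_space)" by simp
    also have "\<dots> = mass_to W A z * mass_to W B z"
      by (simp add: mass_to_def)
    finally show ?thesis .
  qed
  moreover have "(\<integral>z. ?f p z \<partial>unit_space) = indicator (A \<times> B) p * cod W (fst p) (snd p)" for p
  proof -
    have "(\<lambda>z. ?f p z) = (\<lambda>z. indicator (A \<times> B) p * (W (fst p) z * W (snd p) z))"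
      by (cases p) (auto simp: indicator_def)
    then show ?thesis by (simp only: cod_def integral_mult_right_zero)
  qed
  ultimately show ?thesis
    by (metis (no_types, lifting) Bochner_Integration.integral_cong space_unit)
qed

lemma sets_unit_Int [simp]: "A \<in> sets unit_space \<Longrightarrow> A \<inter> {0..<1} = A"
  using sets.Int_space_eq2[of A unit_space] by simp

text \<open>Rectangles are an intersection-stable generator, so the vanishing of integrals extends
  to all measurable sets; then \<open>k\<close> has the same density as 0.\<close>

lemma usq_rectangles_AE_zero:
  fixes k :: "real \<times> real \<Rightarrow> real"
  assumes k: "integrable usq k"
    and z: "\<And>A B. A \<in> sets unit_space \<Longrightarrow> B \<in> sets unit_space \<Longrightarrow> (\<integral>p. indicator (A \<times> B) p * k p \<partial>usq) = 0"
  shows "AE p in usq. k p = 0"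
proof -
  let ?G = "{a \<times> b | a b. a \<in> sets unit_space \<and> b \<in> sets unit_space}"
  let ?Om = "space unit_space \<times> space unit_space"
  have sets: "sets usq = sigma_sets ?Om ?G" by (rule sets_pair_measure)
  have ind: "integrable usq (\<lambda>p. indicator S p * k p)" if "S \<in> sets usq" for S
    using integrable_real_mult_indicator[OF that k] by (simp add: mult.commute)
  have "(\<integral>p. indicator S p * k p \<partial>usq) = 0" if "S \<in> sets usq" for S
  proof -
    have "Int_stable ?G" by (rule Int_stable_pair_measure_generator)
    moreover have "?G \<subseteq> Pow ?Om" by (rule pair_measure_closed)
    moreover have "S \<in> sigma_sets ?Om ?G" using that sets by simp
    ultimately show ?thesis
    proof (induction rule: sigma_sets_induct_disjoint)
      case (basic A)
      then show ?case using z by auto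
    next
      case empty
      show ?case by simp
    next
      case (compl A)
      have A: "A \<in> sets usq" using compl sets by simp
      have sp: "(\<integral>p. k p \<partial>usq) = 0"
      proof -
        have "(\<integral>p. k p \<partial>usq) = (\<integral>p. indicator (space unit_space \<times> space unit_space) p * k p \<partial>usq)"
          by (intro Bochner_Integration.integral_cong refl) (auto simp: space_pair_measure)
        also have "\<dots> = 0" by (rule z) (rule sets.top)+
        finally show ?thesis .
      qed
      have "(\<integral>p. indicator (?Om - A) p * k p \<partial>usq) = (\<integral>p. k p - indicator A p * k p \<partial>usq)"
        by (intro Bochner_Integration.integral_cong refl) (auto simp: space_pair_measure indicator_def)
      also have "\<dots> = 0" using sp compl.IH by (simp add: Bochner_Integration.integral_diff[OF k ind[OF A]])
      finally show ?case .
    next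
      case (union A)
      have A: "range A \<subseteq> sets usq" using union sets by simp
      have "(\<integral>p. indicator (\<Union>i. A i) p * k p \<partial>usq) = set_lebesgue_integral usq (\<Union>i. A i) k"
        by (simp add: set_lebesgue_integral_def)
      also have "\<dots> = (\<Sum>i. set_lebesgue_integral usq (A i) k)"
      proof (rule lebesgue_integral_countable_add)
        show "A i \<in> sets usq" for i using A by auto
        show "A i \<inter> A j = {}" if "i \<noteq> j" for i j using union.hyps that by (auto simp: disjoint_family_on_def)
        show "set_integrable usq (\<Union>i. A i) k"
          unfolding set_integrable_def using ind[of "\<Union>i. A i"] A by auto
      qed
      also have "\<dots> = 0" using union.IH by (simp add: set_lebesgue_integral_def)
      finally show ?case .
    qed
  qed
  then have "AE p in usq. k p = (\<lambda>_. 0) p"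
    by (intro density_unique_real) (auto intro: k simp: set_lebesgue_integral_def)
  then show ?thesis by simp
qed

text \<open>Let \<open>F A\<close> be the sum of the rows over \<open>A\<close>. For
  \<open>A\<close> and \<open>B\<close> inside \<open>G\<close> the inner product of
  \<open>F A\<close> and \<open>F B\<close> is c |A| |B|, so |G| F A - |A| F G has norm zero. All
  averages of rows over subsets of \<open>G\<close> therefore agree with the average row
  \<open>g\<close>, and almost every row in \<open>G\<close> equals \<open>g\<close>.\<close>

lemma const_codegree_twins:
  assumes W: "graphon W" and G: "G \<in> sets unit_space" "measure unit_space G > 0"
    and c: "AE p in usq. fst p \<in> G \<and> snd p \<in> G \<longrightarrow> cod W (fst p) (snd p) = c"
  shows "AE a in unit_space. a \<in> G \<longrightarrow> measure unit_space (cls W a) > 0"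
proof -
  let ?m = "measure unit_space"
  define F where "F = mass_to W"
  have Fm: "F A \<in> borel_measurable unit_space" if "A \<in> sets unit_space" for A
    unfolding F_def by (rule mass_to_measurable[OF W that])
  have Fb: "0 \<le> F A z \<and> F A z \<le> 1" if "z \<in> {0..<1}" for A z
    unfolding F_def by (rule mass_to_bounds[OF W that])
  have FF: "(\<integral>z. F A z * F B z \<partial>unit_space) = c * ?m A * ?m B"
    if A: "A \<in> sets unit_space" "A \<subseteq> G" and B: "B \<in> sets unit_space" "B \<subseteq> G" for A B
  proof -
    have "(\<integral>z. F A z * F B z \<partial>unit_space) = (\<integral>p. indicator (A \<times> B) p * cod W (fst p) (snd p) \<partial>usq)"
      unfolding F_def by (rule cod_rectangle[OF W A(1) B(1)])
    also have "\<dots> = (\<integral>p. c * indicator (A \<times> B) p \<partial>usq)"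
    proof (rule integral_cong_AE)
      show "(\<lambda>p. indicator (A \<times> B) p * cod W (fst p) (snd p)) \<in> borel_measurable usq"
        using A B by (intro borel_measurable_times cod_measurable[OF W]) auto
      show "(\<lambda>p. c * indicator (A \<times> B) p) \<in> borel_measurable usq" using A B by auto
      show "AE p in usq. indicator (A \<times> B) p * cod W (fst p) (snd p) = c * indicator (A \<times> B) p"
        using c by eventually_elim (use A B in \<open>auto simp: indicator_def\<close>)
    qed
    also have "\<dots> = c * measure usq (A \<times> B)" using A B by simp
    also have "measure usq (A \<times> B) = ?m A * ?m B"
      using unit.emeasure_pair_measure_Times[OF A(1) B(1)] by (simp add: measure_def enn2real_mult)
    finally show ?thesis by simp
  qed
  define g where "g z = F G z / ?m G" for z
  have gm: "g \<in> borel_measurable unit_space" unfolding g_def[abs_def] using Fm[OF G(1)] by simp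
  have FA: "AE z in unit_space. F A z = ?m A * g z" if A: "A \<in> sets unit_space" "A \<subseteq> G" for A
  proof -
    have i: "integrable unit_space (\<lambda>z. F X z * F Y z)"
      if "X \<in> sets unit_space" "Y \<in> sets unit_space" for X Y
    proof (rule integrable_unit[of _ 1])
      show "(\<lambda>z. F X z * F Y z) \<in> borel_measurable unit_space" using Fm that by simp
      fix z :: real assume "z \<in> {0..<1}"
      then show "\<bar>F X z * F Y z\<bar> \<le> 1" using Fb[of z X] Fb[of z Y] by (simp add: abs_mult mult_le_one)
    qed
    \<comment> \<open>The three inner products in the expanded square are all multiples of
      \<open>c\<close>, and they cancel.\<close>
    let ?h = "\<lambda>z. (?m G * F A z - ?m A * F G z)\<^sup>2"
    have eq: "?h = (\<lambda>z. (?m G)\<^sup>2 * (F A z * F A z) - 2 * ?m G * ?m A * (F A z * F G z) + (?m A)\<^sup>2 * (F G z * F G z))"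
      by (auto simp: power2_eq_square algebra_simps)
    note ii = i[OF A(1) A(1)] i[OF A(1) G(1)] i[OF G(1) G(1)]
    have ih: "integrable unit_space ?h"
      unfolding eq by (intro Bochner_Integration.integrable_add Bochner_Integration.integrable_diff integrable_mult_right ii)
    have "(\<integral>z. ?h z \<partial>unit_space) = (?m G)\<^sup>2 * (c * ?m A * ?m A) - 2 * ?m G * ?m A * (c * ?m A * ?m G) + (?m A)\<^sup>2 * (c * ?m G * ?m G)"
      unfolding eq
      by (simp add: ii FF[OF A A] FF[OF A G(1) order_refl] FF[OF G(1) order_refl G(1) order_refl])
    also have "\<dots> = 0" by (simp add: power2_eq_square algebra_simps)
    finally have "AE z in unit_space. ?h z = 0" using integral_nonneg_eq_0_iff_AE[OF ih] by simp
    then show ?thesis by eventually_elim (use G in \<open>simp add: g_def field_simps\<close>)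
  qed
  \<comment> \<open>The deviation of the rows in \<open>G\<close> from the average row. Integrated
    over \<open>A \<times> B\<close> it becomes the integral over \<open>B\<close> of
    \<open>F (A \<inter> G) - |A \<inter> G| g\<close>, which is zero.\<close>
  let ?k = "\<lambda>p. indicator G (fst p) * (W (fst p) (snd p) - g (snd p))"
  have km: "?k \<in> borel_measurable usq"
    by (intro borel_measurable_times borel_measurable_diff graphon_measurable[OF W]
       measurable_compose[OF measurable_fst borel_measurable_indicator[OF G(1)]] measurable_compose[OF measurable_snd gm])
  have gb: "\<bar>g z\<bar> \<le> 1 / ?m G" if "z \<in> {0..<1}" for z
    using Fb[OF that, of G] G by (simp add: g_def divide_right_mono)
  have ki: "integrable usq ?k"
  proof (rule integrable_usq[of _ "1 + 1 / ?m G", OF km])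
    fix a b :: real assume ab: "a \<in> {0..<1}" "b \<in> {0..<1}"
    have "\<bar>W a b - g b\<bar> \<le> 1 + 1 / ?m G"
      using graphon_range(1,2)[OF W ab] gb[OF ab(2)] by linarith
    then show "\<bar>indicator G (fst (a, b)) * (W (fst (a, b)) (snd (a, b)) - g (snd (a, b)))\<bar> \<le> 1 + 1 / ?m G"
      using G by (auto simp: indicator_def)
  qed
  have "AE p in usq. ?k p = 0"
  proof (rule usq_rectangles_AE_zero[OF ki])
    fix A B assume A: "A \<in> sets unit_space" and B: "B \<in> sets unit_space"
    let ?f = "\<lambda>p. indicator (A \<times> B) p * ?k p"
    have fi: "integrable usq ?f"
      using integrable_real_mult_indicator[OF _ ki, of "A \<times> B"] A B by (simp add: mult.commute)
    have "(\<integral>p. ?f p \<partial>usq) = (\<integral>z. (\<integral>a. ?f (a, z) \<partial>unit_space) \<partial>unit_space)"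
      using unit2.integral_snd[of "\<lambda>a z. ?f (a, z)"] fi by (simp add: case_prod_unfold)
    also have "\<dots> = (\<integral>z. 0 \<partial>unit_space)"
    proof (rule integral_cong_AE)
      have AG: "A \<inter> G \<in> sets unit_space" "A \<inter> G \<subseteq> G" using A G by auto
      have inner: "(\<integral>a. ?f (a, z) \<partial>unit_space) = indicator B z * (F (A \<inter> G) z - ?m (A \<inter> G) * g z)"
        if z: "z \<in> {0..<1}" for z
      proof -
        have i1: "integrable unit_space (\<lambda>a. indicator (A \<inter> G) a * W a z)"
        proof (rule integrable_unit[of _ 1])
          show "(\<lambda>a. indicator (A \<inter> G) a * W a z) \<in> borel_measurable unit_space"
            using AG z by (intro borel_measurable_times graphon_measurable_comp[OF W]) (auto intro!: measurable_const)
          fix a :: real assume a: "a \<in> {0..<1}"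
          show "\<bar>indicator (A \<inter> G) a * W a z\<bar> \<le> 1" using graphon_range(1,2)[OF W a z] by (simp add: indicator_def)
        qed
        have i2: "integrable unit_space (\<lambda>a. indicator (A \<inter> G) a * g z)"
          by (rule integrable_mult_left, rule integrable_unit[of _ 1], rule borel_measurable_indicator[OF AG(1)])
             (simp add: indicator_def)
        have "(\<lambda>a. ?f (a, z)) = (\<lambda>a. indicator B z * (indicator (A \<inter> G) a * W a z - indicator (A \<inter> G) a * g z))"
          by (auto simp: indicator_def)
        then have "(\<integral>a. ?f (a, z) \<partial>unit_space) =
          (\<integral>a. indicator B z * (indicator (A \<inter> G) a * W a z - indicator (A \<inter> G) a * g z) \<partial>unit_space)" by (rule arg_cong)
        also have "\<dots> = indicator B z * ((\<integral>a. indicator (A \<inter> G) a * W a z \<partial>unit_space) - (\<integral>a. indicator (A \<inter> G) a * g z \<partial>unit_space))"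
          by (simp only: integral_mult_right_zero Bochner_Integration.integral_diff[OF i1 i2])
        also have "(\<integral>a. indicator (A \<inter> G) a * g z \<partial>unit_space) = ?m (A \<inter> G) * g z"
          using AG sets.Int_space_eq2[OF AG(1)] by simp
        finally show ?thesis by (simp add: F_def mass_to_def)
      qed
      show "(\<lambda>z. \<integral>a. ?f (a, z) \<partial>unit_space) \<in> borel_measurable unit_space"
      proof (subst measurable_cong)
        show "(\<integral>a. ?f (a, z) \<partial>unit_space) = indicator B z * (F (A \<inter> G) z - ?m (A \<inter> G) * g z)"
          if "z \<in> space unit_space" for z using inner that by simp
        show "(\<lambda>z. indicator B z * (F (A \<inter> G) z - ?m (A \<inter> G) * g z)) \<in> borel_measurable unit_space"
          using B Fm[OF AG(1)] gm by simp
      qed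
      have "AE z in unit_space. z \<in> {0..<1}" by (rule AE_I2) simp
      then show "AE z in unit_space. (\<integral>a. ?f (a, z) \<partial>unit_space) = 0"
        using FA[OF AG]
      proof eventually_elim
        case (elim z)
        show ?case unfolding inner[OF elim(1)] using elim(2) by simp
      qed
    qed simp
    finally show "(\<integral>p. ?f p \<partial>usq) = 0" by simp
  qed
  then have "AE a in unit_space. AE z in unit_space. ?k (a, z) = 0" by (rule unit2.AE_pair)
  then have rows: "AE a in unit_space. a \<in> G \<longrightarrow> (AE z in unit_space. W a z = g z)"
  proof eventually_elim
    case (elim a)
    show ?case
    proof
      assume "a \<in> G"
      with elim show "AE z in unit_space. W a z = g z" by simp
    qed
  qed
  have "AE a in unit_space. a \<in> {0..<1}" by (rule AE_I2) simp
  with rows show ?thesis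
  proof eventually_elim
    case (elim a)
    show ?case
    proof
      assume aG: "a \<in> G"
      then have ra: "AE z in unit_space. W a z = g z" using elim by simp
      have "AE b in unit_space. b \<in> G \<longrightarrow> b \<in> cls W a"
        using rows AE_space
      proof eventually_elim
        case (elim b)
        show ?case
        proof
          assume "b \<in> G"
          then have "AE z in unit_space. W b z = g z" using elim by simp
          with ra have "AE z in unit_space. W a z = W b z" by eventually_elim simp
          then show "b \<in> cls W a" using elim by (simp add: cls_def)
        qed
      qed
      then have "?m G \<le> ?m (cls W a)"
        by (intro unit.finite_measure_mono_AE) (auto intro!: cls_measurable[OF W] elim)
      then show "?m (cls W a) > 0" using G by linarith
    qed
  qed
qed

section \<open>Prescribed codegrees\<close>

text \<open>If three weights at mutual distance two along a path are u/r, u, r'u, then the two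
  vertices between them have codegree u and degrees (1 + 1/r) u and (1 + r') u. The list contains
  these factors, as unordered pairs, for consecutive ratios r, r' on the model cycles: 1/2, 1/8, 4,
  2 at even positions and 5, 1/125, 1/5, 25 at odd ones.\<close>

definition codes :: "(real \<times> real) list" where
  "codes = [(3/2, 3), (3/2, 9/8), (9, 3/2), (3, 5), (5/4, 3),
            (6, 6/5), (6, 26), (26/25, 6), (6/5, 126/125), (126, 6/5)]"

definition is_code :: "real \<Rightarrow> real \<Rightarrow> real \<Rightarrow> bool" where
  "is_code u d e \<longleftrightarrow> (\<exists>(a, b)\<in>set codes. (d = a * u \<and> e = b * u) \<or> (d = b * u \<and> e = a * u))"

definition code_poly :: "real \<Rightarrow> real \<Rightarrow> real \<Rightarrow> real" where
  "code_poly u d e = (\<Prod>(a, b)\<leftarrow>codes.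
     ((d - a * u)\<^sup>2 + (e - b * u)\<^sup>2) * ((d - b * u)\<^sup>2 + (e - a * u)\<^sup>2))"

text \<open>The three factors allow disjoint rows, 0/1 twins and coded pairs. Every other pair gets
  a positive value.\<close>

definition core_poly :: "real \<Rightarrow> real \<Rightarrow> real \<Rightarrow> real" where
  "core_poly u d e = u\<^sup>2 * ((u - d)\<^sup>2 + (u - e)\<^sup>2) * code_poly u d e"

text \<open>These are the values inside a set of measure 1/2 on which \<open>W\<close> is 1/2 and
  whose points have no other neighbours: degree 1/2 * 1/2 and codegree 1/2 * 1/4.\<close>

definition const_poly :: "real \<Rightarrow> real \<Rightarrow> real \<Rightarrow> real" where
  "const_poly u d e = (u - 1/8)\<^sup>2 + (d - 1/4)\<^sup>2 + (e - 1/4)\<^sup>2"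

definition core_val :: real where "core_val = core_poly (1/8) (1/4) (1/4)"

lemma prod_list_nonneg': "(\<And>a. a \<in> set as \<Longrightarrow> 0 \<le> f a) \<Longrightarrow> 0 \<le> (\<Prod>a\<leftarrow>as. f a :: real)"
  by (induction as) auto

lemma prod_list_eq_0: "(\<Prod>a\<leftarrow>as. f a :: real) = 0 \<longleftrightarrow> (\<exists>a\<in>set as. f a = 0)"
  by (induction as) auto

lemma code_poly_nonneg: "0 \<le> code_poly u d e"
  unfolding code_poly_def by (rule prod_list_nonneg') (auto simp: case_prod_unfold)

lemma code_poly_eq_0: "code_poly u d e = 0 \<longleftrightarrow> is_code u d e"
  unfolding code_poly_def is_code_def prod_list_eq_0
  by (simp add: case_prod_unfold sum_power2_eq_zero_iff)

lemma core_poly_nonneg: "0 \<le> core_poly u d e"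
  unfolding core_poly_def by (simp add: code_poly_nonneg)

lemma core_poly_eq_0: "core_poly u d e = 0 \<longleftrightarrow> u = 0 \<or> (u = d \<and> u = e) \<or> is_code u d e"
  unfolding core_poly_def by (auto simp: code_poly_eq_0 sum_power2_eq_zero_iff)

lemma const_poly_nonneg: "0 \<le> const_poly u d e"
  unfolding const_poly_def by simp

lemma const_poly_eq_0: "const_poly u d e = 0 \<longleftrightarrow> u = 1/8 \<and> d = 1/4 \<and> e = 1/4"
proof
  assume "const_poly u d e = 0"
  moreover have "0 \<le> (u - 1/8)\<^sup>2" "0 \<le> (d - 1/4)\<^sup>2" "0 \<le> (e - 1/4)\<^sup>2" by simp_all
  ultimately have "(u - 1/8)\<^sup>2 = 0" "(d - 1/4)\<^sup>2 = 0" "(e - 1/4)\<^sup>2 = 0"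
    unfolding const_poly_def by linarith+
  then show "u = 1/8 \<and> d = 1/4 \<and> e = 1/4" by simp
next
  assume "u = 1/8 \<and> d = 1/4 \<and> e = 1/4"
  then have "u = 1/8" "d = 1/4" "e = 1/4" by simp_all
  then show "const_poly u d e = 0" by (simp only: const_poly_def) simp
qed

lemma core_val_pos: "core_val > 0"
proof -
  have "core_val \<noteq> 0" unfolding core_val_def core_poly_eq_0 by (simp add: is_code_def codes_def)
  then show ?thesis using core_poly_nonneg[of "1/8" "1/4" "1/4"] unfolding core_val_def by linarith
qed

text \<open>The closest pair in \<open>codes\<close> is (6/5, 126/125), with quotient 25/21 > 11/10.
  This gap makes it possible to separate points by bands of degrees.\<close>

lemma is_code_ratio: "is_code u d e \<Longrightarrow> 0 < d \<Longrightarrow> 0 < e \<Longrightarrow> 11/10 * d < e \<or> 11/10 * e < d"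
  unfolding is_code_def codes_def by auto

definition core_of :: "(real \<Rightarrow> real \<Rightarrow> real) \<Rightarrow> real \<times> real \<Rightarrow> real" where
  "core_of W p = core_poly (cod W (fst p) (snd p)) (deg W (fst p)) (deg W (snd p))"

text \<open>By the first clause \<open>core_of\<close> takes only the values 0 and
  \<open>core_val\<close> almost everywhere. The moments are those of a row integral equal to
  \<open>core_val / 2\<close> on half of the interval and 0 elsewhere; the last clause makes
  \<open>W\<close> average 1/2 on the block.\<close>

definition forced_pairs :: "(real \<Rightarrow> real \<Rightarrow> real) \<Rightarrow> bool" where
  "forced_pairs W \<longleftrightarrow> graphon W \<and>
    (AE p in usq. core_of W p * const_poly (cod W (fst p) (snd p)) (deg W (fst p)) (deg W (snd p)) = 0) \<and>
    (\<integral>a. (\<integral>b. core_of W (a, b) \<partial>unit_space) \<partial>unit_space) = core_val / 4 \<and>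
    (\<integral>a. (\<integral>b. core_of W (a, b) \<partial>unit_space)\<^sup>2 \<partial>unit_space) = core_val\<^sup>2 / 8 \<and>
    (\<integral>a. (\<integral>b. core_of W (a, b) \<partial>unit_space) ^ 3 \<partial>unit_space) = core_val ^ 3 / 16 \<and>
    (\<integral>p. W (fst p) (snd p) * core_of W p \<partial>usq) = core_val / 8"

definition const_pair :: "(real \<Rightarrow> real \<Rightarrow> real) \<Rightarrow> real \<times> real \<Rightarrow> bool" where
  "const_pair W p \<longleftrightarrow> cod W (fst p) (snd p) = 1/8 \<and> deg W (fst p) = 1/4 \<and> deg W (snd p) = 1/4"

lemma core_of_measurable:
  assumes "graphon W"
  shows "core_of W \<in> borel_measurable usq"
proof -
  note [measurable] = cod_measurable[OF assms] deg_measurable[OF assms]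
  have [measurable]: "(\<lambda>p. deg W (fst p)) \<in> borel_measurable usq" "(\<lambda>p. deg W (snd p)) \<in> borel_measurable usq"
    by measurable
  have "(\<lambda>p. code_poly (cod W (fst p) (snd p)) (deg W (fst p)) (deg W (snd p))) \<in> borel_measurable usq"
    unfolding code_poly_def codes_def by simp
  then show ?thesis unfolding core_of_def[abs_def] core_poly_def by measurable
qed

lemma const_pair_measurable:
  assumes "graphon W"
  shows "{p\<in>space usq. const_pair W p} \<in> sets usq"
proof -
  note [measurable] = cod_measurable[OF assms] deg_measurable[OF assms]
  show ?thesis unfolding const_pair_def by measurable
qed

lemma forced_pairs_cases:
  assumes "forced_pairs W"
  shows "AE p in usq. cod W (fst p) (snd p) = 0 \<or>
    (cod W (fst p) (snd p) = deg W (fst p) \<and> cod W (fst p) (snd p) = deg W (snd p)) \<or>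
    is_code (cod W (fst p) (snd p)) (deg W (fst p)) (deg W (snd p)) \<or> const_pair W p"
  using assms unfolding forced_pairs_def core_of_def
  by (auto simp: core_poly_eq_0 const_poly_eq_0 const_pair_def elim!: eventually_mono)

text \<open>Let \<open>q a\<close> be the measure of the section at \<open>a\<close> of the set
  \<open>Q\<close> of constant pairs. Three moments show that \<open>q\<close> takes only the values
  0 and 1/2. With \<open>G\<close> the set where it is 1/2, symmetry puts \<open>Q\<close> inside
  \<open>G \<times> G\<close>, and both sets have measure 1/4.\<close>

lemma forced_pairs_block:
  assumes "forced_pairs W"
  obtains G where "G \<in> sets unit_space" "measure unit_space G = 1/2"
    "AE p in usq. const_pair W p \<longleftrightarrow> fst p \<in> G \<and> snd p \<in> G"
proof -
  have W: "graphon W" using assms by (simp add: forced_pairs_def)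
  let ?r = core_val
  define Q where "Q = {p\<in>space usq. const_pair W p}"
  have Qm: "Q \<in> sets usq" unfolding Q_def by (rule const_pair_measurable[OF W])
  have Qsym: "(b, a) \<in> Q \<longleftrightarrow> (a, b) \<in> Q" for a b
    by (auto simp: Q_def const_pair_def cod_sym[of W b a] space_pair_measure)
  have Qsec: "(\<lambda>b. indicator Q (a, b) :: real) \<in> borel_measurable unit_space" if "a \<in> {0..<1}" for a
    by (rule measurable_compose_Pair1[OF _ borel_measurable_indicator[OF Qm]]) (use that in simp)
  have coreQ: "AE p in usq. core_of W p = ?r * indicator Q p"
  proof -
    have "AE p in usq. core_of W p * const_poly (cod W (fst p) (snd p)) (deg W (fst p)) (deg W (snd p)) = 0"
      using assms by (simp add: forced_pairs_def)
    then show ?thesis using AE_space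
    proof eventually_elim
      case (elim p)
      show ?case
      proof (cases "const_pair W p")
        case True
        then have "core_of W p = core_val" unfolding core_of_def core_val_def const_pair_def by (elim conjE) (simp only:)
        then show ?thesis using elim True by (simp add: Q_def)
      next
        case False
        then have "core_of W p = 0" using elim by (auto simp: const_poly_eq_0 const_pair_def)
        then show ?thesis using False by (simp add: Q_def)
      qed
    qed
  qed
  define q :: "real \<Rightarrow> real" where "q a = (\<integral>b. indicator Q (a, b) \<partial>unit_space)" for a
  have qm: "q \<in> borel_measurable unit_space"
  proof -
    have "(\<lambda>(a, b). indicator Q (a, b) :: real) \<in> borel_measurable usq" using Qm by (simp add: case_prod_unfold)
    from unit.borel_measurable_lebesgue_integral[OF this] show ?thesis unfolding q_def[abs_def] .
  qed
  have q01: "0 \<le> q a \<and> q a \<le> 1" for a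
    unfolding q_def using integral_unit_bounds[of "\<lambda>b. indicator Q (a, b)"] by (simp add: indicator_def)
  have coreq: "AE a in unit_space. (\<integral>b. core_of W (a, b) \<partial>unit_space) = ?r * q a"
  proof -
    have "AE a in unit_space. AE b in unit_space. core_of W (a, b) = ?r * indicator Q (a, b)"
      using unit2.AE_pair[OF coreQ] by simp
    then show ?thesis using AE_space
    proof eventually_elim
      case (elim a)
      have "(\<integral>b. core_of W (a, b) \<partial>unit_space) = (\<integral>b. ?r * indicator Q (a, b) \<partial>unit_space)"
      proof (rule integral_cong_AE)
        show "(\<lambda>b. core_of W (a, b)) \<in> borel_measurable unit_space"
          using measurable_compose_Pair1[OF _ core_of_measurable[OF W], of a] elim by simp
        show "(\<lambda>b. ?r * indicator Q (a, b)) \<in> borel_measurable unit_space"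
          by (intro borel_measurable_times borel_measurable_const Qsec) (use elim in simp)
        show "AE b in unit_space. core_of W (a, b) = ?r * indicator Q (a, b)" using elim by simp
      qed
      then show ?case by (simp add: q_def)
    qed
  qed
  have corem: "(\<lambda>a. \<integral>b. core_of W (a, b) \<partial>unit_space) \<in> borel_measurable unit_space"
  proof -
    have "(\<lambda>(a, b). core_of W (a, b)) \<in> borel_measurable usq" using core_of_measurable[OF W] by (simp add: case_prod_unfold)
    from unit.borel_measurable_lebesgue_integral[OF this] show ?thesis .
  qed
  have moments: "(\<integral>a. (\<integral>b. core_of W (a, b) \<partial>unit_space) ^ k \<partial>unit_space) = ?r ^ k * (\<integral>a. q a ^ k \<partial>unit_space)" for k
  proof -
    have "(\<integral>a. (\<integral>b. core_of W (a, b) \<partial>unit_space) ^ k \<partial>unit_space) = (\<integral>a. ?r ^ k * q a ^ k \<partial>unit_space)"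
    proof (rule integral_cong_AE)
      show "(\<lambda>a. (\<integral>b. core_of W (a, b) \<partial>unit_space) ^ k) \<in> borel_measurable unit_space"
        using corem by simp
      show "(\<lambda>a. ?r ^ k * q a ^ k) \<in> borel_measurable unit_space" using qm by simp
      show "AE a in unit_space. (\<integral>b. core_of W (a, b) \<partial>unit_space) ^ k = ?r ^ k * q a ^ k"
        using coreq by eventually_elim (simp add: power_mult_distrib)
    qed
    then show ?thesis by simp
  qed
  have m1: "(\<integral>a. q a \<partial>unit_space) = 1/4"
    using moments[of 1] assms core_val_pos by (simp add: forced_pairs_def)
  have m2: "(\<integral>a. q a ^ 2 \<partial>unit_space) = 1/8"
    using moments[of 2] assms core_val_pos by (simp add: forced_pairs_def field_simps)
  have m3: "(\<integral>a. q a ^ 3 \<partial>unit_space) = 1/16"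
    using moments[of 3] assms core_val_pos by (simp add: forced_pairs_def field_simps)
  have qi: "integrable unit_space (\<lambda>a. q a ^ k)" for k
    by (rule integrable_unit[of _ 1]) (use qm q01 in \<open>auto simp: power_le_one\<close>)
  have qi1: "integrable unit_space q" using qi[of 1] by simp
  have "AE a in unit_space. q a * (q a - 1/2)\<^sup>2 = 0"
  proof -
    \<comment> \<open>The integral of the expansion is 1/16 - 1/8 + 1/4 * 1/4 = 0.\<close>
    have eq: "(\<lambda>a. q a * (q a - 1/2)\<^sup>2) = (\<lambda>a. q a ^ 3 - q a ^ 2 + 1/4 * q a)"
      by (auto simp: power2_eq_square power3_eq_cube algebra_simps)
    have i: "integrable unit_space (\<lambda>a. q a * (q a - 1/2)\<^sup>2)"
      unfolding eq by (intro Bochner_Integration.integrable_add Bochner_Integration.integrable_diff integrable_mult_right qi qi1)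
    have "(\<integral>a. q a * (q a - 1/2)\<^sup>2 \<partial>unit_space) = 0"
      unfolding eq by (simp add: qi qi1 m1 m2 m3)
    then show ?thesis using integral_nonneg_eq_0_iff_AE[OF i] q01 by simp
  qed
  then have q2: "AE a in unit_space. q a = 0 \<or> q a = 1/2" by eventually_elim auto
  define G where "G = {a\<in>space unit_space. q a = 1/2}"
  have G: "G \<in> sets unit_space" unfolding G_def using qm by measurable
  have qG: "AE a in unit_space. q a = 1/2 * indicator G a"
    using q2 AE_space by eventually_elim (auto simp: G_def)
  have mG: "measure unit_space G = 1/2"
  proof -
    have "(\<integral>a. q a \<partial>unit_space) = (\<integral>a. 1/2 * indicator G a \<partial>unit_space)"
      by (rule integral_cong_AE) (use qm G qG in auto)
    then show ?thesis using m1 G by simp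
  qed
  have sec: "AE a in unit_space. a \<notin> G \<longrightarrow> (AE b in unit_space. (a, b) \<notin> Q)"
    using qG AE_space
  proof eventually_elim
    case (elim a)
    show ?case
    proof
      assume "a \<notin> G"
      then have "(\<integral>b. indicator Q (a, b) \<partial>unit_space) = (0::real)" using elim by (simp add: q_def)
      moreover have "integrable unit_space (\<lambda>b. indicator Q (a, b) :: real)"
        by (rule integrable_unit[of _ 1, OF Qsec]) (use elim in \<open>auto simp: indicator_def\<close>)
      ultimately have "AE b in unit_space. indicator Q (a, b) = (0::real)"
        using integral_nonneg_eq_0_iff_AE[of unit_space "\<lambda>b. indicator Q (a, b)"] by simp
      then show "AE b in unit_space. (a, b) \<notin> Q" by eventually_elim (auto simp: indicator_def split: if_splits)
    qed
  qed
  have Gm: "Measurable.pred unit_space (\<lambda>a. a \<in> G)" using G by simp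
  have Qp: "Measurable.pred usq (\<lambda>p. p \<in> Q)" using Qm by simp
  have A1: "AE a in unit_space. AE b in unit_space. (a, b) \<in> Q \<longrightarrow> a \<in> G"
    using sec
  proof eventually_elim
    case (elim a)
    show ?case
    proof (cases "a \<in> G")
      case False
      then have "AE b in unit_space. (a, b) \<notin> Q" using elim by simp
      then show ?thesis by eventually_elim simp
    qed simp
  qed
  have A2: "AE a in unit_space. AE b in unit_space. (a, b) \<in> Q \<longrightarrow> b \<in> G"
  proof (subst unit2.AE_commute)
    show "{x\<in>space usq. (fst x, snd x) \<in> Q \<longrightarrow> snd x \<in> G} \<in> sets usq"
      using Qp measurable_compose[OF measurable_snd Gm] by measurable
    show "AE b in unit_space. AE a in unit_space. (a, b) \<in> Q \<longrightarrow> b \<in> G"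
      using A1 Qsym by simp
  qed
  have sub: "AE p in usq. p \<in> Q \<longrightarrow> fst p \<in> G \<and> snd p \<in> G"
  proof (rule unit2.AE_pair_measure)
    show "{x\<in>space usq. x \<in> Q \<longrightarrow> fst x \<in> G \<and> snd x \<in> G} \<in> sets usq"
      using Qp measurable_compose[OF measurable_fst Gm] measurable_compose[OF measurable_snd Gm] by measurable
    show "AE a in unit_space. AE b in unit_space. (a, b) \<in> Q \<longrightarrow> fst (a, b) \<in> G \<and> snd (a, b) \<in> G"
      using A1 A2
    proof eventually_elim
      case (elim a)
      from elim show ?case by eventually_elim simp
    qed
  qed
  have GG: "G \<times> G \<in> sets usq" using G by auto
  have "(\<integral>p. indicator Q p \<partial>usq) = (1/4 :: real)"
  proof -
    have "integrable usq (indicator Q :: _ \<Rightarrow> real)" using Qm by (simp add: unit2.P.emeasure_finite less_top[symmetric])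
    from unit2.integral_fst'[OF this] show ?thesis using m1 by (simp add: q_def)
  qed
  moreover have "(\<integral>p. indicator (G \<times> G) p \<partial>usq) = (1/4 :: real)"
  proof -
    have "measure usq (G \<times> G) = measure unit_space G * measure unit_space G"
      using unit.emeasure_pair_measure_Times[OF G G] by (simp add: measure_def enn2real_mult)
    also have "\<dots> = 1/4" unfolding mG by simp
    finally show ?thesis using GG by simp
  qed
  ultimately have "(\<integral>p. indicator (G \<times> G) p - indicator Q p \<partial>usq) = (0 :: real)"
    using Qm GG by (simp add: Bochner_Integration.integral_diff unit2.P.emeasure_finite less_top[symmetric])
  moreover have "AE p in usq. 0 \<le> indicator (G \<times> G) p - (indicator Q p :: real)"
    using sub by eventually_elim (auto simp: indicator_def mem_Times_iff)
  moreover have "integrable usq (\<lambda>p. indicator (G \<times> G) p - (indicator Q p :: real))"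
    using Qm GG by (intro Bochner_Integration.integrable_diff) (auto simp: unit2.P.emeasure_finite less_top[symmetric])
  ultimately have "AE p in usq. indicator (G \<times> G) p - indicator Q p = (0 :: real)"
    using integral_nonneg_eq_0_iff_AE by blast
  then have "AE p in usq. const_pair W p \<longleftrightarrow> fst p \<in> G \<and> snd p \<in> G"
    using AE_space by eventually_elim (auto simp: indicator_def mem_Times_iff Q_def split: if_splits)
  then show ?thesis using that G mG by blast
qed

text \<open>Outside the block the points are sorted by degree into bands of ratio 10/11. No coded
  pair fits into one band, so two points of a band are twins or have codegree zero. Points without
  twins in a band thus have rows of pairwise disjoint support, which for a set of positive measure
  is impossible unless their degrees vanish.\<close>

lemma forced_pairs_twins:
  assumes "forced_pairs W"
  shows "AE a in unit_space. measure unit_space (cls W a) > 0"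
proof -
  have W: "graphon W" using assms by (simp add: forced_pairs_def)
  obtain G where G: "G \<in> sets unit_space" "measure unit_space G = 1/2"
    and GG: "AE p in usq. const_pair W p \<longleftrightarrow> fst p \<in> G \<and> snd p \<in> G" by (rule forced_pairs_block[OF assms])
  have onG: "AE a in unit_space. a \<in> G \<longrightarrow> measure unit_space (cls W a) > 0"
  proof (rule const_codegree_twins[OF W G(1)])
    show "AE p in usq. fst p \<in> G \<and> snd p \<in> G \<longrightarrow> cod W (fst p) (snd p) = 1/8"
      using GG by eventually_elim (auto simp: const_pair_def)
  qed (simp add: G)
  note dm = deg_measurable[OF W]
  define T where "T = {p\<in>space usq. cod W (fst p) (snd p) = deg W (fst p) \<and> cod W (fst p) (snd p) = deg W (snd p)}"
  have Tm: "T \<in> sets usq" unfolding T_def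
    using cod_measurable[OF W] measurable_compose[OF measurable_fst dm] measurable_compose[OF measurable_snd dm] by measurable
  have Tcls: "Pair a -` T \<subseteq> cls W a" if a: "a \<in> {0..<1}" for a
  proof
    fix b assume "b \<in> Pair a -` T"
    then have b: "b \<in> {0..<1}" "cod W a b = deg W a" "cod W a b = deg W b" by (auto simp: T_def space_pair_measure)
    have "AE z in unit_space. W a z = W b z" using twin_rows[OF W a b] by eventually_elim simp
    then show "b \<in> cls W a" using b by (simp add: cls_def)
  qed
  have Tsec: "Pair a -` T \<in> sets unit_space" for a using Tm by (rule sets_Pair1)
  define N where "N = {a\<in>space unit_space. deg W a > 0 \<and> a \<notin> G \<and> emeasure unit_space (Pair a -` T) = 0}"
  have Nm: "N \<in> sets unit_space"
  proof -
    have "(\<lambda>a. emeasure unit_space (Pair a -` T)) \<in> borel_measurable unit_space"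
      by (rule unit.measurable_emeasure_Pair[OF Tm])
    then show ?thesis unfolding N_def using dm G(1) by measurable
  qed
  have N0: "emeasure unit_space N = 0"
  proof -
    \<comment> \<open>The bands cover all of \<open>N\<close>, because degrees there are positive
      and at most 1.\<close>
    define L where "L j = N \<inter> {a\<in>space unit_space. (10/11) ^ Suc j < deg W a \<and> deg W a \<le> (10/11) ^ j}" for j
    have Lm: "L j \<in> sets unit_space" for j unfolding L_def using Nm dm by measurable
    have L0: "emeasure unit_space (L j) = 0" for j
    proof -
      have notT: "AE p in usq. fst p \<in> N \<longrightarrow> p \<notin> T"
      proof (rule unit2.AE_pair_measure)
        show "{x\<in>space usq. fst x \<in> N \<longrightarrow> x \<notin> T} \<in> sets usq"
          using Nm Tm by measurable
        show "AE a in unit_space. AE b in unit_space. fst (a, b) \<in> N \<longrightarrow> (a, b) \<notin> T"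
        proof (rule AE_I2)
          fix a assume "a \<in> space unit_space"
          show "AE b in unit_space. fst (a, b) \<in> N \<longrightarrow> (a, b) \<notin> T"
          proof (cases "a \<in> N")
            case True
            then have "Pair a -` T \<in> null_sets unit_space" using Tsec by (auto simp: N_def null_sets_def)
            from AE_not_in[OF this] show ?thesis by eventually_elim auto
          qed simp
        qed
      qed
      have cod0: "AE p in usq. indicator (L j \<times> L j) p * cod W (fst p) (snd p) = 0"
        using forced_pairs_cases[OF assms] GG notT AE_space
      proof eventually_elim
        case (elim p)
        show ?case
        proof (cases "p \<in> L j \<times> L j")
          case True
          have p: "fst p \<in> N" "0 < deg W (fst p)" "0 < deg W (snd p)" "fst p \<notin> G"
            "(10/11) ^ Suc j < deg W (fst p)" "deg W (fst p) \<le> (10/11) ^ j"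
            "(10/11) ^ Suc j < deg W (snd p)" "deg W (snd p) \<le> (10/11) ^ j"
            using True by (auto simp: L_def N_def)
          have "\<not> is_code (cod W (fst p) (snd p)) (deg W (fst p)) (deg W (snd p))"
            using is_code_ratio[OF _ p(2,3)] p(5-8) by auto
          moreover have "\<not> const_pair W p" using elim(2) p(4) by simp
          moreover have "\<not> (cod W (fst p) (snd p) = deg W (fst p) \<and> cod W (fst p) (snd p) = deg W (snd p))"
            using elim(3,4) p(1) by (simp add: T_def)
          ultimately have "cod W (fst p) (snd p) = 0" using elim(1) by blast
          then show ?thesis by simp
        qed simp
      qed
      \<comment> \<open>Codegree zero almost everywhere on the square of \<open>L j\<close> says
        that the total row of \<open>L j\<close> has norm zero; then the degrees of its points
        integrate to zero.\<close>
      have "(\<integral>z. mass_to W (L j) z * mass_to W (L j) z \<partial>unit_space) = 0"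
        unfolding cod_rectangle[OF W Lm Lm] using cod0 by (rule integral_eq_zero_AE)
      moreover have im: "integrable unit_space (\<lambda>z. mass_to W (L j) z * mass_to W (L j) z)"
        using mass_to_measurable[OF W Lm] mass_to_bounds[OF W]
        by (intro integrable_unit[of _ 1]) (auto simp: abs_mult intro!: mult_le_one)
      ultimately have "AE z in unit_space. mass_to W (L j) z * mass_to W (L j) z = 0"
        using integral_nonneg_eq_0_iff_AE[OF im] by simp
      then have mz: "AE z in unit_space. mass_to W (L j) z = 0" by eventually_elim simp
      have fi: "integrable usq (\<lambda>p. indicator (L j) (fst p) * W (fst p) (snd p))"
      proof (rule integrable_usq[of _ 1])
        show "(\<lambda>p. indicator (L j) (fst p) * W (fst p) (snd p)) \<in> borel_measurable usq"
          by (intro borel_measurable_times graphon_measurable[OF W] measurable_compose[OF measurable_fst borel_measurable_indicator[OF Lm]])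
        fix a b :: real assume "a \<in> {0..<1}" "b \<in> {0..<1}"
        then show "\<bar>indicator (L j) (fst (a, b)) * W (fst (a, b)) (snd (a, b))\<bar> \<le> 1"
          using graphon_range(1,2)[OF W, of a b] by (auto simp: indicator_def)
      qed
      have "(\<integral>a. indicator (L j) a * deg W a \<partial>unit_space) = (\<integral>p. indicator (L j) (fst p) * W (fst p) (snd p) \<partial>usq)"
        using unit2.integral_fst'[OF fi] by (simp add: deg_def)
      also have "\<dots> = (\<integral>z. mass_to W (L j) z \<partial>unit_space)"
        using unit2.integral_snd[of "\<lambda>a z. indicator (L j) a * W a z"] fi
        by (simp add: mass_to_def case_prod_unfold)
      also have "\<dots> = 0" using mz by (rule integral_eq_zero_AE)
      finally have "(\<integral>a. indicator (L j) a * deg W a \<partial>unit_space) = 0" .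
      moreover have "integrable unit_space (\<lambda>a. indicator (L j) a * deg W a)"
        using Lm dm deg_bounds[OF W] by (intro integrable_unit[of _ 1]) (auto simp: indicator_def)
      moreover have "AE a in unit_space. 0 \<le> indicator (L j) a * deg W a"
        by (rule AE_I2) (simp add: deg_bounds[OF W] indicator_def)
      ultimately have "AE a in unit_space. indicator (L j) a * deg W a = 0"
        using integral_nonneg_eq_0_iff_AE by blast
      then have "AE a in unit_space. a \<notin> L j"
        by eventually_elim (auto simp: L_def N_def indicator_def split: if_splits)
      then show ?thesis using Lm by (simp add: AE_iff_null_sets[symmetric] AE_iff_measurable[OF Lm] null_sets_def)
    qed
    have "N \<subseteq> (\<Union>j. L j)"
    proof
      fix a assume a: "a \<in> N"
      then have d: "0 < deg W a" "deg W a \<le> 1" "a \<in> {0..<1}" using deg_bounds[OF W, of a] by (auto simp: N_def)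
      obtain n where n: "(10/11) ^ n < deg W a" using real_arch_pow_inv[OF d(1), of "10/11"] by auto
      define k where "k = (LEAST n. (10/11) ^ n < deg W a)"
      have k: "(10/11) ^ k < deg W a" unfolding k_def by (rule LeastI[of _ n]) (rule n)
      have "k \<noteq> 0" using k d by (metis power_0 linorder_not_less)
      then obtain j where j: "k = Suc j" by (cases k) auto
      have "\<not> (10/11) ^ j < deg W a" using not_less_Least[of j "\<lambda>n. (10/11) ^ n < deg W a"] j k_def by auto
      then have "a \<in> L j" using a k j d by (auto simp: L_def)
      then show "a \<in> (\<Union>j. L j)" by auto
    qed
    moreover have "emeasure unit_space (\<Union>j. L j) = 0"
      using L0 Lm by (intro emeasure_UN_eq_0) auto
    ultimately show ?thesis using Lm by (metis emeasure_mono le_zero_eq sets.countable_UN top.extremum_unique subset_UNIV image_subset_iff)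
  qed
  \<comment> \<open>All points of degree zero have the zero row almost everywhere, so they form one
    class unless they are a null set.\<close>
  have zero: "AE a in unit_space. deg W a = 0 \<longrightarrow> measure unit_space (cls W a) > 0"
  proof -
    let ?Z = "{a\<in>space unit_space. deg W a = 0}"
    have Z: "?Z \<in> sets unit_space" using dm by measurable
    have row0: "AE z in unit_space. W a z = 0" if "a \<in> ?Z" for a
    proof -
      have a: "a \<in> {0..<1}" using that by simp
      have "AE z in unit_space. 0 \<le> W a z" by (rule AE_I2) (simp add: graphon_range(1)[OF W a])
      from integral_nonneg_eq_0_iff_AE[OF integrable_section[OF W a] this] that
      show ?thesis by (simp add: deg_def)
    qed
    have sub: "?Z \<subseteq> cls W a" if "a \<in> ?Z" for a
    proof
      fix b assume b: "b \<in> ?Z"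
      from row0[OF that] row0[OF b] have "AE z in unit_space. W a z = W b z" by eventually_elim simp
      then show "b \<in> cls W a" using b by (simp add: cls_def)
    qed
    show ?thesis
    proof (cases "measure unit_space ?Z > 0")
      case True
      show ?thesis
      proof (rule AE_I2, intro impI)
        fix a assume a: "a \<in> space unit_space" "deg W a = 0"
        then have "measure unit_space ?Z \<le> measure unit_space (cls W a)"
          using sub[of a] cls_measurable[OF W, of a] by (intro unit.finite_measure_mono) auto
        then show "measure unit_space (cls W a) > 0" using True by linarith
      qed
    next
      case False
      then have "measure unit_space ?Z = 0" using measure_nonneg[of unit_space ?Z] by linarith
      then have "?Z \<in> null_sets unit_space" using Z by (auto simp: null_sets_def unit.emeasure_eq_measure)
      from AE_not_in[OF this] AE_space show ?thesis by eventually_elim auto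
    qed
  qed
  have "AE a in unit_space. a \<notin> N" using N0 Nm by (intro AE_not_in) (auto simp: null_sets_def)
  then show ?thesis using onG zero AE_space
  proof eventually_elim
    case (elim a)
    show ?case
    proof (cases "deg W a = 0 \<or> a \<in> G")
      case True
      then show ?thesis using elim by auto
    next
      case False
      then have "deg W a > 0" using deg_bounds[OF W, of a] elim by auto
      then have "emeasure unit_space (Pair a -` T) \<noteq> 0" using False elim by (auto simp: N_def)
      then have "measure unit_space (Pair a -` T) > 0"
        by (simp add: unit.emeasure_eq_measure zero_less_measure_iff)
      moreover have "measure unit_space (Pair a -` T) \<le> measure unit_space (cls W a)"
        using Tcls[of a] cls_measurable[OF W, of a] elim by (intro unit.finite_measure_mono) auto
      ultimately show ?thesis by linarith
    qed
  qed
qed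

section \<open>The countable quotient by twin classes\<close>

definition fiber :: "(real \<Rightarrow> nat) \<Rightarrow> nat \<Rightarrow> real set" where
  "fiber \<pi> i = {x\<in>{0..<1}. \<pi> x = i}"

definition lmass :: "(real \<Rightarrow> nat) \<Rightarrow> nat \<Rightarrow> real" where
  "lmass \<pi> i = measure unit_space (fiber \<pi> i)"

lemma AE_pos_point:
  assumes "AE x in M. P x" "D \<in> sets M" "measure M D > 0"
  shows "\<exists>x\<in>D. P x"
proof (rule ccontr)
  assume c: "\<not> ?thesis"
  have "AE x in M. x \<notin> D" using assms(1) by eventually_elim (use c in auto)
  then have "D \<in> null_sets M" using AE_iff_null_sets[OF assms(2)] by simp
  then show False using assms(3) by (simp add: measure_def null_setsD1)
qed

lemma AE_usq_fst:
  assumes "AE a in unit_space. P a" "Measurable.pred unit_space P"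
  shows "AE p in usq. P (fst p)"
proof (rule unit2.AE_pair_measure)
  show "{x\<in>space usq. P (fst x)} \<in> sets usq" using measurable_compose[OF measurable_fst assms(2)] by measurable
  show "AE a in unit_space. AE b in unit_space. P (fst (a, b))" using assms(1) by eventually_elim simp
qed

lemma AE_usq_snd:
  assumes "AE a in unit_space. P a" "Measurable.pred unit_space P"
  shows "AE p in usq. P (snd p)"
proof (rule unit2.AE_pair_measure)
  show "{x\<in>space usq. P (snd x)} \<in> sets usq" using measurable_compose[OF measurable_snd assms(2)] by measurable
  show "AE a in unit_space. AE b in unit_space. P (snd (a, b))" using assms(1) by simp
qed

lemma self_in_cls: "a \<in> {0..<1} \<Longrightarrow> a \<in> cls W a"
  by (simp add: cls_def)

lemma cls_eq:
  assumes "b \<in> cls W a"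
  shows "cls W b = cls W a"
proof -
  have ab: "AE z in unit_space. W a z = W b z" using assms by (simp add: cls_def)
  have "(AE z in unit_space. W b z = W c z) \<longleftrightarrow> (AE z in unit_space. W a z = W c z)" for c
  proof
    assume "AE z in unit_space. W b z = W c z"
    with ab show "AE z in unit_space. W a z = W c z" by eventually_elim simp
  next
    assume "AE z in unit_space. W a z = W c z"
    with ab show "AE z in unit_space. W b z = W c z" by eventually_elim simp
  qed
  then show ?thesis by (simp add: cls_def)
qed

lemma countable_disjoint_positive:
  assumes C: "\<And>C. C \<in> \<C> \<Longrightarrow> C \<in> sets unit_space \<and> measure unit_space C > 0" and d: "disjoint \<C>"
  shows "countable \<C>"
proof -
  define L where "L n = {C\<in>\<C>. measure unit_space C > 1 / Suc n}" for n
  have "finite (L n)" for n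
  proof -
    have "card F \<le> Suc n" if F: "F \<subseteq> L n" "finite F" for F
    proof -
      have "card F * (1 / Suc n) = (\<Sum>C\<in>F. 1 / Suc n)" by simp
      also have "\<dots> \<le> (\<Sum>C\<in>F. measure unit_space C)"
        using F by (intro sum_mono) (auto simp: L_def)
      also have "\<dots> = measure unit_space (\<Union>C\<in>F. C)"
      proof (rule unit.finite_measure_finite_Union[symmetric])
        show "finite F" by fact
        show "(\<lambda>C. C) ` F \<subseteq> sets unit_space" using F C by (auto simp: L_def)
        show "disjoint_family_on (\<lambda>C. C) F"
          using d F unfolding disjoint_family_on_def disjoint_def L_def by blast
      qed
      also have "\<dots> \<le> 1" by (rule unit.prob_le_1)
      finally have "real (card F) \<le> Suc n" by (simp add: field_simps)
      then show ?thesis by linarith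
    qed
    then show ?thesis using finite_if_finite_subsets_card_bdd by blast
  qed
  moreover have "\<C> \<subseteq> (\<Union>n. L n)"
  proof
    fix D assume D: "D \<in> \<C>"
    obtain n where "inverse (of_nat (Suc n)) < measure unit_space D"
      using reals_Archimedean C[OF D] by blast
    then show "D \<in> (\<Union>n. L n)" using D by (auto simp: L_def inverse_eq_divide)
  qed
  ultimately show ?thesis by (meson countable_UN countable_finite countable_subset countableI_type)
qed

text \<open>Distinct twin classes are disjoint, so those of positive measure are countably many and
  receive the labels \<open>Suc _\<close>; label 0 takes the null remainder. Rows are constant on a
  class in one variable, and symmetry of \<open>W\<close> gives constancy in the other.\<close>

theorem graphon_discretization:
  assumes W: "graphon W" and pos: "AE a in unit_space. measure unit_space (cls W a) > 0"
  obtains \<pi> :: "real \<Rightarrow> nat" and A where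
    "\<pi> \<in> unit_space \<rightarrow>\<^sub>M count_space UNIV"
    "\<And>i j. A i j = A j i" "\<And>i j. 0 \<le> A i j \<and> A i j \<le> 1"
    "AE p in usq. W (fst p) (snd p) = A (\<pi> (fst p)) (\<pi> (snd p))"
    "\<And>i j. lmass \<pi> i > 0 \<Longrightarrow> lmass \<pi> j > 0 \<Longrightarrow> (\<And>k. lmass \<pi> k > 0 \<Longrightarrow> A i k = A j k) \<Longrightarrow> i = j"
proof -
  let ?m = "measure unit_space"
  define \<C> where "\<C> = cls W ` {a\<in>{0..<1}. ?m (cls W a) > 0}"
  have Cm: "C \<in> sets unit_space \<and> ?m C > 0" if "C \<in> \<C>" for C
    using that cls_measurable[OF W] by (auto simp: \<C>_def)
  have "disjoint \<C>"
  proof (rule disjointI)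
    fix C D assume "C \<in> \<C>" "D \<in> \<C>" "C \<noteq> D"
    then show "C \<inter> D = {}" using cls_eq unfolding \<C>_def by blast
  qed
  then have cC: "countable \<C>" using countable_disjoint_positive Cm by blast
  define \<pi> where "\<pi> a = (if ?m (cls W a) > 0 then Suc (to_nat_on \<C> (cls W a)) else 0)" for a
  have inC: "cls W a \<in> \<C>" if "a \<in> {0..<1}" "?m (cls W a) > 0" for a using that by (auto simp: \<C>_def)
  have fib: "fiber \<pi> (\<pi> a) = cls W a" if a: "a \<in> {0..<1}" "?m (cls W a) > 0" for a
  proof
    show "cls W a \<subseteq> fiber \<pi> (\<pi> a)"
    proof
      fix b assume b: "b \<in> cls W a"
      then have "b \<in> {0..<1}" by (simp add: cls_def)
      then show "b \<in> fiber \<pi> (\<pi> a)" using cls_eq[OF b] by (simp add: fiber_def \<pi>_def)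
    qed
    show "fiber \<pi> (\<pi> a) \<subseteq> cls W a"
    proof
      fix b assume "b \<in> fiber \<pi> (\<pi> a)"
      then have b: "b \<in> {0..<1}" "\<pi> b = \<pi> a" by (auto simp: fiber_def)
      then have mb: "?m (cls W b) > 0" "to_nat_on \<C> (cls W b) = to_nat_on \<C> (cls W a)"
        using a by (auto simp: \<pi>_def split: if_splits)
      then have "cls W b = cls W a" using inj_on_to_nat_on[OF cC] inC a b by (auto dest: inj_onD)
      then show "b \<in> cls W a" using self_in_cls[OF b(1), of W] by simp
    qed
  qed
  have fS: "fiber \<pi> (Suc n) \<in> sets unit_space" for n
  proof (cases "fiber \<pi> (Suc n) = {}")
    case False
    then obtain a where a: "a \<in> {0..<1}" "\<pi> a = Suc n" by (auto simp: fiber_def)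
    then have "?m (cls W a) > 0" by (auto simp: \<pi>_def split: if_splits)
    then show ?thesis using fib[of a] a cls_measurable[OF W, of a] by simp
  qed simp
  have fm: "fiber \<pi> i \<in> sets unit_space" for i
  proof (cases i)
    case 0
    have "fiber \<pi> 0 = space unit_space - (\<Union>n. fiber \<pi> (Suc n))"
      by (auto simp: fiber_def) (metis not0_implies_Suc)
    also have "\<dots> \<in> sets unit_space"
      by (rule sets.Diff[OF sets.top], rule sets.countable_UN) (use fS in auto)
    finally show ?thesis using 0 by simp
  qed (use fS in simp)
  have pm: "\<pi> \<in> unit_space \<rightarrow>\<^sub>M count_space UNIV"
  proof -
    have "\<pi> -` {i} \<inter> space unit_space = fiber \<pi> i" for i by (auto simp: fiber_def)
    then show ?thesis using fm by (simp add: measurable_count_space_eq2_countable)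
  qed
  have posl: "AE a in unit_space. lmass \<pi> (\<pi> a) > 0"
    using pos AE_space by eventually_elim (simp add: lmass_def fib)
  define I where "I i j = (\<integral>p. indicator (fiber \<pi> i \<times> fiber \<pi> j) p * W (fst p) (snd p) \<partial>usq)" for i j
  \<comment> \<open>The average over the rectangle of two classes, with default 0 when one of them
    is null.\<close>
  define A where "A i j = (if lmass \<pi> i > 0 \<and> lmass \<pi> j > 0 then I i j / (lmass \<pi> i * lmass \<pi> j) else 0)" for i j
  have rm: "fiber \<pi> i \<times> fiber \<pi> j \<in> sets usq" for i j using fm by auto
  have Im: "(\<lambda>p. indicator (fiber \<pi> i \<times> fiber \<pi> j) p * W (fst p) (snd p)) \<in> borel_measurable usq" for i j
    by (rule borel_measurable_times[OF borel_measurable_indicator[OF rm] graphon_measurable[OF W]])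
  have mprod: "measure usq (fiber \<pi> i \<times> fiber \<pi> j) = lmass \<pi> i * lmass \<pi> j" for i j
    using unit.emeasure_pair_measure_Times[OF fm fm, of i j] by (simp add: measure_def enn2real_mult lmass_def)
  have Isym: "I i j = I j i" for i j
  proof -
    have "I j i = (\<integral>(x, y). (\<lambda>p. indicator (fiber \<pi> j \<times> fiber \<pi> i) p * W (fst p) (snd p)) (y, x) \<partial>usq)"
      unfolding I_def using unit2.integral_product_swap[OF Im[of j i]] by simp
    also have "\<dots> = I i j" unfolding I_def
    proof (rule Bochner_Integration.integral_cong[OF refl])
      fix p assume p: "p \<in> space usq"
      have "W (snd p) (fst p) = W (fst p) (snd p)"
        by (rule graphon_range(3)[OF W]) (use p in \<open>auto simp: space_pair_measure\<close>)
      then show "(case p of (x, y) \<Rightarrow> indicator (fiber \<pi> j \<times> fiber \<pi> i) (y, x) * W (fst (y, x)) (snd (y, x))) =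
        indicator (fiber \<pi> i \<times> fiber \<pi> j) p * W (fst p) (snd p)"
        by (cases p) (auto simp: indicator_def)
    qed
    finally show ?thesis by simp
  qed
  have I01: "0 \<le> I i j \<and> I i j \<le> lmass \<pi> i * lmass \<pi> j" for i j
  proof
    have W01: "0 \<le> W (fst p) (snd p) \<and> W (fst p) (snd p) \<le> 1" if "p \<in> space usq" for p
      using that graphon_range(1,2)[OF W, of "fst p" "snd p"] by (auto simp: space_pair_measure)
    show "0 \<le> I i j" unfolding I_def
      by (rule Bochner_Integration.integral_nonneg) (simp add: W01 indicator_def)
    have "I i j \<le> (\<integral>p. indicator (fiber \<pi> i \<times> fiber \<pi> j) p \<partial>usq)" unfolding I_def
    proof (rule integral_mono)
      show "integrable usq (\<lambda>p. indicator (fiber \<pi> i \<times> fiber \<pi> j) p * W (fst p) (snd p))"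
        by (rule integrable_usq[of _ 1, OF Im]) (use graphon_range(1,2)[OF W] in \<open>auto simp: indicator_def\<close>)
      show "integrable usq (indicator (fiber \<pi> i \<times> fiber \<pi> j) :: _ \<Rightarrow> real)"
        using rm by (simp add: unit2.P.emeasure_finite less_top[symmetric])
      show "indicator (fiber \<pi> i \<times> fiber \<pi> j) p * W (fst p) (snd p) \<le> indicator (fiber \<pi> i \<times> fiber \<pi> j) p"
        if "p \<in> space usq" for p using W01[OF that] by (simp add: indicator_def)
    qed
    then show "I i j \<le> lmass \<pi> i * lmass \<pi> j" using rm mprod by simp
  qed
  have key: "AE p in usq. p \<in> fiber \<pi> i \<times> fiber \<pi> j \<longrightarrow> W (fst p) (snd p) = A i j"
    if pi: "lmass \<pi> i > 0" and pj: "lmass \<pi> j > 0" for i j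
  proof -
    let ?D = "fiber \<pi>"
    obtain a where a: "a \<in> ?D i" "lmass \<pi> (\<pi> a) > 0" "?m (cls W a) > 0"
      using AE_pos_point[OF AE_conjI[OF posl pos] fm[of i]] pi by (auto simp: lmass_def)
    obtain b where b: "b \<in> ?D j" "lmass \<pi> (\<pi> b) > 0" "?m (cls W b) > 0"
      using AE_pos_point[OF AE_conjI[OF posl pos] fm[of j]] pj by (auto simp: lmass_def)
    have a01: "a \<in> {0..<1}" "b \<in> {0..<1}" using a b by (auto simp: fiber_def)
    have Da: "?D i = cls W a" using fib[OF a01(1) a(3)] a(1) by (simp add: fiber_def)
    have Db: "?D j = cls W b" using fib[OF a01(2) b(3)] b(1) by (simp add: fiber_def)
    let ?S = "{p\<in>space usq. fst p \<in> ?D i \<longrightarrow> W (fst p) (snd p) = W a (snd p)}"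
    have Sm: "?S \<in> sets usq"
    proof -
      have [measurable]: "(\<lambda>p. W (fst p) (snd p)) \<in> borel_measurable usq" "(\<lambda>p. W a (snd p)) \<in> borel_measurable usq"
        using graphon_measurable[OF W] measurable_compose[OF measurable_snd graphon_sections[OF W a01(1)]] by auto
      have [measurable]: "Measurable.pred unit_space (\<lambda>x. x \<in> ?D i)" using fm by simp
      show ?thesis by measurable
    qed
    have A1: "AE x in unit_space. AE z in unit_space. x \<in> ?D i \<longrightarrow> W x z = W a z"
    proof (rule AE_I2)
      fix x assume "x \<in> space unit_space"
      show "AE z in unit_space. x \<in> ?D i \<longrightarrow> W x z = W a z"
      proof (cases "x \<in> ?D i")
        case True
        then have "AE z in unit_space. W a z = W x z" unfolding Da by (simp add: cls_def)
        then show ?thesis by eventually_elim simp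
      qed simp
    qed
    have A1p: "AE p in usq. fst p \<in> ?D i \<longrightarrow> W (fst p) (snd p) = W a (snd p)"
      by (rule unit2.AE_pair_measure[OF Sm]) (use A1 in simp)
    have A2: "AE z in unit_space. AE x in unit_space. x \<in> ?D i \<longrightarrow> W x z = W a z"
      using A1 unit2.AE_commute[of "\<lambda>x z. x \<in> ?D i \<longrightarrow> W x z = W a z"] Sm by simp
    \<comment> \<open>For \<open>z\<close> in the class of \<open>b\<close>, the value
      \<open>W a z\<close> is the average over \<open>?D i\<close> of the column at
      \<open>z\<close>; by symmetry this is an average of the row of \<open>z\<close>, which agrees
      with the row of \<open>b\<close>. So the value does not depend on \<open>z\<close>.\<close>
    define c where "c = (\<integral>x. indicator (?D i) x * W b x \<partial>unit_space) / lmass \<pi> i"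
    have ai: "AE z in unit_space. z \<in> ?D j \<longrightarrow> W a z = c"
      using A2 AE_space
    proof eventually_elim
      case (elim z)
      have z01: "z \<in> {0..<1}" using elim(2) by simp
      show ?case
      proof
        assume z: "z \<in> ?D j"
        have mz: "(\<lambda>x. indicator (?D i) x * W x z) \<in> borel_measurable unit_space"
          using z01 fm by (intro borel_measurable_times graphon_measurable_comp[OF W]) (auto intro!: measurable_const)
        have "lmass \<pi> i * W a z = (\<integral>x. indicator (?D i) x * W a z \<partial>unit_space)"
          using fm by (simp add: lmass_def)
        also have "\<dots> = (\<integral>x. indicator (?D i) x * W x z \<partial>unit_space)"
        proof (rule integral_cong_AE[OF _ mz])
          show "(\<lambda>x. indicator (?D i) x * W a z) \<in> borel_measurable unit_space" using fm by simp
          show "AE x in unit_space. indicator (?D i) x * W a z = indicator (?D i) x * W x z"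
            using elim(1) by eventually_elim (simp add: indicator_def)
        qed
        also have "\<dots> = (\<integral>x. indicator (?D i) x * W b x \<partial>unit_space)"
        proof (rule integral_cong_AE[OF mz])
          show "(\<lambda>x. indicator (?D i) x * W b x) \<in> borel_measurable unit_space"
            using fm graphon_sections[OF W a01(2)] by simp
          have "AE x in unit_space. W b x = W z x" using z unfolding Db by (simp add: cls_def)
          then show "AE x in unit_space. indicator (?D i) x * W x z = indicator (?D i) x * W b x"
            using AE_space
          proof eventually_elim
            case (elim x)
            then show ?case using graphon_range(3)[OF W z01, of x] by simp
          qed
        qed
        finally show "W a z = c" using pi by (simp add: c_def field_simps)
      qed
    qed
    have "AE p in usq. snd p \<in> ?D j \<longrightarrow> W a (snd p) = c"
    proof (rule AE_usq_snd[OF ai])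
      have [measurable]: "W a \<in> borel_measurable unit_space" by (rule graphon_sections[OF W a01(1)])
      have [measurable]: "Measurable.pred unit_space (\<lambda>x. x \<in> ?D j)" using fm by simp
      show "Measurable.pred unit_space (\<lambda>z. z \<in> ?D j \<longrightarrow> W a z = c)" by measurable
    qed
    with A1p have c: "AE p in usq. p \<in> ?D i \<times> ?D j \<longrightarrow> W (fst p) (snd p) = c"
      by eventually_elim (auto simp: mem_Times_iff)
    have "I i j = (\<integral>p. c * indicator (?D i \<times> ?D j) p \<partial>usq)" unfolding I_def
    proof (rule integral_cong_AE[OF Im])
      show "(\<lambda>p. c * indicator (?D i \<times> ?D j) p) \<in> borel_measurable usq" using rm by simp
      show "AE p in usq. indicator (?D i \<times> ?D j) p * W (fst p) (snd p) = c * indicator (?D i \<times> ?D j) p"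
        using c by eventually_elim (simp add: indicator_def)
    qed
    also have "\<dots> = c * (lmass \<pi> i * lmass \<pi> j)" using rm mprod by simp
    finally have "A i j = c" using pi pj by (simp add: A_def)
    then show ?thesis using c by simp
  qed
  have keyall: "AE p in usq. \<forall>i j. lmass \<pi> i > 0 \<longrightarrow> lmass \<pi> j > 0 \<longrightarrow>
      p \<in> fiber \<pi> i \<times> fiber \<pi> j \<longrightarrow> W (fst p) (snd p) = A i j"
    unfolding AE_all_countable using key by auto
  have poslm: "Measurable.pred unit_space (\<lambda>a. lmass \<pi> (\<pi> a) > 0)"
    by (rule measurable_compose[OF pm]) simp
  have all: "AE p in usq. W (fst p) (snd p) = A (\<pi> (fst p)) (\<pi> (snd p))"
    using keyall AE_usq_fst[OF posl poslm] AE_usq_snd[OF posl poslm] AE_space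
    by eventually_elim (auto simp: fiber_def mem_Times_iff space_pair_measure)
  show ?thesis
  proof (rule that[OF pm])
    show "A i j = A j i" for i j using Isym[of i j] by (simp add: A_def mult.commute conj_commute)
    show "0 \<le> A i j \<and> A i j \<le> 1" for i j using I01[of i j] by (auto simp: A_def divide_le_eq_1)
    show "AE p in usq. W (fst p) (snd p) = A (\<pi> (fst p)) (\<pi> (snd p))" by (rule all)
    fix i j assume ij: "lmass \<pi> i > 0" "lmass \<pi> j > 0" and eq: "\<And>k. lmass \<pi> k > 0 \<Longrightarrow> A i k = A j k"
    have rows: "AE x in unit_space. AE z in unit_space. W x z = A (\<pi> x) (\<pi> z)"
      using unit2.AE_pair[OF all] by simp
    obtain x where x: "x \<in> fiber \<pi> i" "AE z in unit_space. W x z = A (\<pi> x) (\<pi> z)" "?m (cls W x) > 0"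
      using AE_pos_point[OF AE_conjI[OF rows pos] fm[of i]] ij by (auto simp: lmass_def)
    obtain y where y: "y \<in> fiber \<pi> j" "AE z in unit_space. W y z = A (\<pi> y) (\<pi> z)" "?m (cls W y) > 0"
      using AE_pos_point[OF AE_conjI[OF rows pos] fm[of j]] ij by (auto simp: lmass_def)
    have "\<pi> x = i" "\<pi> y = j" using x(1) y(1) by (auto simp: fiber_def)
    have "AE z in unit_space. W x z = W y z"
      using x(2) y(2) posl by eventually_elim (use eq \<open>\<pi> x = i\<close> \<open>\<pi> y = j\<close> in auto)
    then have "y \<in> cls W x" using y(1) by (simp add: cls_def fiber_def)
    then have "\<pi> y = \<pi> x" using cls_eq[of y W x] by (simp add: \<pi>_def)
    then show "i = j" using \<open>\<pi> x = i\<close> \<open>\<pi> y = j\<close> by simp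
  qed
qed

section \<open>Step graphons\<close>

definition stepg :: "(real \<Rightarrow> nat) \<Rightarrow> (nat \<Rightarrow> nat \<Rightarrow> real) \<Rightarrow> real \<Rightarrow> real \<Rightarrow> real" where
  "stepg \<pi> A x y = A (\<pi> x) (\<pi> y)"

definition ldeg :: "(real \<Rightarrow> nat) \<Rightarrow> (nat \<Rightarrow> nat \<Rightarrow> real) \<Rightarrow> nat \<Rightarrow> real" where
  "ldeg \<pi> A i = (\<integral>z. A i (\<pi> z) \<partial>unit_space)"

definition lcod :: "(real \<Rightarrow> nat) \<Rightarrow> (nat \<Rightarrow> nat \<Rightarrow> real) \<Rightarrow> nat \<Rightarrow> nat \<Rightarrow> real" where
  "lcod \<pi> A i j = (\<integral>z. A i (\<pi> z) * A j (\<pi> z) \<partial>unit_space)"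

lemma deg_stepg: "deg (stepg \<pi> A) x = ldeg \<pi> A (\<pi> x)"
  by (simp add: deg_def stepg_def ldeg_def)

lemma cod_stepg: "cod (stepg \<pi> A) x y = lcod \<pi> A (\<pi> x) (\<pi> y)"
  by (simp add: cod_def stepg_def lcod_def)

lemma lcod_sym: "lcod \<pi> A i j = lcod \<pi> A j i"
  by (simp add: lcod_def mult.commute)

lemma graphon_stepg:
  assumes p: "\<pi> \<in> unit_space \<rightarrow>\<^sub>M count_space UNIV" and A: "\<And>i j. A i j = A j i" "\<And>i j. 0 \<le> A i j \<and> A i j \<le> 1"
  shows "graphon (stepg \<pi> A)"
proof -
  have "(\<lambda>q. A (\<pi> (fst q)) (\<pi> (snd q))) \<in> borel_measurable usq"
  proof -
    have "(\<lambda>q. (\<pi> (fst q), \<pi> (snd q))) \<in> usq \<rightarrow>\<^sub>M count_space UNIV \<Otimes>\<^sub>M count_space UNIV"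
      using p by measurable
    then have m: "(\<lambda>q. (\<pi> (fst q), \<pi> (snd q))) \<in> usq \<rightarrow>\<^sub>M count_space (UNIV \<times> UNIV)"
      by (simp add: pair_measure_countable)
    from measurable_compose[OF m, of "\<lambda>q. A (fst q) (snd q)" borel] show ?thesis by simp
  qed
  then show ?thesis using A by (auto simp: graphon_def stepg_def case_prod_unfold)
qed

lemma graph_density_cong_AE:
  assumes W: "graphon W" "graphon W'" and eq: "AE p in usq. W (fst p) (snd p) = W' (fst p) (snd p)"
  shows "graph_density H W = graph_density H W'"
proof -
  let ?n = "card (verts H)"
  have "AE x in points ?n. \<forall>e\<in>vpairs ?n. W (x (fst e)) (x (snd e)) = W' (x (fst e)) (x (snd e))"
  proof (rule AE_finite_allI[OF finite_vpairs])
    fix e assume "e \<in> vpairs ?n"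
    then have "fst e < ?n" "snd e < ?n" "fst e \<noteq> snd e" by (auto simp: vpairs_def)
    from AE_points_pairI[OF this eq]
    show "AE x in points ?n. W (x (fst e)) (x (snd e)) = W' (x (fst e)) (x (snd e))" by simp
  qed
  then have "AE x in points ?n. ind_weight ?n W E x = ind_weight ?n W' E x" for E
  proof eventually_elim
    case (elim x)
    then show ?case unfolding ind_weight_def by (intro prod.cong refl) auto
  qed
  then have "(\<integral>x. ind_weight ?n W E x \<partial>points ?n) = (\<integral>x. ind_weight ?n W' E x \<partial>points ?n)" for E
    by (intro integral_cong_AE ind_weight_measurable W)
  then show ?thesis by (simp add: graph_density_sum W)
qed

lemma fiber_measurable:
  assumes "\<pi> \<in> unit_space \<rightarrow>\<^sub>M count_space UNIV"
  shows "fiber \<pi> i \<in> sets unit_space"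
proof -
  have "\<pi> -` {i} \<inter> space unit_space \<in> sets unit_space" by (rule measurable_sets[OF assms]) simp
  moreover have "\<pi> -` {i} \<inter> space unit_space = fiber \<pi> i" by (auto simp: fiber_def)
  ultimately show ?thesis by simp
qed

lemma emeasure_label_tuple:
  assumes p: "\<pi> \<in> unit_space \<rightarrow>\<^sub>M count_space UNIV"
  shows "{x\<in>space (points n). \<forall>t\<in>{..<n}. x t \<in> fiber \<pi> (\<phi> t)} \<in> sets (points n)"
    "emeasure (points n) {x\<in>space (points n). \<forall>t\<in>{..<n}. x t \<in> fiber \<pi> (\<phi> t)} = (\<Prod>t<n. ennreal (lmass \<pi> (\<phi> t)))"
proof -
  interpret product_prob_space "\<lambda>_. unit_space" "{..<n}"
    by (intro product_prob_spaceI prob_space_unit_space)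
  show "{x\<in>space (points n). \<forall>t\<in>{..<n}. x t \<in> fiber \<pi> (\<phi> t)} \<in> sets (points n)"
    using fiber_measurable[OF p] by (intro sets.sets_Collect_finite_All sets_Collect_single) auto
  show "emeasure (points n) {x\<in>space (points n). \<forall>t\<in>{..<n}. x t \<in> fiber \<pi> (\<phi> t)} = (\<Prod>t<n. ennreal (lmass \<pi> (\<phi> t)))"
    using fiber_measurable[OF p] by (subst emeasure_PiM_Collect) (auto simp: lmass_def unit.emeasure_eq_measure)
qed

text \<open>A tuple of labels of positive mass occurs with positive probability. In this way
  identities valid almost everywhere become identities between labels.\<close>

lemma AE_points_labels:
  assumes p: "\<pi> \<in> unit_space \<rightarrow>\<^sub>M count_space UNIV" and Q: "AE x in points n. Q x"
    and pos: "\<And>t. t < n \<Longrightarrow> lmass \<pi> (\<phi> t) > 0"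
  shows "\<exists>x\<in>space (points n). (\<forall>t<n. \<pi> (x t) = \<phi> t) \<and> Q x"
proof -
  interpret prob_space "points n" by (rule prob_space_points)
  let ?S = "{x\<in>space (points n). \<forall>t\<in>{..<n}. x t \<in> fiber \<pi> (\<phi> t)}"
  have "measure (points n) ?S = (\<Prod>t<n. lmass \<pi> (\<phi> t))"
    unfolding measure_def emeasure_label_tuple(2)[OF p]
    by (simp add: prod_ennreal lmass_def enn2real_ennreal prod_nonneg)
  also have "\<dots> > 0" using pos by (intro prod_pos) auto
  finally obtain x where "x \<in> ?S" "Q x" using AE_pos_point[OF Q emeasure_label_tuple(1)[OF p]] by blast
  then show ?thesis by (auto simp: fiber_def)
qed

definition label_map :: "(real \<Rightarrow> nat) \<Rightarrow> nat \<Rightarrow> (nat \<Rightarrow> real) \<Rightarrow> nat \<Rightarrow> nat" where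
  "label_map \<pi> n x = (\<lambda>t\<in>{..<n}. \<pi> (x t))"

abbreviation tuples :: "nat \<Rightarrow> (nat \<Rightarrow> nat) set" where "tuples n \<equiv> {..<n} \<rightarrow>\<^sub>E UNIV"

lemma label_map_measurable:
  assumes p: "\<pi> \<in> unit_space \<rightarrow>\<^sub>M count_space UNIV"
  shows "label_map \<pi> n \<in> points n \<rightarrow>\<^sub>M count_space (tuples n)"
proof -
  have c: "countable (tuples n)" by (intro countable_PiE) auto
  have "label_map \<pi> n -` {\<phi>} \<inter> space (points n) \<in> sets (points n)" if "\<phi> \<in> tuples n" for \<phi>
  proof -
    have "label_map \<pi> n x = \<phi> \<longleftrightarrow> (\<forall>t\<in>{..<n}. x t \<in> fiber \<pi> (\<phi> t))" if x: "x \<in> space (points n)" for x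
    proof
      assume "label_map \<pi> n x = \<phi>"
      then show "\<forall>t\<in>{..<n}. x t \<in> fiber \<pi> (\<phi> t)"
        using space_pointsD[OF x] by (auto simp: label_map_def fiber_def)
    next
      assume h: "\<forall>t\<in>{..<n}. x t \<in> fiber \<pi> (\<phi> t)"
      show "label_map \<pi> n x = \<phi>"
        by (rule PiE_ext[of _ "{..<n}" "\<lambda>_. UNIV"]) (use h \<open>\<phi> \<in> tuples n\<close> in \<open>auto simp: label_map_def fiber_def\<close>)
    qed
    then have "label_map \<pi> n -` {\<phi>} \<inter> space (points n) = {x\<in>space (points n). \<forall>t\<in>{..<n}. x t \<in> fiber \<pi> (\<phi> t)}"
      by auto
    then show ?thesis using emeasure_label_tuple(1)[OF p] by simp
  qed
  then show ?thesis unfolding measurable_count_space_eq_countable[OF c]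
    by (auto simp: label_map_def)
qed

text \<open>An involution of label tuples that preserves the product of masses preserves their
  distribution. It may treat different tuples differently, so it need not come from one permutation
  of the labels.\<close>

lemma integral_label_permute:
  fixes G :: "(nat \<Rightarrow> nat) \<Rightarrow> real"
  assumes p: "\<pi> \<in> unit_space \<rightarrow>\<^sub>M count_space UNIV"
    and \<tau>: "\<And>\<phi>. \<phi> \<in> tuples n \<Longrightarrow> \<tau> \<phi> \<in> tuples n" "\<And>\<phi>. \<phi> \<in> tuples n \<Longrightarrow> \<tau> (\<tau> \<phi>) = \<phi>"
    and m: "\<And>\<phi> t. \<phi> \<in> tuples n \<Longrightarrow> t < n \<Longrightarrow> lmass \<pi> (\<tau> \<phi> t) = lmass \<pi> (\<phi> t)"
  shows "(\<integral>x. G (\<tau> (label_map \<pi> n x)) \<partial>points n) = (\<integral>x. G (label_map \<pi> n x) \<partial>points n)"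
proof -
  let ?C = "count_space (tuples n)"
  define L where "L = distr (points n) ?C (label_map \<pi> n)"
  have lm: "label_map \<pi> n \<in> points n \<rightarrow>\<^sub>M ?C" by (rule label_map_measurable[OF p])
  have c: "countable (tuples n)" by (intro countable_PiE) auto
  have Ls: "emeasure L {\<phi>} = (\<Prod>t<n. ennreal (lmass \<pi> (\<phi> t)))" if \<phi>: "\<phi> \<in> tuples n" for \<phi>
  proof -
    have "label_map \<pi> n -` {\<phi>} \<inter> space (points n) = {x\<in>space (points n). \<forall>t\<in>{..<n}. x t \<in> fiber \<pi> (\<phi> t)}"
    proof -
      have "label_map \<pi> n x = \<phi> \<longleftrightarrow> (\<forall>t\<in>{..<n}. x t \<in> fiber \<pi> (\<phi> t))" if x: "x \<in> space (points n)" for x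
      proof
        assume "label_map \<pi> n x = \<phi>"
        then show "\<forall>t\<in>{..<n}. x t \<in> fiber \<pi> (\<phi> t)"
          using space_pointsD[OF x] by (auto simp: label_map_def fiber_def)
      next
        assume h: "\<forall>t\<in>{..<n}. x t \<in> fiber \<pi> (\<phi> t)"
        show "label_map \<pi> n x = \<phi>"
          by (rule PiE_ext[of _ "{..<n}" "\<lambda>_. UNIV"]) (use h \<phi> in \<open>auto simp: label_map_def fiber_def\<close>)
      qed
      then show ?thesis by auto
    qed
    then show ?thesis unfolding L_def
      using emeasure_distr[OF lm, of "{\<phi>}"] \<phi> emeasure_label_tuple(2)[OF p] by simp
  qed
  have gm: "F \<in> borel_measurable ?C" for F :: "(nat \<Rightarrow> nat) \<Rightarrow> real" by simp
  have tm: "\<tau> \<in> L \<rightarrow>\<^sub>M ?C" unfolding L_def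
    by (simp only: measurable_distr_eq1 measurable_count_space_eq1) (intro Pi_I, simp only: space_count_space, erule \<tau>(1))
  have "distr L ?C \<tau> = L"
  proof (rule measure_eqI_countable[OF _ _ c])
    show "sets (distr L ?C \<tau>) = Pow (tuples n)" by simp
    show "sets L = Pow (tuples n)" by (simp add: L_def)
    fix \<phi> assume \<phi>: "\<phi> \<in> tuples n"
    have sp: "space L = tuples n" by (simp add: L_def)
    have "\<tau> -` {\<phi>} \<inter> space L = {\<tau> \<phi>}"
    proof (intro equalityI subsetI)
      fix \<psi> assume "\<psi> \<in> \<tau> -` {\<phi>} \<inter> space L"
      then have "\<tau> \<psi> = \<phi>" "\<psi> \<in> tuples n" using sp by simp_all
      then show "\<psi> \<in> {\<tau> \<phi>}" using \<tau>(2)[of \<psi>] by simp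
    next
      fix \<psi> assume "\<psi> \<in> {\<tau> \<phi>}"
      then show "\<psi> \<in> \<tau> -` {\<phi>} \<inter> space L" using \<tau>[OF \<phi>] sp by simp
    qed
    then have "emeasure (distr L ?C \<tau>) {\<phi>} = emeasure L {\<tau> \<phi>}"
      using emeasure_distr[OF tm, of "{\<phi>}"] \<phi> by simp
    also have "\<dots> = emeasure L {\<phi>}"
      unfolding Ls[OF \<phi>] Ls[OF \<tau>(1)[OF \<phi>]] by (intro prod.cong refl) (simp add: m[OF \<phi>])
    finally show "emeasure (distr L ?C \<tau>) {\<phi>} = emeasure L {\<phi>}" .
  qed
  then have "(\<integral>\<phi>. G \<phi> \<partial>L) = (\<integral>\<phi>. G \<phi> \<partial>distr L ?C \<tau>)" by simp
  also have "\<dots> = (\<integral>\<phi>. G (\<tau> \<phi>) \<partial>L)" by (rule integral_distr[OF tm]) (rule gm)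
  finally have "(\<integral>\<phi>. G \<phi> \<partial>L) = (\<integral>\<phi>. G (\<tau> \<phi>) \<partial>L)" .
  moreover have "(\<integral>\<phi>. G \<phi> \<partial>L) = (\<integral>x. G (label_map \<pi> n x) \<partial>points n)"
    unfolding L_def by (rule integral_distr[OF lm]) (rule gm)
  moreover have "(\<integral>\<phi>. G (\<tau> \<phi>) \<partial>L) = (\<integral>x. G (\<tau> (label_map \<pi> n x)) \<partial>points n)"
    unfolding L_def by (rule integral_distr[OF lm]) (rule gm)
  ultimately show ?thesis by (simp only:)
qed

text \<open>The tool for comparing two weightings on the same labels: every single tuple is
  relabelled so that its entries under \<open>A'\<close> become those under
  \<open>A\<close>.\<close>

lemma graph_density_label_permute:
  assumes p: "\<pi> \<in> unit_space \<rightarrow>\<^sub>M count_space UNIV"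
    and A: "\<And>i j. A i j = A j i" "\<And>i j. 0 \<le> A i j \<and> A i j \<le> 1"
    and A': "\<And>i j. A' i j = A' j i" "\<And>i j. 0 \<le> A' i j \<and> A' i j \<le> 1"
    and n: "card (verts H) = n"
    and \<tau>: "\<And>\<phi>. \<phi> \<in> tuples n \<Longrightarrow> \<tau> \<phi> \<in> tuples n" "\<And>\<phi>. \<phi> \<in> tuples n \<Longrightarrow> \<tau> (\<tau> \<phi>) = \<phi>"
    and m: "\<And>\<phi> t. \<phi> \<in> tuples n \<Longrightarrow> t < n \<Longrightarrow> lmass \<pi> (\<tau> \<phi> t) = lmass \<pi> (\<phi> t)"
    and e: "\<And>\<phi> s t. \<phi> \<in> tuples n \<Longrightarrow> s < n \<Longrightarrow> t < n \<Longrightarrow> A' (\<tau> \<phi> s) (\<tau> \<phi> t) = A (\<phi> s) (\<phi> t)"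
  shows "graph_density H (stepg \<pi> A') = graph_density H (stepg \<pi> A)"
proof -
  define G where "G B E \<phi> = (\<Prod>(u, v)\<in>vpairs n. if (u, v) \<in> E then B (\<phi> u) (\<phi> v) else 1 - B (\<phi> u) (\<phi> v))"
    for B :: "nat \<Rightarrow> nat \<Rightarrow> real" and E and \<phi> :: "nat \<Rightarrow> nat"
  have ind: "ind_weight n (stepg \<pi> B) E x = G B E (label_map \<pi> n x)" for B E x
    unfolding ind_weight_def G_def
    by (intro prod.cong refl) (auto simp: vpairs_def label_map_def stepg_def)
  have tup: "label_map \<pi> n x \<in> tuples n" for x by (auto simp: label_map_def)
  have GG: "G A' E (\<tau> \<phi>) = G A E \<phi>" if "\<phi> \<in> tuples n" for E \<phi>
    unfolding G_def by (intro prod.cong refl) (auto simp: vpairs_def e[OF that])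
  have eq: "(\<integral>x. ind_weight n (stepg \<pi> A') E x \<partial>points n) = (\<integral>x. ind_weight n (stepg \<pi> A) E x \<partial>points n)" for E
  proof -
    have "(\<integral>x. ind_weight n (stepg \<pi> A') E x \<partial>points n) = (\<integral>x. G A' E (label_map \<pi> n x) \<partial>points n)"
      by (simp only: ind)
    also have "\<dots> = (\<integral>x. G A' E (\<tau> (label_map \<pi> n x)) \<partial>points n)"
      by (rule integral_label_permute[OF p, symmetric]) (erule \<tau> m, assumption?)+
    also have "\<dots> = (\<integral>x. ind_weight n (stepg \<pi> A) E x \<partial>points n)"
      by (simp only: ind GG[OF tup])
    finally show ?thesis .
  qed
  show ?thesis
    unfolding graph_density_sum[OF graphon_stepg[OF p A]] graph_density_sum[OF graphon_stepg[OF p A']] n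
    by (simp only: eq)
qed

section \<open>Windows of four consecutive weights and the prescribed statistics\<close>

text \<open>A further relation between the two middle weights. Kinds 1 and 2 belong to the turn at
  scale \<open>w\<close>, read in its two directions; kind 3 marks the place where the two
  progressions meet; any other number imposes nothing.\<close>

definition wrel :: "nat \<Rightarrow> real \<Rightarrow> real \<Rightarrow> real" where
  "wrel k b c = (if k = 1 then b - c\<^sup>2 else if k = 2 then c - b\<^sup>2 else if k = 3 then b - c else 0)"

definition wcase :: "real \<times> real \<times> nat \<Rightarrow> real \<Rightarrow> real \<Rightarrow> real \<Rightarrow> real \<Rightarrow> real" where
  "wcase w a b c d = (c - fst w * a)\<^sup>2 + (d - fst (snd w) * b)\<^sup>2 + (wrel (snd (snd w)) b c)\<^sup>2"

definition left_turn :: "real \<times> real \<times> nat" where "left_turn = (2, 25, 1)"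

text \<open>Together with \<open>left_turn\<close> the list is closed under reversal, which sends
  the ratios (S, T) to (1/T, 1/S). The reverse of \<open>left_turn\<close> is (1/25, 1/2, 2) and
  lies in this list, so a turn is singled out in one direction only.\<close>

definition other_windows :: "(real \<times> real \<times> nat) list" where
  "other_windows = [(2, 1/5, 0), (1/5, 2, 0), (5, 1/2, 0), (1/2, 5, 0),
    (25, 1/8, 0), (1/8, 5, 0), (1/25, 1/2, 2), (8, 1/25, 0), (1/5, 8, 0),
    (5, 4, 3), (4, 1/125, 0), (1/125, 2, 0), (1/4, 1/5, 3), (125, 1/4, 0), (1/2, 125, 0)]"

definition okwin :: "real \<Rightarrow> real \<Rightarrow> real \<Rightarrow> real \<Rightarrow> bool" where
  "okwin a b c d \<longleftrightarrow> (\<exists>w\<in>set (left_turn # other_windows). wcase w a b c d = 0)"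

lemma wcase_eq_0: "wcase (S, T, k) a b c d = 0 \<longleftrightarrow> c = S * a \<and> d = T * b \<and> wrel k b c = 0"
proof
  assume h: "wcase (S, T, k) a b c d = 0"
  have "0 \<le> (c - S * a)\<^sup>2" "0 \<le> (d - T * b)\<^sup>2" "0 \<le> (wrel k b c)\<^sup>2" by simp_all
  then have "(c - S * a)\<^sup>2 = 0" "(d - T * b)\<^sup>2 = 0" "(wrel k b c)\<^sup>2 = 0"
    using h unfolding wcase_def fst_conv snd_conv by linarith+
  then show "c = S * a \<and> d = T * b \<and> wrel k b c = 0" by simp
qed (auto simp: wcase_def)

lemma wcase_nonneg: "0 \<le> wcase w a b c d"
  by (simp add: wcase_def)

type_synonym quad = "real \<Rightarrow> real \<Rightarrow> real \<Rightarrow> real \<Rightarrow> real \<Rightarrow> real \<Rightarrow> real"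

text \<open>On a path x0, x1, x2, x3 the numbers \<open>b\<close> and \<open>c\<close> are the
  masses of x1 and x2, and \<open>d1 - c\<close>, \<open>d2 - b\<close> those of x0 and x3. The
  first two factors vanish if x0, x2 or x1, x3 are twins (a walk turning back),
  \<open>const_poly\<close> discards the block. The factor for \<open>left_turn\<close> is left out:
  once \<open>win_poly\<close> is forced to vanish, this polynomial can be nonzero only at left
  turns.\<close>

definition win_rest :: quad where
  "win_rest b c d0 d1 d2 d3 = ((b - d0)\<^sup>2 + (b - d2)\<^sup>2) * ((c - d1)\<^sup>2 + (c - d3)\<^sup>2) * const_poly b d0 d2 *
     (\<Prod>w\<leftarrow>other_windows. wcase w (d1 - c) b c (d2 - b))"

definition win_poly :: quad where
  "win_poly b c d0 d1 d2 d3 = win_rest b c d0 d1 d2 d3 * wcase left_turn (d1 - c) b c (d2 - b)"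

definition at_path :: "quad \<Rightarrow> (real \<Rightarrow> real \<Rightarrow> real) \<Rightarrow> (nat \<Rightarrow> real) \<Rightarrow> real" where
  "at_path F W x = F (cod W (x 0) (x 2)) (cod W (x 1) (x 3)) (deg W (x 0)) (deg W (x 1)) (deg W (x 2)) (deg W (x 3))"

definition path_edges :: "(nat \<times> nat) set" where "path_edges = {(0, 1), (1, 2), (2, 3)}"

lemma path_edges: "path_edges \<subseteq> vpairs 4"
  by (auto simp: path_edges_def vpairs_def)

lemma win_rest_nonneg: "0 \<le> win_rest b c d0 d1 d2 d3"
  unfolding win_rest_def by (intro mult_nonneg_nonneg prod_list_nonneg' const_poly_nonneg wcase_nonneg) auto

lemma win_rest_eq_0: "win_rest b c d0 d1 d2 d3 = 0 \<longleftrightarrow> (b = d0 \<and> b = d2) \<or> (c = d1 \<and> c = d3) \<or>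
    (b = 1/8 \<and> d0 = 1/4 \<and> d2 = 1/4) \<or> (\<exists>w\<in>set other_windows. wcase w (d1 - c) b c (d2 - b) = 0)"
  unfolding win_rest_def mult_eq_0_iff prod_list_eq_0 const_poly_eq_0 sum_power2_eq_zero_iff by auto

lemma win_poly_nonneg: "0 \<le> win_poly b c d0 d1 d2 d3"
  unfolding win_poly_def by (simp add: win_rest_nonneg wcase_nonneg)

lemma win_poly_eq_0: "win_poly b c d0 d1 d2 d3 = 0 \<longleftrightarrow> (b = d0 \<and> b = d2) \<or> (c = d1 \<and> c = d3) \<or>
    (b = 1/8 \<and> d0 = 1/4 \<and> d2 = 1/4) \<or> okwin (d1 - c) b c (d2 - b)"
  unfolding win_poly_def mult_eq_0_iff win_rest_eq_0 okwin_def by auto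

lemma star_poly_core_poly:
  assumes "star_poly m f" "star_poly m g" "star_poly m h"
  shows "star_poly m (\<lambda>W x. core_poly (f W x) (g W x) (h W x))"
proof -
  have "star_poly m (\<lambda>W x. code_poly (f W x) (g W x) (h W x))"
    unfolding code_poly_def case_prod_unfold by (intro star_poly_prod_list star_poly_intros assms)
  then show ?thesis unfolding core_poly_def by (intro star_poly_intros assms)
qed

lemma star_poly_wcase:
  assumes "star_poly m f" "star_poly m g" "star_poly m h" "star_poly m k"
  shows "star_poly m (\<lambda>W x. wcase w (f W x) (g W x) (h W x) (k W x))"
proof -
  have "star_poly m (\<lambda>W x. wrel k (g W x) (h W x))" for k
  proof -
    consider "k = 1" | "k = 2" | "k = 3" | "k \<noteq> 1" "k \<noteq> 2" "k \<noteq> 3" by blast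
    then show ?thesis
      by cases (simp_all add: wrel_def star_poly.const star_poly_diff star_poly_power assms)
  qed
  then show ?thesis unfolding wcase_def by (intro star_poly_intros assms)
qed

lemma star_poly_win_rest: "star_poly 4 (at_path win_rest)"
  unfolding at_path_def[abs_def] win_rest_def const_poly_def
  by (intro star_poly_intros star_poly_prod_list star_poly_wcase) auto

lemma star_poly_win_poly: "star_poly 4 (at_path win_poly)"
proof -
  have "star_poly 4 (\<lambda>W x. at_path win_rest W x *
    wcase left_turn (deg W (x 1) - cod W (x 1) (x 3)) (cod W (x 0) (x 2)) (cod W (x 1) (x 3)) (deg W (x 2) - cod W (x 0) (x 2)))"
    by (intro star_poly.mult star_poly_win_rest star_poly_wcase star_poly_intros) auto
  then show ?thesis by (simp add: at_path_def[abs_def] win_poly_def)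
qed

definition core_at :: "nat \<Rightarrow> nat \<Rightarrow> (real \<Rightarrow> real \<Rightarrow> real) \<Rightarrow> (nat \<Rightarrow> real) \<Rightarrow> real" where
  "core_at i j W x = core_poly (cod W (x i) (x j)) (deg W (x i)) (deg W (x j))"

lemma star_poly_core_at: "i < m \<Longrightarrow> j < m \<Longrightarrow> i \<noteq> j \<Longrightarrow> star_poly m (core_at i j)"
  unfolding core_at_def[abs_def] by (intro star_poly_core_poly star_poly_intros)

definition pair_at :: "(real \<Rightarrow> real \<Rightarrow> real) \<Rightarrow> (nat \<Rightarrow> real) \<Rightarrow> real" where
  "pair_at W x = core_at 0 1 W x * const_poly (cod W (x 0) (x 1)) (deg W (x 0)) (deg W (x 1))"

lemma star_poly_pair_at: "star_poly 2 pair_at"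
  unfolding pair_at_def[abs_def] const_poly_def
  by (intro star_poly_intros star_poly_core_at) auto

text \<open>All clauses but the last are equations between numbers determined by densities.
  Irrationality is a property of one such number, so it too is inherited by graphons with the same
  densities.\<close>

definition forced :: "(real \<Rightarrow> real \<Rightarrow> real) \<Rightarrow> bool" where
  "forced W \<longleftrightarrow> graphon W \<and> stat 2 {} pair_at W = 0 \<and> stat 2 {} (core_at 0 1) W = core_val / 4 \<and>
    stat 3 {} (\<lambda>W x. core_at 0 1 W x * core_at 0 2 W x) W = core_val\<^sup>2 / 8 \<and>
    stat 4 {} (\<lambda>W x. core_at 0 1 W x * core_at 0 2 W x * core_at 0 3 W x) W = core_val ^ 3 / 16 \<and>
    stat 2 {(0, 1)} (core_at 0 1) W = core_val / 8 \<and>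
    stat 4 path_edges (at_path win_poly) W = 0 \<and>
    stat 4 path_edges (at_path win_rest) W \<notin> \<rat>"

lemma agree_mono: "agree N W W' \<Longrightarrow> M \<le> N \<Longrightarrow> agree M W W'"
  by (auto simp: agree_def)

theorem forced_determined:
  "\<exists>N. \<forall>W W'. graphon W \<longrightarrow> graphon W' \<longrightarrow> agree N W W' \<longrightarrow> forced W' \<longrightarrow> forced W"
proof -
  let ?s = "[(2, {}, pair_at), (2, {}, core_at 0 1), (3, {}, \<lambda>W x. core_at 0 1 W x * core_at 0 2 W x),
    (4, {}, \<lambda>W x. core_at 0 1 W x * core_at 0 2 W x * core_at 0 3 W x), (2, {(0, 1)}, core_at 0 1),
    (4, path_edges, at_path win_poly), (4, path_edges, at_path win_rest)]"
  have sp: "star_poly 2 pair_at" "star_poly 2 (core_at 0 1)"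
    "star_poly 3 (\<lambda>W x. core_at 0 1 W x * core_at 0 2 W x)"
    "star_poly 4 (\<lambda>W x. core_at 0 1 W x * core_at 0 2 W x * core_at 0 3 W x)"
    "star_poly 4 (at_path win_poly)" "star_poly 4 (at_path win_rest)"
    by (intro star_poly_pair_at star_poly_win_poly star_poly_win_rest star_poly.mult star_poly_core_at; simp)+
  have ed: "{(0, 1)} \<subseteq> vpairs 2" by (auto simp: vpairs_def)
  obtain N1 where N1: "\<And>W W'. graphon W \<Longrightarrow> graphon W' \<Longrightarrow> agree N1 W W' \<Longrightarrow> stat 2 {} pair_at W = stat 2 {} pair_at W'"
    using stat_determined[OF sp(1), of "{}"] by auto
  obtain N2 where N2: "\<And>W W'. graphon W \<Longrightarrow> graphon W' \<Longrightarrow> agree N2 W W' \<Longrightarrow> stat 2 {} (core_at 0 1) W = stat 2 {} (core_at 0 1) W'"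
    using stat_determined[OF sp(2), of "{}"] by auto
  obtain N3 where N3: "\<And>W W'. graphon W \<Longrightarrow> graphon W' \<Longrightarrow> agree N3 W W' \<Longrightarrow>
    stat 3 {} (\<lambda>W x. core_at 0 1 W x * core_at 0 2 W x) W = stat 3 {} (\<lambda>W x. core_at 0 1 W x * core_at 0 2 W x) W'"
    using stat_determined[OF sp(3), of "{}"] by auto
  obtain N4 where N4: "\<And>W W'. graphon W \<Longrightarrow> graphon W' \<Longrightarrow> agree N4 W W' \<Longrightarrow>
    stat 4 {} (\<lambda>W x. core_at 0 1 W x * core_at 0 2 W x * core_at 0 3 W x) W =
    stat 4 {} (\<lambda>W x. core_at 0 1 W x * core_at 0 2 W x * core_at 0 3 W x) W'"
    using stat_determined[OF sp(4), of "{}"] by auto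
  obtain N5 where N5: "\<And>W W'. graphon W \<Longrightarrow> graphon W' \<Longrightarrow> agree N5 W W' \<Longrightarrow>
    stat 2 {(0, 1)} (core_at 0 1) W = stat 2 {(0, 1)} (core_at 0 1) W'"
    using stat_determined[OF sp(2) ed] by auto
  obtain N6 where N6: "\<And>W W'. graphon W \<Longrightarrow> graphon W' \<Longrightarrow> agree N6 W W' \<Longrightarrow>
    stat 4 path_edges (at_path win_poly) W = stat 4 path_edges (at_path win_poly) W'"
    using stat_determined[OF sp(5) path_edges] by auto
  obtain N7 where N7: "\<And>W W'. graphon W \<Longrightarrow> graphon W' \<Longrightarrow> agree N7 W W' \<Longrightarrow>
    stat 4 path_edges (at_path win_rest) W = stat 4 path_edges (at_path win_rest) W'"
    using stat_determined[OF sp(6) path_edges] by auto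
  define N where "N = N1 + N2 + N3 + N4 + N5 + N6 + N7"
  show ?thesis
  proof (intro exI[of _ N] allI impI)
    fix W W' assume a: "graphon W" "graphon W'" "agree N W W'" "forced W'"
    have ag: "agree M W W'" if "M \<le> N" for M by (rule agree_mono[OF a(3) that])
    show "forced W"
      using a(1,4) N1[OF a(1,2) ag] N2[OF a(1,2) ag] N3[OF a(1,2) ag] N4[OF a(1,2) ag] N5[OF a(1,2) ag]
        N6[OF a(1,2) ag] N7[OF a(1,2) ag]
      unfolding forced_def N_def by simp
  qed
qed

lemma stat2: "graphon W \<Longrightarrow> g \<in> borel_measurable usq \<Longrightarrow> (\<And>x. f W x = g (x 0, x 1)) \<Longrightarrow> stat 2 {} f W = (\<integral>p. g p \<partial>usq)"
  unfolding stat_def by (simp add: integral_points_pair)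

lemma core_at_eq: "core_at i j W x = core_of W (x i, x j)"
  by (simp add: core_at_def core_of_def)

lemma core_of_bounded:
  assumes "graphon W"
  shows "\<exists>B\<ge>0. \<forall>a\<in>{0..<1}. \<forall>b\<in>{0..<1}. \<bar>core_of W (a, b)\<bar> \<le> B"
proof -
  obtain B where B: "B \<ge> 0" "\<forall>x\<in>space (points 2). \<bar>core_at 0 1 W x\<bar> \<le> B"
    using star_poly_bounded[OF star_poly_core_at[of 0 2 1] assms] by auto
  show ?thesis
  proof (intro exI[of _ B] conjI ballI B(1))
    fix a b :: real assume ab: "a \<in> {0..<1}" "b \<in> {0..<1}"
    define x where "x = (\<lambda>i\<in>{..<2::nat}. if i = 0 then a else b)"
    have "x \<in> space (points 2)" using ab by (auto simp: x_def space_PiM)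
    then have "\<bar>core_at 0 1 W x\<bar> \<le> B" using B(2) by blast
    then show "\<bar>core_of W (a, b)\<bar> \<le> B" by (simp add: core_at_eq x_def)
  qed
qed

lemma core_row_bound:
  assumes "B \<ge> 0" "\<forall>a\<in>{0..<1}. \<forall>b\<in>{0..<1}. \<bar>core_of W (a, b)\<bar> \<le> B" "a \<in> {0..<1}"
  shows "\<bar>\<integral>b. core_of W (a, b) \<partial>unit_space\<bar> \<le> B"
proof -
  have nn: "core_of W (a, b) \<ge> 0" for b by (simp add: core_of_def core_poly_nonneg)
  have "(\<integral>b. core_of W (a, b) \<partial>unit_space) \<le> B"
  proof (cases "integrable unit_space (\<lambda>b. core_of W (a, b))")
    case True
    have "AE b in unit_space. core_of W (a, b) \<le> B"
    proof (rule AE_I2)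
      fix b assume "b \<in> space unit_space"
      then have "\<bar>core_of W (a, b)\<bar> \<le> B" using assms(2,3) by simp
      then show "core_of W (a, b) \<le> B" by simp
    qed
    then show ?thesis by (rule unit.integral_le_const[OF True])
  qed (simp add: not_integrable_integral_eq assms(1))
  moreover have "0 \<le> (\<integral>b. core_of W (a, b) \<partial>unit_space)" using nn by simp
  ultimately show ?thesis by simp
qed

text \<open>One factor of the power of the row integral is opened up as an integral over the second
  coordinate.\<close>

lemma integral_core_moment:
  assumes W: "graphon W"
  shows "(\<integral>p. core_of W p * (\<integral>b. core_of W (fst p, b) \<partial>unit_space) ^ k \<partial>usq) =
    (\<integral>a. (\<integral>b. core_of W (a, b) \<partial>unit_space) ^ Suc k \<partial>unit_space)"
proof -
  define r where "r a = (\<integral>b. core_of W (a, b) \<partial>unit_space)" for a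
  have rm: "r \<in> borel_measurable unit_space"
  proof -
    have "(\<lambda>(a, b). core_of W (a, b)) \<in> borel_measurable usq" using core_of_measurable[OF W] by (simp add: case_prod_unfold)
    from unit.borel_measurable_lebesgue_integral[OF this] show ?thesis unfolding r_def[abs_def] .
  qed
  obtain B where B: "B \<ge> 0" "\<forall>a\<in>{0..<1}. \<forall>b\<in>{0..<1}. \<bar>core_of W (a, b)\<bar> \<le> B" using core_of_bounded[OF W] by auto
  have rb: "\<bar>r a\<bar> \<le> B" if a: "a \<in> {0..<1}" for a
    unfolding r_def by (rule core_row_bound[OF B a])
  have m: "(\<lambda>p. core_of W p * r (fst p) ^ k) \<in> borel_measurable usq"
    by (intro borel_measurable_times borel_measurable_power core_of_measurable[OF W] measurable_compose[OF measurable_fst rm])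
  have i: "integrable usq (\<lambda>p. core_of W p * r (fst p) ^ k)"
  proof (rule integrable_usq[of _ "B * B ^ k", OF m])
    fix a b :: real assume ab: "a \<in> {0..<1}" "b \<in> {0..<1}"
    have "\<bar>core_of W (a, b)\<bar> * \<bar>r a\<bar> ^ k \<le> B * B ^ k"
      using B ab rb[OF ab(1)] by (intro mult_mono power_mono) auto
    then show "\<bar>core_of W (a, b) * r (fst (a, b)) ^ k\<bar> \<le> B * B ^ k" by (simp add: abs_mult power_abs)
  qed
  have "(\<integral>p. core_of W p * r (fst p) ^ k \<partial>usq) = (\<integral>a. (\<integral>b. core_of W (a, b) * r a ^ k \<partial>unit_space) \<partial>unit_space)"
    using unit2.integral_fst'[OF i] by simp
  also have "\<dots> = (\<integral>a. r a ^ Suc k \<partial>unit_space)" by (simp add: r_def)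
  finally show ?thesis by (simp only: r_def)
qed

text \<open>The products of \<open>core_at\<close> with common root 0 become moments of the row
  integral when the other coordinates are integrated out one at a time.\<close>

lemma forced_imp_forced_pairs:
  assumes "forced W"
  shows "forced_pairs W"
proof -
  have W: "graphon W" using assms by (simp add: forced_def)
  let ?r = "\<lambda>a. \<integral>b. core_of W (a, b) \<partial>unit_space"
  note cm = core_of_measurable[OF W]
  have rm: "?r \<in> borel_measurable unit_space"
  proof -
    have "(\<lambda>(a, b). core_of W (a, b)) \<in> borel_measurable usq" using cm by (simp add: case_prod_unfold)
    from unit.borel_measurable_lebesgue_integral[OF this] show ?thesis .
  qed
  have crm: "(\<lambda>p. core_of W p * ?r (fst p) ^ k) \<in> borel_measurable usq" for k
    by (intro borel_measurable_times borel_measurable_power cm measurable_compose[OF measurable_fst rm])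
  have "AE x in points 2. (\<Prod>(u, v)\<in>{}. W (x u) (x v)) * pair_at W x = 0"
    using assms by (intro stat_zero_AE[OF star_poly_pair_at W])
      (auto simp: forced_def pair_at_def core_at_def core_poly_nonneg const_poly_nonneg)
  moreover define P where "P p \<longleftrightarrow> core_of W p * const_poly (cod W (fst p) (snd p)) (deg W (fst p)) (deg W (snd p)) = 0" for p
  ultimately have "AE x in points 2. P (x 0, x 1)" by (simp add: pair_at_def core_at_eq)
  moreover have "Measurable.pred usq P"
  proof -
    have [measurable]: "(\<lambda>p. cod W (fst p) (snd p)) \<in> borel_measurable usq" "core_of W \<in> borel_measurable usq"
      "(\<lambda>p. deg W (fst p)) \<in> borel_measurable usq" "(\<lambda>p. deg W (snd p)) \<in> borel_measurable usq"
      using cod_measurable[OF W] cm measurable_compose[OF measurable_fst deg_measurable[OF W]]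
        measurable_compose[OF measurable_snd deg_measurable[OF W]] by auto
    show ?thesis unfolding P_def[abs_def] const_poly_def by measurable
  qed
  ultimately have "AE p in usq. P p" using AE_points_pair[of 0 2 1 P] by simp
  then have c1: "AE p in usq. core_of W p * const_poly (cod W (fst p) (snd p)) (deg W (fst p)) (deg W (snd p)) = 0"
    by (simp only: P_def)
  have "(\<integral>p. core_of W p \<partial>usq) = core_val / 4"
    using assms stat2[OF W cm, of "core_at 0 1"] by (simp add: forced_def core_at_eq)
  then have c2: "(\<integral>a. ?r a \<partial>unit_space) = core_val / 4" using integral_core_moment[OF W, of 0] by simp
  have i3: "stat 3 {} (\<lambda>W x. core_at 0 1 W x * core_at 0 2 W x) W = (\<integral>p. core_of W p * ?r (fst p) ^ 1 \<partial>usq)"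
  proof -
    have i: "integrable (points (Suc 2)) (\<lambda>x. core_at 0 1 W x * core_at 0 2 W x)"
      using stat_integrable[of 3 "\<lambda>W x. core_at 0 1 W x * core_at 0 2 W x" W "{}"] W
      by (simp add: star_poly.mult star_poly_core_at numeral_3_eq_3 numeral_2_eq_2)
    have "stat 3 {} (\<lambda>W x. core_at 0 1 W x * core_at 0 2 W x) W = (\<integral>x. core_at 0 1 W x * core_at 0 2 W x \<partial>points (Suc 2))"
      by (simp add: stat_def numeral_3_eq_3 numeral_2_eq_2)
    also have "\<dots> = (\<integral>x. core_of W (x 0, x 1) * ?r (x 0) \<partial>points 2)"
      unfolding integral_points_Suc[OF i] by (simp add: core_at_eq)
    also have "\<dots> = (\<integral>p. core_of W p * ?r (fst p) ^ 1 \<partial>usq)"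
      using integral_points_pair[of 0 2 1, OF _ _ _ crm[of 1]] by simp
    finally show ?thesis .
  qed
  have i4: "stat 4 {} (\<lambda>W x. core_at 0 1 W x * core_at 0 2 W x * core_at 0 3 W x) W = (\<integral>p. core_of W p * ?r (fst p) ^ 2 \<partial>usq)"
  proof -
    have i: "integrable (points (Suc 3)) (\<lambda>x. core_at 0 1 W x * core_at 0 2 W x * core_at 0 3 W x)"
      using stat_integrable[of 4 "\<lambda>W x. core_at 0 1 W x * core_at 0 2 W x * core_at 0 3 W x" W "{}"] W
      by (simp add: star_poly.mult star_poly_core_at)
    obtain B where B: "B \<ge> 0" "\<forall>a\<in>{0..<1}. \<forall>b\<in>{0..<1}. \<bar>core_of W (a, b)\<bar> \<le> B" using core_of_bounded[OF W] by auto
    have rb: "\<bar>?r a\<bar> \<le> B" if a: "a \<in> {0..<1}" for a by (rule core_row_bound[OF B a])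
    have ii: "integrable (points (Suc 2)) (\<lambda>x. core_at 0 1 W x * core_at 0 2 W x * ?r (x 0))"
    proof (rule integrable_points[of _ _ "B * B * B"])
      have "core_at 0 1 W \<in> borel_measurable (points (Suc 2))" "core_at 0 2 W \<in> borel_measurable (points (Suc 2))"
        by (rule star_poly_measurable[OF star_poly_core_at W]; simp)+
      then show "(\<lambda>x. core_at 0 1 W x * core_at 0 2 W x * ?r (x 0)) \<in> borel_measurable (points (Suc 2))"
        using measurable_compose[OF measurable_coord[of 0 "Suc 2"] rm] by simp
      fix x assume x: "x \<in> space (points (Suc 2))"
      have x3: "x 0 \<in> {0..<1}" "x 1 \<in> {0..<1}" "x 2 \<in> {0..<1}" using space_pointsD[OF x] by auto
      have "\<bar>core_of W (x 0, x 1)\<bar> * \<bar>core_of W (x 0, x 2)\<bar> * \<bar>?r (x 0)\<bar> \<le> B * B * B"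
        using B x3 rb[OF x3(1)] by (intro mult_mono) auto
      then show "\<bar>core_at 0 1 W x * core_at 0 2 W x * ?r (x 0)\<bar> \<le> B * B * B"
        by (simp add: abs_mult core_at_eq)
    qed
    have "stat 4 {} (\<lambda>W x. core_at 0 1 W x * core_at 0 2 W x * core_at 0 3 W x) W =
        (\<integral>x. core_at 0 1 W x * core_at 0 2 W x * core_at 0 3 W x \<partial>points (Suc 3))"
      by (simp add: stat_def)
    also have "\<dots> = (\<integral>x. core_at 0 1 W x * core_at 0 2 W x * ?r (x 0) \<partial>points (Suc 2))"
      unfolding integral_points_Suc[OF i] by (simp add: core_at_eq)
    also have "\<dots> = (\<integral>x. core_of W (x 0, x 1) * ?r (x 0) ^ 2 \<partial>points 2)"
      unfolding integral_points_Suc[OF ii] by (simp add: core_at_eq power2_eq_square mult_ac)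
    also have "\<dots> = (\<integral>p. core_of W p * ?r (fst p) ^ 2 \<partial>usq)"
      using integral_points_pair[of 0 2 1, OF _ _ _ crm[of 2]] by simp
    finally show ?thesis .
  qed
  have c3: "(\<integral>a. (?r a)\<^sup>2 \<partial>unit_space) = core_val\<^sup>2 / 8"
    using i3 integral_core_moment[OF W, of 1] assms by (simp add: forced_def numeral_2_eq_2)
  have c4: "(\<integral>a. ?r a ^ 3 \<partial>unit_space) = core_val ^ 3 / 16"
    using i4 integral_core_moment[OF W, of 2] assms by (simp add: forced_def numeral_3_eq_3)
  have c5: "(\<integral>p. W (fst p) (snd p) * core_of W p \<partial>usq) = core_val / 8"
  proof -
    have "stat 2 {(0, 1)} (core_at 0 1) W = (\<integral>x. (\<lambda>p. W (fst p) (snd p) * core_of W p) (x 0, x 1) \<partial>points 2)"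
      by (simp add: stat_def core_at_eq)
    also have "\<dots> = (\<integral>p. W (fst p) (snd p) * core_of W p \<partial>usq)"
      by (rule integral_points_pair) (auto intro: borel_measurable_times[OF graphon_measurable[OF W] cm])
    finally show ?thesis using assms by (simp add: forced_def)
  qed
  show ?thesis unfolding forced_pairs_def using W c1 c2 c3 c4 c5 by simp
qed

section \<open>Labelled graphs of forced graphons\<close>

locale step_graph =
  fixes \<pi> :: "real \<Rightarrow> nat" and A :: "nat \<Rightarrow> nat \<Rightarrow> real"
  assumes pm: "\<pi> \<in> unit_space \<rightarrow>\<^sub>M count_space UNIV"
    and A_sym: "A i j = A j i" and A01: "0 \<le> A i j \<and> A i j \<le> 1"
begin

abbreviation "m \<equiv> lmass \<pi>"
abbreviation "d \<equiv> ldeg \<pi> A"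
abbreviation "U \<equiv> lcod \<pi> A"

lemma graphon_step: "graphon (stepg \<pi> A)"
  by (rule graphon_stepg[OF pm A_sym A01])

lemma fib: "fiber \<pi> i \<in> sets unit_space"
  by (rule fiber_measurable[OF pm])

lemma m_nonneg: "0 \<le> m i" and m_le_1: "m i \<le> 1"
  by (simp_all add: lmass_def)

lemma label_measurable: "(\<lambda>z. f (\<pi> z)) \<in> borel_measurable unit_space" for f :: "nat \<Rightarrow> real"
  by (rule measurable_compose[OF pm]) simp

lemma label_integrable: "(\<And>k. \<bar>f k\<bar> \<le> B) \<Longrightarrow> integrable unit_space (\<lambda>z. f (\<pi> z))" for f :: "nat \<Rightarrow> real"
  by (rule integrable_unit[of _ B, OF label_measurable]) simp

lemma AE_label_pos: "AE z in unit_space. m (\<pi> z) > 0"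
proof -
  have "AE z in unit_space. \<forall>i. m i = 0 \<longrightarrow> z \<notin> fiber \<pi> i"
    unfolding AE_all_countable
  proof
    fix i
    show "AE z in unit_space. m i = 0 \<longrightarrow> z \<notin> fiber \<pi> i"
    proof (cases "m i = 0")
      case True
      then have "fiber \<pi> i \<in> null_sets unit_space"
        using fib by (auto simp: null_sets_def unit.emeasure_eq_measure lmass_def)
      from AE_not_in[OF this] show ?thesis by eventually_elim simp
    qed simp
  qed
  then show ?thesis using AE_space
  proof eventually_elim
    case (elim z)
    then have "m (\<pi> z) \<noteq> 0" by (auto simp: fiber_def)
    then show ?case using m_nonneg[of "\<pi> z"] by linarith
  qed
qed

lemma AE_label_point:
  assumes "AE z in unit_space. P z" "m i > 0"
  shows "\<exists>z\<in>{0..<1}. \<pi> z = i \<and> P z"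
  using AE_pos_point[OF assms(1) fib[of i]] assms(2) by (auto simp: lmass_def fiber_def)

lemma label_integral_zero:
  fixes f :: "nat \<Rightarrow> real"
  assumes "\<And>k. 0 \<le> f k \<and> f k \<le> B" "(\<integral>z. f (\<pi> z) \<partial>unit_space) = 0" "m k > 0"
  shows "f k = 0"
proof -
  have "integrable unit_space (\<lambda>z. f (\<pi> z))" by (rule label_integrable[of f B]) (use assms(1) in simp)
  then have "AE z in unit_space. f (\<pi> z) = 0"
    using integral_nonneg_eq_0_iff_AE[of unit_space "\<lambda>z. f (\<pi> z)"] assms(1,2) by simp
  from AE_label_point[OF this assms(3)] show ?thesis by auto
qed

lemma label_integral_cong:
  fixes f g :: "nat \<Rightarrow> real"
  assumes "\<And>k. m k > 0 \<Longrightarrow> f k = g k"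
  shows "(\<integral>z. f (\<pi> z) \<partial>unit_space) = (\<integral>z. g (\<pi> z) \<partial>unit_space)"
  using AE_label_pos by (intro integral_cong_AE label_measurable) (auto elim!: eventually_mono simp: assms)

lemma label_integral_sum:
  fixes f :: "nat \<Rightarrow> real"
  assumes "finite K" "\<And>k. m k > 0 \<Longrightarrow> k \<notin> K \<Longrightarrow> f k = 0"
  shows "(\<integral>z. f (\<pi> z) \<partial>unit_space) = (\<Sum>k\<in>K. m k * f k)"
proof -
  have "(\<integral>z. f (\<pi> z) \<partial>unit_space) = (\<integral>z. (\<Sum>k\<in>K. f k * indicator {k} (\<pi> z)) \<partial>unit_space)"
  proof (rule label_integral_cong)
    fix k assume k: "m k > 0"
    have "(\<Sum>j\<in>K. f j * indicator {j} k) = (\<Sum>j\<in>K. if j = k then f k else 0)"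
      by (intro sum.cong) (auto simp: indicator_def)
    also have "\<dots> = f k" using assms k by (simp add: sum.delta)
    finally show "f k = (\<Sum>j\<in>K. f j * indicator {j} k)" by simp
  qed
  also have "\<dots> = (\<Sum>k\<in>K. \<integral>z. f k * indicator {k} (\<pi> z) \<partial>unit_space)"
  proof (rule Bochner_Integration.integral_sum)
    fix k
    show "integrable unit_space (\<lambda>z. f k * indicator {k} (\<pi> z))"
      by (rule label_integrable[of "\<lambda>j. f k * indicator {k} j" "\<bar>f k\<bar>"]) (simp add: indicator_def)
  qed
  also have "\<dots> = (\<Sum>k\<in>K. m k * f k)"
  proof (intro sum.cong refl)
    fix k
    have "(\<integral>z. f k * indicator {k} (\<pi> z) \<partial>unit_space) = (\<integral>z. f k * indicator (fiber \<pi> k) z \<partial>unit_space)"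
      by (intro Bochner_Integration.integral_cong refl) (auto simp: fiber_def indicator_def)
    also have "\<dots> = m k * f k" using fib by (simp add: lmass_def)
    finally show "(\<integral>z. f k * indicator {k} (\<pi> z) \<partial>unit_space) = m k * f k" .
  qed
  finally show ?thesis .
qed

lemma d_nonneg: "0 \<le> d i"
  unfolding ldeg_def using A01 by simp

lemma U_nonneg: "0 \<le> U i j"
  unfolding lcod_def using A01 by simp

lemma d_zero: "d i = 0 \<Longrightarrow> m k > 0 \<Longrightarrow> A i k = 0"
  unfolding ldeg_def by (rule label_integral_zero[of "A i" 1]) (use A01 in auto)

lemma U_zero: "U i j = 0 \<Longrightarrow> m k > 0 \<Longrightarrow> A i k * A j k = 0"
  unfolding lcod_def
  by (rule label_integral_zero[of "\<lambda>k. A i k * A j k" 1]) (use A01 in \<open>auto intro: mult_le_one\<close>)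

lemma d_minus_U: "d i - U i j = (\<integral>z. A i (\<pi> z) * (1 - A j (\<pi> z)) \<partial>unit_space)"
proof -
  have i1: "integrable unit_space (\<lambda>z. A i (\<pi> z))" by (rule label_integrable[of "A i" 1]) (use A01 in auto)
  have i2: "integrable unit_space (\<lambda>z. A i (\<pi> z) * A j (\<pi> z))"
    by (rule label_integrable[of "\<lambda>k. A i k * A j k" 1]) (use A01 in \<open>auto simp: abs_mult intro: mult_le_one\<close>)
  show ?thesis unfolding ldeg_def lcod_def
    by (subst Bochner_Integration.integral_diff[OF i1 i2, symmetric]) (simp add: algebra_simps)
qed

lemma U_eq_d: "U i j = d i \<Longrightarrow> m k > 0 \<Longrightarrow> A i k * (1 - A j k) = 0"
  using label_integral_zero[of "\<lambda>k. A i k * (1 - A j k)" 1 k] d_minus_U[of i j] A01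
  by (simp add: mult_le_one)

end

text \<open>The quotients of the larger by the smaller entry of each pair in \<open>codes\<close>.
  No product of two of them is again in the list, and this bounds the number of neighbours by
  two.\<close>

definition cratios :: "real list" where
  "cratios = [25/21, 4/3, 5/3, 2, 12/5, 13/3, 5, 75/13, 6, 105]"

lemma cratios_product_free: "a \<in> set cratios \<Longrightarrow> b \<in> set cratios \<Longrightarrow> a * b \<notin> set cratios"
proof -
  have "\<forall>a\<in>set cratios. \<forall>b\<in>set cratios. a * b \<notin> set cratios" by (simp add: cratios_def)
  then show "a \<in> set cratios \<Longrightarrow> b \<in> set cratios \<Longrightarrow> a * b \<notin> set cratios" by blast
qed

lemma is_code_sym: "is_code u x y \<Longrightarrow> is_code u y x"
  unfolding is_code_def by fast

lemma codes_ratios: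
  assumes "(a, b) \<in> set codes"
  shows "0 < a \<and> 0 < b \<and> (b < a \<longrightarrow> a / b \<in> set cratios) \<and> (a < b \<longrightarrow> b / a \<in> set cratios)"
proof -
  have "\<forall>p\<in>set codes. 0 < fst p \<and> 0 < snd p \<and> (snd p < fst p \<longrightarrow> fst p / snd p \<in> set cratios) \<and>
    (fst p < snd p \<longrightarrow> snd p / fst p \<in> set cratios)"
    by (simp add: codes_def cratios_def)
  from bspec[OF this assms] show ?thesis by simp
qed

lemma is_code_ratios:
  assumes "is_code u x y" "y < x" "0 < y"
  shows "\<exists>r\<in>set cratios. x = r * y"
proof -
  obtain a b where ab: "(a, b) \<in> set codes" "(x = a * u \<and> y = b * u) \<or> (x = b * u \<and> y = a * u)"
    using assms(1) unfolding is_code_def by blast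
  have pos: "0 < a" "0 < b" using codes_ratios[OF ab(1)] by auto
  have "0 < u" using ab(2) assms(3) pos by (auto simp: zero_less_mult_iff)
  from ab(2) show ?thesis
  proof
    assume h: "x = a * u \<and> y = b * u"
    then have "b < a" using assms(2) \<open>0 < u\<close> by simp
    then have "a / b \<in> set cratios" using codes_ratios[OF ab(1)] by auto
    moreover have "x = a / b * y" using h pos by simp
    ultimately show ?thesis by blast
  next
    assume h: "x = b * u \<and> y = a * u"
    then have "a < b" using assms(2) \<open>0 < u\<close> by simp
    then have "b / a \<in> set cratios" using codes_ratios[OF ab(1)] by auto
    moreover have "x = b / a * y" using h pos by simp
    ultimately show ?thesis by blast
  qed
qed

lemma is_code_no_chain:
  assumes "is_code u x y" "is_code v y z" "is_code w x z" "z < y" "y < x" "0 < z"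
  shows False
proof -
  obtain a where a: "a \<in> set cratios" "x = a * y" using is_code_ratios[OF assms(1)] assms by auto
  obtain b where b: "b \<in> set cratios" "y = b * z" using is_code_ratios[OF assms(2)] assms by auto
  obtain c where c: "c \<in> set cratios" "x = c * z" using is_code_ratios[OF assms(3)] assms by auto
  have "c = a * b" using a b c assms(6) by simp
  then show False using cratios_product_free[OF a(1) b(1)] c(1) by simp
qed

text \<open>Sorted by size, the quotient of the largest and the smallest number would be a product
  of two quotients from \<open>cratios\<close>.\<close>

lemma is_code_no_triple:
  assumes "is_code u x y" "is_code v y z" "is_code w x z" "0 < x" "0 < y" "0 < z"
  shows False
proof -
  note s = is_code_sym[OF assms(1)] is_code_sym[OF assms(2)] is_code_sym[OF assms(3)]
  have ne: "x \<noteq> y" "y \<noteq> z" "x \<noteq> z"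
    using is_code_ratio[OF assms(1)] is_code_ratio[OF assms(2)] is_code_ratio[OF assms(3)] assms(4-6) by auto
  then consider "z < y" "y < x" | "y < z" "z < x" | "z < x" "x < y" | "x < z" "z < y" | "y < x" "x < z" | "x < y" "y < z"
    by linarith
  then show False
  proof cases
    case 1 then show ?thesis using is_code_no_chain[OF assms(1,2,3)] assms by simp
  next
    case 2 then show ?thesis using is_code_no_chain[OF assms(3) s(2) assms(1)] assms by simp
  next
    case 3 then show ?thesis using is_code_no_chain[OF s(1) assms(3,2)] assms by simp
  next
    case 4 then show ?thesis using is_code_no_chain[OF assms(2) s(3) s(1)] assms by simp
  next
    case 5 then show ?thesis using is_code_no_chain[OF s(3) assms(1) s(2)] assms by simp
  next
    case 6 then show ?thesis using is_code_no_chain[OF s(2) s(1) s(3)] assms by simp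
  qed
qed

text \<open>All entries of \<open>codes\<close> exceed 1. On a path this says that a vertex next to
  a shared neighbour has further mass around it, so the path goes on.\<close>

lemma is_code_gt: "is_code u x y \<Longrightarrow> 0 < u \<Longrightarrow> u < x \<and> u < y"
  unfolding is_code_def codes_def by auto

locale forced_step = step_graph +
  assumes forced: "forced (stepg \<pi> A)"
    and twin_free: "m i > 0 \<Longrightarrow> m j > 0 \<Longrightarrow> (\<And>k. m k > 0 \<Longrightarrow> A i k = A j k) \<Longrightarrow> i = j"
begin

definition cp :: "nat \<Rightarrow> nat \<Rightarrow> bool" where
  "cp i j \<longleftrightarrow> U i j = 1/8 \<and> d i = 1/4 \<and> d j = 1/4"

lemma const_pair_step: "const_pair (stepg \<pi> A) p \<longleftrightarrow> cp (\<pi> (fst p)) (\<pi> (snd p))"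
  by (simp add: const_pair_def cp_def deg_stepg cod_stepg)

lemma pair_cases:
  assumes "m i > 0" "m j > 0"
  shows "U i j = 0 \<or> (U i j = d i \<and> U i j = d j) \<or> is_code (U i j) (d i) (d j) \<or> cp i j"
proof -
  have "AE x in points 2. (\<Prod>(u, v)\<in>{}. stepg \<pi> A (x u) (x v)) * pair_at (stepg \<pi> A) x = 0"
    using forced by (intro stat_zero_AE[OF star_poly_pair_at graphon_step])
      (auto simp: forced_def pair_at_def core_at_def core_poly_nonneg const_poly_nonneg)
  then have AE: "AE x in points 2. pair_at (stepg \<pi> A) x = 0" by simp
  have pos: "m (if t = 0 then i else j) > 0" for t :: nat using assms by simp
  obtain x where x: "\<forall>t<2. \<pi> (x t) = (if t = 0 then i else j)" "pair_at (stepg \<pi> A) x = 0"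
    using AE_points_labels[OF pm AE, of "\<lambda>t. if t = 0 then i else j", OF pos] by blast
  have "\<pi> (x 0) = i" "\<pi> (x 1) = j" using x(1) by auto
  then have "core_poly (U i j) (d i) (d j) * const_poly (U i j) (d i) (d j) = 0"
    using x(2) by (simp add: pair_at_def core_at_def deg_stepg cod_stepg)
  then show ?thesis by (auto simp: core_poly_eq_0 const_poly_eq_0 cp_def)
qed

lemma window_zero:
  assumes "m x > 0" "m z > 0" "m y > 0" "m t > 0"
  shows "A x z * A z y * A y t * win_poly (U x y) (U z t) (d x) (d z) (d y) (d t) = 0"
proof -
  have "AE v in points 4. (\<Prod>(u, w)\<in>path_edges. stepg \<pi> A (v u) (v w)) * at_path win_poly (stepg \<pi> A) v = 0"
    using forced by (intro stat_zero_AE[OF star_poly_win_poly graphon_step path_edges])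
      (auto simp: forced_def at_path_def win_poly_nonneg)
  note AE = this
  have pos: "m (if n = 0 then x else if n = 1 then z else if n = 2 then y else t) > 0" for n :: nat using assms by simp
  obtain v where v: "\<forall>n<4. \<pi> (v n) = (if n = 0 then x else if n = 1 then z else if n = 2 then y else t)"
    "(\<Prod>(u, w)\<in>path_edges. stepg \<pi> A (v u) (v w)) * at_path win_poly (stepg \<pi> A) v = 0"
    using AE_points_labels[OF pm AE, of "\<lambda>n. if n = 0 then x else if n = 1 then z else if n = 2 then y else t", OF pos]
    by blast
  have "\<pi> (v 0) = x" "\<pi> (v 1) = z" "\<pi> (v 2) = y" "\<pi> (v 3) = t" using v(1) by auto
  then show ?thesis using v(2) by (simp add: at_path_def deg_stepg cod_stepg stepg_def path_edges_def mult_ac)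
qed

lemma label_rectangle_point:
  assumes "AE p in usq. P p" "S \<in> sets unit_space" "measure unit_space S > 0"
    "T \<in> sets unit_space" "measure unit_space T > 0"
  shows "\<exists>a\<in>S. \<exists>b\<in>T. P (a, b)"
proof -
  have "measure usq (S \<times> T) = measure unit_space S * measure unit_space T"
    using unit.emeasure_pair_measure_Times[OF assms(2,4)] by (simp add: measure_def enn2real_mult)
  then have "measure usq (S \<times> T) > 0" using assms by simp
  moreover have "S \<times> T \<in> sets usq" using assms by auto
  ultimately show ?thesis using AE_pos_point[OF assms(1), of "S \<times> T"] by auto
qed

text \<open>Two labels \<open>i\<close> and \<open>j\<close> that meet the block in positive measure
  have \<open>U i i = U i j = U j j = 1/8\<close>, so their rows have distance zero and
  \<open>twin_free\<close> identifies them. Hence the block is a single fibre up to a null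
  set.\<close>

lemma block_exists:
  "\<exists>g. m g = 1/2 \<and> (\<forall>i j. m i > 0 \<longrightarrow> m j > 0 \<longrightarrow> (cp i j \<longleftrightarrow> i = g \<and> j = g))"
proof -
  obtain G where G: "G \<in> sets unit_space" "measure unit_space G = 1/2"
    and GG: "AE p in usq. const_pair (stepg \<pi> A) p \<longleftrightarrow> fst p \<in> G \<and> snd p \<in> G"
    by (rule forced_pairs_block[OF forced_imp_forced_pairs[OF forced]])
  have GG': "AE p in usq. cp (\<pi> (fst p)) (\<pi> (snd p)) \<longleftrightarrow> fst p \<in> G \<and> snd p \<in> G"
    using GG by (simp add: const_pair_step)
  define S where "S = {i. measure unit_space (fiber \<pi> i \<inter> G) > 0}"
  have fG: "fiber \<pi> i \<inter> G \<in> sets unit_space" "fiber \<pi> i - G \<in> sets unit_space" for i using fib G by auto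
  have Sm: "m i > 0" if "i \<in> S" for i
  proof -
    have "measure unit_space (fiber \<pi> i \<inter> G) \<le> m i"
      unfolding lmass_def by (rule unit.finite_measure_mono) (use fib in auto)
    then show ?thesis using that by (simp add: S_def)
  qed
  have cpS: "cp i j" if "i \<in> S" "j \<in> S" for i j
  proof -
    have pos: "measure unit_space (fiber \<pi> i \<inter> G) > 0" "measure unit_space (fiber \<pi> j \<inter> G) > 0"
      using that by (auto simp: S_def)
    obtain a b where "a \<in> fiber \<pi> i \<inter> G" "b \<in> fiber \<pi> j \<inter> G" "cp (\<pi> (fst (a, b))) (\<pi> (snd (a, b))) \<longleftrightarrow> fst (a, b) \<in> G \<and> snd (a, b) \<in> G"
      using label_rectangle_point[OF GG' fG(1) pos(1) fG(1) pos(2)] by blast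
    then show ?thesis by (auto simp: fiber_def)
  qed
  have Seq: "i = j" if "i \<in> S" "j \<in> S" for i j
  proof (rule twin_free)
    show "m i > 0" "m j > 0" using that Sm by auto
    fix k assume k: "m k > 0"
    have ii: "integrable unit_space (\<lambda>z. A a (\<pi> z) * A b (\<pi> z))" for a b
      by (rule label_integrable[of "\<lambda>k. A a k * A b k" 1]) (use A01 in \<open>auto simp: abs_mult intro: mult_le_one\<close>)
    have eq: "(\<lambda>z. (A i (\<pi> z) - A j (\<pi> z))\<^sup>2) =
        (\<lambda>z. A i (\<pi> z) * A i (\<pi> z) - 2 * (A i (\<pi> z) * A j (\<pi> z)) + A j (\<pi> z) * A j (\<pi> z))"
      by (auto simp: power2_eq_square algebra_simps)
    have "(\<integral>z. (A i (\<pi> z) - A j (\<pi> z))\<^sup>2 \<partial>unit_space) = U i i - 2 * U i j + U j j"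
      unfolding eq lcod_def by (simp add: ii)
    also have "\<dots> = 0" using cpS[OF that] cpS[of i i] cpS[of j j] that by (simp add: cp_def)
    finally have "(A i k - A j k)\<^sup>2 = 0"
    proof (rule label_integral_zero[of "\<lambda>k. (A i k - A j k)\<^sup>2" 1 k, rotated])
      show "m k > 0" by fact
      fix l
      have "\<bar>A i l - A j l\<bar> \<le> 1" using A01[of i l] A01[of j l] by (simp add: abs_le_iff)
      then show "0 \<le> (A i l - A j l)\<^sup>2 \<and> (A i l - A j l)\<^sup>2 \<le> 1" by (simp add: abs_square_le_1)
    qed
    then show "A i k = A j k" by simp
  qed
  have "S \<noteq> {}"
  proof
    assume "S = {}"
    then have "measure unit_space (fiber \<pi> i \<inter> G) = 0" for i
      using measure_nonneg[of unit_space "fiber \<pi> i \<inter> G"] by (auto simp: S_def not_less intro: antisym)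
    then have "emeasure unit_space (\<Union>i. fiber \<pi> i \<inter> G) = 0"
      using fG by (intro emeasure_UN_eq_0) (auto simp: unit.emeasure_eq_measure)
    moreover have "(\<Union>i. fiber \<pi> i \<inter> G) = G"
      using sets.sets_into_space[OF G(1)] by (auto simp: fiber_def)
    ultimately show False using G(2) by (simp add: measure_def)
  qed
  then obtain g where g: "g \<in> S" by auto
  have Sg: "i \<in> S \<longleftrightarrow> i = g" for i using Seq g by auto
  have n0: "measure unit_space (fiber \<pi> i \<inter> G) = 0" if "i \<noteq> g" for i
    using Sg[of i] that measure_nonneg[of unit_space "fiber \<pi> i \<inter> G"] by (simp add: S_def)
  have sub: "measure unit_space (fiber \<pi> g - G) = 0"
  proof (rule ccontr)
    assume "measure unit_space (fiber \<pi> g - G) \<noteq> 0"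
    then have "measure unit_space (fiber \<pi> g - G) > 0"
      using measure_nonneg[of unit_space "fiber \<pi> g - G"] by linarith
    then obtain a b where "a \<in> fiber \<pi> g - G" "b \<in> fiber \<pi> g" "cp (\<pi> (fst (a, b))) (\<pi> (snd (a, b))) \<longleftrightarrow> fst (a, b) \<in> G \<and> snd (a, b) \<in> G"
      using label_rectangle_point[OF GG' fG(2)[of g] _ fib[of g]] Sm[OF g] by (auto simp: lmass_def)
    then show False using cpS[OF g g] by (auto simp: fiber_def)
  qed
  have mg: "m g = 1/2"
  proof -
    have "AE x in unit_space. x \<in> fiber \<pi> g \<longleftrightarrow> x \<in> G"
    proof -
      have "AE x in unit_space. x \<notin> fiber \<pi> g - G"
        using sub fG by (intro AE_not_in) (auto simp: null_sets_def unit.emeasure_eq_measure)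
      moreover have "AE x in unit_space. \<forall>i. i \<noteq> g \<longrightarrow> x \<notin> fiber \<pi> i \<inter> G"
        unfolding AE_all_countable
      proof
        fix i
        show "AE x in unit_space. i \<noteq> g \<longrightarrow> x \<notin> fiber \<pi> i \<inter> G"
        proof (cases "i = g")
          case False
          then have "fiber \<pi> i \<inter> G \<in> null_sets unit_space" using n0 fG by (auto simp: null_sets_def unit.emeasure_eq_measure)
          from AE_not_in[OF this] show ?thesis by eventually_elim simp
        qed simp
      qed
      ultimately show ?thesis using AE_space by eventually_elim (auto simp: fiber_def)
    qed
    then have "measure unit_space (fiber \<pi> g) = measure unit_space G"
      by (intro unit.finite_measure_eq_AE) (use fib G in auto)
    then show ?thesis using G by (simp add: lmass_def)
  qed
  have pr: "Measurable.pred unit_space (\<lambda>x. x \<notin> T)" if "T \<in> sets unit_space" for T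
  proof -
    have "{x\<in>space unit_space. x \<notin> T} = space unit_space - T" by blast
    then show ?thesis unfolding pred_def using sets.compl_sets[OF that] by (simp only:)
  qed
  have "i = g \<and> j = g" if "m i > 0" "m j > 0" "cp i j" for i j
  proof -
    have pos: "measure unit_space (fiber \<pi> i) > 0" "measure unit_space (fiber \<pi> j) > 0" using that by (auto simp: lmass_def)
    have "i \<in> S"
    proof (rule ccontr)
      assume "i \<notin> S"
      then have "fiber \<pi> i \<inter> G \<in> null_sets unit_space"
        using fG n0 Sg by (auto simp: null_sets_def unit.emeasure_eq_measure)
      from AE_not_in[OF this] have "AE x in unit_space. x \<notin> fiber \<pi> i \<inter> G" .
      then have "AE p in usq. fst p \<notin> fiber \<pi> i \<inter> G" by (rule AE_usq_fst) (rule pr[OF fG(1)])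
      with GG' have "AE p in usq. (cp (\<pi> (fst p)) (\<pi> (snd p)) \<longleftrightarrow> fst p \<in> G \<and> snd p \<in> G) \<and> fst p \<notin> fiber \<pi> i \<inter> G"
        by eventually_elim simp
      from label_rectangle_point[OF this fib pos(1) fib pos(2)] show False using that(3) by (auto simp: fiber_def)
    qed
    moreover have "j \<in> S"
    proof (rule ccontr)
      assume "j \<notin> S"
      then have "fiber \<pi> j \<inter> G \<in> null_sets unit_space"
        using fG n0 Sg by (auto simp: null_sets_def unit.emeasure_eq_measure)
      from AE_not_in[OF this] have "AE x in unit_space. x \<notin> fiber \<pi> j \<inter> G" .
      then have "AE p in usq. snd p \<notin> fiber \<pi> j \<inter> G" by (rule AE_usq_snd) (rule pr[OF fG(1)])
      with GG' have "AE p in usq. (cp (\<pi> (fst p)) (\<pi> (snd p)) \<longleftrightarrow> fst p \<in> G \<and> snd p \<in> G) \<and> snd p \<notin> fiber \<pi> j \<inter> G"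
        by eventually_elim simp
      from label_rectangle_point[OF this fib pos(1) fib pos(2)] show False using that(3) by (auto simp: fiber_def)
    qed
    ultimately show ?thesis using Sg by simp
  qed
  then show ?thesis using mg cpS[OF g g] by blast
qed

definition g :: nat where
  "g = (SOME g. m g = 1/2 \<and> (\<forall>i j. m i > 0 \<longrightarrow> m j > 0 \<longrightarrow> (cp i j \<longleftrightarrow> i = g \<and> j = g)))"

lemma mg: "m g = 1/2" and cp_iff: "m i > 0 \<Longrightarrow> m j > 0 \<Longrightarrow> cp i j \<longleftrightarrow> i = g \<and> j = g"
  using someI_ex[OF block_exists] unfolding g_def[symmetric] by auto

lemma Ugg: "U g g = 1/8" and dg: "d g = 1/4"
  using cp_iff[of g g] mg by (auto simp: cp_def)

lemma AE_usq_labels: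
  assumes "\<And>i j. m i > 0 \<Longrightarrow> m j > 0 \<Longrightarrow> P i j"
  shows "AE p in usq. P (\<pi> (fst p)) (\<pi> (snd p))"
proof -
  have mm: "Measurable.pred unit_space (\<lambda>a. m (\<pi> a) > 0)" by (rule measurable_compose[OF pm]) simp
  show ?thesis
    using AE_usq_fst[OF AE_label_pos mm] AE_usq_snd[OF AE_label_pos mm] by eventually_elim (rule assms)
qed

lemma fiber_rectangle: "measure usq (fiber \<pi> i \<times> fiber \<pi> j) = m i * m j"
  using unit.emeasure_pair_measure_Times[OF fib fib, of i j] by (simp add: measure_def enn2real_mult lmass_def)

lemma fiber_rectangle_sets: "fiber \<pi> i \<times> fiber \<pi> j \<in> sets usq"
  using fib by auto

text \<open>Only the pair of block labels contributes to the edge-weighted integral of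
  \<open>core_of\<close>, namely \<open>core_val * A g g / 4\<close>, and this is prescribed to be
  \<open>core_val / 8\<close>.\<close>

lemma Agg: "A g g = 1/2"
proof -
  have "(\<integral>p. stepg \<pi> A (fst p) (snd p) * core_of (stepg \<pi> A) p \<partial>usq) =
    (\<integral>p. core_val * A g g * indicator (fiber \<pi> g \<times> fiber \<pi> g) p \<partial>usq)"
  proof (rule integral_cong_AE)
    show "(\<lambda>p. stepg \<pi> A (fst p) (snd p) * core_of (stepg \<pi> A) p) \<in> borel_measurable usq"
      by (rule borel_measurable_times[OF graphon_measurable[OF graphon_step] core_of_measurable[OF graphon_step]])
    show "(\<lambda>p. core_val * A g g * indicator (fiber \<pi> g \<times> fiber \<pi> g) p) \<in> borel_measurable usq"
      by (rule borel_measurable_times[OF borel_measurable_const borel_measurable_indicator[OF fiber_rectangle_sets]])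
    have lab: "A i j * core_poly (U i j) (d i) (d j) = core_val * A g g * (if i = g \<and> j = g then 1 else 0)"
      if "m i > 0" "m j > 0" for i j
    proof (cases "i = g \<and> j = g")
      case True
      then show ?thesis by (simp add: Ugg dg core_val_def)
    next
      case False
      then have "core_poly (U i j) (d i) (d j) = 0" using pair_cases[OF that] cp_iff[OF that] by (auto simp: core_poly_eq_0)
      then show ?thesis using False by auto
    qed
    have "AE p in usq. A (\<pi> (fst p)) (\<pi> (snd p)) * core_poly (U (\<pi> (fst p)) (\<pi> (snd p))) (d (\<pi> (fst p))) (d (\<pi> (snd p))) =
      core_val * A g g * (if \<pi> (fst p) = g \<and> \<pi> (snd p) = g then 1 else 0)"
      by (rule AE_usq_labels) (rule lab)
    then show "AE p in usq. stepg \<pi> A (fst p) (snd p) * core_of (stepg \<pi> A) p = core_val * A g g * indicator (fiber \<pi> g \<times> fiber \<pi> g) p"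
      using AE_space
      by eventually_elim (auto simp: stepg_def core_of_def deg_stepg cod_stepg fiber_def indicator_def mem_Times_iff space_pair_measure)
  qed
  also have "\<dots> = core_val * A g g * (1/4)"
    using fiber_rectangle_sets fiber_rectangle[of g g] mg by simp
  finally have "core_val * A g g * (1/4) = (\<integral>p. stepg \<pi> A (fst p) (snd p) * core_of (stepg \<pi> A) p \<partial>usq)" by (rule sym)
  also have "\<dots> = core_val / 8"
    using forced_imp_forced_pairs[OF forced] unfolding forced_pairs_def by (elim conjE)
  finally have "core_val * (2 * A g g) = core_val * 1" by (simp add: algebra_simps)
  then have "2 * A g g = 1" using core_val_pos by (simp only: mult_cancel_left) simp
  then show ?thesis by simp
qed

text \<open>The block alone already accounts for the degree: 1/2 * 1/2 = 1/4.\<close>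

lemma Ag0: "m j > 0 \<Longrightarrow> j \<noteq> g \<Longrightarrow> A g j = 0"
proof -
  assume j: "m j > 0" "j \<noteq> g"
  let ?f = "\<lambda>k. if k = g then 0 else A g k"
  have i1: "integrable unit_space (\<lambda>z. A g (\<pi> z))" by (rule label_integrable[of "A g" 1]) (use A01 in auto)
  have i2: "integrable unit_space (\<lambda>z. if \<pi> z = g then A g g else 0)"
    by (rule label_integrable[of "\<lambda>k. if k = g then A g g else 0" 1]) (use A01 in auto)
  have "(\<integral>z. ?f (\<pi> z) \<partial>unit_space) = (\<integral>z. A g (\<pi> z) - (if \<pi> z = g then A g g else 0) \<partial>unit_space)"
    by (intro Bochner_Integration.integral_cong refl) auto
  also have "\<dots> = d g - (\<integral>z. (if \<pi> z = g then A g g else 0) \<partial>unit_space)"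
    unfolding ldeg_def by (rule Bochner_Integration.integral_diff[OF i1 i2])
  also have "(\<integral>z. (if \<pi> z = g then A g g else 0) \<partial>unit_space) = (\<Sum>k\<in>{g}. m k * (if k = g then A g g else 0))"
    by (rule label_integral_sum) auto
  finally have "(\<integral>z. ?f (\<pi> z) \<partial>unit_space) = 0" by (simp add: dg mg Agg)
  from label_integral_zero[of ?f 1, OF _ this j(1)] A01 j(2) show "A g j = 0" by auto
qed

end

context forced_step
begin

text \<open>Apply the pair rule to two points with the same label \<open>i\<close>. Equal degrees
  are never coded, so the codegree equals the degree, which forces
  \<open>A i k * (1 - A i k) = 0\<close>.\<close>

lemma A_zero_one:
  assumes i: "m i > 0" "i \<noteq> g" and k: "m k > 0"
  shows "A i k = 0 \<or> A i k = 1"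
proof (cases "d i = 0")
  case True
  then show ?thesis using d_zero k by simp
next
  case False
  then have d: "d i > 0" using d_nonneg[of i] by simp
  have "U i i \<noteq> 0"
  proof
    assume "U i i = 0"
    then have "A i k = 0" if "m k > 0" for k using U_zero[of i i k] that by simp
    then have "d i = 0" unfolding ldeg_def using label_integral_cong[of "A i" "\<lambda>_. 0"] by simp
    then show False using False by simp
  qed
  then have "U i i = d i"
    using pair_cases[OF i(1) i(1)] cp_iff[OF i(1) i(1)] i(2) is_code_ratio[of "U i i" "d i" "d i"] d by auto
  from U_eq_d[OF this k] show ?thesis by simp
qed

definition V :: "nat set" where "V = {i. m i > 0 \<and> i \<noteq> g \<and> d i > 0}"
definition N :: "nat \<Rightarrow> nat set" where "N i = {k. m k > 0 \<and> A i k = 1}"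

lemma V_pos: "i \<in> V \<Longrightarrow> m i > 0" by (simp add: V_def)

lemma N_V:
  assumes "i \<in> V" "k \<in> N i"
  shows "k \<in> V" "i \<in> N k"
proof -
  have k: "m k > 0" "A i k = 1" using assms by (auto simp: N_def)
  have "k \<noteq> g"
  proof
    assume "k = g"
    then have "A g i = 1" using k(2) A_sym[of i g] by simp
    then show False using Ag0[of i] assms(1) by (simp add: V_def)
  qed
  moreover have "d k \<noteq> 0"
  proof
    assume "d k = 0"
    from d_zero[OF this V_pos[OF assms(1)]] show False using k A_sym[of i k] by simp
  qed
  then have "d k > 0" using d_nonneg[of k] by linarith
  ultimately show "k \<in> V" using k by (simp add: V_def)
  show "i \<in> N k" using k A_sym[of i k] V_pos[OF assms(1)] by (simp add: N_def)
qed

lemma A_V: "i \<in> V \<Longrightarrow> m k > 0 \<Longrightarrow> A i k = (if k \<in> N i then 1 else 0)"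
proof -
  assume h: "i \<in> V" "m k > 0"
  then have "A i k = 0 \<or> A i k = 1" by (intro A_zero_one) (simp_all add: V_def)
  then show ?thesis using h by (elim disjE) (simp_all add: N_def)
qed

lemma rows_determined:
  assumes "i \<in> V" "j \<in> V" "N i = N j"
  shows "i = j"
proof (rule twin_free[OF V_pos[OF assms(1)] V_pos[OF assms(2)]])
  fix k assume "m k > 0"
  then show "A i k = A j k" using A_V[OF assms(1)] A_V[OF assms(2)] assms(3) by simp
qed

lemma d_sum: "i \<in> V \<Longrightarrow> finite (N i) \<Longrightarrow> d i = (\<Sum>k\<in>N i. m k)"
proof -
  assume h: "i \<in> V" "finite (N i)"
  have "d i = (\<Sum>k\<in>N i. m k * A i k)"
    unfolding ldeg_def by (rule label_integral_sum[OF h(2)]) (simp add: A_V[OF h(1)])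
  also have "\<dots> = (\<Sum>k\<in>N i. m k)" by (intro sum.cong) (simp_all add: N_def)
  finally show ?thesis .
qed

lemma U_sum: "i \<in> V \<Longrightarrow> j \<in> V \<Longrightarrow> finite (N i \<inter> N j) \<Longrightarrow> U i j = (\<Sum>k\<in>N i \<inter> N j. m k)"
proof -
  assume h: "i \<in> V" "j \<in> V" "finite (N i \<inter> N j)"
  have "U i j = (\<Sum>k\<in>N i \<inter> N j. m k * (A i k * A j k))"
    unfolding lcod_def by (rule label_integral_sum[OF h(3)]) (auto simp: A_V[OF h(1)] A_V[OF h(2)])
  also have "\<dots> = (\<Sum>k\<in>N i \<inter> N j. m k)" by (intro sum.cong) (simp_all add: N_def)
  finally show ?thesis .
qed

lemma common_code:
  assumes "i \<in> V" "j \<in> V" "i \<noteq> j" "k \<in> N i" "k \<in> N j"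
  shows "is_code (U i j) (d i) (d j)" "U i j > 0"
proof -
  have k: "m k > 0" "A i k = 1" "A j k = 1" using assms by (auto simp: N_def)
  then have "U i j \<noteq> 0" using U_zero[of i j k] by auto
  then show pos: "U i j > 0" using U_nonneg[of i j] by simp
  have "\<not> (U i j = d i \<and> U i j = d j)"
  proof
    assume e: "U i j = d i \<and> U i j = d j"
    have rows: "A i l = A j l" if "m l > 0" for l
    proof -
      have "A i l * (1 - A j l) = 0" using U_eq_d[of i j l] e that by simp
      moreover have "A j l * (1 - A i l) = 0" using U_eq_d[of j i l] e that lcod_sym[of \<pi> A i j] by simp
      ultimately show ?thesis by (cases "A i l = 0") auto
    qed
    have "i = j" by (rule twin_free[OF V_pos[OF assms(1)] V_pos[OF assms(2)] rows])
    then show False using assms by simp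
  qed
  moreover have "\<not> cp i j" using cp_iff[of i j] assms(1,2) by (auto simp: V_def)
  ultimately show "is_code (U i j) (d i) (d j)" 
    using pair_cases[OF V_pos[OF assms(1)] V_pos[OF assms(2)]] pos by auto
qed

text \<open>Three neighbours of \<open>z\<close> would share the neighbour \<open>z\<close>
  pairwise, hence have pairwise coded degrees.\<close>

lemma N_le_2:
  assumes "z \<in> V"
  shows "finite (N z)" "card (N z) \<le> 2"
proof -
  have *: "False" if S: "x \<in> N z" "y \<in> N z" "w \<in> N z" "x \<noteq> y" "y \<noteq> w" "x \<noteq> w" for x y w
  proof -
    have xyw: "x \<in> V" "y \<in> V" "w \<in> V" "z \<in> N x" "z \<in> N y" "z \<in> N w" using N_V[OF assms] S by auto
    show False
      using is_code_no_triple[OF common_code(1)[of x y z] common_code(1)[of y w z] common_code(1)[of x w z]] xyw S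
      by (auto simp: V_def)
  qed
  have "card F \<le> 2" if F: "F \<subseteq> N z" "finite F" for F
  proof (rule ccontr)
    assume "\<not> card F \<le> 2"
    then have "3 \<le> card F" by simp
    then obtain T where T: "T \<subseteq> F" "card T = 3" using obtain_subset_with_card_n by metis
    then obtain x y w where "T = {x, y, w}" "x \<noteq> y" "y \<noteq> w" "x \<noteq> w" by (auto simp: card_3_iff)
    then show False using *[of x y w] T F by auto
  qed
  then show "finite (N z)" "card (N z) \<le> 2" using finite_if_finite_subsets_card_bdd by blast+
qed

definition V2 :: "nat set" where "V2 = {z\<in>V. card (N z) = 2}"

lemma V2_pos: "z \<in> V2 \<Longrightarrow> 0 < m z" by (simp add: V2_def V_def)

text \<open>A second common neighbour \<open>w\<close> of \<open>x\<close> and \<open>y\<close>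
  would give \<open>N x = N y = {z, w}\<close> by the bound two, and then \<open>x = y\<close>. So
  masses can be read off from codegrees. Since \<open>m z < d x\<close>, the vertex \<open>x\<close>
  has another neighbour besides \<open>z\<close>: paths in \<open>V2\<close> never end.\<close>

lemma two_nbrs:
  assumes z: "z \<in> V" and xy: "x \<in> N z" "y \<in> N z" "x \<noteq> y"
  shows "z \<in> V2" "N z = {x, y}" "x \<in> V2" "y \<in> V2" "N x \<inter> N y = {z}" "U x y = m z" "d z = m x + m y"
    "m z < d x" "m z < d y"
proof -
  have c: "finite (N z)" "card (N z) \<le> 2" using N_le_2[OF z] by auto
  show Nz: "N z = {x, y}"
    by (rule card_seteq[symmetric]) (use c xy in auto)
  then show z2: "z \<in> V2" using z xy by (simp add: V2_def)
  have V: "x \<in> V" "y \<in> V" "z \<in> N x" "z \<in> N y" using N_V[OF z] xy by auto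
  note code = common_code[OF V(1,2) xy(3) V(3,4)]
  show I: "N x \<inter> N y = {z}"
  proof (rule ccontr)
    assume "N x \<inter> N y \<noteq> {z}"
    then obtain w where w: "w \<in> N x" "w \<in> N y" "w \<noteq> z" using V by auto
    have "N x = {z, w}" "N y = {z, w}"
      by (rule card_seteq[symmetric]; use N_le_2[OF V(1)] N_le_2[OF V(2)] w V in auto)+
    then show False using rows_determined[OF V(1,2)] xy by simp
  qed
  then show Um: "U x y = m z" using U_sum[OF V(1,2)] by simp
  show "d z = m x + m y" using d_sum[OF z c(1)] Nz xy by simp
  show lt: "m z < d x" "m z < d y" using is_code_gt[OF code] Um by auto
  have "card (N w) = 2" if w: "w \<in> V" "z \<in> N w" "m z < d w" for w
  proof -
    have "card (N w) \<noteq> 0" using N_le_2[OF w(1)] w(2) by auto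
    moreover have "card (N w) \<noteq> 1"
    proof
      assume "card (N w) = 1"
      then have "N w = {z}" using w(2) by (metis card_1_singletonE singletonD)
      then show False using d_sum[OF w(1)] w(3) by simp
    qed
    ultimately show ?thesis using N_le_2(2)[OF w(1)] by linarith
  qed
  then show "x \<in> V2" "y \<in> V2" using V lt by (auto simp: V2_def)
qed

lemma V2_nbrs:
  assumes "z \<in> V2" "x \<in> N z"
  shows "x \<in> V2" "z \<in> N x" "\<exists>y. y \<noteq> x \<and> N z = {x, y}"
proof -
  have z: "z \<in> V" using assms by (simp add: V2_def)
  have "card (N z) = 2" using assms by (simp add: V2_def)
  then obtain y where y: "y \<noteq> x" "N z = {x, y}" using assms(2) by (metis card_2_iff insertE singletonD insert_commute)
  then show "\<exists>y. y \<noteq> x \<and> N z = {x, y}" by blast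
  show "x \<in> V2" by (rule two_nbrs(3)[OF z assms(2), of y]) (use y in auto)
  show "z \<in> N x" using N_V[OF z assms(2)] by simp
qed

lemma window_ok:
  assumes z: "z \<in> V2" and y: "x \<in> N z" "y \<in> N z" "x \<noteq> y" "t \<in> N y" "t \<noteq> z"
  shows "okwin (m x) (m z) (m y) (m t)"
proof -
  have zV: "z \<in> V" using z by (simp add: V2_def)
  note t1 = two_nbrs[OF zV y(1,2,3)]
  have yV: "y \<in> V" using t1(4) by (simp add: V2_def)
  have zy: "z \<in> N y" using N_V[OF zV y(2)] by simp
  note t2 = two_nbrs[OF yV zy y(4) y(5)[symmetric]]
  have pos: "m x > 0" "m z > 0" "m y > 0" "m t > 0" using t1(3) t2(4) V2_pos z t1(4) by auto
  have "A x z = 1" "A z y = 1" "A y t = 1" using y A_sym[of x z] by (auto simp: N_def)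
  then have "win_poly (U x y) (U z t) (d x) (d z) (d y) (d t) = 0" using window_zero[OF pos] by simp
  moreover have "\<not> (U x y = 1/8 \<and> d x = 1/4 \<and> d y = 1/4)"
    using cp_iff[of x y] pos t1(3) by (auto simp: cp_def V2_def V_def)
  ultimately have "okwin (d z - U z t) (U x y) (U z t) (d y - U x y)"
    using t1 t2 unfolding win_poly_eq_0 by auto
  then show ?thesis using t1 t2 by simp
qed

text \<open>With w for the mass of \<open>y\<close>, the four weights are w/2, w^2, w, 25 w^2; thus
  \<open>y\<close> carries the scale of the turn.\<close>

definition Lwin :: "nat \<Rightarrow> nat \<Rightarrow> nat \<Rightarrow> nat \<Rightarrow> bool" where
  "Lwin x z y t \<longleftrightarrow> z \<in> V2 \<and> y \<in> V2 \<and> x \<in> N z \<and> y \<in> N z \<and> x \<noteq> y \<and> t \<in> N y \<and> t \<noteq> z \<and>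
     m y = 2 * m x \<and> m t = 25 * m z \<and> m z = (m y)\<^sup>2"

text \<open>The product \<open>win_poly\<close> vanishes on every path, so where its factor
  \<open>win_rest\<close> does not vanish the factor for \<open>left_turn\<close> must. Nonvanishing
  of \<open>win_rest\<close> also excludes the block and walks that turn back.\<close>

lemma Lwin_if_rest:
  assumes pos: "m x > 0" "m z > 0" "m y > 0" "m t > 0"
    and ne: "A x z * A z y * A y t * win_rest (U x y) (U z t) (d x) (d z) (d y) (d t) \<noteq> 0"
  shows "Lwin x z y t" "A x z = 1" "A z y = 1" "A y t = 1"
proof -
  have a: "A x z \<noteq> 0" "A z y \<noteq> 0" "A y t \<noteq> 0" and r: "win_rest (U x y) (U z t) (d x) (d z) (d y) (d t) \<noteq> 0"
    using ne by auto
  have gg: "i = g \<longleftrightarrow> j = g" if "A i j \<noteq> 0" "m i > 0" "m j > 0" for i j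
    using Ag0[of i] Ag0[of j] A_sym[of i j] that by (cases "i = g"; cases "j = g") simp_all
  have eqs: "x = g \<longleftrightarrow> z = g" "z = g \<longleftrightarrow> y = g" "y = g \<longleftrightarrow> t = g"
    using gg a pos by simp_all
  have "x \<noteq> g"
  proof
    assume "x = g"
    then have "x = g" "y = g" using eqs by auto
    then show False using r by (auto simp: win_rest_eq_0 Ugg dg)
  qed
  then have ng: "x \<noteq> g" "z \<noteq> g" "y \<noteq> g" "t \<noteq> g" using eqs by auto
  show a1: "A x z = 1" "A z y = 1" "A y t = 1" 
    using A_zero_one[OF pos(1) ng(1) pos(2)] A_zero_one[OF pos(2) ng(2) pos(3)] A_zero_one[OF pos(3) ng(3) pos(4)] a
    by simp_all
  have dpos: "d i > 0" if "A i k = 1" "m k > 0" for i k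
  proof -
    have "d i \<noteq> 0" using d_zero[of i k] that by auto
    then show ?thesis using d_nonneg[of i] by linarith
  qed
  have V: "x \<in> V" "z \<in> V" "y \<in> V"
    using ng pos a1 dpos[of x z] dpos[of z y] dpos[of y t] by (auto simp: V_def)
  have Ns: "x \<in> N z" "y \<in> N z" "t \<in> N y" "z \<in> N y" using a1 A_sym[of x z] A_sym[of z y] pos by (simp_all add: N_def)
  have self: "U i i = d i" if "i \<in> V" for i
    using U_sum[OF that that] d_sum[OF that] N_le_2[OF that] by simp
  have "x \<noteq> y" using r self[OF V(1)] by (auto simp: win_rest_eq_0)
  moreover have "t \<noteq> z" using r self[OF V(2)] by (auto simp: win_rest_eq_0)
  moreover note t1 = two_nbrs[OF V(2) Ns(1,2) \<open>x \<noteq> y\<close>]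
  moreover note t2 = two_nbrs[OF V(3) Ns(4,3) \<open>t \<noteq> z\<close>[symmetric]]
  moreover have "win_poly (U x y) (U z t) (d x) (d z) (d y) (d t) = 0" using window_zero[OF pos] a1 by simp
  then have "wcase left_turn (d z - U z t) (U x y) (U z t) (d y - U x y) = 0" using r by (simp add: win_poly_def)
  then have "wcase left_turn (m x) (m z) (m y) (m t) = 0" using t1 t2 by simp
  then have "m y = 2 * m x \<and> m t = 25 * m z \<and> m z = (m y)\<^sup>2"
    unfolding left_turn_def wcase_eq_0 by (simp add: wrel_def)
  ultimately show "Lwin x z y t" using Ns by (simp add: Lwin_def)
qed

lemma Rats_prod_list: "(\<And>a. a \<in> set as \<Longrightarrow> f a \<in> \<rat>) \<Longrightarrow> (\<Prod>a\<leftarrow>as. f a :: real) \<in> \<rat>"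
  by (induction as) auto

lemma win_rest_rat:
  assumes "b \<in> \<rat>" "c \<in> \<rat>" "d0 \<in> \<rat>" "d1 \<in> \<rat>" "d2 \<in> \<rat>" "d3 \<in> \<rat>"
  shows "win_rest b c d0 d1 d2 d3 \<in> \<rat>"
proof -
  have "wcase w (d1 - c) b c (d2 - b) \<in> \<rat>" if w: "w \<in> set other_windows" for w
  proof -
    have "fst w \<in> \<rat>" "fst (snd w) \<in> \<rat>" using w by (auto simp: other_windows_def)
    moreover have "wrel k b c \<in> \<rat>" for k using assms by (auto simp: wrel_def)
    ultimately show ?thesis unfolding wcase_def using assms by auto
  qed
  then have "(\<Prod>w\<leftarrow>other_windows. wcase w (d1 - c) b c (d2 - b)) \<in> \<rat>" by (rule Rats_prod_list)
  then show ?thesis unfolding win_rest_def const_poly_def using assms by auto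
qed

text \<open>The irrational statistic is the sum over left turns of polynomials in masses and
  degrees; finitely many rational terms cannot give it. The degrees of \<open>x\<close> and
  \<open>t\<close> involve their outer neighbours, hence the sets \<open>N x\<close> and
  \<open>N t\<close> in the hypothesis.\<close>

lemma Lwin_infinite:
  assumes rat: "\<And>x z y t v. Lwin x z y t \<Longrightarrow> v \<in> {x, z, y, t} \<union> N x \<union> N t \<Longrightarrow> m v \<in> \<rat>"
  shows "infinite {(x, z, y, t). Lwin x z y t}"
proof
  assume fin: "finite {(x, z, y, t). Lwin x z y t}"
  define f where "f \<phi> = A (\<phi> 0) (\<phi> 1) * A (\<phi> 1) (\<phi> 2) * A (\<phi> 2) (\<phi> 3) *
    win_rest (U (\<phi> 0) (\<phi> 2)) (U (\<phi> 1) (\<phi> 3)) (d (\<phi> 0)) (d (\<phi> 1)) (d (\<phi> 2)) (d (\<phi> 3))" for \<phi> :: "nat \<Rightarrow> nat"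
  define T where "T = {\<phi>\<in>tuples 4. Lwin (\<phi> 0) (\<phi> 1) (\<phi> 2) (\<phi> 3)}"
  have finT: "finite T"
  proof (rule finite_imageD[of "\<lambda>\<phi>. (\<phi> 0, \<phi> 1, \<phi> 2, \<phi> 3)"])
    show "finite ((\<lambda>\<phi>. (\<phi> 0, \<phi> 1, \<phi> 2, \<phi> 3)) ` T)"
      by (rule finite_subset[OF _ fin]) (auto simp: T_def)
    show "inj_on (\<lambda>\<phi>. (\<phi> 0, \<phi> 1, \<phi> 2, \<phi> 3)) T"
    proof (rule inj_onI)
      fix \<phi> \<psi> assume h: "\<phi> \<in> T" "\<psi> \<in> T" "(\<phi> 0, \<phi> 1, \<phi> 2, \<phi> 3) = (\<psi> 0, \<psi> 1, \<psi> 2, \<psi> 3)"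
      show "\<phi> = \<psi>"
      proof (rule PiE_ext[of _ "{..<4}" "\<lambda>_. UNIV"])
        show "\<phi> \<in> tuples 4" "\<psi> \<in> tuples 4" using h by (auto simp: T_def)
        fix i :: nat assume "i \<in> {..<4}"
        then have "i = 0 \<or> i = 1 \<or> i = 2 \<or> i = 3" by auto
        then show "\<phi> i = \<psi> i" using h(3) by auto
      qed
    qed
  qed
  have ev: "AE x in points 4. f (label_map \<pi> 4 x) = (\<Sum>\<phi>\<in>T. f \<phi> * indicator {x\<in>space (points 4). \<forall>t\<in>{..<4}. x t \<in> fiber \<pi> (\<phi> t)} x)"
  proof -
    have "AE x in points 4. \<forall>t\<in>{..<4}. m (\<pi> (x t)) > 0"
    proof (rule AE_finite_allI)
      fix t :: nat assume "t \<in> {..<4}"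
      then have t: "t < 4" by simp
      have "AE y in distr (points 4) unit_space (\<lambda>x. x t). m (\<pi> y) > 0"
        using AE_label_pos by (simp only: distr_points_coord[OF t])
      from AE_distrD[OF measurable_coord[OF t] this] show "AE x in points 4. m (\<pi> (x t)) > 0" .
    qed simp
    then show ?thesis using AE_space
    proof eventually_elim
      case (elim x)
      let ?l = "label_map \<pi> 4 x"
      have lt: "?l \<in> tuples 4" by (auto simp: label_map_def)
      have l: "?l 0 = \<pi> (x 0)" "?l 1 = \<pi> (x 1)" "?l 2 = \<pi> (x 2)" "?l 3 = \<pi> (x 3)" by (auto simp: label_map_def)
      have pos: "m (?l 0) > 0" "m (?l 1) > 0" "m (?l 2) > 0" "m (?l 3) > 0" using elim(1) l by auto
      have in_iff: "x \<in> {x\<in>space (points 4). \<forall>t\<in>{..<4}. x t \<in> fiber \<pi> (\<phi> t)} \<longleftrightarrow> \<phi> = ?l" if "\<phi> \<in> T" for \<phi>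
      proof
        assume "\<phi> = ?l"
        then show "x \<in> {x\<in>space (points 4). \<forall>t\<in>{..<4}. x t \<in> fiber \<pi> (\<phi> t)}"
          using elim(2) space_pointsD[OF elim(2)] by (auto simp: label_map_def fiber_def)
      next
        assume h: "x \<in> {x\<in>space (points 4). \<forall>t\<in>{..<4}. x t \<in> fiber \<pi> (\<phi> t)}"
        show "\<phi> = ?l"
          by (rule PiE_ext[of _ "{..<4}" "\<lambda>_. UNIV"]) (use h that lt in \<open>auto simp: label_map_def fiber_def T_def\<close>)
      qed
      have "(\<Sum>\<phi>\<in>T. f \<phi> * indicator {x\<in>space (points 4). \<forall>t\<in>{..<4}. x t \<in> fiber \<pi> (\<phi> t)} x) = (\<Sum>\<phi>\<in>T. if \<phi> = ?l then f ?l else 0)"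
      proof (intro sum.cong refl)
        fix \<phi> assume "\<phi> \<in> T"
        then show "f \<phi> * indicator {x\<in>space (points 4). \<forall>t\<in>{..<4}. x t \<in> fiber \<pi> (\<phi> t)} x = (if \<phi> = ?l then f ?l else 0)"
          using in_iff[of \<phi>] by (simp only: indicator_def of_bool_def) simp
      qed
      also have "\<dots> = (if ?l \<in> T then f ?l else 0)" using finT by (simp add: sum.delta)
      also have "\<dots> = f ?l"
      proof (cases "f ?l = 0")
        case False
        then have "Lwin (?l 0) (?l 1) (?l 2) (?l 3)" using Lwin_if_rest(1)[OF pos] by (simp add: f_def)
        then show ?thesis using lt by (simp add: T_def)
      qed simp
      finally show ?case by simp
    qed
  qed
  have st: "stat 4 path_edges (at_path win_rest) (stepg \<pi> A) = (\<integral>x. f (label_map \<pi> 4 x) \<partial>points 4)"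
    unfolding stat_def
    by (intro Bochner_Integration.integral_cong refl)
       (simp add: f_def label_map_def path_edges_def at_path_def deg_stepg cod_stepg stepg_def mult_ac)
  interpret P4: prob_space "points 4" by (rule prob_space_points)
  let ?S = "\<lambda>\<phi>. {x\<in>space (points 4). \<forall>t\<in>{..<4}. x t \<in> fiber \<pi> (\<phi> t)}"
  have Ss: "?S \<phi> \<in> sets (points 4)" for \<phi> by (rule emeasure_label_tuple(1)[OF pm])
  have "(\<integral>x. f (label_map \<pi> 4 x) \<partial>points 4) = (\<integral>x. (\<Sum>\<phi>\<in>T. f \<phi> * indicator (?S \<phi>) x) \<partial>points 4)"
  proof (rule integral_cong_AE[OF _ _ ev])
    show "(\<lambda>x. f (label_map \<pi> 4 x)) \<in> borel_measurable (points 4)"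
      by (rule measurable_compose[OF label_map_measurable[OF pm]]) simp
    show "(\<lambda>x. \<Sum>\<phi>\<in>T. f \<phi> * indicator (?S \<phi>) x) \<in> borel_measurable (points 4)"
      by (intro borel_measurable_sum borel_measurable_times borel_measurable_const borel_measurable_indicator Ss)
  qed
  also have "\<dots> = (\<Sum>\<phi>\<in>T. \<integral>x. f \<phi> * indicator (?S \<phi>) x \<partial>points 4)"
  proof (rule Bochner_Integration.integral_sum)
    fix \<phi>
    show "integrable (points 4) (\<lambda>x. f \<phi> * indicator (?S \<phi>) x)"
      by (rule integrable_points[of _ _ "\<bar>f \<phi>\<bar>"])
         (intro borel_measurable_times borel_measurable_const borel_measurable_indicator Ss, auto simp: indicator_def)
  qed
  also have "\<dots> = (\<Sum>\<phi>\<in>T. f \<phi> * (\<Prod>t<4. m (\<phi> t)))"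
  proof (intro sum.cong refl)
    fix \<phi>
    have "measure (points 4) (?S \<phi>) = (\<Prod>t<4. m (\<phi> t))"
      unfolding measure_def emeasure_label_tuple(2)[OF pm]
      by (simp add: prod_ennreal lmass_def enn2real_ennreal prod_nonneg)
    moreover have "?S \<phi> \<inter> space (points 4) = ?S \<phi>" by auto
    ultimately show "(\<integral>x. f \<phi> * indicator (?S \<phi>) x \<partial>points 4) = f \<phi> * (\<Prod>t<4. m (\<phi> t))"
      using Ss[of \<phi>] by (simp only: integral_mult_right_zero Bochner_Integration.integral_indicator)
  qed
  also have "\<dots> \<in> \<rat>"
  proof (rule Rats_sum)
    fix \<phi> assume "\<phi> \<in> T"
    then have L: "Lwin (\<phi> 0) (\<phi> 1) (\<phi> 2) (\<phi> 3)" by (simp add: T_def)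
    let ?x = "\<phi> 0" and ?z = "\<phi> 1" and ?y = "\<phi> 2" and ?t = "\<phi> 3"
    have zV: "?z \<in> V" "?y \<in> V" using L by (auto simp: Lwin_def V2_def)
    have b: "?x \<in> N ?z" "?y \<in> N ?z" "?x \<noteq> ?y" "?t \<in> N ?y" "?z \<in> N ?y" "?z \<noteq> ?t"
      using L N_V[OF zV(1), of ?y] by (auto simp: Lwin_def)
    note t1 = two_nbrs[OF zV(1) b(1-3)] and t2 = two_nbrs[OF zV(2) b(5,4,6)]
    have r: "m ?x \<in> \<rat>" "m ?z \<in> \<rat>" "m ?y \<in> \<rat>" "m ?t \<in> \<rat>"
      "\<And>v. v \<in> N ?x \<Longrightarrow> m v \<in> \<rat>" "\<And>v. v \<in> N ?t \<Longrightarrow> m v \<in> \<rat>"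
      using rat[OF L] by auto
    have dx: "d ?x \<in> \<rat>" "d ?t \<in> \<rat>"
      using d_sum[of ?x] d_sum[of ?t] t1(3) t2(4) N_le_2 r(5,6) by (auto simp: V2_def intro!: Rats_sum)
    have "A ?x ?z = 1" "A ?z ?y = 1" "A ?y ?t = 1" using b A_sym[of ?x ?z] by (auto simp: N_def)
    then have "f \<phi> \<in> \<rat>" unfolding f_def
      using r t1(6,7) t2(6,7) dx by (simp add: win_rest_rat)
    moreover have "(\<Prod>t<4. m (\<phi> t)) \<in> \<rat>"
      using r by (simp add: eval_nat_numeral)
    ultimately show "f \<phi> * (\<Prod>t<4. m (\<phi> t)) \<in> \<rat>" by simp
  qed
  finally show False using forced st by (simp add: forced_def)
qed

text \<open>Entries 0 and 1 contribute nothing; the square of the block has measure 1/4 and density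
  value \<open>- ln 2\<close>.\<close>

lemma entropy: "graphon_entropy (stepg \<pi> A) = - (ln 2) / 4"
proof -
  let ?h = "\<lambda>w::real. w * ln w + (1 - w) * ln (1 - w)"
  have lab: "?h (A i j) = - ln 2 * (if i = g \<and> j = g then 1 else 0)" if "m i > 0" "m j > 0" for i j
  proof (cases "i = g \<and> j = g")
    case True
    then have ij: "i = g" "j = g" by simp_all
    have "?h (1/2) = - ln 2" by (simp add: ln_div)
    then show ?thesis unfolding ij Agg by (simp only: simp_thms if_True mult_1_right)
  next
    case False
    then have "A i j = 0 \<or> A i j = 1"
      using A_zero_one[OF that(1) _ that(2)] Ag0[OF that(2)] by auto
    then show ?thesis using False by auto
  qed
  have "AE p in usq. ?h (A (\<pi> (fst p)) (\<pi> (snd p))) = - ln 2 * (if \<pi> (fst p) = g \<and> \<pi> (snd p) = g then 1 else 0)"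
    by (rule AE_usq_labels) (rule lab)
  then have "AE p in usq. ?h (stepg \<pi> A (fst p) (snd p)) = - ln 2 * indicator (fiber \<pi> g \<times> fiber \<pi> g) p"
    using AE_space
    by eventually_elim (auto simp: stepg_def fiber_def indicator_def mem_Times_iff space_pair_measure)
  then have "graphon_entropy (stepg \<pi> A) = (\<integral>p. - ln 2 * indicator (fiber \<pi> g \<times> fiber \<pi> g) p \<partial>usq)"
    unfolding graphon_entropy_def case_prod_unfold
  proof (rule integral_cong_AE[rotated 2])
    note [measurable] = graphon_measurable[OF graphon_step]
    show "(\<lambda>p. ?h (stepg \<pi> A (fst p) (snd p))) \<in> borel_measurable usq" by measurable
    show "(\<lambda>p. - ln 2 * indicator (fiber \<pi> g \<times> fiber \<pi> g) p :: real) \<in> borel_measurable usq"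
      by (rule borel_measurable_times[OF borel_measurable_const borel_measurable_indicator[OF fiber_rectangle_sets]])
  qed
  also have "\<dots> = - (ln 2) / 4"
    using fiber_rectangle_sets fiber_rectangle[of g g] mg by simp
  finally show ?thesis .
qed

end

section \<open>Runs of weights\<close>

definition okseq :: "(nat \<Rightarrow> real) \<Rightarrow> bool" where
  "okseq q \<longleftrightarrow> (\<forall>i. 0 < q i \<and> q i \<le> 1 \<and> okwin (q i) (q (i+1)) (q (i+2)) (q (i+3)))"

text \<open>The two ways in which a run can proceed: one progression is multiplied by
  \<open>r\<close> while the other is divided by \<open>s\<close>. The exponent \<open>e\<close>
  belongs to the relation at the end of the run: equality of the middle weights for (2, 5), and a
  square, as in \<open>left_turn\<close>, for (5, 2).\<close>

definition slopes :: "real \<Rightarrow> real \<Rightarrow> nat \<Rightarrow> bool" where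
  "slopes s r e \<longleftrightarrow> (s = 2 \<and> r = 5 \<and> e = 1) \<or> (s = 5 \<and> r = 2 \<and> e = 2)"

lemma slopes_gt: "slopes s r e \<Longrightarrow> 1 < s \<and> 1 < r \<and> 0 < e"
  by (auto simp: slopes_def)

lemma okseq_shift: "okseq q \<Longrightarrow> okseq (\<lambda>i. q (k + i))"
proof -
  assume q: "okseq q"
  show ?thesis unfolding okseq_def
  proof
    fix i
    have "0 < q (k+i) \<and> q (k+i) \<le> 1 \<and> okwin (q (k+i)) (q (k+i+1)) (q (k+i+2)) (q (k+i+3))"
      using q unfolding okseq_def by blast
    then show "0 < q (k+i) \<and> q (k+i) \<le> 1 \<and> okwin (q (k+i)) (q (k+(i+1))) (q (k+(i+2))) (q (k+(i+3)))"
      by (simp only: add.assoc)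
  qed
qed

lemma okwin_cases:
  assumes "okwin a b c d"
  shows "c = 2 * a \<and> d = 25 * b \<and> b = c\<^sup>2 \<or> c = 2 * a \<and> d = b / 5 \<or> c = a / 5 \<and> d = 2 * b \<or>
    c = 5 * a \<and> d = b / 2 \<or> c = a / 2 \<and> d = 5 * b \<or> c = 25 * a \<and> d = b / 8 \<or> c = a / 8 \<and> d = 5 * b \<or>
    c = a / 25 \<and> d = b / 2 \<and> c = b\<^sup>2 \<or> c = 8 * a \<and> d = b / 25 \<or> c = a / 5 \<and> d = 8 * b \<or>
    c = 5 * a \<and> d = 4 * b \<and> b = c \<or> c = 4 * a \<and> d = b / 125 \<or> c = a / 125 \<and> d = 2 * b \<or>
    c = a / 4 \<and> d = b / 5 \<and> b = c \<or> c = 125 * a \<and> d = b / 4 \<or> c = a / 2 \<and> d = 125 * b"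
  using assms unfolding okwin_def left_turn_def other_windows_def
  by (simp add: wcase_eq_0 wrel_def)

text \<open>The table of windows in a form common to both slopes. A run alternates the ratios r and
  1/s. It can end by a turn with ratios s^2, 1/r^3, s, or by the reversed shape of the other
  orientation, with ratios r^3, 1/s^2, 1/r.\<close>

lemma okwin_steps:
  assumes t: "slopes s r e" and ok: "okwin a b c d" and pos: "0 < a" "0 < b"
  shows "c = r * a \<Longrightarrow> d = b / s \<or> (d = s\<^sup>2 * b \<and> b = c ^ e)"
    and "c = a / s \<Longrightarrow> d = r * b \<or> d = r ^ 3 * b"
    and "c = r ^ 3 * a \<Longrightarrow> d = b / s\<^sup>2"
    and "c = a / s\<^sup>2 \<Longrightarrow> d = b / r \<and> c = b ^ e"
    and "c = s\<^sup>2 * a \<Longrightarrow> d = b / r ^ 3"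
    and "c = a / r ^ 3 \<Longrightarrow> d = s * b"
    and "c = a / r \<Longrightarrow> d = s * b \<or> d = s ^ 3 * b"
proof -
  consider "s = 2" "r = 5" "e = 1" | "s = 5" "r = 2" "e = 2" using t unfolding slopes_def by blast
  note sr = this
  note C = okwin_cases[OF ok]
  show "c = r * a \<Longrightarrow> d = b / s \<or> (d = s\<^sup>2 * b \<and> b = c ^ e)"
    using sr by cases (insert C pos, elim disjE conjE; simp)+
  show "c = a / s \<Longrightarrow> d = r * b \<or> d = r ^ 3 * b"
    using sr by cases (insert C pos, elim disjE conjE; simp)+
  show "c = r ^ 3 * a \<Longrightarrow> d = b / s\<^sup>2"
    using sr by cases (insert C pos, elim disjE conjE; simp)+
  show "c = a / s\<^sup>2 \<Longrightarrow> d = b / r \<and> c = b ^ e"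
    using sr by cases (insert C pos, elim disjE conjE; simp)+
  show "c = s\<^sup>2 * a \<Longrightarrow> d = b / r ^ 3"
    using sr by cases (insert C pos, elim disjE conjE; simp)+
  show "c = a / r ^ 3 \<Longrightarrow> d = s * b"
    using sr by cases (insert C pos, elim disjE conjE; simp)+
  show "c = a / r \<Longrightarrow> d = s * b \<or> d = s ^ 3 * b"
    using sr by cases (insert C pos, elim disjE conjE; simp)+
qed

text \<open>In the equation the left side strictly falls and the right side strictly grows with the
  exponent.\<close>

lemma crossing_unique:
  fixes a b s r :: real
  assumes "0 < a" "0 < b" "1 < s" "1 < r" "0 < e"
    and "a / s ^ h = (b * r ^ (h + 1)) ^ e" "a / s ^ k = (b * r ^ (k + 1)) ^ e"
  shows "h = k"
proof -
  have False if hk: "h < k" and E: "a / s ^ h = (b * r ^ (h + 1)) ^ e" "a / s ^ k = (b * r ^ (k + 1)) ^ e" for h k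
  proof -
    have "a / s ^ k < a / s ^ h" using hk assms by (intro divide_strict_left_mono power_strict_increasing) auto
    moreover have "(b * r ^ (h + 1)) ^ e < (b * r ^ (k + 1)) ^ e"
      using hk assms by (intro power_strict_mono mult_strict_left_mono power_strict_increasing) auto
    ultimately show False using E by simp
  qed
  then show ?thesis using assms(6,7) by (metis linorder_neqE_nat)
qed

text \<open>The index \<open>h\<close> is where the progressions, continued formally, satisfy the
  relation of the turn; both ways of ending a run yield the same equation for it. The reversed shape
  leaves the run early, because a step by r^3 skips two terms; this is why regularity is claimed
  only for i + 2 <= h.\<close>

lemma run_lemma:
  assumes q: "okseq q" and t: "slopes s r e" and st: "q 2 = r * q 0"
  shows "\<exists>h. q 1 / s ^ h = (q 0 * r ^ (h + 1)) ^ e \<and>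
    (\<forall>i. i + 2 \<le> h \<longrightarrow> q (2*i) = q 0 * r ^ i \<and> q (2*i+1) = q 1 / s ^ i) \<and>
    (((\<forall>i\<le>h. q (2*i) = q 0 * r ^ i \<and> q (2*i+1) = q 1 / s ^ i) \<and> q (2*h+2) = q 0 * r ^ (h + 1) \<and>
       q (2*h+3) = s\<^sup>2 * (q 1 / s ^ h) \<and> q (2*h+4) = q (2*h+2) / r ^ 3 \<and> q (2*h+5) = s * q (2*h+3)) \<or>
     (3 \<le> h \<and> q (2*h-2) = q 0 * r ^ (h + 1) \<and> q (2*h-1) = q 1 / s ^ h \<and> q (2*h) = q 0 * r ^ h))" (is "\<exists>h. ?P h")
proof -
  have g: "1 < s" "1 < r" using slopes_gt[OF t] by auto
  have pos: "0 < q i" "q i \<le> 1" for i using q by (auto simp: okseq_def)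
  have ok: "okwin (q i) (q (i+1)) (q (i+2)) (q (i+3))" for i using q by (simp add: okseq_def)
  note S = okwin_steps[OF t ok pos(1) pos(1)]
  define run where "run j \<longleftrightarrow> (\<forall>i\<le>j. q (2*i) = q 0 * r ^ i \<and> q (2*i+1) = q 1 / s ^ i) \<and> q (2*j+2) = q 0 * r ^ (j+1)" for j
  have run0: "run 0" using st by (simp add: run_def numeral_2_eq_2 mult.commute)
  have "\<not> (\<forall>j. run j)"
  proof
    assume a: "\<forall>j. run j"
    \<comment> \<open>Weights are at most 1, so growth by \<open>r\<close> cannot go on
      forever.\<close>
    obtain k where "1 / q 0 < r ^ k" using real_arch_pow[OF g(2)] by blast
    then have "1 < q 0 * r ^ k" using pos(1)[of 0] by (simp add: field_simps)
    moreover have "q (2*k) = q 0 * r ^ k" using a by (auto simp: run_def)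
    ultimately show False using pos(2)[of "2*k"] by simp
  qed
  then obtain j where j: "run j" "\<not> run (Suc j)" using run0 by (metis nat_induct)
  have J: "q (2*j) = q 0 * r ^ j" "q (2*j+1) = q 1 / s ^ j" "q (2*j+2) = q 0 * r ^ (j+1)"
    "\<And>i. i \<le> j \<Longrightarrow> q (2*i) = q 0 * r ^ i \<and> q (2*i+1) = q 1 / s ^ i"
    using j(1) by (auto simp: run_def)
  have "q (2*j+2) = r * q (2*j)" using J by simp
  from S(1)[OF this] consider "q (2*j+3) = s\<^sup>2 * q (2*j+1)" "q (2*j+1) = q (2*j+2) ^ e" | "q (2*j+3) = q (2*j+1) / s" by blast
  then show ?thesis
  proof cases
    case 1
    have a: "q (2*j+4) = q (2*j+2) / r ^ 3" using S(5)[of "2*j+1"] 1 by (simp add: numeral_eq_Suc)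
    have "q (2*j+5) = s * q (2*j+3)" using S(6)[of "2*j+2"] a by (simp add: numeral_eq_Suc)
    then have F: "(\<forall>i\<le>j. q (2*i) = q 0 * r ^ i \<and> q (2*i+1) = q 1 / s ^ i) \<and> q (2*j+2) = q 0 * r ^ (j + 1) \<and>
       q (2*j+3) = s\<^sup>2 * (q 1 / s ^ j) \<and> q (2*j+4) = q (2*j+2) / r ^ 3 \<and> q (2*j+5) = s * q (2*j+3)"
      using J 1(1) a by (auto simp only:)
    have eq: "q 1 / s ^ j = (q 0 * r ^ (j + 1)) ^ e" using 1(2) J(2,3) by simp
    have "\<forall>i. i + 2 \<le> j \<longrightarrow> q (2*i) = q 0 * r ^ i \<and> q (2*i+1) = q 1 / s ^ i" using J(4) by simp
    then have "?P j" using eq F by (intro conjI disjI1) simp_all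
    then show ?thesis ..
  next
    case 2
    have E1: "q (2*j+3) = q 1 / s ^ (j+1)" using 2 J(2) by (simp add: field_simps)
    \<comment> \<open>Another regular step would extend the run, against the choice of
      \<open>j\<close> as its last index.\<close>
    have ne: "q (2*j+4) \<noteq> r * q (2*j+2)"
    proof
      assume h: "q (2*j+4) = r * q (2*j+2)"
      have "run (Suc j)" unfolding run_def
      proof (intro conjI allI impI)
        fix i assume "i \<le> Suc j"
        then consider "i \<le> j" | "i = Suc j" by linarith
        then have "q (2*i) = q 0 * r ^ i \<and> q (2*i+1) = q 1 / s ^ i"
        proof cases
          case 1 then show ?thesis using J(4) by simp
        next
          case 2
          then have "2*i = 2*j+2" "2*i+1 = 2*j+3" "i = j+1" by auto
          then show ?thesis using J(3) E1 by (simp only:)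
        qed
        then show "q (2*i) = q 0 * r ^ i" "q (2*i+1) = q 1 / s ^ i" by auto
      next
        show "q (2 * Suc j + 2) = q 0 * r ^ (Suc j + 1)" using h J(3) by (simp add: numeral_eq_Suc)
      qed
      then show False using j(2) by simp
    qed
    \<comment> \<open>After the ratio 1/s the only alternative to \<open>r\<close> is r^3, and from
      there the next two windows are determined, including the relation of the turn.\<close>
    have a: "q (2*j+4) = r ^ 3 * q (2*j+2)"
      using S(2)[of "2*j+1"] 2 ne by (simp add: numeral_eq_Suc)
    then have b: "q (2*j+5) = q (2*j+3) / s\<^sup>2" using S(3)[of "2*j+2"] by (simp add: numeral_eq_Suc)
    have c: "q (2*j+6) = q (2*j+4) / r \<and> q (2*j+5) = q (2*j+4) ^ e"
      using S(4)[of "2*j+3"] b by (simp add: numeral_eq_Suc)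
    have O4: "q (2*j+4) = q 0 * r ^ (j+4)"
      unfolding a J(3) by (simp add: power_add power3_eq_cube power4_eq_xxxx)
    have E3: "q (2*j+5) = q 1 / s ^ (j+3)"
      unfolding b E1 by (simp add: power_add power3_eq_cube power2_eq_square)
    have O3: "q (2*j+6) = q 0 * r ^ (j+3)" using c g unfolding O4 by (simp add: power_add power3_eq_cube power4_eq_xxxx)
    \<comment> \<open>The crossing index is j + 3: the jump by r^3 lands at the power j + 4, which
      is the power h + 1 of the equation.\<close>
    have eq: "2*(j+3)-2 = 2*j+4" "2*(j+3)-1 = 2*j+5" "2*(j+3) = 2*j+6" "j+3+1 = j+4" by auto
    show ?thesis
    proof (intro exI[of _ "j+3"] conjI allI impI)
      show "q 1 / s ^ (j+3) = (q 0 * r ^ (j+3+1)) ^ e" using c E3 O4 unfolding eq by simp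
      fix i assume "i + 2 \<le> j + 3"
      have "q (2*i) = q 0 * r ^ i \<and> q (2*i+1) = q 1 / s ^ i"
      proof -
        consider "i \<le> j" | "i = j+1" using \<open>i + 2 \<le> j + 3\<close> by linarith
        then show ?thesis
        proof cases
          case 1 then show ?thesis using J(4) by simp
        next
          case 2
          then have "2*i = 2*j+2" "2*i+1 = 2*j+3" by auto
          then show ?thesis using J(3) E1 2 by (simp only:)
        qed
      qed
      then show "q (2*i) = q 0 * r ^ i" "q (2*i+1) = q 1 / s ^ i" by auto
    next
      have "3 \<le> j+3 \<and> q (2*(j+3)-2) = q 0 * r ^ (j+3+1) \<and> q (2*(j+3)-1) = q 1 / s ^ (j+3) \<and> q (2*(j+3)) = q 0 * r ^ (j+3)"
        unfolding eq(1,2,4) unfolding eq(3) by (intro conjI O4 E3 O3) simp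
      then show "(\<forall>i\<le>j+3. q (2*i) = q 0 * r ^ i \<and> q (2*i+1) = q 1 / s ^ i) \<and> q (2*(j+3)+2) = q 0 * r ^ (j+3+1) \<and>
         q (2*(j+3)+3) = s\<^sup>2 * (q 1 / s ^ (j+3)) \<and> q (2*(j+3)+4) = q (2*(j+3)+2) / r ^ 3 \<and> q (2*(j+3)+5) = s * q (2*(j+3)+3) \<or>
       (3 \<le> j+3 \<and> q (2*(j+3)-2) = q 0 * r ^ (j+3+1) \<and> q (2*(j+3)-1) = q 1 / s ^ (j+3) \<and> q (2*(j+3)) = q 0 * r ^ (j+3))"
        by (rule disjI2)
    qed
  qed
qed

section \<open>Walks along paths and stretches of prescribed weights\<close>

text \<open>After a left turn of scale w the weights are w, 25 w^2, w/8, 125 w^2, w/16 and so on: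
  from the second one on, \<open>Ow w i\<close> and \<open>Ew w i\<close> alternate.\<close>

definition Ow :: "real \<Rightarrow> nat \<Rightarrow> real" where "Ow w i = 25 * w\<^sup>2 * 5 ^ i"
definition Ew :: "real \<Rightarrow> nat \<Rightarrow> real" where "Ew w i = w / 8 / 2 ^ i"

context forced_step
begin

definition walk :: "(nat \<Rightarrow> nat) \<Rightarrow> bool" where
  "walk p \<longleftrightarrow> (\<forall>k. p k \<in> V2 \<and> p (Suc k) \<in> N (p k) \<and> p (Suc (Suc k)) \<noteq> p k)"

text \<open>Iterate the map on pairs (previous label, current label). On a finite cycle the walk
  simply runs round repeatedly.\<close>

lemma walk_exists:
  assumes "z \<in> V2" "x \<in> N z"
  obtains p where "walk p" "p 0 = x" "p 1 = z"
proof -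
  define st where "st e = (snd e, SOME y. y \<in> N (snd e) \<and> y \<noteq> fst e)" for e :: "nat \<times> nat"
  define e where "e k = (st ^^ k) (x, z)" for k
  have eS: "e (Suc k) = st (e k)" for k by (simp add: e_def)
  have stp: "snd (st f) \<in> N (snd f) \<and> snd (st f) \<noteq> fst f" if f: "snd f \<in> V2" "fst f \<in> N (snd f)" for f
  proof -
    obtain y where "y \<noteq> fst f" "N (snd f) = {fst f, y}" using V2_nbrs(3)[OF f] by auto
    then have "\<exists>y. y \<in> N (snd f) \<and> y \<noteq> fst f" by blast
    from someI_ex[OF this] show ?thesis by (simp add: st_def)
  qed
  have inv: "snd (e k) \<in> V2 \<and> fst (e k) \<in> N (snd (e k))" for k
  proof (induction k)
    case 0 then show ?case using assms by (simp add: e_def)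
  next
    case (Suc k)
    have s: "snd (st (e k)) \<in> N (snd (e k))" using stp Suc by simp
    have f: "fst (st (e k)) = snd (e k)" by (simp add: st_def)
    show ?case unfolding eS f using V2_nbrs(1,2)[OF _ s] Suc by simp
  qed
  define p where "p k = fst (e k)" for k
  have pS: "p (Suc k) = snd (e k)" for k by (simp add: p_def eS st_def)
  have "walk p" unfolding walk_def
  proof (intro allI conjI)
    fix k
    show "p k \<in> V2" using V2_nbrs(1)[of "snd (e k)" "fst (e k)"] inv[of k] by (simp add: p_def)
    show "p (Suc k) \<in> N (p k)" unfolding pS using V2_nbrs(2)[of "snd (e k)" "fst (e k)"] inv[of k] by (simp add: p_def)
    have "p (Suc (Suc k)) = snd (st (e k))" by (simp only: pS eS)
    then show "p (Suc (Suc k)) \<noteq> p k" using stp[of "e k"] inv[of k] by (simp add: p_def)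
  qed
  moreover have "p 0 = x" "p 1 = z" by (simp_all add: p_def e_def st_def)
  ultimately show ?thesis using that by blast
qed

lemma walk_okseq:
  assumes "walk p"
  shows "okseq (\<lambda>i. m (p i))"
  unfolding okseq_def
proof (intro allI conjI)
  fix i
  have w: "p k \<in> V2" "p (Suc k) \<in> N (p k)" "p (Suc (Suc k)) \<noteq> p k" for k using assms by (auto simp: walk_def)
  show "0 < m (p i)" by (rule V2_pos[OF w(1)])
  show "m (p i) \<le> 1" by (rule m_le_1)
  have "p i \<in> N (p (Suc i))" by (rule V2_nbrs(2)[OF w(1) w(2)])
  from window_ok[OF w(1) this w(2) w(3)[symmetric] w(2) w(3)]
  show "okwin (m (p i)) (m (p (i+1))) (m (p (i+2))) (m (p (i+3)))" by (simp add: numeral_3_eq_3)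
qed

lemma walk_next:
  assumes "walk p" "y \<in> N (p (Suc k))" "y \<noteq> p k"
  shows "p (Suc (Suc k)) = y"
proof -
  have w: "p k \<in> V2" "p (Suc k) \<in> N (p k)" "p (Suc (Suc k)) \<noteq> p k" for k using assms by (auto simp: walk_def)
  have "p k \<in> N (p (Suc k))" by (rule V2_nbrs(2)[OF w(1) w(2)])
  from V2_nbrs(3)[OF w(1) this] obtain v where "N (p (Suc k)) = {p k, v}" by blast
  then show ?thesis using assms(2,3) w(2)[of "Suc k"] w(3)[of k] by auto
qed

text \<open>Positions 1 to l are inner; 0 and l + 1 are the two ends, whose further neighbours are
  left open.\<close>

definition seg :: "nat \<Rightarrow> (nat \<Rightarrow> nat) \<Rightarrow> bool" where
  "seg l a \<longleftrightarrow> (\<forall>t\<le>l+1. a t \<in> V2) \<and> (\<forall>t\<le>l. a (t+1) \<in> N (a t)) \<and> (\<forall>t<l. a (t+2) \<noteq> a t)"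

lemma seg_forward: "walk p \<Longrightarrow> seg l (\<lambda>t. p (t + k))"
  by (auto simp: walk_def seg_def)

lemma seg_backward:
  assumes "walk p" "l + 1 \<le> k"
  shows "seg l (\<lambda>t. p (k - t))"
  unfolding seg_def
proof (intro conjI allI impI)
  have w: "p k \<in> V2" "p (Suc k) \<in> N (p k)" "p (Suc (Suc k)) \<noteq> p k" for k using assms by (auto simp: walk_def)
  show "p (k - t) \<in> V2" for t by (rule w)
  fix t
  show "p (k - (t + 1)) \<in> N (p (k - t))" if "t \<le> l"
  proof -
    have "k - t = Suc (k - (t + 1))" using that assms by simp
    then show ?thesis using V2_nbrs(2)[OF w(1) w(2)] by simp
  qed
  show "p (k - (t + 2)) \<noteq> p (k - t)" if "t < l"
  proof -
    have "k - t = Suc (Suc (k - (t + 2)))" using that assms by simp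
    then show ?thesis using w(3)[of "k - (t + 2)"] by simp
  qed
qed

text \<open>The end factors record the continuations. The first end weighs w for X = 8, as after a
  left turn, and w/4 for X = 2, the regular continuation. At the other end Y = 5 continues the
  progression, and Y = 125 is the jump of a reversed turn.\<close>

definition wseg :: "nat \<Rightarrow> real \<Rightarrow> real \<Rightarrow> real \<Rightarrow> (nat \<Rightarrow> nat) \<Rightarrow> bool" where
  "wseg n w X Y a \<longleftrightarrow> seg (2*n+2) a \<and> (\<forall>i\<le>n. m (a (2*i+1)) = Ow w i \<and> m (a (2*i+2)) = Ew w i) \<and>
     m (a 0) = X * Ew w 0 \<and> m (a (2*n+3)) = Y * Ow w n"

lemma slopes_25: "slopes 2 5 1" and slopes_52: "slopes 5 2 2"
  by (auto simp: slopes_def)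

text \<open>Used for the walk leaving a left turn in the opposite direction. There the run starts at
  w^2, w/2, so the stretch begins four positions later and is preceded by the regular weight
  w/4.\<close>

lemma wseg_before:
  assumes P: "walk P" and w: "0 < w" "w * 10 ^ (n + 5) = 1"
    and P0: "m (P 1) = w" "m (P 2) = w\<^sup>2" "m (P 3) = w / 2"
  shows "\<exists>Y\<in>{5, 125}. wseg n w 2 Y (\<lambda>t. P (t + 5))"
proof -
  let ?q = "\<lambda>i. m (P i)"
  have ok: "okseq ?q" by (rule walk_okseq[OF P])
  have pos: "0 < ?q i" for i using ok by (auto simp: okseq_def)
  have okw: "okwin (?q i) (?q (i+1)) (?q (i+2)) (?q (i+3))" for i using ok unfolding okseq_def by blast
  note S = okwin_steps[OF slopes_25 okw pos pos]
  have w5: "w < 1/1000"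
  proof -
    have "(10::real) ^ 4 \<le> 10 ^ (n + 5)" by (intro power_increasing) auto
    then have "w * 10 ^ 4 \<le> w * 10 ^ (n + 5)" using w(1) by (intro mult_left_mono) auto
    then show ?thesis using w by simp
  qed
  \<comment> \<open>A jump right at the start would force the relation w/8 = 125 w^2, hence w =
    1/1000, but here w is smaller.\<close>
  have "?q 4 \<noteq> 125 * ?q 2"
  proof
    assume h: "?q 4 = 125 * ?q 2"
    have h5: "?q 5 = ?q 3 / 4" using S(3)[of 2] h by (simp add: numeral_eq_Suc)
    have "?q 5 = ?q 4" using S(4)[of 3] h5 by (simp add: numeral_eq_Suc)
    then have "w / 8 = 125 * w\<^sup>2" using h h5 P0 by simp
    then have "w * (1000 * w - 1) = 0" by (simp add: power2_eq_square algebra_simps)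
    then show False using w(1) w5 by simp
  qed
  then have q4: "?q 4 = 5 * ?q 2"
    using S(2)[of 1] P0 by (simp add: numeral_eq_Suc)
  let ?r = "\<lambda>i. m (P (2 + i))"
  have okr: "okseq ?r" by (rule okseq_shift[OF ok])
  have r0: "?r 2 = 5 * ?r 0" using q4 by (simp add: numeral_eq_Suc)
  have r01: "?r 0 = w\<^sup>2" "?r 1 = w / 2" using P0 by (simp_all add: numeral_eq_Suc)
  obtain h where h: "?r 1 / 2 ^ h = (?r 0 * 5 ^ (h + 1)) ^ 1"
    and seq: "\<forall>i. i + 2 \<le> h \<longrightarrow> ?r (2*i) = ?r 0 * 5 ^ i \<and> ?r (2*i+1) = ?r 1 / 2 ^ i"
    and ex: "((\<forall>i\<le>h. ?r (2*i) = ?r 0 * 5 ^ i \<and> ?r (2*i+1) = ?r 1 / 2 ^ i) \<and> ?r (2*h+2) = ?r 0 * 5 ^ (h + 1) \<and>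
       ?r (2*h+3) = 2\<^sup>2 * (?r 1 / 2 ^ h) \<and> ?r (2*h+4) = ?r (2*h+2) / 5 ^ 3 \<and> ?r (2*h+5) = 2 * ?r (2*h+3)) \<or>
     (3 \<le> h \<and> ?r (2*h-2) = ?r 0 * 5 ^ (h + 1) \<and> ?r (2*h-1) = ?r 1 / 2 ^ h \<and> ?r (2*h) = ?r 0 * 5 ^ h)"
    using run_lemma[OF okr slopes_25 r0] by (elim exE conjE)
  \<comment> \<open>Since w * 10^(n+5) = 1, the exponent n + 4 solves the crossing equation w/2/2^h
    = w^2 5^(h+1).\<close>
  have "?r 1 / 2 ^ (n+4) = (?r 0 * 5 ^ (n+4+1)) ^ 1"
  proof -
    have "w / 2 / 2 ^ (n + 4) = w * (w * 10 ^ (n + 5)) / 2 ^ (n + 5)" using w(2) by (simp add: power_add)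
    also have "(10::real) ^ (n + 5) = 5 ^ (n + 5) * 2 ^ (n + 5)" by (simp flip: power_mult_distrib)
    finally show ?thesis unfolding r01 by (simp add: power2_eq_square)
  qed
  from crossing_unique[OF pos pos _ _ _ h this] have hn: "h = n + 4" by simp
  have Y: "?r (2*n+6) = 5 * Ow w n \<or> ?r (2*n+6) = 125 * Ow w n"
    using ex
  proof
    assume "(\<forall>i\<le>h. ?r (2*i) = ?r 0 * 5 ^ i \<and> ?r (2*i+1) = ?r 1 / 2 ^ i) \<and> ?r (2*h+2) = ?r 0 * 5 ^ (h + 1) \<and>
       ?r (2*h+3) = 2\<^sup>2 * (?r 1 / 2 ^ h) \<and> ?r (2*h+4) = ?r (2*h+2) / 5 ^ 3 \<and> ?r (2*h+5) = 2 * ?r (2*h+3)"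
    then have f: "\<forall>i\<le>h. ?r (2*i) = ?r 0 * 5 ^ i" by blast
          have "n+3 \<le> h" using hn by simp
          with f have "?r (2*(n+3)) = ?r 0 * 5 ^ (n+3)" by blast
    then have "?r (2*n+6) = 5 * Ow w n" unfolding r01 by (simp add: Ow_def power_add algebra_simps)
    then show ?thesis ..
  next
    assume "3 \<le> h \<and> ?r (2*h-2) = ?r 0 * 5 ^ (h + 1) \<and> ?r (2*h-1) = ?r 1 / 2 ^ h \<and> ?r (2*h) = ?r 0 * 5 ^ h"
    then have "?r (2*h-2) = ?r 0 * 5 ^ (h + 1)" by blast
    moreover have "2*h-2 = 2*n+6" using hn by simp
    ultimately have "?r (2*n+6) = 125 * Ow w n" unfolding r01 hn by (simp add: Ow_def power_add algebra_simps)
    then show ?thesis ..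
  qed
  have "wseg n w 2 Y (\<lambda>t. P (t + 5))" if "?r (2*n+6) = Y * Ow w n" for Y
    unfolding wseg_def
  proof (intro conjI allI impI)
    show "seg (2*n+2) (\<lambda>t. P (t + 5))" by (rule seg_forward[OF P])
    show "m (P (0 + 5)) = 2 * Ew w 0" using seq[rule_format, of 1] hn unfolding r01 by (simp add: Ew_def numeral_eq_Suc)
    show "m (P (2*n+3+5)) = Y * Ow w n" using that by (simp add: add.commute)
    fix i assume i: "i \<le> n"
    have "?r (2*(i+2)) = w\<^sup>2 * 5 ^ (i+2) \<and> ?r (2*(i+2)+1) = w / 2 / 2 ^ (i+2)" using seq[rule_format, of "i+2"] i hn unfolding r01 by simp
    moreover have "2 + 2*(i+2) = 2*i+1+5" "2 + (2*(i+2)+1) = 2*i+2+5" by auto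
    ultimately have "m (P (2*i+1+5)) = w\<^sup>2 * 5 ^ (i+2)" "m (P (2*i+2+5)) = w / 2 / 2 ^ (i+2)" by (simp_all only:)
    then show "m (P (2*i+1+5)) = Ow w i" "m (P (2*i+2+5)) = Ew w i"
      by (simp_all add: Ow_def Ew_def power_add algebra_simps)
  qed
  then show ?thesis using Y by blast
qed

text \<open>The run starting at a left turn meets a turn and comes back through the same weights in
  reverse order. The kind of the turn fixes which of 5 and 125 is seen on the way out, and the other
  one is seen on the way back.\<close>

lemma wseg_after:
  assumes P: "walk P" and w: "0 < w"
    and P0: "m (P 2) = w" "m (P 3) = 25 * w\<^sup>2" "m (P 4) = w / 8" "m (P 5) = 125 * w\<^sup>2"
  shows "\<exists>h. w * 10 ^ (h + 3) = 1 \<and> (\<forall>n. h = n + 2 \<longrightarrow> (\<exists>Y Y' X. {Y, Y'} = {5, 125} \<and> X \<in> {2, 8} \<and>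
    wseg n w 8 Y (\<lambda>t. P (t + 2)) \<and> wseg n w X Y' (\<lambda>t. P (4*n+12 - t))))"
proof -
  let ?p = "\<lambda>i. m (P i)"
  have ok: "okseq ?p" by (rule walk_okseq[OF P])
  have pos: "0 < ?p i" for i using ok by (auto simp: okseq_def)
  have okw: "okwin (?p i) (?p (i+1)) (?p (i+2)) (?p (i+3))" for i using ok unfolding okseq_def by blast
  let ?q = "\<lambda>i. m (P (3 + i))"
  have okq: "okseq ?q" by (rule okseq_shift[OF ok])
  have q01: "?q 0 = 25 * w\<^sup>2" "?q 1 = w / 8" using P0 by (simp_all add: numeral_eq_Suc)
  have q2: "?q 2 = 5 * ?q 0" using P0 by (simp add: numeral_eq_Suc)
  obtain h where h: "?q 1 / 2 ^ h = (?q 0 * 5 ^ (h + 1)) ^ 1"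
    and seq: "\<forall>i. i + 2 \<le> h \<longrightarrow> ?q (2*i) = ?q 0 * 5 ^ i \<and> ?q (2*i+1) = ?q 1 / 2 ^ i"
    and ex: "((\<forall>i\<le>h. ?q (2*i) = ?q 0 * 5 ^ i \<and> ?q (2*i+1) = ?q 1 / 2 ^ i) \<and> ?q (2*h+2) = ?q 0 * 5 ^ (h + 1) \<and>
       ?q (2*h+3) = 2\<^sup>2 * (?q 1 / 2 ^ h) \<and> ?q (2*h+4) = ?q (2*h+2) / 5 ^ 3 \<and> ?q (2*h+5) = 2 * ?q (2*h+3)) \<or>
     (3 \<le> h \<and> ?q (2*h-2) = ?q 0 * 5 ^ (h + 1) \<and> ?q (2*h-1) = ?q 1 / 2 ^ h \<and> ?q (2*h) = ?q 0 * 5 ^ h)"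
    using run_lemma[OF okq slopes_25 q2] by (elim exE conjE)
  \<comment> \<open>The crossing equation w/8/2^h = 25 w^2 5^(h+1) with w cancelled.\<close>
  have w10: "w * 10 ^ (h + 3) = 1"
  proof -
    have "w / 8 = 25 * w\<^sup>2 * 5 ^ (h + 1) * 2 ^ h" using h unfolding q01 by (simp add: field_simps)
    then have "w * 1 = w * (w * (1000 * (5 ^ h * 2 ^ h)))" by (simp add: power2_eq_square algebra_simps)
    then have "1 = w * (1000 * (5 ^ h * 2 ^ h))" using w by (simp only: mult_cancel_left) simp
    then show ?thesis by (simp add: power_add flip: power_mult_distrib)
  qed
  show ?thesis
  proof (intro exI[of _ h] conjI w10 allI impI)
    fix n assume hn: "h = n + 2"
    have fwd: "wseg n w 8 Y (\<lambda>t. P (t + 2))" if "?q (2*n+2) = Y * Ow w n" for Y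
      unfolding wseg_def
    proof (intro conjI allI impI)
      show "seg (2*n+2) (\<lambda>t. P (t + 2))" by (rule seg_forward[OF P])
      show "m (P (0 + 2)) = 8 * Ew w 0" using P0(1) by (simp add: Ew_def numeral_2_eq_2)
      have "2*n+3+2 = 3 + (2*n+2)" by simp
      then show "m (P (2*n+3+2)) = Y * Ow w n" using that by (simp only:)
      fix i assume i: "i \<le> n"
      have "?q (2*i) = Ow w i \<and> ?q (2*i+1) = Ew w i" using seq[rule_format, of i] i hn unfolding q01 by (simp add: Ow_def Ew_def)
      moreover have "3 + 2*i = 2*i+1+2" "3 + (2*i+1) = 2*i+2+2" by auto
      ultimately show "m (P (2*i+1+2)) = Ow w i" "m (P (2*i+2+2)) = Ew w i" by (simp_all only:)
    qed
    \<comment> \<open>The way back, started at position \<open>c\<close> with the weights of index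
      \<open>b\<close>. An ordinary turn gives b = n, and a reversed one gives b = n + 2; in both
      cases c + 2b = 4n + 10, so one formula places the backward segment.\<close>
    have bwd: "\<exists>X\<in>{2, 8}. wseg n w X Y (\<lambda>t. P (4*n+12 - t))"
      if c: "0 < c" "m (P c) = Ew w b" "m (P (c+1)) = Ow w b" "m (P (c+2)) = 2 * m (P c)"
        and bc: "c + 2*b = 4*n+10" "n \<le> b" and Y: "b = n \<and> m (P (2*n+9)) = Y * Ow w n \<or> b = n+2 \<and> Y = 5" for c b Y
    proof -
      let ?r = "\<lambda>i. m (P (c + i))"
      have okr: "okseq ?r" by (rule okseq_shift[OF ok])
      have r01: "?r 0 = Ew w b" "?r 1 = Ow w b" using c by auto
      have r2: "?r 2 = 2 * ?r 0" using c by simp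
      obtain h' where h': "?r 1 / 5 ^ h' = (?r 0 * 2 ^ (h' + 1)) ^ 2"
        and seq': "\<forall>i. i + 2 \<le> h' \<longrightarrow> ?r (2*i) = ?r 0 * 2 ^ i \<and> ?r (2*i+1) = ?r 1 / 5 ^ i"
        and ex': "((\<forall>i\<le>h'. ?r (2*i) = ?r 0 * 2 ^ i \<and> ?r (2*i+1) = ?r 1 / 5 ^ i) \<and> ?r (2*h'+2) = ?r 0 * 2 ^ (h' + 1) \<and>
           ?r (2*h'+3) = 5\<^sup>2 * (?r 1 / 5 ^ h') \<and> ?r (2*h'+4) = ?r (2*h'+2) / 2 ^ 3 \<and> ?r (2*h'+5) = 5 * ?r (2*h'+3)) \<or>
         (3 \<le> h' \<and> ?r (2*h'-2) = ?r 0 * 2 ^ (h' + 1) \<and> ?r (2*h'-1) = ?r 1 / 5 ^ h' \<and> ?r (2*h') = ?r 0 * 2 ^ h')"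
        using run_lemma[OF okr slopes_52 r2] by (elim exE conjE)
      \<comment> \<open>Both sides equal w^2, the weight next to w at the turn of scale w.\<close>
      have "?r 1 / 5 ^ (b+2) = (?r 0 * 2 ^ (b+2+1)) ^ 2"
        unfolding r01 by (simp add: Ow_def Ew_def power_add power_mult_distrib field_simps)
      from crossing_unique[OF pos pos _ _ _ h' this] have hk: "h' = b + 2" by simp
      obtain X where X: "X \<in> {2, 8}" "?r (2*b+2) = X * Ew w 0"
      proof -
        from ex' show thesis
        proof
          assume "(\<forall>i\<le>h'. ?r (2*i) = ?r 0 * 2 ^ i \<and> ?r (2*i+1) = ?r 1 / 5 ^ i) \<and> ?r (2*h'+2) = ?r 0 * 2 ^ (h' + 1) \<and>
           ?r (2*h'+3) = 5\<^sup>2 * (?r 1 / 5 ^ h') \<and> ?r (2*h'+4) = ?r (2*h'+2) / 2 ^ 3 \<and> ?r (2*h'+5) = 5 * ?r (2*h'+3)"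
          then have f: "\<forall>i\<le>h'. ?r (2*i) = ?r 0 * 2 ^ i" by blast
          have "b+1 \<le> h'" using hk by simp
          with f have "?r (2*(b+1)) = ?r 0 * 2 ^ (b+1)" by blast
          then have "?r (2*b+2) = 2 * Ew w 0" unfolding r01 by (simp add: Ew_def)
          then show thesis using that by blast
        next
          assume "3 \<le> h' \<and> ?r (2*h'-2) = ?r 0 * 2 ^ (h' + 1) \<and> ?r (2*h'-1) = ?r 1 / 5 ^ h' \<and> ?r (2*h') = ?r 0 * 2 ^ h'"
          then have "?r (2*h'-2) = ?r 0 * 2 ^ (h' + 1)" by blast
          moreover have "2*h'-2 = 2*b+2" using hk by simp
          ultimately have "?r (2*b+2) = 8 * Ew w 0" unfolding r01 hk by (simp add: Ew_def power_add)
          then show thesis using that by blast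
        qed
      qed
      note cb = bc(1)
      have Y9: "m (P (2*n+9)) = Y * Ow w n"
        using Y
      proof
        assume b: "b = n+2 \<and> Y = 5"
        have "?r (2*1+1) = ?r 1 / 5 ^ 1" using seq'[rule_format, of 1] hk b by simp
        moreover have "c + (2*1+1) = 2*n+9" using cb b by simp
        ultimately have "m (P (2*n+9)) = Ow w b / 5" unfolding r01 by (simp only: power_one_right)
        then show ?thesis using b by (simp add: Ow_def)
      qed simp
      have "wseg n w X Y (\<lambda>t. P (4*n+12 - t))" unfolding wseg_def
      proof (intro conjI allI impI)
        show "seg (2*n+2) (\<lambda>t. P (4*n+12 - t))" by (rule seg_backward[OF P]) simp
        have "4*n+12 - 0 = c + (2*b+2)" using cb by simp
        then show "m (P (4*n+12 - 0)) = X * Ew w 0" using X by (simp only:)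
        have "4*n+12 - (2*n+3) = 2*n+9" by simp
        then show "m (P (4*n+12 - (2*n+3))) = Y * Ow w n" using Y9 by (simp only:)
        fix i assume i: "i \<le> n"
        then have ib: "i \<le> b" using bc by simp
        have e: "4*n+12 - (2*i+1) = c + (2*(b - i) + 1)" "4*n+12 - (2*i+2) = c + 2*(b - i)" using cb ib by auto
        have "?r (2*(b-i)) = Ew w b * 2 ^ (b - i) \<and> ?r (2*(b-i)+1) = Ow w b / 5 ^ (b - i)"
          using seq'[rule_format, of "b - i"] hk ib unfolding r01 by simp
        moreover have "Ew w b * 2 ^ (b - i) = Ew w i" "Ow w b / 5 ^ (b - i) = Ow w i"
          using ib by (simp_all add: Ew_def Ow_def power_diff field_simps)
        ultimately show "m (P (4*n+12 - (2*i+1))) = Ow w i" "m (P (4*n+12 - (2*i+2))) = Ew w i"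
          unfolding e by auto
      qed
      then show ?thesis using X by blast
    qed
    show "\<exists>Y Y' X. {Y, Y'} = {5, 125} \<and> X \<in> {2, 8} \<and>
      wseg n w 8 Y (\<lambda>t. P (t + 2)) \<and> wseg n w X Y' (\<lambda>t. P (4*n+12 - t))"
      using ex
    proof
      assume F: "(\<forall>i\<le>h. ?q (2*i) = ?q 0 * 5 ^ i \<and> ?q (2*i+1) = ?q 1 / 2 ^ i) \<and> ?q (2*h+2) = ?q 0 * 5 ^ (h + 1) \<and>
       ?q (2*h+3) = 2\<^sup>2 * (?q 1 / 2 ^ h) \<and> ?q (2*h+4) = ?q (2*h+2) / 5 ^ 3 \<and> ?q (2*h+5) = 2 * ?q (2*h+3)"
      have f: "\<forall>i\<le>h. ?q (2*i) = ?q 0 * 5 ^ i" using F by blast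
          have "n+1 \<le> h" using hn by simp
          with f have "?q (2*(n+1)) = ?q 0 * 5 ^ (n+1)" by blast
      then have "?q (2*n+2) = 5 * Ow w n" unfolding q01 by (simp add: Ow_def)
      from fwd[OF this] have a: "wseg n w 8 5 (\<lambda>t. P (t + 2))" .
      have e: "3 + (2*h+2) = 2*n+9" "3 + (2*h+3) = 2*n+10" "3 + (2*h+4) = 2*n+10+1" "3 + (2*h+5) = 2*n+10+2"
        using hn by auto
      have F': "?q (2*h+2) = ?q 0 * 5 ^ (h + 1)" "?q (2*h+3) = 2\<^sup>2 * (?q 1 / 2 ^ h)" "?q (2*h+4) = ?q (2*h+2) / 5 ^ 3"
        "?q (2*h+5) = 2 * ?q (2*h+3)" using F by blast+
      have b1: "m (P (2*n+9)) = 125 * Ow w n" using F'(1)[unfolded e q01] unfolding hn by (simp add: Ow_def power_add)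
      have b2: "m (P (2*n+10)) = Ew w n" using F'(2)[unfolded e q01] unfolding hn by (simp add: Ew_def power_add)
      have b3: "m (P (2*n+10+1)) = Ow w n" using F'(3) b1 unfolding e by simp
      have b4: "m (P (2*n+10+2)) = 2 * m (P (2*n+10))" using F'(4) unfolding e .
      obtain X where "X \<in> {2, 8}" "wseg n w X 125 (\<lambda>t. P (4*n+12 - t))"
        using bwd[OF _ b2 b3 b4, of 125] b1 by auto
      then show ?thesis using a by blast
    next
      assume B: "3 \<le> h \<and> ?q (2*h-2) = ?q 0 * 5 ^ (h + 1) \<and> ?q (2*h-1) = ?q 1 / 2 ^ h \<and> ?q (2*h) = ?q 0 * 5 ^ h"
      have e: "2*h-2 = 2*n+2" "2*h-1 = 2*n+3" "2*h = 2*n+4" using hn by auto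
      have B': "?q (2*n+2) = ?q 0 * 5 ^ (h + 1)" "?q (2*n+3) = ?q 1 / 2 ^ h" "?q (2*n+4) = ?q 0 * 5 ^ h" 
        using B[unfolded e(1,2)] unfolding e(3) by blast+
      have "?q (2*n+2) = 125 * Ow w n" using B'(1) unfolding q01 hn by (simp add: Ow_def power_add)
      from fwd[OF this] have a: "wseg n w 8 125 (\<lambda>t. P (t + 2))" .
      have e': "3 + (2*n+2) = 2*n+5" "3 + (2*n+3) = 2*n+6" "3 + (2*n+4) = 2*n+7" by auto
      have b2: "?p (2*n+6) = Ew w (n+2)" using B'(2)[unfolded e' q01] unfolding hn by (simp add: Ew_def)
      have b3: "?p (2*n+7) = Ow w (n+2)" using B'(3)[unfolded e' q01] unfolding hn by (simp add: Ow_def)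
      have b1: "?p (2*n+5) = 5 * Ow w (n+2)" using B'(1)[unfolded e' q01] unfolding hn by (simp add: Ow_def)
      have "?p (2*n+7) = ?p (2*n+5) / 5" using b1 b3 by simp
      then have c: "?p (2*n+8) = 2 * ?p (2*n+6) \<or> ?p (2*n+8) = 2 ^ 3 * ?p (2*n+6)"
        using okwin_steps(7)[OF slopes_25 okw pos pos, of "2*n+5"] by (simp add: numeral_eq_Suc)
      \<comment> \<open>The factor 8 would start a second reversed turn at once, whose relation
        gives 20^(n+2) = 1.\<close>
      have "?p (2*n+8) \<noteq> 2 ^ 3 * ?p (2*n+6)"
      proof
        assume c8: "?p (2*n+8) = 2 ^ 3 * ?p (2*n+6)"
        have c9: "?p (2*n+9) = ?p (2*n+7) / 5\<^sup>2"
          using okwin_steps(3)[OF slopes_52 okw pos pos, of "2*n+6"] c8 by (simp add: numeral_eq_Suc)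
        have "?p (2*n+9) = ?p (2*n+8) ^ 2"
          using okwin_steps(4)[OF slopes_52 okw pos pos, of "2*n+7"] c9 by (simp add: numeral_eq_Suc)
        then have eq: "Ow w (n+2) / 25 = 64 * (Ew w (n+2))\<^sup>2" using c8 c9 b2 b3 by (simp add: power_mult_distrib)
        have "w\<^sup>2 * 5 ^ (n+2) * (4 ^ (n+2)) = w\<^sup>2"
        proof -
          have "w\<^sup>2 * 5 ^ (n+2) = w\<^sup>2 / (2 ^ (n+2))\<^sup>2" using eq by (simp add: Ow_def Ew_def power_divide)
          moreover have "((2::real) ^ (n+2))\<^sup>2 = 4 ^ (n+2)" by (simp add: power2_eq_square flip: power_mult_distrib)
          ultimately show ?thesis by simp
        qed
        then have "(20::real) ^ (n+2) = 1" using w by (simp flip: power_mult_distrib)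
        moreover have "(20::real) ^ (n+2) > 1" by (intro one_less_power) auto
        ultimately show False by simp
      qed
      have b4: "?p (2*n+6+2) = 2 * ?p (2*n+6)"
      proof -
        have "2*n+6+2 = 2*n+8" by simp
        then show ?thesis using c \<open>?p (2*n+8) \<noteq> 2 ^ 3 * ?p (2*n+6)\<close> by (simp only:) blast
      qed
      have b3': "?p (2*n+6+1) = Ow w (n+2)" using b3 by (simp add: numeral_eq_Suc)
      obtain X where "X \<in> {2, 8}" "wseg n w X 5 (\<lambda>t. P (4*n+12 - t))"
        using bwd[OF _ b2 b3' b4, of 5] by auto
      then show ?thesis using a by blast
    qed
  qed
qed

text \<open>The path through the turn is followed in both directions. Ratio 25 must be followed by
  1/8 and then by 5, which gives the two weights after \<open>t\<close>.\<close>

lemma Lwin_walk: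
  assumes L: "Lwin x z y t"
  obtains P Q where "walk P" "P 0 = x" "P 1 = z" "P 2 = y" "P 3 = t" "walk Q" "Q 0 = t" "Q 1 = y" "Q 2 = z" "Q 3 = x"
    "m (P 4) = m y / 8" "m (P 5) = 125 * (m y)\<^sup>2"
proof -
  have l: "z \<in> V2" "y \<in> V2" "x \<in> N z" "y \<in> N z" "x \<noteq> y" "t \<in> N y" "t \<noteq> z"
    and e: "m y = 2 * m x" "m t = 25 * m z" "m z = (m y)\<^sup>2" using L by (auto simp: Lwin_def)
  have zy: "z \<in> N y" using V2_nbrs(2)[OF l(1,4)] .
  obtain P where P: "walk P" "P 0 = x" "P 1 = z" by (rule walk_exists[OF l(1,3)])
  have P2: "P 2 = y" using walk_next[OF P(1), of y 0] P l by (simp add: numeral_2_eq_2)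
  have P3: "P 3 = t" using walk_next[OF P(1), of t 1] P P2 l by (simp add: numeral_2_eq_2 numeral_3_eq_3)
  obtain Q where Q: "walk Q" "Q 0 = t" "Q 1 = y" by (rule walk_exists[OF l(2,6)])
  have Q2: "Q 2 = z" using walk_next[OF Q(1), of z 0] Q l zy by (simp add: numeral_2_eq_2)
  have Q3: "Q 3 = x" using walk_next[OF Q(1), of x 1] Q Q2 l by (simp add: numeral_2_eq_2 numeral_3_eq_3)
  have ok: "okseq (\<lambda>i. m (P i))" by (rule walk_okseq[OF P(1)])
  have pos: "0 < m (P i)" for i using ok by (auto simp: okseq_def)
  have okw: "okwin (m (P i)) (m (P (i+1))) (m (P (i+2))) (m (P (i+3)))" for i using ok unfolding okseq_def by blast
  have "m (P (1+3)) = m (P (1+1)) / 2 ^ 3"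
    using P P2 P3 e by (intro okwin_steps(5)[OF slopes_52 okw pos pos]) (simp add: numeral_3_eq_3 numeral_2_eq_2)
  then have P4: "m (P 4) = m y / 8" using P2 by (simp add: numeral_eq_Suc)
  have "m (P (2+3)) = 5 * m (P (2+1))"
    using P P2 P3 P4 e by (intro okwin_steps(6)[OF slopes_52 okw pos pos]) (simp add: numeral_eq_Suc)
  then have "m (P 5) = 125 * (m y)\<^sup>2" using P3 e by (simp add: numeral_eq_Suc)
  with P P2 P3 Q Q2 Q3 P4 show ?thesis using that by blast
qed

text \<open>Three stretches are available: (8, Y) right after the turn, (X, Y') on the way back with
  Y' different from Y, and (2, Y4) before the turn. If X = 2, the first two differ at both ends. If
  X = 8, the third is paired with whichever of the first two has the other value at the far
  end.\<close>

lemma Lwin_segments: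
  assumes L: "Lwin x z y t"
  shows "\<exists>h. m y * 10 ^ (h + 3) = 1 \<and> (\<forall>n. h = n + 2 \<longrightarrow> (\<exists>X X' Y Y' a b. {X, X'} = {2, 8} \<and> {Y, Y'} = {5, 125} \<and>
    wseg n (m y) X Y a \<and> wseg n (m y) X' Y' b))"
proof -
  obtain P Q where P: "walk P" "P 0 = x" "P 1 = z" "P 2 = y" "P 3 = t" and Q: "walk Q" "Q 0 = t" "Q 1 = y" "Q 2 = z" "Q 3 = x"
    and P45: "m (P 4) = m y / 8" "m (P 5) = 125 * (m y)\<^sup>2" by (rule Lwin_walk[OF L])
  have e: "m y = 2 * m x" "m t = 25 * m z" "m z = (m y)\<^sup>2" using L by (auto simp: Lwin_def)
  have w: "0 < m y" by (rule V2_pos) (use L in \<open>simp add: Lwin_def\<close>)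
  obtain h where h: "m y * 10 ^ (h + 3) = 1"
    and sg: "\<forall>n. h = n + 2 \<longrightarrow> (\<exists>Y Y' X. {Y, Y'} = {5, 125} \<and> X \<in> {2, 8} \<and>
      wseg n (m y) 8 Y (\<lambda>t. P (t + 2)) \<and> wseg n (m y) X Y' (\<lambda>t. P (4*n+12 - t)))"
    using wseg_after[OF P(1) w] P P45 e by auto
  show ?thesis
  proof (intro exI[of _ h] conjI h allI impI)
    fix n assume hn: "h = n + 2"
    obtain Y Y' X where Y: "{Y, Y'} = {5, 125}" and X: "X \<in> {2, 8}"
      and s1: "wseg n (m y) 8 Y (\<lambda>t. P (t + 2))" and s2: "wseg n (m y) X Y' (\<lambda>t. P (4*n+12 - t))"
      using sg hn by blast
    have "m y * 10 ^ (n + 5) = 1" using h hn by (simp add: add.commute)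
    then obtain Y4 where Y4: "Y4 \<in> {5, 125}" and s4: "wseg n (m y) 2 Y4 (\<lambda>t. Q (t + 5))"
      using wseg_before[OF Q(1) w] Q e by auto
    have Y4': "Y4 = Y \<or> Y4 = Y'" using Y4 unfolding Y[symmetric] by simp
    show "\<exists>X X' Y Y' a b. {X, X'} = {2, 8} \<and> {Y, Y'} = {5, 125} \<and> wseg n (m y) X Y a \<and> wseg n (m y) X' Y' b"
    proof (cases "X = 2")
      case True
      then have "wseg n (m y) 2 Y' (\<lambda>t. P (4*n+12 - t))" using s2 by simp
      moreover have "{8, 2::real} = {2, 8}" by auto
      ultimately show ?thesis using s1 Y by blast
    next
      case False
      then have s2': "wseg n (m y) 8 Y' (\<lambda>t. P (4*n+12 - t))" using s2 X by simp
      have e: "{2, 8::real} = {2, 8}" "{8, 2::real} = {2, 8}" by auto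
      from Y4' show ?thesis
      proof
        assume "Y4 = Y"
        then have "wseg n (m y) 2 Y (\<lambda>t. Q (t + 5))" using s4 by simp
        then show ?thesis using s2' e(1) Y by blast
      next
        assume "Y4 = Y'"
        then have "wseg n (m y) 2 Y' (\<lambda>t. Q (t + 5))" using s4 by simp
        then show ?thesis using s1 e(2) Y by blast
      qed
    qed
  qed
qed

text \<open>The scale is a power of 1/10, and all weights near the turn are rational multiples of w
  or w^2, including the two outer neighbours.\<close>

lemma Lwin_rational:
  assumes L: "Lwin x z y t" and v: "v \<in> {x, z, y, t} \<union> N x \<union> N t"
  shows "m v \<in> \<rat>"
proof -
  obtain P Q where P: "walk P" "P 0 = x" "P 1 = z" "P 2 = y" "P 3 = t" and Q: "walk Q" "Q 0 = t" "Q 1 = y" "Q 2 = z" "Q 3 = x"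
    and P45: "m (P 4) = m y / 8" "m (P 5) = 125 * (m y)\<^sup>2" by (rule Lwin_walk[OF L])
  have e: "m y = 2 * m x" "m t = 25 * m z" "m z = (m y)\<^sup>2" using L by (auto simp: Lwin_def)
  obtain h where h: "m y * 10 ^ (h + 3) = 1" using Lwin_segments[OF L] by blast
  have "m y = 1 / 10 ^ (h + 3)" using h by (simp add: field_simps)
  then have ry: "m y \<in> \<rat>" by simp
  have rx: "m x = m y / 2" using e by simp
  have r: "m x \<in> \<rat>" "m z \<in> \<rat>" "m t \<in> \<rat>" using ry unfolding rx e(2,3) by simp_all
  have nt: "m v \<in> \<rat>" if "v \<in> N t"
  proof (cases "v = y")
    case False
    then have "P 4 = v" using walk_next[OF P(1), of v 2] P that by (simp add: numeral_eq_Suc)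
    then have v: "m v = m y / 8" using P45(1) by (simp only:)
    show ?thesis unfolding v using ry by simp
  qed (use ry in simp)
  have nx: "m v \<in> \<rat>" if "v \<in> N x"
  proof (cases "v = z")
    case False
    then have Q4: "Q 4 = v" using walk_next[OF Q(1), of v 2] Q that by (simp add: numeral_eq_Suc)
    have ok: "okseq (\<lambda>i. m (Q i))" by (rule walk_okseq[OF Q(1)])
    have pos: "0 < m (Q i)" for i using ok by (auto simp: okseq_def)
    have okw: "okwin (m (Q i)) (m (Q (i+1))) (m (Q (i+2))) (m (Q (i+3)))" for i using ok unfolding okseq_def by blast
    have "m (Q (1+3)) = 5 * m (Q (1+1)) \<or> m (Q (1+3)) = 5 ^ 3 * m (Q (1+1))"
      using Q rx by (intro okwin_steps(2)[OF slopes_25 okw pos pos]) (simp add: numeral_3_eq_3 numeral_2_eq_2)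
    then have "m v = 5 * m z \<or> m v = 125 * m z" using Q4 Q by (simp add: numeral_eq_Suc)
    then show ?thesis using r by auto
  qed (use r in simp)
  show ?thesis using v nt nx r ry by auto
qed

lemma finite_heavy:
  assumes "0 < c"
  shows "finite {i. c \<le> m i}"
proof -
  have bd: "real (card F) * c \<le> 1" if F: "F \<subseteq> {i. c \<le> m i}" "finite F" for F
  proof -
    have "real (card F) * c \<le> (\<Sum>i\<in>F. m i)" using F by (intro sum_bounded_below) auto
    also have "\<dots> = measure unit_space (\<Union>i\<in>F. fiber \<pi> i)"
      unfolding lmass_def
      by (rule unit.finite_measure_finite_Union[symmetric, OF F(2)]) (use fib in \<open>auto simp: disjoint_family_on_def fiber_def\<close>)
    also have "\<dots> \<le> 1" by simp
    finally show ?thesis .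
  qed
  have "card F \<le> nat \<lceil>1 / c\<rceil>" if "F \<subseteq> {i. c \<le> m i}" "finite F" for F
  proof -
    have "real (card F) \<le> 1 / c" using bd[OF that] assms by (simp add: field_simps)
    then show ?thesis by linarith
  qed
  then show ?thesis using finite_if_finite_subsets_card_bdd by blast
qed

text \<open>A label \<open>y\<close> belongs to finitely many left turns, as all its neighbourhoods
  are finite, and only finitely many labels have mass at least \<open>c\<close>. Infinitely many
  left turns thus need arbitrarily small scales.\<close>

lemma Lwin_small:
  assumes "0 < c"
  shows "\<exists>x z y t. Lwin x z y t \<and> m y < c"
proof (rule ccontr)
  assume "\<not> ?thesis"
  then have big: "c \<le> m y" if "Lwin x z y t" for x z y t
    using that not_le by blast
  define H where "H = {i. c \<le> m i} \<inter> V2"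
  have fH: "finite H" using finite_heavy[OF assms] by (simp add: H_def)
  have fN: "finite (N i)" if "i \<in> V2" for i using that N_le_2(1) by (auto simp: V2_def)
  define Z where "Z = (\<Union>y\<in>H. N y)"
  have ZV: "Z \<subseteq> V2" unfolding Z_def H_def using V2_nbrs(1) by blast
  have fZ: "finite Z" unfolding Z_def using fH fN by (auto simp: H_def)
  have fX: "finite (\<Union>z\<in>Z. N z)" using fZ fN ZV by auto
  have "{(x, z, y, t). Lwin x z y t} \<subseteq> (\<Union>z\<in>Z. N z) \<times> Z \<times> H \<times> Z"
  proof -
    have "x \<in> (\<Union>z\<in>Z. N z) \<and> z \<in> Z \<and> y \<in> H \<and> t \<in> Z" if L: "Lwin x z y t" for x z y t
    proof (intro conjI)
    from L have l: "z \<in> V2" "y \<in> V2" "x \<in> N z" "y \<in> N z" "t \<in> N y" by (auto simp: Lwin_def)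
    have yH: "y \<in> H" using big[OF L] l by (simp add: H_def)
    have zy: "z \<in> N y" using V2_nbrs(2)[OF l(1,4)] .
    show "y \<in> H" by fact
    show zZ: "z \<in> Z" using yH zy by (auto simp: Z_def)
    show "t \<in> Z" using yH l by (auto simp: Z_def)
    show "x \<in> (\<Union>z\<in>Z. N z)" using zZ l by blast
    qed
    note sub = this
    show ?thesis
    proof
      fix p assume p: "p \<in> {(x, z, y, t). Lwin x z y t}"
      obtain x z y t where xyz: "p = (x, z, y, t)" by (rule prod_cases4)
      then have "Lwin x z y t" using p by simp
      from sub[OF this] show "p \<in> (\<Union>z\<in>Z. N z) \<times> Z \<times> H \<times> Z" unfolding xyz by simp
    qed
  qed
  then have "finite {(x, z, y, t). Lwin x z y t}" by (rule finite_subset) (intro finite_cartesian_product fX fZ fH)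
  moreover have "infinite {(x, z, y, t). Lwin x z y t}" by (rule Lwin_infinite) (rule Lwin_rational)
  ultimately show False by simp
qed

theorem long_segments:
  obtains n w X X' Y Y' a b where "k \<le> n" "w * 10 ^ (n + 5) = 1" "{X, X'} = {2, 8}" "{Y, Y'} = {5, 125}"
    "wseg n w X Y a" "wseg n w X' Y' b"
proof -
  have "0 < 1 / (10::real) ^ (k + 5)" by simp
  from Lwin_small[OF this] obtain x z y t where L: "Lwin x z y t" and small: "m y < 1 / 10 ^ (k + 5)"
    by (elim exE conjE)
  obtain h where h: "m y * 10 ^ (h + 3) = 1"
    and sg: "\<forall>n. h = n + 2 \<longrightarrow> (\<exists>X X' Y Y' a b. {X, X'} = {2, 8} \<and> {Y, Y'} = {5, 125} \<and>
    wseg n (m y) X Y a \<and> wseg n (m y) X' Y' b)" using Lwin_segments[OF L] by (elim exE conjE)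
  have w: "0 < m y" by (rule V2_pos) (use L in \<open>simp add: Lwin_def\<close>)
  have "m y * 10 ^ (k + 5) < m y * 10 ^ (h + 3)" unfolding h using small by (simp add: field_simps)
  then have "(10::real) ^ (k + 5) < 10 ^ (h + 3)" using w by (simp only: mult_less_cancel_left_pos)
  then have "k + 5 < h + 3" by (rule power_less_imp_less_exp[rotated]) simp
  then have hh: "h = (h - 2) + 2" "k \<le> h - 2" "h + 3 = h - 2 + 5" by auto
  obtain X X' Y Y' a b where "{X, X'} = {2, 8}" "{Y, Y'} = {5, 125}"
    "wseg (h - 2) (m y) X Y a" "wseg (h - 2) (m y) X' Y' b" using sg[rule_format, OF hh(1)] by (elim exE conjE)
  moreover have "m y * 10 ^ (h - 2 + 5) = 1" unfolding hh(3)[symmetric] by (rule h)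
  ultimately show ?thesis by (intro that[OF hh(2)])
qed

end

section \<open>Crossing over two segments\<close>

text \<open>The 2-switch familiar from degree sequences: the edges pq, rs give way to ps, rq, so
  every vertex keeps its number of neighbours.\<close>

definition exchange :: "('v \<Rightarrow> 'v \<Rightarrow> real) \<Rightarrow> 'v \<Rightarrow> 'v \<Rightarrow> 'v \<Rightarrow> 'v \<Rightarrow> 'v \<Rightarrow> 'v \<Rightarrow> real" where
  "exchange A p q r s u v =
    (if u = p \<and> v = q \<or> u = q \<and> v = p \<or> u = r \<and> v = s \<or> u = s \<and> v = r then 0
     else if u = p \<and> v = s \<or> u = s \<and> v = p \<or> u = r \<and> v = q \<or> u = q \<and> v = r then 1 else A u v)"

lemma exchange_swap: "exchange A r s p q u v = exchange A p q r s u v"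
  unfolding exchange_def by (simp only: disj_ac)

lemma exchange_sym:
  assumes "A u v = A v u"
  shows "exchange A p q r s u v = exchange A p q r s v u"
  unfolding exchange_def assms by (simp only: disj_ac conj_commute)

lemma exchange_away: "u \<noteq> q \<Longrightarrow> u \<noteq> s \<Longrightarrow> v \<noteq> q \<Longrightarrow> v \<noteq> s \<Longrightarrow> exchange A p q r s u v = A u v"
  by (simp add: exchange_def)

lemma exchange_rest: "u \<noteq> p \<Longrightarrow> u \<noteq> q \<Longrightarrow> u \<noteq> r \<Longrightarrow> u \<noteq> s \<Longrightarrow> exchange A p q r s u v = A u v"
  by (simp add: exchange_def)

lemma exchange_inner:
  assumes "q \<noteq> p" "q \<noteq> r" "q \<noteq> s" "p \<noteq> r" "x \<noteq> p" "A q k = (if k \<in> {p, x} then 1 else 0)"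
  shows "exchange A p q r s q k = (if k \<in> {r, x} then 1 else 0)"
proof -
  have "exchange A p q r s q k = (if k = p then 0 else if k = r then 1 else A q k)"
    using assms(1-4) by (simp add: exchange_def)
  then have "exchange A p q r s q k = (if k = p then 0 else if k = r then 1 else if k \<in> {p, x} then 1 else 0)"
    by (simp only: assms(6))
  then show ?thesis using assms(4,5) by auto
qed

lemma exchange_outer:
  assumes "q \<noteq> p" "q \<noteq> s" "p \<noteq> r" "s \<noteq> p" "A p q = 1" "A p s = 0"
  shows "exchange A p q r s p k = A p k + (if k = s then 1 else 0) - (if k = q then 1 else 0)"
proof -
  have "exchange A p q r s p k = (if k = q then 0 else if k = s then 1 else A p k)"
    using assms(1-4) by (simp add: exchange_def)
  then show ?thesis using assms by (cases "k = q"; cases "k = s") simp_all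
qed

definition flip :: "(nat \<Rightarrow> nat \<Rightarrow> real) \<Rightarrow> (nat \<Rightarrow> nat) \<Rightarrow> (nat \<Rightarrow> nat) \<Rightarrow> nat \<Rightarrow> nat \<Rightarrow> real" where
  "flip A a b = exchange A (a 0) (a 1) (b 0) (b 1)"

lemma flip_swap: "flip A b a u v = flip A a b u v"
  unfolding flip_def by (rule exchange_swap)

text \<open>Only positions strictly below \<open>k\<close> are swapped. The labels at position
  \<open>k\<close> stay in place and form the cut across which the two arrangements
  disagree.\<close>

definition interchange :: "(nat \<Rightarrow> nat) \<Rightarrow> (nat \<Rightarrow> nat) \<Rightarrow> nat \<Rightarrow> nat \<Rightarrow> nat" where
  "interchange a b k u = (if \<exists>t\<in>{1..<k}. u = a t then b (SOME t. t \<in> {1..<k} \<and> u = a t)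
     else if \<exists>t\<in>{1..<k}. u = b t then a (SOME t. t \<in> {1..<k} \<and> u = b t) else u)"

text \<open>The inner weights agree position by position, both ends differ. Inner weights are
  pairwise distinct and differ from the first ends, which keeps the two segments from overlapping.
  With \<open>null\<close>, rows are exact at all labels, as needed for relabelling arbitrary
  tuples.\<close>

locale twin_segments = forced_step +
  fixes l :: nat and a b :: "nat \<Rightarrow> nat"
  assumes null: "m i = 0 \<Longrightarrow> A i j = 0"
    and sa: "seg l a" and sb: "seg l b" and l2: "2 \<le> l"
    and mw: "1 \<le> t \<Longrightarrow> t \<le> l \<Longrightarrow> m (a t) = m (b t)"
    and m0: "m (a 0) \<noteq> m (b 0)" and m1: "m (a (l+1)) \<noteq> m (b (l+1))"
    and winj: "1 \<le> s \<Longrightarrow> s \<le> l \<Longrightarrow> 1 \<le> t \<Longrightarrow> t \<le> l \<Longrightarrow> m (a s) = m (a t) \<Longrightarrow> s = t"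
    and w0: "1 \<le> t \<Longrightarrow> t \<le> l \<Longrightarrow> m (a t) \<noteq> m (a 0) \<and> m (a t) \<noteq> m (b 0)"
begin

text \<open>The situation is symmetric in the two segments, so facts about \<open>a\<close> transfer
  to \<open>b\<close>.\<close>

lemma swapped: "twin_segments \<pi> A l b a"
proof (unfold_locales)
  fix s t :: nat assume h: "1 \<le> s" "s \<le> l" "1 \<le> t" "t \<le> l" "m (b s) = m (b t)"
  show "s = t" by (rule winj[OF h(1-4)]) (simp add: mw[OF h(1,2)] mw[OF h(3,4)] h(5))
next
  fix t assume h: "1 \<le> t" "t \<le> l"
  show "m (b t) \<noteq> m (b 0) \<and> m (b t) \<noteq> m (a 0)" using w0[OF h] mw[OF h] by simp
  show "m (b t) = m (a t)" using mw[OF h] by simp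
next
  show "m i = 0 \<Longrightarrow> A i j = 0" for i j by (rule null)
  show "seg l b" "seg l a" "2 \<le> l" by (rule sb, rule sa, rule l2)
  show "m (b 0) \<noteq> m (a 0)" "m (b (l+1)) \<noteq> m (a (l+1))" by (rule m0[symmetric], rule m1[symmetric])
qed

abbreviation "A' \<equiv> flip A a b"
abbreviation "\<sigma> \<equiv> interchange a b"

lemma a_V2: "t \<le> l+1 \<Longrightarrow> a t \<in> V2" using sa by (simp add: seg_def)

lemma a_V: "t \<le> l+1 \<Longrightarrow> a t \<in> V" using a_V2 by (simp add: V2_def)

lemma nbrs_a:
  assumes t: "1 \<le> t" "t \<le> l"
  shows "N (a t) = {a (t-1), a (t+1)}" "d (a t) = m (a (t-1)) + m (a (t+1))" "a (t-1) \<noteq> a (t+1)"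
    "is_code (U (a (t-1)) (a (t+1))) (d (a (t-1))) (d (a (t+1)))"
proof -
  have e: "t - 1 + 1 = t" "t - 1 + 2 = t + 1" using t by auto
  have h: "a (s+1) \<in> N (a s)" if "s \<le> l" for s using sa that by (simp add: seg_def)
  have h': "a (s+2) \<noteq> a s" if "s < l" for s using sa that by (simp add: seg_def)
  have le: "t - 1 \<le> l" "t - 1 < l" using t by auto
  note s = h[OF le(1), unfolded e] h[OF t(2)] h'[OF le(2), unfolded e]
  have v: "a (t-1) \<in> V2" "a t \<in> V" "a (t-1) \<in> V" "a (t+1) \<in> V" using t a_V2 a_V by auto
  have x: "a (t-1) \<in> N (a t)" by (rule V2_nbrs(2)[OF v(1) s(1)])
  note two = two_nbrs[OF v(2) x s(2) s(3)[symmetric]]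
  show "N (a t) = {a (t-1), a (t+1)}" "d (a t) = m (a (t-1)) + m (a (t+1))" by (fact two(2), fact two(7))
  show "a (t-1) \<noteq> a (t+1)" using s(3) by simp
  show "is_code (U (a (t-1)) (a (t+1))) (d (a (t-1))) (d (a (t+1)))"
    by (rule common_code(1)[OF v(3,4) s(3)[symmetric] s(1)]) (rule N_V(2)[OF v(2) s(2)])
qed

lemmas nbrs_b = twin_segments.nbrs_a[OF swapped]

lemma row:
  assumes "i \<in> V"
  shows "A i k = (if k \<in> N i then 1 else 0)"
proof (cases "m k > 0")
  case True then show ?thesis by (rule A_V[OF assms])
next
  case False
  then have "m k = 0" using m_nonneg[of k] by simp
  from null[OF this, of i] show ?thesis using False A_sym[of i k] by (simp add: N_def)
qed

lemma row_a: "1 \<le> t \<Longrightarrow> t \<le> l \<Longrightarrow> A (a t) k = (if k \<in> {a (t-1), a (t+1)} then 1 else 0)"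
  using row[OF a_V[of t], of k] nbrs_a(1)[of t] by simp

lemmas row_b = twin_segments.row_a[OF swapped]

lemma a_inj: "1 \<le> s \<Longrightarrow> s \<le> l \<Longrightarrow> 1 \<le> t \<Longrightarrow> t \<le> l \<Longrightarrow> a s = a t \<longleftrightarrow> s = t"
  using winj[of s t] by auto

lemmas b_inj = twin_segments.a_inj[OF swapped]

lemma ends: "1 \<le> t \<Longrightarrow> t \<le> l \<Longrightarrow> a t \<noteq> a 0 \<and> a t \<noteq> b 0 \<and> b t \<noteq> a 0 \<and> b t \<noteq> b 0" "a 0 \<noteq> b 0"
proof -
  assume t: "1 \<le> t" "t \<le> l"
  show "a t \<noteq> a 0 \<and> a t \<noteq> b 0 \<and> b t \<noteq> a 0 \<and> b t \<noteq> b 0"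
  proof (intro conjI notI)
    assume "a t = a 0" then show False using w0[OF t] by simp
  next
    assume "a t = b 0" then show False using w0[OF t] by simp
  next
    assume "b t = a 0" then show False using w0[OF t] mw[OF t] by simp
  next
    assume "b t = b 0" then show False using w0[OF t] mw[OF t] by simp
  qed
next
  show "a 0 \<noteq> b 0"
  proof
    assume "a 0 = b 0" then show False using m0 by simp
  qed
qed

lemma l1: "1 \<le> l" and one_le_two: "(1::nat) \<le> 2" using l2 by simp_all

lemma ends_ne: "a 1 \<noteq> a 0" "a 1 \<noteq> b 0" "b 1 \<noteq> a 0" "b 1 \<noteq> b 0" "a 2 \<noteq> a 0" "a 2 \<noteq> b 0" "b 2 \<noteq> a 0"
  using ends(1)[OF order_refl l1] ends(1)[OF one_le_two l2] by (simp_all only: simp_thms)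

text \<open>If the segments met at position t + 1, their neighbours there would agree as sets.
  Running in the same direction, they would already meet at t, and so on back to the distinct ends.
  Running in opposite directions, the weights at t and t + 2 would agree, against
  \<open>winj\<close>, \<open>w0\<close> or \<open>m1\<close>.\<close>

lemma ab_same: "1 \<le> t \<Longrightarrow> t \<le> l \<Longrightarrow> a t \<noteq> b t"
proof (induction t)
  case (Suc t)
  show ?case
  proof
    assume e: "a (Suc t) = b (Suc t)"
    have n: "{a t, a (t+2)} = {b t, b (t+2)}" using nbrs_a(1)[OF Suc.prems] nbrs_b(1)[OF Suc.prems] e by simp
    have ne: "a t \<noteq> b t"
    proof (cases "t = 0")
      case True then show ?thesis using ends(2) by simp
    next
      case False then show ?thesis using Suc by simp
    qed
    then have x: "b t = a (t+2)" "a t = b (t+2)" 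
      using n[unfolded doubleton_eq_iff] by (elim disjE conjE; simp only: simp_thms)+
    show False
    proof (cases "t = 0")
      case True
      have "m (a 0) = m (a 2)" using x(2) mw[of 2] l2 True by (simp add: numeral_2_eq_2)
      then show False using w0[of 2] l2 by simp
    next
      case False
      have "m (a (t+2)) = m (a t)" using x(1) mw[of t] False Suc.prems by simp
      moreover have "m (b (t+2)) = m (a t)" using x(2) by simp
      ultimately show False
      proof (cases "t + 2 \<le> l")
        case True
        assume "m (a (t+2)) = m (a t)"
        then show False using winj[of "t+2" t] True False by simp
      next
        case f: False
        then have "t + 2 = l + 1" using Suc.prems by simp
        moreover assume "m (a (t+2)) = m (a t)" "m (b (t+2)) = m (a t)"
        ultimately show False using m1 by simp
      qed
    qed
  qed
qed simp

lemma ab: "1 \<le> s \<Longrightarrow> s \<le> l \<Longrightarrow> 1 \<le> t \<Longrightarrow> t \<le> l \<Longrightarrow> a s \<noteq> b t"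
proof
  assume h: "1 \<le> s" "s \<le> l" "1 \<le> t" "t \<le> l" and e: "a s = b t"
  have "m (a s) = m (a t)" unfolding e mw[OF h(3,4)] by (rule refl)
  from winj[OF h this] have "s = t" .
  with e have "a t = b t" by (simp only:)
  with ab_same[OF h(3,4)] show False by (rule notE)
qed

lemma interchange_a:
  assumes t: "1 \<le> t" "t \<le> l" and k: "k \<le> l"
  shows "\<sigma> k (a t) = (if t < k then b t else a t)"
proof (cases "t < k")
  case True
  have "s = t" if "s \<in> {1..<k}" "a t = a s" for s
  proof -
    have "1 \<le> s" "s \<le> l" using that(1) k by auto
    from a_inj[OF t this] that(2) show ?thesis by blast
  qed
  then have so: "(SOME s. s \<in> {1..<k} \<and> a t = a s) = t" using True t(1) by (intro some_equality) (simp, blast)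
  have "t \<in> {1..<k}" using True t(1) by simp
  then have "\<exists>s\<in>{1..<k}. a t = a s" by blast
  then show ?thesis using True unfolding interchange_def so by (simp only: if_True)
next
  case False
  have "a t \<noteq> a s" "a t \<noteq> b s" if "s \<in> {1..<k}" for s
  proof -
    have s: "1 \<le> s" "s \<le> l" "s \<noteq> t" using that k False by auto
    show "a t \<noteq> a s" using a_inj[OF t s(1,2)] s(3) by blast
    show "a t \<noteq> b s" by (rule ab[OF t s(1,2)])
  qed
  then have "\<not> (\<exists>s\<in>{1..<k}. a t = a s)" "\<not> (\<exists>s\<in>{1..<k}. a t = b s)" by blast+
  then show ?thesis using False unfolding interchange_def by (simp only: if_False)
qed

lemma interchange_swap:
  assumes k: "k \<le> l"
  shows "interchange b a k u = \<sigma> k u"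
proof -
  have "\<not> ((\<exists>t\<in>{1..<k}. u = a t) \<and> (\<exists>t\<in>{1..<k}. u = b t))"
  proof (intro notI, elim conjE bexE)
    fix s t assume h: "s \<in> {1..<k}" "t \<in> {1..<k}" "u = a s" "u = b t"
    have "a s \<noteq> b t" by (rule ab) (use h(1,2) k in auto)
    then show False using h(3,4) by blast
  qed
  then show ?thesis unfolding interchange_def
    by (cases "\<exists>t\<in>{1..<k}. u = a t"; cases "\<exists>t\<in>{1..<k}. u = b t") (simp_all only: if_True if_False simp_thms)
qed

lemma interchange_b: "1 \<le> t \<Longrightarrow> t \<le> l \<Longrightarrow> k \<le> l \<Longrightarrow> \<sigma> k (b t) = (if t < k then a t else b t)"
  using twin_segments.interchange_a[OF swapped, of t k] interchange_swap[of k] by simp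

lemma interchange_other:
  assumes "\<And>t. 1 \<le> t \<Longrightarrow> t \<le> l \<Longrightarrow> u \<noteq> a t \<and> u \<noteq> b t" "k \<le> l"
  shows "\<sigma> k u = u"
proof -
  have "u \<noteq> a t \<and> u \<noteq> b t" if "t \<in> {1..<k}" for t by (rule assms(1)) (use that assms(2) in auto)
  then have "\<not> (\<exists>t\<in>{1..<k}. u = a t)" "\<not> (\<exists>t\<in>{1..<k}. u = b t)" by blast+
  then show ?thesis unfolding interchange_def by (simp only: if_False)
qed

lemma label_cases:
  obtains t where "1 \<le> t" "t \<le> l" "u = a t" | t where "1 \<le> t" "t \<le> l" "u = b t"
  | "\<And>t. 1 \<le> t \<Longrightarrow> t \<le> l \<Longrightarrow> u \<noteq> a t \<and> u \<noteq> b t"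
  by blast

lemma interchange_invol:
  assumes k: "k \<le> l"
  shows "\<sigma> k (\<sigma> k u) = u"
proof (rule label_cases[of u])
  fix t assume t: "1 \<le> t" "t \<le> l" and u: "u = a t"
  show ?thesis unfolding u interchange_a[OF t k]
    by (cases "t < k") (simp_all only: if_True if_False interchange_a[OF t k] interchange_b[OF t k])
next
  fix t assume t: "1 \<le> t" "t \<le> l" and u: "u = b t"
  show ?thesis unfolding u interchange_b[OF t k]
    by (cases "t < k") (simp_all only: if_True if_False interchange_a[OF t k] interchange_b[OF t k])
next
  assume "\<And>t. 1 \<le> t \<Longrightarrow> t \<le> l \<Longrightarrow> u \<noteq> a t \<and> u \<noteq> b t"
  from interchange_other[OF this k] show ?thesis by (simp only:)
qed

lemma interchange_mass:
  assumes k: "k \<le> l"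
  shows "m (\<sigma> k u) = m u"
proof (rule label_cases[of u])
  fix t assume t: "1 \<le> t" "t \<le> l" and u: "u = a t"
  show ?thesis unfolding u interchange_a[OF t k] using mw[OF t] by (simp split: if_split)
next
  fix t assume t: "1 \<le> t" "t \<le> l" and u: "u = b t"
  show ?thesis unfolding u interchange_b[OF t k] using mw[OF t] by (simp split: if_split)
next
  assume "\<And>t. 1 \<le> t \<Longrightarrow> t \<le> l \<Longrightarrow> u \<noteq> a t \<and> u \<noteq> b t"
  from interchange_other[OF this k] show ?thesis by (simp only:)
qed

lemma interchange_pair:
  assumes k: "k \<le> l" and s: "1 \<le> s" "s \<le> l"
  shows "\<sigma> k u \<in> {a s, b s} \<longleftrightarrow> u \<in> {a s, b s}"
proof -
  have *: "\<sigma> k u \<in> {a s, b s}" if "u \<in> {a s, b s}" for u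
  proof -
    from that consider "u = a s" | "u = b s" by blast
    then show ?thesis
    proof cases
      case 1
      show ?thesis unfolding 1 interchange_a[OF s k] by (cases "s < k") (simp_all only: if_True if_False insert_iff simp_thms)
    next
      case 2
      show ?thesis unfolding 2 interchange_b[OF s k] by (cases "s < k") (simp_all only: if_True if_False insert_iff simp_thms)
    qed
  qed
  show ?thesis
  proof
    assume "\<sigma> k u \<in> {a s, b s}"
    from *[OF this] show "u \<in> {a s, b s}" unfolding interchange_invol[OF k] .
  qed (rule *)
qed

lemma flip_sym: "A' u v = A' v u"
  unfolding flip_def by (rule exchange_sym, rule A_sym)

lemma flip01: "0 \<le> A' u v \<and> A' u v \<le> 1"
  unfolding flip_def exchange_def using A01[of u v] by (simp only: split: if_split) (simp only: order_refl zero_le_one simp_thms)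

lemma flip_other: "u \<noteq> a 1 \<Longrightarrow> u \<noteq> b 1 \<Longrightarrow> v \<noteq> a 1 \<Longrightarrow> v \<noteq> b 1 \<Longrightarrow> A' u v = A u v"
  unfolding flip_def by (rule exchange_away)

lemma flip_row_a:
  assumes t: "1 \<le> t" "t \<le> l"
  shows "A' (a t) k = (if k \<in> {if t = 1 then b 0 else a (t-1), a (t+1)} then 1 else 0)"
proof (cases "t = 1")
  case True
  note ne = ends_ne(1,2) ab_same[OF order_refl l1] ends(2) ends_ne(5)
  have r: "A (a 1) k = (if k \<in> {a 0, a 2} then 1 else 0)" 
  proof -
    have "(1::nat) - 1 = 0" "(1::nat) + 1 = 2" "(1::nat) \<le> 1" "1 \<le> l" using l2 by auto
    then show ?thesis using row_a[of 1 k] by (simp only:)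
  qed
  have t1: "t - 1 = 0" "t + 1 = 2" using True by auto
  have "A' (a 1) k = (if k \<in> {b 0, a 2} then 1 else 0)"
    unfolding flip_def by (rule exchange_inner[where A = A]) (rule ne r)+
  then show ?thesis unfolding True by (simp only: if_True simp_thms one_add_one)
next
  case False
  have n: "a t \<noteq> a 0" "a t \<noteq> b 0" using ends(1)[OF t] by blast+
  have "1 \<le> l" using l2 by simp
  then have "a t \<noteq> a 1" "a t \<noteq> b 1" using a_inj[OF t, of 1] ab[OF t, of 1] False by blast+
  with n have "A' (a t) k = A (a t) k" unfolding flip_def by (intro exchange_rest)
  then show ?thesis using row_a[OF t, of k] False by (simp only: if_False)
qed

lemma flip_row_b:
  assumes t: "1 \<le> t" "t \<le> l"
  shows "A' (b t) k = (if k \<in> {if t = 1 then a 0 else b (t-1), b (t+1)} then 1 else 0)"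
  using twin_segments.flip_row_a[OF swapped t, of k] unfolding flip_swap[of A a b] .

text \<open>The label \<open>a t\<close> is sent to \<open>b t\<close>, whose neighbours after the
  flip are exactly the images of \<open>a (t-1)\<close> and \<open>a (t+1)\<close>. For t = 1 the
  former is \<open>a 0\<close>, which is fixed; for t + 1 = c the latter is at the cut and
  excluded.\<close>

lemma compat_a:
  assumes c: "1 \<le> c" "c \<le> l" and v: "v \<noteq> a c" "v \<noteq> b c" and t: "1 \<le> t" "t < c"
  shows "A' (\<sigma> c (a t)) (\<sigma> c v) = A (a t) v"
proof -
  have tl: "t \<le> l" using t c by simp
  have inv: "\<sigma> c v = x \<longleftrightarrow> v = \<sigma> c x" for x using interchange_invol[OF c(2)] by metis
  have fix0: "\<sigma> c (a 0) = a 0"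
  proof (rule interchange_other[OF _ c(2)])
    fix s assume "1 \<le> s" "s \<le> l"
    note e = ends(1)[OF this]
    show "a 0 \<noteq> a s \<and> a 0 \<noteq> b s"
      by (rule conjI[OF not_sym[OF conjunct1[OF e]] not_sym[OF conjunct1[OF conjunct2[OF conjunct2[OF e]]]]])
  qed
  have prev: "\<sigma> c v = (if t = 1 then a 0 else b (t-1)) \<longleftrightarrow> v = a (t-1)"
  proof (cases "t = 1")
    case True then show ?thesis unfolding inv using fix0 by simp
  next
    case False
    then have t': "1 \<le> t - 1" "t - 1 \<le> l" "t - 1 < c" using t c by auto
    then have "\<sigma> c (b (t-1)) = a (t-1)" using interchange_b[OF t'(1,2) c(2)] by (simp only: if_True)
    then show ?thesis unfolding inv using False by simp
  qed
  have nxt: "\<sigma> c v = b (t+1) \<longleftrightarrow> v = a (t+1)"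
  proof (cases "t + 1 < c")
    case True
    then have t': "1 \<le> t + 1" "t + 1 \<le> l" using c by auto
    then have "\<sigma> c (b (t+1)) = a (t+1)" using interchange_b[OF t' c(2)] True by (simp only: if_True)
    then show ?thesis unfolding inv by simp
  next
    case False
    then have "t + 1 = c" using t by simp
    moreover have "\<sigma> c (b c) = b c" using interchange_b[of c c] c by simp
    ultimately show ?thesis unfolding inv using v by simp
  qed
  have "\<sigma> c (a t) = b t" using interchange_a[OF t(1) tl c(2)] t by simp
  then show ?thesis using flip_row_b[OF t(1) tl, of "\<sigma> c v"] row_a[OF t(1) tl, of v] prev nxt by simp
qed

lemma compat_b:
  assumes "1 \<le> c" "c \<le> l" "v \<noteq> a c" "v \<noteq> b c" "1 \<le> t" "t < c"
  shows "A' (\<sigma> c (b t)) (\<sigma> c v) = A (b t) v"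
  using twin_segments.compat_a[OF swapped assms(1,2,4,3,5,6)] interchange_swap[OF assms(2)] flip_swap[of A a b] by simp

text \<open>The flip joins \<open>a 0\<close> to \<open>b 1\<close> and \<open>b 0\<close> to
  \<open>a 1\<close>. Swapping the names of all positions below \<open>c\<close> repairs this and
  moves the defect to the edges at position \<open>c\<close>, which \<open>u\<close> and
  \<open>v\<close> avoid.\<close>

lemma compat:
  assumes c: "1 \<le> c" "c \<le> l" and v: "v \<noteq> a c" "v \<noteq> b c" and u: "u \<noteq> a c" "u \<noteq> b c"
  shows "A' (\<sigma> c u) (\<sigma> c v) = A u v"
proof -
  have inner: "A' (\<sigma> c u) (\<sigma> c v) = A u v"
    if "\<exists>t\<in>{1..<c}. u = a t \<or> u = b t" "v \<noteq> a c" "v \<noteq> b c" for u v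
  proof -
    from that(1) obtain t where t: "t \<in> {1..<c}" "u = a t \<or> u = b t" by (elim bexE)
    have t': "1 \<le> t" "t < c" using t(1) by auto
    from t(2) show ?thesis
    proof
      assume "u = a t" then show ?thesis using compat_a[OF c that(2,3) t'] by (simp only:)
    next
      assume "u = b t" then show ?thesis using compat_b[OF c that(2,3) t'] by (simp only:)
    qed
  qed
  show ?thesis
  proof (cases "\<exists>t\<in>{1..<c}. u = a t \<or> u = b t")
    case True from inner[OF this v] show ?thesis .
  next
    case fu: False
    show ?thesis
    proof (cases "\<exists>t\<in>{1..<c}. v = a t \<or> v = b t")
      case True
      from inner[OF this u] show ?thesis unfolding flip_sym[of "\<sigma> c u" "\<sigma> c v"] A_sym[of u v] .
    next
      case fv: False
      have fu': "\<not> (\<exists>t\<in>{1..<c}. u = a t)" "\<not> (\<exists>t\<in>{1..<c}. u = b t)"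
        and fv': "\<not> (\<exists>t\<in>{1..<c}. v = a t)" "\<not> (\<exists>t\<in>{1..<c}. v = b t)" using fu fv by blast+
      have su: "\<sigma> c u = u" "\<sigma> c v = v"
        unfolding interchange_def using fu' fv' by (simp_all only: if_False)
      have "u \<noteq> a 1 \<and> u \<noteq> b 1 \<and> v \<noteq> a 1 \<and> v \<noteq> b 1"
      proof (cases "c = 1")
        case True then show ?thesis using u v by (simp only: simp_thms)
      next
        case False
        then have "1 \<in> {1..<c}" using c by simp
        then show ?thesis using fu' fv' by blast
      qed
      then show ?thesis unfolding su by (intro flip_other) (elim conjE, assumption)+
    qed
  qed
qed

lemma index_unique:
  assumes "u \<in> {a s, b s}" "u \<in> {a t, b t}" and s: "1 \<le> s" "s \<le> l" and t: "1 \<le> t" "t \<le> l"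
  shows "s = t"
proof -
  from assms(1,2) consider "u = a s" "u = a t" | "u = b s" "u = b t" | "u = a s" "u = b t" | "u = b s" "u = a t" by blast
  then show ?thesis
  proof cases
    case 1 show ?thesis using a_inj[OF s t] trans[OF 1(1)[symmetric] 1(2)] by (rule iffD1)
  next
    case 2 show ?thesis using b_inj[OF s t] trans[OF 2(1)[symmetric] 2(2)] by (rule iffD1)
  next
    case 3 from ab[OF s t] trans[OF 3(1)[symmetric] 3(2)] show ?thesis by (rule notE)
  next
    case 4 from ab[OF t s] trans[OF 4(2)[symmetric] 4(1)] show ?thesis by (rule notE)
  qed
qed

text \<open>Fewer than l labels miss one of the l disjoint pairs {a g, b g}. The first missed
  position serves as the cut for that tuple, and relabelling below it turns \<open>A\<close> into
  the flipped weighting.\<close>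

lemma density_flip:
  assumes n: "card (verts H) < l"
  shows "graph_density H (stepg \<pi> A') = graph_density H (stepg \<pi> A)"
proof -
  let ?n = "card (verts H)"
  define gap where "gap \<phi> g \<longleftrightarrow> (1 \<le> g \<and> g \<le> l) \<and> (\<forall>t<?n. \<phi> t \<notin> {a g, b g})" for \<phi> :: "nat \<Rightarrow> nat" and g
  define G where "G \<phi> = (LEAST g. gap \<phi> g)" for \<phi>
  define \<tau> where "\<tau> \<phi> = (\<lambda>t\<in>{..<?n}. \<sigma> (G \<phi>) (\<phi> t))" for \<phi>
  have \<tau>t: "\<tau> \<phi> t = \<sigma> (G \<phi>) (\<phi> t)" if "t < ?n" for \<phi> t using that by (simp add: \<tau>_def)
  have ex: "\<exists>g. gap \<phi> g" for \<phi>
  proof (rule ccontr)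
    assume "\<nexists>g. gap \<phi> g"
    note none = this
    have "\<forall>g\<in>{1..l}. \<exists>t. t < ?n \<and> \<phi> t \<in> {a g, b g}"
    proof (rule ballI, rule ccontr)
      fix g assume g: "g \<in> {1..l}" and n: "\<nexists>t. t < ?n \<and> \<phi> t \<in> {a g, b g}"
      have "1 \<le> g \<and> g \<le> l" using g by simp
      moreover have "\<forall>t<?n. \<phi> t \<notin> {a g, b g}"
      proof (intro allI impI notI)
        fix t assume "t < ?n" "\<phi> t \<in> {a g, b g}"
        with n show False by (elim notE) (intro exI[of _ t] conjI)
      qed
      ultimately have "gap \<phi> g" unfolding gap_def by (rule conjI)
      with none show False by (elim notE) (rule exI)
    qed
    from bchoice[OF this] obtain c where c: "\<forall>g\<in>{1..l}. c g < ?n \<and> \<phi> (c g) \<in> {a g, b g}" ..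
    have "inj_on c {1..l}"
    proof (rule inj_onI)
      fix g g' assume h: "g \<in> {1..l}" "g' \<in> {1..l}" "c g = c g'"
      have x: "\<phi> (c g) \<in> {a g, b g}" using bspec[OF c h(1)] by (rule conjunct2)
      have y: "\<phi> (c g) \<in> {a g', b g'}" unfolding h(3) using bspec[OF c h(2)] by (rule conjunct2)
      show "g = g'" by (rule index_unique[OF x y]) (use h(1,2) in auto)
    qed
    then have "card {1..l} \<le> card {..<?n}" by (rule card_inj_on_le) (use c in auto)
    then show False using n by simp
  qed
  have Gg: "gap \<phi> (G \<phi>)" for \<phi> unfolding G_def by (rule LeastI_ex[OF ex])
  have Gl: "1 \<le> G \<phi>" "G \<phi> \<le> l" for \<phi> using Gg[of \<phi>] by (auto simp: gap_def)
  \<comment> \<open>Interchanging preserves each pair {a g, b g} as a set, so the relabelled tuple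
    has the same first gap, and relabelling twice gives back the tuple.\<close>
  have "gap (\<tau> \<phi>) g \<longleftrightarrow> gap \<phi> g" for \<phi> g
  proof (cases "1 \<le> g \<and> g \<le> l")
    case True
    then have g: "1 \<le> g" "g \<le> l" by auto
    have "(\<forall>t<?n. \<tau> \<phi> t \<notin> {a g, b g}) \<longleftrightarrow> (\<forall>t<?n. \<phi> t \<notin> {a g, b g})"
    proof (intro all_cong)
      fix t assume "t < ?n"
      show "\<tau> \<phi> t \<notin> {a g, b g} \<longleftrightarrow> \<phi> t \<notin> {a g, b g}"
        unfolding \<tau>t[OF \<open>t < ?n\<close>] interchange_pair[OF Gl(2) g] ..
    qed
    then show ?thesis unfolding gap_def by (simp only:)
  qed (simp only: gap_def simp_thms)
  then have G\<tau>: "G (\<tau> \<phi>) = G \<phi>" for \<phi> by (simp add: G_def)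
  show ?thesis
  proof (rule graph_density_label_permute[where \<tau> = \<tau> and n = ?n, OF pm A_sym A01 flip_sym flip01 refl])
    fix \<phi> assume \<phi>: "\<phi> \<in> tuples ?n"
    show tt: "\<tau> \<phi> \<in> tuples ?n" by (auto simp: \<tau>_def)
    show "\<tau> (\<tau> \<phi>) = \<phi>"
    proof (rule PiE_ext[of _ "{..<?n}" "\<lambda>_. UNIV"])
      show "\<tau> (\<tau> \<phi>) \<in> tuples ?n" by (auto simp: \<tau>_def)
      fix t assume "t \<in> {..<?n}"
      then have t: "t < ?n" by simp
      show "\<tau> (\<tau> \<phi>) t = \<phi> t" unfolding \<tau>t[OF t] G\<tau> interchange_invol[OF Gl(2)] ..
    qed (rule \<phi>)
    fix t assume t: "t < ?n"
    show "lmass \<pi> (\<tau> \<phi> t) = lmass \<pi> (\<phi> t)" unfolding \<tau>t[OF t] by (rule interchange_mass[OF Gl(2)])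
    fix s assume s: "s < ?n"
    have ne: "\<phi> t \<noteq> a (G \<phi>)" "\<phi> t \<noteq> b (G \<phi>)" if "t < ?n" for t
      using Gg[of \<phi>] that unfolding gap_def by blast+
    show "A' (\<tau> \<phi> s) (\<tau> \<phi> t) = A (\<phi> s) (\<phi> t)"
      unfolding \<tau>t[OF s] \<tau>t[OF t] by (rule compat[OF Gl ne[OF t] ne[OF s]])
  qed
qed

lemma step_flip: "step_graph \<pi> A'"
  by unfold_locales (rule pm, rule flip_sym, rule flip01)

abbreviation "d' \<equiv> ldeg \<pi> A'"

text \<open>The only degrees that change are those at \<open>a 1\<close> and \<open>b 1\<close>, and
  they trade values because the weights at position 2 agree. The degrees at \<open>a 0\<close> and
  \<open>b 0\<close> stay, since the weights at position 1 agree.\<close>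

lemma d'_a1: "d' (a 1) = d (b 1)"
proof -
  have r: "A' (a 1) k = (if k \<in> {b 0, a 2} then 1 else 0)" for k
    using flip_row_a[OF order_refl l1, of k] unfolding one_add_one by (simp only: if_True simp_thms)
  have "d' (a 1) = (\<Sum>k\<in>{b 0, a 2}. m k * A' (a 1) k)"
    unfolding ldeg_def by (rule label_integral_sum) (simp_all only: r if_False finite.intros)
  also have "\<dots> = (\<Sum>k\<in>{b 0, a 2}. m k)" by (intro sum.cong refl) (simp only: r if_True mult_1_right)
  also have "\<dots> = m (b 0) + m (a 2)" using ends_ne(6) by (simp add: add.commute)
  also have "\<dots> = d (b 1)" using nbrs_b(2)[OF order_refl l1] mw[OF one_le_two l2] unfolding one_add_one by simp
  finally show ?thesis .
qed

lemma d'_b1: "d' (b 1) = d (a 1)"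
proof -
  have "flip A b a = A'" by (intro ext flip_swap)
  then show ?thesis using twin_segments.d'_a1[OF swapped] by (simp only:)
qed

lemma d'_a0: "d' (a 0) = d (a 0)"
proof -
  have "a 0 \<in> {a (1-1), a (1+1)}" by simp
  then have "A (a 0) (a 1) = 1" unfolding A_sym[of "a 0" "a 1"] row_a[OF order_refl l1] by (simp only: if_True)
  moreover have "a 0 \<notin> {b (1-1), b (1+1)}" 
    using ends(2) not_sym[OF ends_ne(7)] unfolding one_add_one diff_self_eq_0 by (simp only: insert_iff empty_iff simp_thms)
  then have "A (a 0) (b 1) = 0" unfolding A_sym[of "a 0" "b 1"] row_b[OF order_refl l1] by (simp only: if_False)
  ultimately have eq: "A' (a 0) k = A (a 0) k + (if k = b 1 then 1 else 0) - (if k = a 1 then 1 else 0)" for k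
    unfolding flip_def
    by (intro exchange_outer[OF ends_ne(1) ab_same[OF order_refl l1] ends(2) ends_ne(3)])
  have i: "integrable unit_space (\<lambda>z. A (a 0) (\<pi> z))" by (rule label_integrable[of "A (a 0)" 1]) (use A01 in auto)
  have j: "integrable unit_space (\<lambda>z. if \<pi> z = x then 1 else 0 :: real)" for x
    by (rule label_integrable[of "\<lambda>k. if k = x then 1 else 0" 1]) simp
  have s: "(\<integral>z. (if \<pi> z = x then 1 else 0) \<partial>unit_space) = m x" for x
    using label_integral_sum[of "{x}" "\<lambda>k. if k = x then 1 else 0"] by simp
  have "d' (a 0) = d (a 0) + m (b 1) - m (a 1)"
    unfolding ldeg_def eq Bochner_Integration.integral_diff[OF Bochner_Integration.integrable_add[OF i j] j]
      Bochner_Integration.integral_add[OF i j] s ..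
  then show ?thesis using mw[OF order_refl l1] by simp
qed

lemma d'_other: "u \<noteq> a 1 \<Longrightarrow> u \<noteq> b 1 \<Longrightarrow> d' u = d u"
proof -
  assume u: "u \<noteq> a 1" "u \<noteq> b 1"
  have "flip A b a = A'" by (intro ext flip_swap)
  then have b0: "d' (b 0) = d (b 0)" using twin_segments.d'_a0[OF swapped] by (simp only:)
  consider "u = a 0" | "u = b 0" | "u \<noteq> a 0" "u \<noteq> b 0" by blast
  then show ?thesis
  proof cases
    case 1 then show ?thesis using d'_a0 by (simp only:)
  next
    case 2 then show ?thesis using b0 by (simp only:)
  next
    case 3
    then have "A' u k = A u k" for k unfolding flip_def using u by (intro exchange_rest)
    then show ?thesis by (simp only: ldeg_def)
  qed
qed

end

section \<open>Detecting the crossing over\<close>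

locale flip_segments = twin_segments +
  assumes dinj: "1 \<le> s \<Longrightarrow> s \<le> l \<Longrightarrow> 1 \<le> t \<Longrightarrow> t \<le> l \<Longrightarrow> d (a s) = d (a t) \<Longrightarrow> s = t"
    and db1: "1 \<le> t \<Longrightarrow> t \<le> l \<Longrightarrow> d (b 1) \<noteq> d (a t)"
begin

text \<open>After the flip \<open>a 1\<close> has the degree of \<open>b 1\<close>, which does not
  occur on the segment \<open>a\<close>. A path through \<open>b 1\<close> would have to start there
  and then follow \<open>b\<close> to position l, where the degree differs because the last ends
  have different weights.\<close>

lemma flipped_path_avoids:
  assumes deg: "\<And>t. 1 \<le> t \<Longrightarrow> t \<le> l \<Longrightarrow> d' (r t) = d (a t)"
    and edge: "\<And>t. 1 \<le> t \<Longrightarrow> t < l \<Longrightarrow> A' (r t) (r (t+1)) \<noteq> 0"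
    and t: "1 \<le> t" "t \<le> l"
  shows "r t \<noteq> a 1" "r t \<noteq> b 1"
proof -
  show "r t \<noteq> a 1"
  proof
    assume "r t = a 1"
    then have "d (b 1) = d (a t)" using deg[OF t] d'_a1 by (simp only:)
    with db1[OF t] show False by (rule notE)
  qed
  show "r t \<noteq> b 1"
  proof
    assume rt: "r t = b 1"
    then have "d (a 1) = d (a t)" using deg[OF t] d'_b1 by (simp only:)
    from dinj[OF order_refl l1 t this] have r1: "r 1 = b 1" using rt by (simp only:)
    have "A' (b 1) (r 2) \<noteq> 0" using edge[OF order_refl] l2 r1 unfolding one_add_one by simp
    then have r2': "r 2 \<in> {a 0, b 2}"
      using flip_row_b[OF order_refl l1, of "r 2"] unfolding one_add_one by (cases "r 2 \<in> {a 0, b 2}") (simp_all only: if_True if_False simp_thms)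
    \<comment> \<open>Both \<open>a 0\<close> and \<open>a 2\<close> are neighbours of
      \<open>a 1\<close>, so their degrees form a coded pair and are different.\<close>
    have "r 2 \<noteq> a 0"
    proof
      assume "r 2 = a 0"
      then have "d' (a 0) = d (a 2)" using deg[OF one_le_two l2] by (simp only:)
      then have e: "d (a 0) = d (a 2)" using d'_a0 by (simp only:)
      have "is_code (U (a 0) (a 2)) (d (a 0)) (d (a 2))"
        using nbrs_a(4)[OF order_refl l1] unfolding one_add_one diff_self_eq_0 .
      moreover have "0 < d (a 0)" "0 < d (a 2)" using a_V[of 0] a_V[of 2] l2 by (auto simp: V_def)
      ultimately show False using is_code_ratio[of "U (a 0) (a 2)" "d (a 0)" "d (a 2)"] e by simp
    qed
    with r2' have r2: "r 2 = b 2" by blast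
    have all: "r s = b s \<and> r (s+1) = b (s+1)" if "1 \<le> s" "s < l" for s
      using that
    proof (induction s rule: nat_induct_at_least)
      case base
      show ?case using r1 r2 unfolding one_add_one by (rule conjI)
    next
      case (Suc s)
      then have ih: "r s = b s" "r (s+1) = b (s+1)" and s: "1 \<le> s" "s + 1 < l" "1 \<le> s + 1" "s + 1 \<le> l" "s + 1 + 1 \<le> l" "s \<le> l" "1 \<le> s + 1 + 1"
        by auto
      have "A' (b (s+1)) (r (s+1+1)) \<noteq> 0" using edge[OF s(3,2)] unfolding ih(2) .
      moreover have "s + 1 \<noteq> 1" "s + 1 - 1 = s" using s by auto
      ultimately have "r (s+1+1) \<in> {b s, b (s+1+1)}"
        using flip_row_b[OF s(3,4), of "r (s+1+1)"] by (cases "r (s+1+1) \<in> {b s, b (s+1+1)}") (simp_all only: if_True if_False simp_thms)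
      moreover have "r (s+1+1) \<noteq> b s"
      proof
        assume "r (s+1+1) = b s"
        then have "d (a (s+1+1)) = d (a s)" using deg[OF s(7,5)] deg[OF s(1,6)] ih(1) by (simp only:)
        from dinj[OF s(7,5) s(1,6) this] show False by simp
      qed
      ultimately have "r (s+1+1) = b (s+1+1)" by blast
      with ih(2) show ?case unfolding Suc_eq_plus1 by (rule conjI)
    qed
    have ls: "1 \<le> l - 1" "l - 1 < l" "l - 1 + 1 = l" using l2 by auto
    have "r l = b l" using conjunct2[OF all[OF ls(1,2)]] unfolding ls(3) .
    then have e: "d' (b l) = d (a l)" using deg[OF l1 order_refl] by (simp only:)
    have bl1: "b l \<noteq> b 1" using b_inj[OF l1 order_refl order_refl l1] l2 by simp
    have bl2: "b l \<noteq> a 1" using not_sym[OF ab[OF order_refl l1 l1 order_refl]] .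
    have "d (b l) = d (a l)" using e unfolding d'_other[OF bl2 bl1] .
    then show False using nbrs_a(2)[OF l1 order_refl] nbrs_b(2)[OF l1 order_refl] mw[OF ls(1)] m1 by simp
  qed
qed

text \<open>Count paths on l vertices whose degrees are exactly those of \<open>a 1\<close>, ...,
  \<open>a l\<close>. Such a path of the flipped weighting avoids the altered labels, so it is also
  a path of the original one. The segment \<open>a\<close> itself is lost, which makes the count
  strictly smaller.\<close>

theorem flip_not_weakly_isomorphic: "\<not> weakly_isomorphic (stepg \<pi> A') (stepg \<pi> A)"
proof
  assume iso: "weakly_isomorphic (stepg \<pi> A') (stepg \<pi> A)"
  interpret s': step_graph \<pi> A' by (rule step_flip)
  \<comment> \<open>Points are numbered from 0 but inner positions from 1, hence the shift. The
    factors of \<open>f\<close> below lie in [0, 1], so \<open>f\<close> equals 1 exactly when all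
    degrees match.\<close>
  define \<delta> where "\<delta> t = d (a (t+1))" for t
  define E where "E = {(t, t+1) |t. t + 1 < l}"
  define f where "f V x = (\<Prod>t\<in>{..<l}. 1 - (deg V (x t) - \<delta> t)\<^sup>2)" for V and x :: "nat \<Rightarrow> real"
  have E: "E \<subseteq> vpairs l" by (auto simp: E_def vpairs_def)
  have finE: "finite E" by (rule finite_subset[OF E finite_vpairs])
  have sp: "star_poly l f" unfolding f_def[abs_def]
    by (rule star_poly_prod) (auto intro!: star_poly_intros)
  have \<delta>01: "0 \<le> \<delta> t \<and> \<delta> t \<le> 1" if "t < l" for t
  proof -
    have "m (a (t+1)) > 0" using V2_pos[OF a_V2] that by simp
    from AE_label_point[OF _ this, of "\<lambda>_. True"] obtain z where z: "z \<in> {0..<1}" "\<pi> z = a (t+1)" by auto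
    show ?thesis using deg_bounds[OF graphon_step z(1)] z(2) by (simp add: deg_stepg \<delta>_def)
  qed
  have fac: "0 \<le> 1 - (deg V (x t) - \<delta> t)\<^sup>2 \<and> 1 - (deg V (x t) - \<delta> t)\<^sup>2 \<le> 1"
    if "graphon V" "x \<in> space (points l)" "t < l" for V x t
  proof -
    have "\<bar>deg V (x t) - \<delta> t\<bar> \<le> 1"
      using deg_bounds[OF that(1), of "x t"] space_pointsD[OF that(2,3)] \<delta>01[OF that(3)] by (simp add: abs_le_iff)
    then have "(deg V (x t) - \<delta> t)\<^sup>2 \<le> 1" by (simp add: abs_square_le_1)
    then show ?thesis by simp
  qed
  have f01: "0 \<le> f V x \<and> f V x \<le> 1" if "graphon V" "x \<in> space (points l)" for V x
    unfolding f_def using fac[OF that] by (intro conjI prod_nonneg prod_le_1) auto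
  have f1: "f V x = 1 \<longleftrightarrow> (\<forall>t<l. deg V (x t) = \<delta> t)" if V: "graphon V" "x \<in> space (points l)" for V x
  proof
    assume e: "f V x = 1"
    show "\<forall>t<l. deg V (x t) = \<delta> t"
    proof (intro allI impI)
      fix t assume t: "t < l"
      have "f V x = (1 - (deg V (x t) - \<delta> t)\<^sup>2) * (\<Prod>s\<in>{..<l} - {t}. 1 - (deg V (x s) - \<delta> s)\<^sup>2)"
        unfolding f_def using t by (intro prod.remove) auto
      also have "\<dots> \<le> (1 - (deg V (x t) - \<delta> t)\<^sup>2) * 1"
        using fac[OF V] t by (intro mult_left_mono prod_le_1) auto
      finally have "(deg V (x t) - \<delta> t)\<^sup>2 \<le> 0" using e by simp
      then show "deg V (x t) = \<delta> t" by simp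
    qed
  qed (simp add: f_def)
  define F where "F B \<phi> = (\<Prod>(u, v)\<in>E. B (\<phi> u) (\<phi> v)) * (if \<forall>t<l. ldeg \<pi> B (\<phi> t) = \<delta> t then 1 else 0 :: real)"
    for B and \<phi> :: "nat \<Rightarrow> nat"
  have lm: "label_map \<pi> l x t = \<pi> (x t)" if "t < l" for x t using that by (simp add: label_map_def)
  have Fi: "(\<Prod>(u, v)\<in>E. stepg \<pi> B (x u) (x v)) * (if f (stepg \<pi> B) x = 1 then 1 else 0) = F B (label_map \<pi> l x)"
    if "graphon (stepg \<pi> B)" "x \<in> space (points l)" for B x
  proof -
    have "(\<Prod>(u, v)\<in>E. stepg \<pi> B (x u) (x v)) = (\<Prod>(u, v)\<in>E. B (label_map \<pi> l x u) (label_map \<pi> l x v))"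
      by (intro prod.cong refl) (auto simp: E_def stepg_def lm)
    moreover have "f (stepg \<pi> B) x = 1 \<longleftrightarrow> (\<forall>t<l. ldeg \<pi> B (label_map \<pi> l x t) = \<delta> t)"
      unfolding f1[OF that] by (simp add: deg_stepg lm)
    ultimately show ?thesis by (simp only: F_def)
  qed
  have Ii: "(\<integral>x. (\<Prod>(u, v)\<in>E. stepg \<pi> B (x u) (x v)) * (if f (stepg \<pi> B) x = 1 then 1 else 0) \<partial>points l) =
      (\<integral>x. F B (label_map \<pi> l x) \<partial>points l)" if "graphon (stepg \<pi> B)" for B
    by (intro Bochner_Integration.integral_cong refl Fi[OF that])
  have eqI: "(\<integral>x. F A' (label_map \<pi> l x) \<partial>points l) = (\<integral>x. F A (label_map \<pi> l x) \<partial>points l)"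
    using weakly_isomorphic_level_set[OF s'.graphon_step graphon_step iso sp E f01]
    unfolding Ii[OF s'.graphon_step] Ii[OF graphon_step] .
  have Fm: "(\<lambda>x. F B (label_map \<pi> l x)) \<in> borel_measurable (points l)" for B
    by (rule measurable_compose[OF label_map_measurable[OF pm]]) simp
  have F01: "0 \<le> F B \<phi> \<and> F B \<phi> \<le> 1" if "\<And>i j. 0 \<le> B i j \<and> B i j \<le> 1" for B \<phi>
  proof -
    have "0 \<le> (\<Prod>(u, v)\<in>E. B (\<phi> u) (\<phi> v))" "(\<Prod>(u, v)\<in>E. B (\<phi> u) (\<phi> v)) \<le> 1"
      using that by (auto intro!: prod_nonneg prod_le_1 simp: case_prod_unfold)
    then show ?thesis by (simp add: F_def)
  qed
  have Fint: "integrable (points l) (\<lambda>x. F B (label_map \<pi> l x))" if "\<And>i j. 0 \<le> B i j \<and> B i j \<le> 1" for B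
    by (rule integrable_points[of _ _ 1, OF Fm]) (use F01[OF that] in auto)
  \<comment> \<open>The comparison holds tuple by tuple, so equal integrals would force equality at
    every tuple of positive mass.\<close>
  have le: "F A' \<phi> \<le> F A \<phi>" for \<phi>
  proof (cases "F A' \<phi> = 0")
    case True then show ?thesis using F01[OF A01] by simp
  next
    case False
    then have dg: "\<forall>t<l. ldeg \<pi> A' (\<phi> t) = \<delta> t" and pr: "(\<Prod>(u, v)\<in>E. A' (\<phi> u) (\<phi> v)) \<noteq> 0"
      unfolding F_def by (auto split: if_splits)
    define r where "r t = \<phi> (t - 1)" for t
    have r1: "d' (r t) = d (a t)" if "1 \<le> t" "t \<le> l" for t
    proof -
      have "t - 1 < l" "t - 1 + 1 = t" using that by auto
      then show ?thesis using dg unfolding r_def \<delta>_def by metis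
    qed
    have nz: "A' (\<phi> t) (\<phi> (t+1)) \<noteq> 0" if "t + 1 < l" for t
    proof -
      have "(t, t+1) \<in> E" using that by (auto simp: E_def)
      then show ?thesis using pr finE by (auto simp: prod_zero_iff case_prod_unfold)
    qed
    have r2: "A' (r t) (r (t+1)) \<noteq> 0" if "1 \<le> t" "t < l" for t
      using nz[of "t - 1"] that by (simp add: r_def)
    have av: "\<phi> t \<noteq> a 1" "\<phi> t \<noteq> b 1" if "t < l" for t
    proof -
      have "1 \<le> t + 1" "t + 1 \<le> l" using that by auto
      from flipped_path_avoids[of r, OF r1 r2 this] show "\<phi> t \<noteq> a 1" "\<phi> t \<noteq> b 1" unfolding r_def by simp_all
    qed
    have "(\<Prod>(u, v)\<in>E. A' (\<phi> u) (\<phi> v)) = (\<Prod>(u, v)\<in>E. A (\<phi> u) (\<phi> v))"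
    proof (intro prod.cong refl)
      fix e assume "e \<in> E"
      then obtain t where e: "e = (t, t+1)" "t + 1 < l" by (auto simp: E_def)
      then have tl: "t < l" by simp
      show "(case e of (u, v) \<Rightarrow> A' (\<phi> u) (\<phi> v)) = (case e of (u, v) \<Rightarrow> A (\<phi> u) (\<phi> v))"
        unfolding e(1) prod.case by (rule flip_other[OF av[OF tl] av[OF e(2)]])
    qed
    moreover have "\<forall>t<l. ldeg \<pi> A (\<phi> t) = \<delta> t"
      using dg d'_other[OF av] by metis
    ultimately have "F A \<phi> = F A' \<phi>" unfolding F_def using dg by simp
    then show ?thesis by simp
  qed
  have "(\<integral>x. F A (label_map \<pi> l x) - F A' (label_map \<pi> l x) \<partial>points l) = 0"
    using eqI Bochner_Integration.integral_diff[OF Fint[OF A01] Fint[OF flip01]] by simp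
  moreover have "integrable (points l) (\<lambda>x. F A (label_map \<pi> l x) - F A' (label_map \<pi> l x))"
    by (rule Bochner_Integration.integrable_diff[OF Fint[OF A01] Fint[OF flip01]])
  ultimately have "AE x in points l. F A (label_map \<pi> l x) - F A' (label_map \<pi> l x) = 0"
    using integral_nonneg_eq_0_iff_AE[of "points l" "\<lambda>x. F A (label_map \<pi> l x) - F A' (label_map \<pi> l x)"] le by simp
  note AE = this
  have pos: "lmass \<pi> (a (t+1)) > 0" if "t < l" for t using V2_pos[OF a_V2] that by simp
  obtain x where x: "\<forall>t<l. \<pi> (x t) = a (t+1)" "F A (label_map \<pi> l x) - F A' (label_map \<pi> l x) = 0"
    using AE_points_labels[OF pm AE, of "\<lambda>t. a (t+1)", OF pos] by blast
  have la: "label_map \<pi> l x t = a (t+1)" if "t < l" for t using x(1) lm that by simp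
  have "F A (label_map \<pi> l x) = 1"
  proof -
    have "(\<Prod>(u, v)\<in>E. A (label_map \<pi> l x u) (label_map \<pi> l x v)) = (\<Prod>(u, v)\<in>E. 1)"
    proof (intro prod.cong refl)
      fix e assume "e \<in> E"
      then obtain t where e: "e = (t, t+1)" "t + 1 < l" by (auto simp: E_def)
      then have tl: "t < l" "1 \<le> t + 1" "t + 1 \<le> l" by auto
      have "a (t+1+1) \<in> {a (t+1-1), a (t+1+1)}" by simp
      then have "A (a (t+1)) (a (t+1+1)) = 1" unfolding row_a[OF tl(2,3)] by (simp only: if_True)
      then show "(case e of (u, v) \<Rightarrow> A (label_map \<pi> l x u) (label_map \<pi> l x v)) = (case e of (u, v) \<Rightarrow> 1)"
        unfolding e(1) prod.case la[OF tl(1)] la[OF e(2)] .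
    qed
    moreover have "\<forall>t<l. ldeg \<pi> A (label_map \<pi> l x t) = \<delta> t" using la by (simp add: \<delta>_def)
    ultimately show ?thesis unfolding F_def by simp
  qed
  \<comment> \<open>Already the first vertex has the wrong degree after the flip.\<close>
  moreover have "F A' (label_map \<pi> l x) = 0"
  proof -
    have l0: "0 < l" using l2 by simp
    have "ldeg \<pi> A' (label_map \<pi> l x 0) = d (b 1)" unfolding la[OF l0] using d'_a1 by simp
    moreover have "d (b 1) \<noteq> \<delta> 0" using db1[OF order_refl l1] by (simp add: \<delta>_def)
    ultimately have "\<not> (\<forall>t<l. ldeg \<pi> A' (label_map \<pi> l x t) = \<delta> t)" using l0 by metis
    then show ?thesis unfolding F_def by (simp only: if_False mult_zero_right)
  qed
  ultimately show False using x(2) by simp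
qed

end

section \<open>Separation of weights and degrees on a stretch\<close>

lemma Ow_pos: "0 < w \<Longrightarrow> 0 < Ow w i" and Ew_pos: "0 < w \<Longrightarrow> 0 < Ew w i"
  by (simp_all add: Ow_def Ew_def)

lemma Ow_Suc: "Ow w (Suc i) = 5 * Ow w i" and Ew_Suc: "Ew w i = 2 * Ew w (Suc i)"
  by (simp_all add: Ow_def Ew_def)

lemma Ow_less: "0 < w \<Longrightarrow> i < j \<Longrightarrow> 5 * Ow w i \<le> Ow w j"
proof (induction j)
  case (Suc j)
  then consider "i < j" | "i = j" by linarith
  then show ?case using Suc Ow_pos[of w j] by cases (simp_all add: Ow_Suc)
qed simp

lemma Ew_less: "0 < w \<Longrightarrow> i < j \<Longrightarrow> 2 * Ew w j \<le> Ew w i"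
proof (induction j)
  case (Suc j)
  then consider "i < j" | "i = j" by linarith
  then show ?case using Suc Ew_pos[of w "Suc j"] Ew_Suc[of w j] by cases simp_all
qed simp

text \<open>The two progressions are closest at index n, where w * 10^(n+5) = 1 gives 500 * Ow w n =
  Ew w n exactly.\<close>

lemma Ow_Ew:
  assumes w: "w * 10 ^ (n + 5) = 1" and ij: "i \<le> n" "j \<le> n"
  shows "500 * Ow w i \<le> Ew w j"
proof -
  have w0: "0 < w" using w by (metis less_eq_real_def mult_le_0_iff not_le zero_less_numeral zero_less_one zero_less_power)
  have "Ow w i \<le> Ow w n" using Ow_less[OF w0, of i n] Ow_pos[OF w0, of i] ij by (cases "i = n") auto
  moreover have "Ew w n \<le> Ew w j" using Ew_less[OF w0, of j n] Ew_pos[OF w0, of n] ij by (cases "j = n") auto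
  moreover have "500 * Ow w n = Ew w n"
  proof -
    have p: "(10::real) ^ n = 5 ^ n * 2 ^ n" by (simp flip: power_mult_distrib)
    have "500 * Ow w n * (8 * 2 ^ n) = w * (w * 10 ^ (n + 5))"
      unfolding power_add p Ow_def by (simp add: power2_eq_square)
    then have "500 * Ow w n * (8 * 2 ^ n) = w" using w by simp
    then show ?thesis by (simp add: Ew_def field_simps)
  qed
  ultimately show ?thesis by simp
qed

context forced_step
begin

lemma wseg_nth:
  assumes "wseg n w X Y a" "1 \<le> t" "t \<le> 2*n+2"
  shows "(\<exists>i\<le>n. t = 2*i+1 \<and> m (a t) = Ow w i) \<or> (\<exists>i\<le>n. t = 2*i+2 \<and> m (a t) = Ew w i)"
proof (cases "odd t")
  case True
  then obtain i where "t = 2*i+1" by (rule oddE)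
  then show ?thesis using assms by (auto simp: wseg_def)
next
  case False
  then obtain j where j: "t = 2*j" by (auto elim: evenE)
  then have "t = 2*(j-1)+2" "j - 1 \<le> n" using assms by auto
  moreover then have "m (a (2*(j-1)+2)) = Ew w (j-1)" using assms(1) unfolding wseg_def by blast
  ultimately show ?thesis by metis
qed

text \<open>Inside, the neighbours give (2 + 1) Ew at odd positions and (1 + 5) Ow at even ones; the
  end factors \<open>X\<close> and \<open>Y\<close> replace 2 and 5 at the first and the last inner
  position.\<close>

lemma wseg_sum:
  assumes s: "wseg n w X Y a" and X: "X \<in> {2, 8}" and Y: "Y \<in> {5, 125}" and t: "1 \<le> t" "t \<le> 2*n+2"
  shows "(\<exists>i\<le>n. t = 2*i+1 \<and> m (a (t-1)) + m (a (t+1)) = (if i = 0 then X + 1 else 3) * Ew w i) \<or>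
    (\<exists>i\<le>n. t = 2*i+2 \<and> m (a (t-1)) + m (a (t+1)) = (if i = n then Y + 1 else 6) * Ow w i)"
proof -
  have O: "m (a (2*i+1)) = Ow w i" and E: "m (a (2*i+2)) = Ew w i" if "i \<le> n" for i
    using s that unfolding wseg_def by blast+
  have e: "m (a 0) = X * Ew w 0" "m (a (2*n+3)) = Y * Ow w n" using s unfolding wseg_def by blast+
  from wseg_nth[OF s t] show ?thesis
  proof
    assume "\<exists>i\<le>n. t = 2*i+1 \<and> m (a t) = Ow w i"
    then obtain i where i: "i \<le> n" "t = 2*i+1" by blast
    have t1: "m (a (t+1)) = Ew w i" using E[OF i(1)] i(2) by simp
    have "m (a (t-1)) + m (a (t+1)) = (if i = 0 then X + 1 else 3) * Ew w i"
    proof (cases i)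
      case 0 then show ?thesis using e(1) t1 i(2) by (simp add: algebra_simps)
    next
      case (Suc k)
      then have "t - 1 = 2*k+2" using i by simp
      then have "m (a (t-1)) = Ew w k" using E[of k] i Suc by simp
      then show ?thesis using t1 Suc Ew_Suc[of w k] by simp
    qed
    then show ?thesis using i by blast
  next
    assume "\<exists>i\<le>n. t = 2*i+2 \<and> m (a t) = Ew w i"
    then obtain i where i: "i \<le> n" "t = 2*i+2" by blast
    have "t - 1 = 2*i+1" using i by simp
    then have t1: "m (a (t-1)) = Ow w i" using O[OF i(1)] by simp
    have "m (a (t-1)) + m (a (t+1)) = (if i = n then Y + 1 else 6) * Ow w i"
    proof (cases "i = n")
      case True
      then have "t + 1 = 2*n+3" using i by simp
      then have "m (a (t+1)) = Y * Ow w n" using e(2) by (simp only:)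
      then show ?thesis using t1 True by (simp add: algebra_simps)
    next
      case False
      then have "t + 1 = 2*(Suc i)+1" "Suc i \<le> n" using i by auto
      then have "m (a (t+1)) = Ow w (Suc i)" using O[of "Suc i"] by simp
      then show ?thesis using t1 False by (simp add: Ow_Suc)
    qed
    then show ?thesis using i by blast
  qed
qed

text \<open>Everything follows from size: consecutive \<open>Ow\<close> differ by a factor 5,
  consecutive \<open>Ew\<close> by 2, and the two families by at least 500.\<close>

lemma wseg_flip_segments:
  assumes null: "\<And>i j. m i = 0 \<Longrightarrow> A i j = 0" and w: "w * 10 ^ (n + 5) = 1"
    and X: "{X, X'} = {2, 8}" and Y: "{Y, Y'} = {5, 125}" and a: "wseg n w X Y a" and b: "wseg n w X' Y' b"
  shows "flip_segments \<pi> A (2*n+2) a b"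
proof -
  have w0: "0 < w" using w by (metis less_eq_real_def mult_le_0_iff not_le zero_less_numeral zero_less_one zero_less_power)
  have X2: "X \<in> {2, 8}" "X' \<in> {2, 8}" "X \<noteq> X'" using X by (auto simp: doubleton_eq_iff)
  have Y2: "Y \<in> {5, 125}" "Y' \<in> {5, 125}" "Y \<noteq> Y'" using Y by (auto simp: doubleton_eq_iff)
  have Op: "0 < Ow w i" and Ep: "0 < Ew w i" for i using Ow_pos[OF w0] Ew_pos[OF w0] by auto
  have EE: "Ew w i \<le> Ew w 0" for i using Ew_less[OF w0, of 0 i] Ep[of i] by (cases "i = 0") auto
  have OO: "Ow w i \<le> Ow w n" if "i \<le> n" for i using Ow_less[OF w0, of i n] Op[of i] that by (cases "i = n") auto
  note OE = Ow_Ew[OF w]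
  have a0: "m (a 0) = X * Ew w 0" "m (b 0) = X' * Ew w 0" "m (a (2*n+3)) = Y * Ow w n" "m (b (2*n+3)) = Y' * Ow w n"
    using a b by (auto simp: wseg_def)
  have twin: "twin_segments \<pi> A (2*n+2) a b"
  proof unfold_locales
    show "m i = 0 \<Longrightarrow> A i j = 0" for i j by (rule null)
    show "seg (2*n+2) a" "seg (2*n+2) b" using a b unfolding wseg_def by blast+
    show "2 \<le> 2*n+2" by simp
    show "m (a 0) \<noteq> m (b 0)" using a0 X2 Ep[of 0] by simp
    have e3: "2*n+2+1 = 2*n+3" by simp
    show "m (a (2*n+2+1)) \<noteq> m (b (2*n+2+1))" unfolding e3 a0(3,4) using Y2(3) Op[of n] by simp
    fix t assume t: "1 \<le> t" "t \<le> 2*n+2"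
    show "m (a t) = m (b t)"
      using wseg_nth[OF a t] wseg_nth[OF b t] by (elim disjE exE conjE) (simp, presburger, presburger, simp)
    have "m (a t) \<le> Ew w 0"
      using wseg_nth[OF a t] OE[of _ 0] EE Op by (elim disjE exE conjE) (smt (verit) le0)+
    then show "m (a t) \<noteq> m (a 0) \<and> m (a t) \<noteq> m (b 0)" using a0 X2(1,2) Ep[of 0] by auto
    fix s assume s: "1 \<le> s" "s \<le> 2*n+2" and e: "m (a s) = m (a t)"
    have Oinj: "i = j" if "Ow w i = Ow w j" for i j
      using Ow_less[OF w0, of i j] Ow_less[OF w0, of j i] Op[of i] Op[of j] that by (cases i j rule: linorder_cases) auto
    have Einj: "i = j" if "Ew w i = Ew w j" for i j
      using Ew_less[OF w0, of i j] Ew_less[OF w0, of j i] Ep[of i] Ep[of j] that by (cases i j rule: linorder_cases) auto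
    have ne: "Ow w i \<noteq> Ew w j" if "i \<le> n" "j \<le> n" for i j using OE[OF that] Op[of i] by linarith
    from wseg_nth[OF a s] wseg_nth[OF a t] show "s = t"
    proof (elim disjE exE conjE)
      fix i j assume "s = 2*i+1" "m (a s) = Ow w i" "t = 2*j+1" "m (a t) = Ow w j"
      then show ?thesis using Oinj[of i j] e by simp
    next
      fix i j assume "s = 2*i+2" "m (a s) = Ew w i" "t = 2*j+2" "m (a t) = Ew w j"
      then show ?thesis using Einj[of i j] e by simp
    next
      fix i j assume "i \<le> n" "j \<le> n" "m (a s) = Ow w i" "m (a t) = Ew w j"
      then show ?thesis using ne[of i j] e by simp
    next
      fix i j assume "i \<le> n" "j \<le> n" "m (a s) = Ew w i" "m (a t) = Ow w j"
      then show ?thesis using ne[of j i] e by simp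
    qed
  qed
  interpret T: twin_segments \<pi> A "2*n+2" a b by (rule twin)
  \<comment> \<open>The factors of the degrees lie between 3 and 126, too small to close the gap of
    500 between the two families. Within a family only the first \<open>Ew\<close> and the last
    \<open>Ow\<close> have an exceptional factor, and it enlarges an already extreme term or keeps
    it extreme.\<close>
  define cE where "cE i = (if i = 0 then X + 1 else 3)" for i :: nat
  define cO where "cO i = (if i = n then Y + 1 else 6)" for i :: nat
  have da: "(\<exists>i\<le>n. t = 2*i+1 \<and> d (a t) = cE i * Ew w i) \<or> (\<exists>i\<le>n. t = 2*i+2 \<and> d (a t) = cO i * Ow w i)"
    if t: "1 \<le> t" "t \<le> 2*n+2" for t
    using wseg_sum[OF a X2(1) Y2(1) t] T.nbrs_a(2)[OF t] unfolding cE_def cO_def by simp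
  have cE: "3 \<le> cE i" "0 < i \<Longrightarrow> cE i = 3" for i using X2(1) by (auto simp: cE_def)
  have cO: "6 \<le> cO i" "cO i \<le> 126" "i < n \<Longrightarrow> cO i = 6" for i using Y2(1) by (auto simp: cO_def)
  have dE: "cE j * Ew w j < cE i * Ew w i" if "i < j" for i j
  proof -
    have "cE j * Ew w j \<le> 3/2 * Ew w i" using cE(2)[of j] Ew_less[OF w0 that] that by simp
    also have "\<dots> < 3 * Ew w i" using Ep[of i] by simp
    also have "\<dots> \<le> cE i * Ew w i" using cE(1) Ep[of i] by (intro mult_right_mono) auto
    finally show ?thesis .
  qed
  have dO: "cO i * Ow w i < cO j * Ow w j" if "i < j" "j \<le> n" for i j
  proof -
    have "cO i * Ow w i < 30 * Ow w i" using cO(3)[of i] Op[of i] that by simp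
    also have "\<dots> \<le> 6 * Ow w j" using Ow_less[OF w0 that(1)] by simp
    also have "\<dots> \<le> cO j * Ow w j" using cO(1) Op[of j] by (intro mult_right_mono) auto
    finally show ?thesis .
  qed
  have dEO: "cO i * Ow w i < 3 * Ew w j" if "i \<le> n" "j \<le> n" for i j
  proof -
    have "cO i * Ow w i \<le> 126 * Ow w i" using cO(2) Op[of i] by (intro mult_right_mono) auto
    also have "\<dots> < 3 * (500 * Ow w i)" using Op[of i] by simp
    also have "\<dots> \<le> 3 * Ew w j" using OE[OF that] by simp
    finally show ?thesis .
  qed
  have dEO': "cO i * Ow w i \<noteq> cE j * Ew w j" if "i \<le> n" "j \<le> n" for i j
  proof -
    have "3 * Ew w j \<le> cE j * Ew w j" using cE(1) Ep[of j] by (intro mult_right_mono) auto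
    then show ?thesis using dEO[OF that] by linarith
  qed
  have db: "d (b 1) = (X' + 1) * Ew w 0"
  proof -
    have "m (b (2*0+2)) = Ew w 0" using b unfolding wseg_def by blast
    then have "m (b 2) = Ew w 0" by (simp add: numeral_2_eq_2)
    then show ?thesis using T.nbrs_b(2)[of 1] a0(2) by (simp add: numeral_2_eq_2 algebra_simps)
  qed
  show ?thesis
  proof unfold_locales
    fix s t :: nat assume s: "1 \<le> s" "s \<le> 2*n+2" and t: "1 \<le> t" "t \<le> 2*n+2" and e: "d (a s) = d (a t)"
    from da[OF s] da[OF t] show "s = t"
    proof (elim disjE exE conjE)
      fix i j assume "s = 2*i+1" "d (a s) = cE i * Ew w i" "t = 2*j+1" "d (a t) = cE j * Ew w j"
      then show ?thesis using dE[of i j] dE[of j i] e by (cases i j rule: linorder_cases) auto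
    next
      fix i j assume "i \<le> n" "j \<le> n" "s = 2*i+2" "d (a s) = cO i * Ow w i" "t = 2*j+2" "d (a t) = cO j * Ow w j"
      then show ?thesis using dO[of i j] dO[of j i] e by (cases i j rule: linorder_cases) auto
    next
      fix i j assume "i \<le> n" "j \<le> n" "d (a s) = cE i * Ew w i" "d (a t) = cO j * Ow w j"
      then show ?thesis using dEO'[of j i] e by simp
    next
      fix i j assume "i \<le> n" "j \<le> n" "d (a s) = cO i * Ow w i" "d (a t) = cE j * Ew w j"
      then show ?thesis using dEO'[of i j] e by simp
    qed
  next
    fix t :: nat assume t: "1 \<le> t" "t \<le> 2*n+2"
    have b3: "3 * Ew w 0 \<le> d (b 1)" unfolding db using X2(2) Ep[of 0] by (intro mult_right_mono) auto
    from da[OF t] show "d (b 1) \<noteq> d (a t)"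
    proof (elim disjE exE conjE)
      fix i assume i: "i \<le> n" "d (a t) = cO i * Ow w i"
      then show ?thesis using dEO[OF i(1), of 0] b3 by simp
    next
      fix i assume i: "i \<le> n" "d (a t) = cE i * Ew w i"
      show ?thesis
      proof (cases "i = 0")
        case True
        then show ?thesis using i db X2(3) Ep[of 0] by (simp add: cE_def)
      next
        case False
        then have "d (a t) = 3 * Ew w i" "2 * Ew w i \<le> Ew w 0" using i cE(2)[of i] Ew_less[OF w0, of 0 i] by auto
        then show ?thesis using b3 Ep[of i] by linarith
      qed
    qed
  qed
qed

text \<open>A finite family has bounded order, so a stretch longer than the total number of its
  vertices can be crossed over without changing any of its densities.\<close>

theorem not_finitely_forcible:
  assumes null: "\<And>i j. m i = 0 \<Longrightarrow> A i j = 0"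
  shows "\<not> finitely_forcible (stepg \<pi> A)"
proof
  assume "finitely_forcible (stepg \<pi> A)"
  then obtain \<F> where fin: "finite \<F>"
    and force: "\<And>W'. graphon W' \<Longrightarrow> (\<And>F. F \<in> \<F> \<Longrightarrow> graph_density F W' = graph_density F (stepg \<pi> A)) \<Longrightarrow>
      weakly_isomorphic W' (stepg \<pi> A)"
    unfolding finitely_forcible_def by blast
  obtain n w X X' Y Y' a b where n: "(\<Sum>F\<in>\<F>. card (verts F)) \<le> n" and sg: "w * 10 ^ (n + 5) = 1" "{X, X'} = {2, 8}" "{Y, Y'} = {5, 125}"
    "wseg n w X Y a" "wseg n w X' Y' b" by (rule long_segments)
  interpret S: flip_segments \<pi> A "2*n+2" a b by (rule wseg_flip_segments[OF null sg])
  interpret S': step_graph \<pi> "flip A a b" by (rule S.step_flip)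
  have "weakly_isomorphic (stepg \<pi> (flip A a b)) (stepg \<pi> A)"
  proof (rule force[OF S'.graphon_step])
    fix F assume "F \<in> \<F>"
    then have "card (verts F) \<le> (\<Sum>F\<in>\<F>. card (verts F))" using fin by (intro member_le_sum) auto
    then have "card (verts F) < 2*n+2" using n by simp
    then show "graph_density F (stepg \<pi> (flip A a b)) = graph_density F (stepg \<pi> A)" by (rule S.density_flip)
  qed
  with S.flip_not_weakly_isomorphic show False by (rule notE)
qed

end

section \<open>A forced graphon exists\<close>

definition nx :: "nat \<Rightarrow> nat \<Rightarrow> nat" where "nx c p = (if p = 4*c+17 then 0 else p + 1)"
definition pv :: "nat \<Rightarrow> nat \<Rightarrow> nat" where "pv c p = (if p = 0 then 4*c+17 else p - 1)"

text \<open>The model cycle number c has 4c + 18 vertices and scale w = 10^-(c+6). Its even weights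
  fall from w over w/8 by halves and then double back to w/2; its odd weights rise from 25 w^2 by
  fives and then fall back to w^2. At positions 2c+8 and 2c+9 both are 20^-(c+6), which is where the
  progressions meet.\<close>

definition cE :: "nat \<Rightarrow> nat \<Rightarrow> real" where
  "cE c q = (1/10) ^ (c+6) * (if q = 0 then 1 else if q \<le> c+4 then (1/2) ^ (q+2) else (1/2) ^ (2*c+9 - q))"
definition cO :: "nat \<Rightarrow> nat \<Rightarrow> real" where
  "cO c q = (1/100) ^ (c+6) * (if q \<le> c+4 then 5 ^ (q+2) else 5 ^ (2*c+8 - q))"
definition cW :: "nat \<Rightarrow> nat \<Rightarrow> real" where
  "cW c p = (if even p then cE c (p div 2) else cO c (p div 2))"

definition cR :: "nat \<Rightarrow> nat \<Rightarrow> real" where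
  "cR c p = (if p = 0 then 1/8 else if p = 4*c+17 then 25 else if p = 2*c+8 then 4 else if p = 2*c+9 then 1/125
     else if p < 2*c+8 then (if even p then 1/2 else 5) else (if even p then 2 else 1/5))"

lemma nx_less: "p < 4*c+18 \<Longrightarrow> nx c p < 4*c+18" and pv_less: "p < 4*c+18 \<Longrightarrow> pv c p < 4*c+18"
  and nx_pv: "p < 4*c+18 \<Longrightarrow> nx c (pv c p) = p" and pv_nx: "p < 4*c+18 \<Longrightarrow> pv c (nx c p) = p"
  by (auto simp: nx_def pv_def)

lemma nx_far:
  assumes "p < 4*c+18"
  shows "nx c p \<noteq> p" "nx c (nx c p) \<noteq> p" "nx c (nx c (nx c p)) \<noteq> p" "nx c (nx c (nx c (nx c p))) \<noteq> p" "pv c p \<noteq> nx c p"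
  using assms by (auto simp: nx_def pv_def)

lemma cE_Suc:
  "q = 0 \<Longrightarrow> cE c (q+1) = 1/8 * cE c q" "1 \<le> q \<Longrightarrow> q < c+4 \<Longrightarrow> cE c (q+1) = 1/2 * cE c q"
  "q = c+4 \<Longrightarrow> cE c (q+1) = 4 * cE c q" "c+5 \<le> q \<Longrightarrow> q < 2*c+8 \<Longrightarrow> cE c (q+1) = 2 * cE c q"
  "q = 2*c+8 \<Longrightarrow> cE c 0 = 2 * cE c q"
proof -
  show "cE c (q+1) = 1/8 * cE c q" if "q = 0" using that by (simp add: cE_def power3_eq_cube)
  show "cE c (q+1) = 1/2 * cE c q" if "1 \<le> q" "q < c+4" using that by (simp add: cE_def)
  show "cE c (q+1) = 4 * cE c q" if "q = c+4"
  proof -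
    have "2*c+9 - (q+1) = c+4" using that by simp
    moreover have "((1::real)/2) ^ (c+4+2) = (1/2) ^ (c+4) * (1/4)" unfolding power_add[of _ "c+4" 2] by (simp add: power2_eq_square)
    ultimately show ?thesis using that by (simp add: cE_def ac_simps)
  qed
  show "cE c (q+1) = 2 * cE c q" if "c+5 \<le> q" "q < 2*c+8"
  proof -
    have "2*c+9 - q = Suc (2*c+9 - (q+1))" using that by simp
    then show ?thesis using that by (simp add: cE_def)
  qed
  show "cE c 0 = 2 * cE c q" if "q = 2*c+8" using that by (simp add: cE_def)
qed

lemma cO_Suc:
  "q < c+4 \<Longrightarrow> cO c (q+1) = 5 * cO c q" "q = c+4 \<Longrightarrow> cO c (q+1) = 1/125 * cO c q"
  "c+5 \<le> q \<Longrightarrow> q < 2*c+8 \<Longrightarrow> cO c (q+1) = 1/5 * cO c q" "q = 2*c+8 \<Longrightarrow> cO c 0 = 25 * cO c q"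
proof -
  show "cO c (q+1) = 5 * cO c q" if "q < c+4" using that by (simp add: cO_def)
  show "cO c (q+1) = 1/125 * cO c q" if "q = c+4"
  proof -
    have "2*c+8 - (q+1) = c+3" using that by simp
    moreover have "(5::real) ^ (c+4+2) = 5 ^ (c+3) * 125" by (simp add: power_add)
    ultimately show ?thesis using that by (simp add: cO_def)
  qed
  show "cO c (q+1) = 1/5 * cO c q" if "c+5 \<le> q" "q < 2*c+8"
  proof -
    have "2*c+8 - q = Suc (2*c+8 - (q+1))" using that by simp
    then show ?thesis using that by (simp add: cO_def)
  qed
  show "cO c 0 = 25 * cO c q" if "q = 2*c+8" using that by (simp add: cO_def)
qed

definition eR :: "nat \<Rightarrow> nat \<Rightarrow> real" where
  "eR c q = (if q = 0 then 1/8 else if q = c+4 then 4 else if q < c+4 then 1/2 else 2)"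
definition oR :: "nat \<Rightarrow> nat \<Rightarrow> real" where
  "oR c q = (if q = 2*c+8 then 25 else if q = c+4 then 1/125 else if q < c+4 then 5 else 1/5)"
definition sq :: "nat \<Rightarrow> nat \<Rightarrow> nat" where "sq c q = (if q = 2*c+8 then 0 else q + 1)"

lemma nx_even: "nx c (2*q) = 2*q+1" and nx_odd: "nx c (2*q+1) = 2 * sq c q"
proof -
  have "2*q \<noteq> 4*c+17" by presburger
  then show "nx c (2*q) = 2*q+1" unfolding nx_def by (simp only: if_False)
  have "2*q+1 = 4*c+17 \<longleftrightarrow> q = 2*c+8" by presburger
  then show "nx c (2*q+1) = 2 * sq c q" unfolding nx_def sq_def by simp
qed

lemma cR_even: "cR c (2*q) = eR c q" and cR_odd: "cR c (2*q+1) = oR c q"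
proof -
  have "2*q \<noteq> 4*c+17" "2*q \<noteq> 2*c+9" "2*q = 2*c+8 \<longleftrightarrow> q = c+4" "2*q < 2*c+8 \<longleftrightarrow> q < c+4" "2*q = 0 \<longleftrightarrow> q = 0" "even (2*q)"
    by presburger+
  then show "cR c (2*q) = eR c q" unfolding cR_def eR_def by (simp only: if_False if_True)
  have "2*q+1 = 4*c+17 \<longleftrightarrow> q = 2*c+8" "2*q+1 \<noteq> 2*c+8" "2*q+1 = 2*c+9 \<longleftrightarrow> q = c+4" "2*q+1 < 2*c+8 \<longleftrightarrow> q < c+4"
    "2*q+1 \<noteq> 0" "\<not> even (2*q+1)" by presburger+
  then show "cR c (2*q+1) = oR c q" unfolding cR_def oR_def by (simp only: if_False if_True)
qed

lemma cW_even: "cW c (2*q) = cE c q" and cW_odd: "cW c (2*q+1) = cO c q"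
  by (simp_all add: cW_def)

lemma parity_cases:
  fixes p :: nat
  obtains q where "p = 2*q" | q where "p = 2*q+1"
  by (meson evenE oddE)

lemma cW_step:
  assumes p: "p < 4*c+18"
  shows "cW c (nx c (nx c p)) = cR c p * cW c p"
proof (rule parity_cases[of p])
  fix q assume q: "p = 2*q"
  have "cE c (sq c q) = eR c q * cE c q"
  proof -
    consider "q = 0" | "1 \<le> q" "q < c+4" | "q = c+4" | "c+5 \<le> q" "q < 2*c+8" | "q = 2*c+8" using p q by linarith
    then show ?thesis
    proof cases
      case 1 show ?thesis using cE_Suc(1)[OF 1, of c] 1 by (simp add: eR_def sq_def)
    next
      case 2 show ?thesis using cE_Suc(2)[OF 2] 2 by (simp add: eR_def sq_def)
    next
      case 3 show ?thesis using cE_Suc(3)[OF 3] 3 by (simp add: eR_def sq_def)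
    next
      case 4 show ?thesis using cE_Suc(4)[OF 4] 4 by (simp add: eR_def sq_def)
    next
      case 5 show ?thesis using cE_Suc(5)[OF 5] 5 by (simp add: eR_def sq_def)
    qed
  qed
  then show ?thesis unfolding q nx_even nx_odd cW_even cR_even .
next
  fix q assume q: "p = 2*q+1"
  have "cO c (sq c q) = oR c q * cO c q"
  proof -
    consider "q < c+4" | "q = c+4" | "c+5 \<le> q" "q < 2*c+8" | "q = 2*c+8" using p q by linarith
    then show ?thesis
    proof cases
      case 1 show ?thesis using cO_Suc(1)[OF 1] 1 by (simp add: oR_def sq_def)
    next
      case 2 show ?thesis using cO_Suc(2)[OF 2] 2 by (simp add: oR_def sq_def)
    next
      case 3 show ?thesis using cO_Suc(3)[OF 3] 3 by (simp add: oR_def sq_def)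
    next
      case 4 show ?thesis using cO_Suc(4)[OF 4] 4 by (simp add: oR_def sq_def)
    qed
  qed
  then show ?thesis unfolding q nx_odd nx_even cW_odd cR_odd .
qed

lemma cR_next:
  assumes p: "p < 4*c+18"
  shows "(cR c p, cR c (nx c p)) \<in> {(1/8, 5), (5, 1/2), (1/2, 5), (4, 1/125), (1/125, 2), (2, 1/5), (1/5, 2), (25, 1/8)} \<or>
    (p = 2*c+7 \<and> (cR c p, cR c (nx c p)) = (5, 4)) \<or> (p = 4*c+16 \<and> (cR c p, cR c (nx c p)) = (2, 25))"
proof (rule parity_cases[of p])
  fix q assume q: "p = 2*q"
  consider "q = 0" | "1 \<le> q" "q < c+4" | "q = c+4" | "c+5 \<le> q" "q < 2*c+8" | "q = 2*c+8" using p q by linarith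
  then show ?thesis unfolding q nx_even cR_even cR_odd by cases (simp_all add: eR_def oR_def)
next
  fix q assume q: "p = 2*q+1"
  consider "q < c+3" | "q = c+3" | "q = c+4" | "c+5 \<le> q" "q < 2*c+8" | "q = 2*c+8" using p q by linarith
  then show ?thesis unfolding q nx_odd cR_even cR_odd by cases (simp_all add: eR_def oR_def sq_def)
qed

text \<open>This case analysis is the source of the entries of \<open>codes\<close>.\<close>

lemma cR_next2:
  assumes p: "p < 4*c+18"
  shows "(1 + 1 / cR c p, 1 + cR c (nx c (nx c p))) \<in> set codes \<or> (1 + cR c (nx c (nx c p)), 1 + 1 / cR c p) \<in> set codes"
proof (rule parity_cases[of p])
  fix q assume q: "p = 2*q"
  consider "q = 0" | "1 \<le> q" "q < c+3" | "q = c+3" | "q = c+4" | "c+5 \<le> q" "q < 2*c+8" | "q = 2*c+8" using p q by linarith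
  then show ?thesis unfolding q nx_even nx_odd cR_even by cases (simp_all add: eR_def sq_def codes_def)
next
  fix q assume q: "p = 2*q+1"
  consider "q < c+3" | "q = c+3" | "q = c+4" | "c+5 \<le> q" "q < 2*c+7" | "q = 2*c+7" | "q = 2*c+8" using p q by linarith
  then show ?thesis unfolding q nx_odd nx_even cR_odd by cases (simp_all add: oR_def sq_def codes_def)
qed

lemma cW_pos: "0 < cW c p"
  by (simp add: cW_def cE_def cO_def)

lemma cW_le: "p < 4*c+18 \<Longrightarrow> cW c p \<le> (1/10) ^ (c+6)"
proof -
  assume p: "p < 4*c+18"
  have E: "cE c q \<le> (1/10) ^ (c+6)" for q
  proof -
    have "(if q = 0 then 1 else if q \<le> c+4 then (1/2) ^ (q+2) else (1/2) ^ (2*c+9 - q)) \<le> (1::real)"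
      using power_le_one[of "1/2::real" "q+2"] power_le_one[of "1/2::real" "2*c+9 - q"] by simp
    from mult_left_mono[OF this, of "(1/10) ^ (c+6)"] show ?thesis by (simp add: cE_def)
  qed
  have "cO c q \<le> (1/10) ^ (c+6)" if "q \<le> 2*c+8" for q
  proof -
    have "(if q \<le> c+4 then 5 ^ (q+2) else 5 ^ (2*c+8 - q)) \<le> (5::real) ^ (c+6)"
    proof (cases "q \<le> c+4")
      case True
      have "(5::real) ^ (q+2) \<le> 5 ^ (c+6)" by (rule power_increasing) (use True in auto)
      then show ?thesis using True by (simp only: if_True)
    next
      case False
      have "(5::real) ^ (2*c+8 - q) \<le> 5 ^ (c+6)" by (rule power_increasing) (use False in auto)
      then show ?thesis using False by (simp only: if_False)
    qed
    then have "cO c q \<le> (1/100) ^ (c+6) * 5 ^ (c+6)" unfolding cO_def by (intro mult_left_mono) auto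
    also have "\<dots> = (1/20) ^ (c+6)" by (simp flip: power_mult_distrib)
    also have "\<dots> \<le> (1/10) ^ (c+6)" by (intro power_mono) auto
    finally show ?thesis .
  qed
  then show ?thesis using E p by (auto simp: cW_def)
qed

lemma okwin_iff:
  "okwin a b c d \<longleftrightarrow> c = 2 * a \<and> d = 25 * b \<and> b = c\<^sup>2 \<or> c = 2 * a \<and> d = b / 5 \<or> c = a / 5 \<and> d = 2 * b \<or>
    c = 5 * a \<and> d = b / 2 \<or> c = a / 2 \<and> d = 5 * b \<or> c = 25 * a \<and> d = b / 8 \<or> c = a / 8 \<and> d = 5 * b \<or>
    c = a / 25 \<and> d = b / 2 \<and> c = b\<^sup>2 \<or> c = 8 * a \<and> d = b / 25 \<or> c = a / 5 \<and> d = 8 * b \<or>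
    c = 5 * a \<and> d = 4 * b \<and> b = c \<or> c = 4 * a \<and> d = b / 125 \<or> c = a / 125 \<and> d = 2 * b \<or>
    c = a / 4 \<and> d = b / 5 \<and> b = c \<or> c = 125 * a \<and> d = b / 4 \<or> c = a / 2 \<and> d = 125 * b"
  unfolding okwin_def left_turn_def other_windows_def by (simp add: wcase_eq_0 wrel_def)

text \<open>Each window of the list has its reverse in the list, so cycles may be traversed either
  way.\<close>

lemma okwin_reverse: "okwin a b c d \<Longrightarrow> okwin d c b a"
  unfolding okwin_iff by (elim disjE conjE) simp_all

lemma cW_window:
  assumes p: "p < 4*c+18"
  shows "okwin (cW c p) (cW c (nx c p)) (cW c (nx c (nx c p))) (cW c (nx c (nx c (nx c p))))"
proof -
  define a b where "a = cW c p" and "b = cW c (nx c p)"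
  have s: "cW c (nx c (nx c p)) = cR c p * a" "cW c (nx c (nx c (nx c p))) = cR c (nx c p) * b"
    unfolding a_def b_def by (rule cW_step[OF p], rule cW_step[OF nx_less[OF p]])
  \<comment> \<open>The meeting point: the window with ratios (5, 4) demands equal middle
    weights.\<close>
  have r1: "b = cR c p * a" if "p = 2*c+7"
  proof -
    have "2*c+8 = 2*(c+4)" "2*c+9 = 2*(c+4)+1" by auto
    then have "cW c (2*c+8) = cE c (c+4)" "cW c (2*c+9) = cO c (c+4)" unfolding cW_def by simp_all
    moreover have "cE c (c+4) = cO c (c+4)"
    proof -
      have "cE c (c+4) = (1/10 * (1/2)) ^ (c+6)" unfolding power_mult_distrib by (simp add: cE_def ac_simps)
      moreover have "cO c (c+4) = (1/100 * 5) ^ (c+6)" unfolding power_mult_distrib by (simp add: cO_def ac_simps)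
      ultimately show ?thesis by simp
    qed
    moreover have "nx c p = 2*c+8" "nx c (nx c p) = 2*c+9" using that by (auto simp: nx_def)
    ultimately show ?thesis using s(1) unfolding b_def by simp
  qed
  \<comment> \<open>The left turn at scale w: its middle weights are w^2 and w.\<close>
  have r2: "b = (cR c p * a)\<^sup>2" if "p = 4*c+16"
  proof -
    have e: "4*c+17 = 2*(2*c+8)+1" by simp
    have "cW c (4*c+17) = cO c (2*c+8)" unfolding e by (rule cW_odd)
    moreover have "cO c (2*c+8) = (cE c 0)\<^sup>2" unfolding cO_def cE_def by (simp add: power_divide power_mult[symmetric] power2_eq_square flip: power_mult_distrib)
    moreover have "nx c p = 4*c+17" "nx c (nx c p) = 0" using that by (auto simp: nx_def)
    ultimately show ?thesis using s(1) unfolding b_def by (simp add: cW_def)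
  qed
  show ?thesis unfolding s unfolding a_def[symmetric] b_def[symmetric]
    using cR_next[OF p] r1 r2 unfolding okwin_iff by (elim disjE conjE insertE emptyE) simp_all
qed

text \<open>The vertices after \<open>p\<close> and two further on share the vertex in between,
  whose weight is the codegree; their degrees are the sums displayed.\<close>

lemma cW_code:
  assumes p: "p < 4*c+18"
  shows "is_code (cW c (nx c (nx c p))) (cW c p + cW c (nx c (nx c p)))
    (cW c (nx c (nx c p)) + cW c (nx c (nx c (nx c (nx c p)))))"
proof -
  define u where "u = cW c (nx c (nx c p))"
  have R0: "cR c p > 0" by (simp add: cR_def)
  have 1: "cW c p = 1 / cR c p * u" unfolding u_def cW_step[OF p] using R0 by simp
  have 2: "cW c (nx c (nx c (nx c (nx c p)))) = cR c (nx c (nx c p)) * u"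
    unfolding u_def by (rule cW_step) (intro nx_less p)
  have e: "cW c p + u = (1 + 1 / cR c p) * u" "u + cW c (nx c (nx c (nx c (nx c p)))) = (1 + cR c (nx c (nx c p))) * u"
    unfolding 1 2 by (simp_all add: algebra_simps)
  show ?thesis unfolding u_def[symmetric] e is_code_def using cR_next2[OF p] by blast
qed

section \<open>Realising the weights by intervals\<close>

lemma label_partition:
  fixes I :: "nat \<Rightarrow> real set"
  assumes I: "\<And>j. I j \<in> sets unit_space" and disj: "\<forall>i j x. x \<in> I i \<longrightarrow> x \<in> I j \<longrightarrow> i = j"
  obtains \<pi> where "\<pi> \<in> unit_space \<rightarrow>\<^sub>M count_space UNIV" "\<And>j. fiber \<pi> (Suc j) = I j"
proof -
  note dis = disj[rule_format]
  define \<pi> where "\<pi> z = (if \<exists>j. z \<in> I j then Suc (THE j. z \<in> I j) else 0)" for z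
  have ps: "\<pi> z = Suc j" if "z \<in> I j" for z j
  proof -
    have "(THE j. z \<in> I j) = j" by (rule the_equality) (rule that, rule dis[OF _ that])
    then show ?thesis using that unfolding \<pi>_def by auto
  qed
  have p0: "\<pi> z = 0" if "\<And>j. z \<notin> I j" for z using that by (simp add: \<pi>_def)
  have sub: "I j \<subseteq> {0..<1}" for j using sets.sets_into_space[OF I[of j]] by simp
  have fib: "fiber \<pi> (Suc j) = I j" for j
  proof (intro equalityI subsetI)
    fix z assume "z \<in> fiber \<pi> (Suc j)"
    then have z: "\<pi> z = Suc j" by (simp add: fiber_def)
    then obtain i where i: "z \<in> I i" using p0 by fastforce
    then show "z \<in> I j" using ps[OF i] z by simp
  next
    fix z assume z: "z \<in> I j"
    have "z \<in> {0..<1}" using sub[of j] z by blast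
    then show "z \<in> fiber \<pi> (Suc j)" using ps[OF z] by (simp add: fiber_def)
  qed
  have fib0: "fiber \<pi> 0 = space unit_space - (\<Union>j. I j)"
  proof (intro equalityI subsetI)
    fix z assume "z \<in> fiber \<pi> 0"
    then show "z \<in> space unit_space - (\<Union>j. I j)" using ps by (auto simp: fiber_def)
  next
    fix z assume "z \<in> space unit_space - (\<Union>j. I j)"
    then show "z \<in> fiber \<pi> 0" using p0[of z] by (auto simp: fiber_def)
  qed
  have sets: "fiber \<pi> i \<in> sets unit_space" for i
  proof (cases i)
    case 0
    have "(\<Union>j. I j) \<in> sets unit_space" using I by (intro sets.countable_UN) auto
    then show ?thesis unfolding 0 fib0 by (rule sets.compl_sets)
  next
    case (Suc j) then show ?thesis using fib I by simp
  qed
  have "\<pi> \<in> unit_space \<rightarrow>\<^sub>M count_space UNIV"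
  proof (rule measurableI)
    fix S :: "nat set"
    have "\<pi> -` S \<inter> space unit_space = (\<Union>i\<in>S. fiber \<pi> i)" by (auto simp: fiber_def)
    also have "\<dots> \<in> sets unit_space" using sets by (intro sets.countable_UN') auto
    finally show "\<pi> -` S \<inter> space unit_space \<in> sets unit_space" .
  qed simp
  then show ?thesis using fib by (rule that)
qed

definition enc :: "nat \<Rightarrow> nat \<Rightarrow> nat" where "enc c p = Suc (Suc (prod_encode (c, p)))"

lemma enc_eq: "enc c p = enc c' p' \<longleftrightarrow> c = c' \<and> p = p'" and enc_ne_1: "enc c p \<noteq> 1"
  by (simp_all add: enc_def prod_encode_eq)

text \<open>Cycle c is placed between 1 - 2^-(c+1) and 1 - 2^-(c+2), in slots of length 10^-(c+6),
  which bounds all its weights. The first half of the unit interval is left to the block.\<close>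

definition lo :: "nat \<Rightarrow> nat \<Rightarrow> real" where "lo c p = 1 - (1/2) ^ (c+1) + real p * (1/10) ^ (c+6)"

lemma lo_bounds:
  assumes "p < 4*c+18"
  shows "1/2 \<le> lo c p" "lo c p + cW c p \<le> lo c (Suc p)" "lo c (Suc p) \<le> 1 - (1/2) ^ (c+2)"
proof -
  have "((1::real)/2) ^ (c+1) \<le> 1/2" using power_le_one[of "1/2::real" c] by simp
  moreover have "0 \<le> real p * (1/10) ^ (c+6)" by simp
  ultimately show "1/2 \<le> lo c p" unfolding lo_def by linarith
  show "lo c p + cW c p \<le> lo c (Suc p)" using cW_le[OF assms] by (simp add: lo_def algebra_simps)
  \<comment> \<open>Replacing the number of slots by a power of 5 turns 10^-c into 2^-c, so the
    slots fit into the interval of the cycle.\<close>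
  have "real (Suc p) \<le> 18 * 5 ^ c"
  proof -
    have "4*c+18 \<le> 18 * 5 ^ c" by (induction c) auto
    then have "Suc p \<le> 18 * 5 ^ c" using assms by linarith
    then have "real (Suc p) \<le> real (18 * 5 ^ c)" by (simp only: of_nat_le_iff)
    then show ?thesis by simp
  qed
  then have "real (Suc p) * (1/10) ^ (c+6) \<le> (18 * 5 ^ c) * (1/10) ^ (c+6)" by (intro mult_right_mono) auto
  also have "\<dots> = 18 / 1000000 * (5 * (1/10)) ^ c" unfolding power_mult_distrib power_add by (simp add: power_divide)
  also have "\<dots> = 18 / 1000000 * (1/2) ^ c" by simp
  also have "\<dots> \<le> 1/4 * (1/2) ^ c" by (intro mult_right_mono) auto
  finally have "real (Suc p) * (1/10) ^ (c+6) \<le> 1/4 * (1/2) ^ c" .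
  moreover have "((1::real)/2) ^ (c+1) = 1/2 * (1/2) ^ c" "((1::real)/2) ^ (c+2) = 1/4 * (1/2) ^ c" by (simp_all add: power_add power2_eq_square)
  ultimately show "lo c (Suc p) \<le> 1 - (1/2) ^ (c+2)" unfolding lo_def by simp
qed

lemma interval_unit:
  assumes "0 \<le> x" "x \<le> y" "y \<le> 1"
  shows "{x..<y} \<in> sets unit_space" "measure unit_space {x..<y} = y - x"
proof -
  have sub: "{x..<y} \<subseteq> {0..<1}" using assms by auto
  show "{x..<y} \<in> sets unit_space" using sub by (simp add: sets_restrict_space_iff)
  show "measure unit_space {x..<y} = y - x" using sub assms by (simp add: measure_restrict_space)
qed

lemma cycle_labels:
  obtains \<pi> where "\<pi> \<in> unit_space \<rightarrow>\<^sub>M count_space UNIV" "lmass \<pi> 1 = 1/2"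
    "\<forall>c p. p < 4*c+18 \<longrightarrow> lmass \<pi> (enc c p) = cW c p"
proof -
  define J where "J c p = (if p < 4*c+18 then {lo c p..<lo c p + cW c p} else {})" for c p
  define I where "I j = (case j of 0 \<Rightarrow> {0..<1/2} | Suc n \<Rightarrow> J (fst (prod_decode n)) (snd (prod_decode n)))" for j
  have Jb: "1/2 \<le> lo c p" "lo c p + cW c p \<le> 1" "0 < cW c p" if "p < 4*c+18" for c p
  proof -
    have "0 < ((1::real)/2) ^ (c+2)" by simp
    then show "lo c p + cW c p \<le> 1" using lo_bounds[OF that] by linarith
  qed (use lo_bounds(1)[OF that] cW_pos in auto)
  have Js: "J c p \<in> sets unit_space" for c p
    using interval_unit(1)[of "lo c p" "lo c p + cW c p"] Jb[of p c] by (auto simp: J_def)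
  have Is: "I j \<in> sets unit_space" for j
    using interval_unit(1)[of 0 "1/2"] Js by (auto simp: I_def split: nat.split)
  have Jd: False if x: "x \<in> J c p" "x \<in> J c' p'" and lt: "c < c' \<or> (c = c' \<and> p < p')" for x c c' p p'
  proof -
    have p: "p < 4*c+18" "p' < 4*c'+18" using x by (auto simp: J_def split: if_splits)
    then have b: "x < lo c p + cW c p" "lo c' p' \<le> x" using x by (auto simp: J_def)
    from lt show False
    proof
      assume c: "c < c'"
      have "((1::real)/2) ^ (c'+1) \<le> (1/2) ^ (c+2)" using c by (intro power_decreasing) auto
      moreover have "1 - (1/2) ^ (c'+1) \<le> lo c' p'" by (simp add: lo_def)
      ultimately show False using b lo_bounds(2,3)[OF p(1)] by linarith
    next
      assume c: "c = c' \<and> p < p'"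
      then have "real (Suc p) * (1/10) ^ (c+6) \<le> real p' * (1/10) ^ (c+6)" by (intro mult_right_mono) auto
      then have "lo c (Suc p) \<le> lo c' p'" using c by (simp add: lo_def)
      then show False using b lo_bounds(2)[OF p(1)] by linarith
    qed
  qed
  have J0: False if "x \<in> J c p" "x < 1/2" for x c p
    using that Jb(1)[of p c] by (auto simp: J_def split: if_splits)
  have Id: "i = j" if x: "x \<in> I i" "x \<in> I j" for x i j
  proof (cases i)
    case 0
    then show ?thesis using x J0 by (cases j) (auto simp: I_def)
  next
    case (Suc n)
    show ?thesis
    proof (cases j)
      case 0
      then show ?thesis using x J0 Suc by (auto simp: I_def)
    next
      case (Suc n')
      obtain c p c' p' where d: "prod_decode n = (c, p)" "prod_decode n' = (c', p')" by fastforce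
      have xx: "x \<in> J c p" "x \<in> J c' p'" using x \<open>i = Suc n\<close> Suc d by (auto simp: I_def)
      have "c = c' \<and> p = p'"
        using Jd[OF xx] Jd[OF xx(2,1)] by (metis linorder_neqE_nat)
      then have "prod_decode n = prod_decode n'" using d by simp
      then have "n = n'" by (simp add: prod_decode_eq)
      then show ?thesis using \<open>i = Suc n\<close> Suc by simp
    qed
  qed
  obtain \<pi> where \<pi>: "\<pi> \<in> unit_space \<rightarrow>\<^sub>M count_space UNIV" "\<And>j. fiber \<pi> (Suc j) = I j"
    by (rule label_partition[of I, OF Is]) (use Id in blast)+
  show ?thesis
  proof (rule that[OF \<pi>(1)])
    have "fiber \<pi> (Suc 0) = {0..<1/2}" unfolding \<pi>(2) by (simp add: I_def)
    then show "lmass \<pi> 1 = 1/2" using interval_unit(2)[of 0 "1/2"] by (simp add: lmass_def)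
    show "\<forall>c p. p < 4*c+18 \<longrightarrow> lmass \<pi> (enc c p) = cW c p"
    proof (intro allI impI)
    fix c p :: nat assume p: "p < 4*c+18"
    have "fiber \<pi> (enc c p) = {lo c p..<lo c p + cW c p}" unfolding enc_def \<pi>(2) using p by (simp add: I_def J_def)
    then show "lmass \<pi> (enc c p) = cW c p" using interval_unit(2)[of "lo c p" "lo c p + cW c p"] Jb[OF p] by (simp add: lmass_def)
    qed
  qed
qed

section \<open>The graph formed by a set of model cycles\<close>

definition adjc :: "nat set \<Rightarrow> nat \<Rightarrow> nat \<Rightarrow> bool" where
  "adjc K i j \<longleftrightarrow> (\<exists>c p. c \<in> K \<and> p < 4*c+18 \<and> i = enc c p \<and> (j = enc c (pv c p) \<or> j = enc c (nx c p)))"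

text \<open>Cycles outside \<open>K\<close> keep their masses but become isolated, so the graphons
  for all \<open>K\<close> share one labelling and can be compared pointwise.\<close>

definition AK :: "nat set \<Rightarrow> nat \<Rightarrow> nat \<Rightarrow> real" where
  "AK K i j = (if i = 1 \<and> j = 1 then 1/2 else if adjc K i j then 1 else 0)"

definition act :: "nat set \<Rightarrow> nat \<Rightarrow> bool" where
  "act K i \<longleftrightarrow> (\<exists>c p. c \<in> K \<and> p < 4*c+18 \<and> i = enc c p)"

lemma adjc_sym: "adjc K i j \<Longrightarrow> adjc K j i"
proof -
  assume "adjc K i j"
  then obtain c p where h: "c \<in> K" "p < 4*c+18" "i = enc c p" "j = enc c (pv c p) \<or> j = enc c (nx c p)"
    unfolding adjc_def by blast
  from h(4) show ?thesis
  proof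
    assume "j = enc c (pv c p)"
    then show ?thesis unfolding adjc_def using h pv_less[OF h(2)] nx_pv[OF h(2)] by metis
  next
    assume "j = enc c (nx c p)"
    then show ?thesis unfolding adjc_def using h nx_less[OF h(2)] pv_nx[OF h(2)] by metis
  qed
qed

lemma adjc_act: "adjc K i j \<Longrightarrow> act K i"
  unfolding adjc_def act_def by blast

lemma adjc_enc: "c \<in> K \<Longrightarrow> p < 4*c+18 \<Longrightarrow> adjc K (enc c p) j \<longleftrightarrow> j \<in> {enc c (pv c p), enc c (nx c p)}"
  unfolding adjc_def enc_eq by blast

lemma act_ne_1: "act K i \<Longrightarrow> i \<noteq> 1"
proof -
  assume "act K i"
  then obtain c p where i: "i = enc c p" unfolding act_def by (elim exE conjE)
  show ?thesis unfolding i by (rule enc_ne_1)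
qed

lemma AK_sym: "AK K i j = AK K j i"
proof -
  have e: "adjc K i j = adjc K j i" by (rule iffI; rule adjc_sym)
  have "(i = 1 \<and> j = 1) = (j = 1 \<and> i = 1)" by (rule conj_commute)
  then show ?thesis unfolding AK_def e by (simp only:)
qed

lemma AK_ne_0: "AK K i j \<noteq> 0 \<Longrightarrow> (i = 1 \<and> j = 1) \<or> adjc K i j"
  unfolding AK_def by (metis (no_types))

lemma AK_adjc: "adjc K i j \<Longrightarrow> AK K i j = 1"
  unfolding AK_def using act_ne_1[OF adjc_act] by (simp only: if_True if_False simp_thms)

lemma AK_row: "c \<in> K \<Longrightarrow> p < 4*c+18 \<Longrightarrow> AK K (enc c p) j = of_bool (j \<in> {enc c (pv c p), enc c (nx c p)})"
  unfolding AK_def adjc_enc using enc_ne_1[of c p] by (simp only: simp_thms if_False of_bool_def)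

lemma AK_C: "AK K 1 j = (if j = 1 then 1/2 else 0)"
  using act_ne_1[OF adjc_act, of K 1 j] unfolding AK_def by (simp only: simp_thms) metis

locale cycles =
  fixes \<pi> :: "real \<Rightarrow> nat" and K :: "nat set"
  assumes pm0: "\<pi> \<in> unit_space \<rightarrow>\<^sub>M count_space UNIV" and mC: "lmass \<pi> 1 = 1/2"
    and mE: "p < 4*c+18 \<Longrightarrow> lmass \<pi> (enc c p) = cW c p"

sublocale cycles \<subseteq> step_graph \<pi> "AK K"
proof
  show "AK K i j = AK K j i" for i j by (rule AK_sym)
  show "0 \<le> AK K i j \<and> AK K i j \<le> 1" for i j by (simp add: AK_def)
qed (rule pm0)

lemma sum_pair: "x \<noteq> y \<Longrightarrow> sum f {x, y} = f x + (f y :: real)"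
  by simp

context cycles
begin

lemma d_act:
  assumes "c \<in> K" "p < 4*c+18"
  shows "d (enc c p) = cW c (pv c p) + cW c (nx c p)"
proof -
  have ne: "enc c (pv c p) \<noteq> enc c (nx c p)" using nx_far(5)[OF assms(2)] unfolding enc_eq by blast
  have "d (enc c p) = (\<Sum>k\<in>{enc c (pv c p), enc c (nx c p)}. m k * AK K (enc c p) k)"
    unfolding ldeg_def by (rule label_integral_sum) (simp_all only: AK_row[OF assms] of_bool_def if_False finite.intros)
  also have "\<dots> = cW c (pv c p) + cW c (nx c p)"
    unfolding sum_pair[OF ne] AK_row[OF assms] using mE pv_less[OF assms(2)] nx_less[OF assms(2)] by simp
  finally show ?thesis .
qed

lemma U_act:
  assumes "c \<in> K" "p < 4*c+18"
  shows "U (enc c p) j = cW c (pv c p) * of_bool (j \<in> {enc c (pv c (pv c p)), enc c p}) +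
    cW c (nx c p) * of_bool (j \<in> {enc c p, enc c (nx c (nx c p))})"
proof -
  have ne: "enc c (pv c p) \<noteq> enc c (nx c p)" using nx_far(5)[OF assms(2)] unfolding enc_eq by blast
  note less = pv_less[OF assms(2)] nx_less[OF assms(2)]
  have "U (enc c p) j = (\<Sum>k\<in>{enc c (pv c p), enc c (nx c p)}. m k * (AK K (enc c p) k * AK K j k))"
    unfolding lcod_def by (rule label_integral_sum) (simp_all only: AK_row[OF assms] of_bool_def if_False finite.intros mult_zero_left)
  also have "\<dots> = cW c (pv c p) * AK K j (enc c (pv c p)) + cW c (nx c p) * AK K j (enc c (nx c p))"
    unfolding sum_pair[OF ne] AK_row[OF assms] using mE less by simp
  also have "AK K j (enc c (pv c p)) = of_bool (j \<in> {enc c (pv c (pv c p)), enc c p})"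
    unfolding AK_sym[of K j] AK_row[OF assms(1) less(1)] nx_pv[OF assms(2)] ..
  also have "AK K j (enc c (nx c p)) = of_bool (j \<in> {enc c p, enc c (nx c (nx c p))})"
    unfolding AK_sym[of K j] AK_row[OF assms(1) less(2)] pv_nx[OF assms(2)] ..
  finally show ?thesis .
qed

lemma U_self: "c \<in> K \<Longrightarrow> p < 4*c+18 \<Longrightarrow> U (enc c p) (enc c p) = d (enc c p)"
  unfolding U_act d_act by (simp only: insert_iff simp_thms of_bool_eq mult_1_right)

lemma U_two:
  assumes "c \<in> K" "p < 4*c+18"
  shows "U (enc c p) (enc c (nx c (nx c p))) = cW c (nx c p)"
proof -
  have a: "nx c (nx c p) \<noteq> p" by (rule nx_far(2)[OF assms(2)])
  have b: "nx c (nx c p) \<noteq> pv c (pv c p)"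
  proof
    assume h: "nx c (nx c p) = pv c (pv c p)"
    have "nx c (nx c (nx c (nx c p))) = p"
      unfolding h nx_pv[OF pv_less[OF assms(2)]] nx_pv[OF assms(2)] ..
    with nx_far(4)[OF assms(2)] show False by (rule notE)
  qed
  show ?thesis unfolding U_act[OF assms] insert_iff empty_iff enc_eq using a b by (simp only: simp_thms of_bool_eq mult_zero_right mult_1_right add_0_left)
qed

lemma row_C_sum: "(\<integral>z. AK K 1 (\<pi> z) * f (\<pi> z) \<partial>unit_space) = 1/4 * f 1" for f :: "nat \<Rightarrow> real"
proof -
  have "(\<integral>z. AK K 1 (\<pi> z) * f (\<pi> z) \<partial>unit_space) = (\<Sum>k\<in>{1}. m k * (AK K 1 k * f k))"
    by (rule label_integral_sum) (simp_all only: AK_C singleton_iff if_False mult_zero_left finite.intros)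
  moreover have "(\<Sum>k\<in>{1}. m k * (AK K 1 k * f k)) = m 1 * (AK K 1 1 * f 1)" by simp
  moreover have a: "AK K 1 1 = 1/2" unfolding AK_C by simp
  ultimately show ?thesis unfolding a mC by simp
qed

lemma d_C: "d 1 = 1/4" using row_C_sum[of "\<lambda>_. 1"] by (simp add: ldeg_def)

lemma U_C: "U 1 j = 1/4 * AK K j 1" unfolding lcod_def by (rule row_C_sum)

lemma U_CC: "U 1 1 = 1/8" unfolding U_C AK_C by simp

lemma U_C0: "j \<noteq> 1 \<Longrightarrow> U 1 j = 0" unfolding U_C AK_sym[of K j] AK_C by (simp only: if_False mult_zero_right)

lemma isolated: "i \<noteq> 1 \<Longrightarrow> \<not> act K i \<Longrightarrow> AK K i k = 0"
  using AK_ne_0[of K i k] adjc_act[of K i k] by blast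

lemma U_isolated: "i \<noteq> 1 \<Longrightarrow> \<not> act K i \<Longrightarrow> U i j = 0"
  unfolding lcod_def isolated by simp

lemma code_two:
  assumes "c \<in> K" "p < 4*c+18"
  shows "is_code (U (enc c p) (enc c (nx c (nx c p)))) (d (enc c p)) (d (enc c (nx c (nx c p))))"
proof -
  note l = assms(2) nx_less[OF assms(2)] nx_less[OF nx_less[OF assms(2)]] pv_less[OF assms(2)]
  show ?thesis
    using cW_code[OF l(4)] unfolding U_two[OF assms] d_act[OF assms] d_act[OF assms(1) l(3)] pv_nx[OF l(2)] nx_pv[OF l(1)] .
qed

text \<open>In a cycle of length at least 18 two different vertices share a neighbour only at
  distance two, where the weights were chosen to give a code. Isolated labels and the block have no
  common neighbours with anything else.\<close>

lemma pair_zero: "core_poly (U i j) (d i) (d j) * const_poly (U i j) (d i) (d j) = 0"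
proof -
  have "U i j = 0 \<or> (U i j = d i \<and> U i j = d j) \<or> is_code (U i j) (d i) (d j) \<or> (i = 1 \<and> j = 1)"
  proof -
    consider "i = 1" | "i \<noteq> 1" "\<not> act K i" | "act K i" by blast
    then show ?thesis
    proof cases
      case 1 then show ?thesis using U_C0[of j] by (cases "j = 1") (simp_all only: simp_thms)
    next
      case 2 then show ?thesis using U_isolated[OF 2] by blast
    next
      case 3
      then obtain c p where c: "c \<in> K" "p < 4*c+18" and i: "i = enc c p" unfolding act_def by blast
      consider "j = enc c p" | "j = enc c (nx c (nx c p))" | "j = enc c (pv c (pv c p))"
        | "j \<notin> {enc c (pv c (pv c p)), enc c p}" "j \<notin> {enc c p, enc c (nx c (nx c p))}" by blast
      then show ?thesis
      proof cases
        case 1 show ?thesis unfolding i 1 U_self[OF c] by blast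
      next
        case 2 show ?thesis unfolding i 2 using code_two[OF c] by blast
      next
        case 3
        define p1 where "p1 = pv c (pv c p)"
        have l: "p1 < 4*c+18" unfolding p1_def by (intro pv_less c(2))
        have e: "nx c (nx c p1) = p" unfolding p1_def nx_pv[OF pv_less[OF c(2)]] nx_pv[OF c(2)] ..
        have "is_code (U j i) (d j) (d i)" using code_two[OF c(1) l] unfolding e i 3 p1_def[symmetric] .
        then have "is_code (U i j) (d i) (d j)" unfolding lcod_sym[of \<pi> "AK K" i j] by (rule is_code_sym)
        then show ?thesis by blast
      next
        case 4 then have "U i j = 0" unfolding i U_act[OF c] by (simp only: of_bool_eq mult_zero_right add_0_left)
        then show ?thesis by blast
      qed
    qed
  qed
  then consider "i = 1 \<and> j = 1" | "U i j = 0 \<or> (U i j = d i \<and> U i j = d j) \<or> is_code (U i j) (d i) (d j)" by blast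
  then show ?thesis
  proof cases
    case 1
    then have "const_poly (U i j) (d i) (d j) = 0" unfolding const_poly_eq_0 by (simp only: U_CC d_C simp_thms)
    then show ?thesis by (simp only: mult_zero_right)
  next
    case 2
    then have "core_poly (U i j) (d i) (d j) = 0" unfolding core_poly_eq_0 .
    then show ?thesis by (simp only: mult_zero_left)
  qed
qed

text \<open>Outside the block codegrees are below 1/8, since weights of cycle vertices are below
  1/16. Hence \<open>const_poly\<close> is nonzero there, and the vanishing product forces
  \<open>core_poly\<close> to be zero.\<close>

lemma core_label: "core_poly (U i j) (d i) (d j) = (if i = 1 \<and> j = 1 then core_val else 0)"
proof (cases "i = 1 \<and> j = 1")
  case True
  then have "i = 1" "j = 1" by blast+
  then show ?thesis unfolding core_val_def by (simp only: U_CC d_C simp_thms if_True)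
next
  case False
  have "const_poly (U i j) (d i) (d j) \<noteq> 0"
  proof
    assume "const_poly (U i j) (d i) (d j) = 0"
    then have u: "U i j = 1/8" unfolding const_poly_eq_0 by blast
    consider "i = 1" | "i \<noteq> 1" "\<not> act K i" | "act K i" by blast
    then show False
    proof cases
      case 1 then show False using U_C0[of j] False u by simp
    next
      case 2 then show False using U_isolated[OF 2] u by simp
    next
      case 3
      then obtain c p where c: "c \<in> K" "p < 4*c+18" and i: "i = enc c p" unfolding act_def by blast
      have t: "cW c q < 1/16" if "q < 4*c+18" for q
      proof -
        have "((1::real)/10) ^ (c+6) \<le> (1/10) ^ 6" by (intro power_decreasing) auto
        moreover have "((1::real)/10) ^ 6 < 1/16" by (simp add: power_divide)
        ultimately show ?thesis using cW_le[OF that] by linarith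
      qed
      have "U i j \<le> cW c (pv c p) + cW c (nx c p)"
        unfolding i U_act[OF c] using cW_pos[of c] by (intro add_mono) (simp_all add: of_bool_def less_imp_le)
      then show False using u t[OF pv_less[OF c(2)]] t[OF nx_less[OF c(2)]] by simp
    qed
  qed
  then have "core_poly (U i j) (d i) (d j) = 0" using pair_zero[of i j] by simp
  then show ?thesis using False by (simp only: if_False)
qed

end

context cycles
begin

lemma C_moment: "(\<integral>x. (if \<forall>t<n. \<pi> (x t) = 1 then 1 else 0 :: real) \<partial>points n) = (1/2) ^ n"
proof -
  let ?S = "{x\<in>space (points n). \<forall>t\<in>{..<n}. x t \<in> fiber \<pi> 1}"
  have S: "?S \<in> sets (points n)" using emeasure_label_tuple(1)[OF pm0, of n "\<lambda>_. 1"] .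
  have "measure (points n) {x\<in>space (points n). \<forall>t\<in>{..<n}. x t \<in> fiber \<pi> (\<phi> t)} = (\<Prod>t<n. lmass \<pi> (\<phi> t))" for \<phi>
    unfolding measure_def emeasure_label_tuple(2)[OF pm0]
    by (simp add: prod_ennreal lmass_def enn2real_ennreal prod_nonneg)
  from this[of "\<lambda>_. 1"] have ms: "measure (points n) ?S = (1/2) ^ n" unfolding mC by simp
  have "(\<integral>x. (if \<forall>t<n. \<pi> (x t) = 1 then 1 else 0 :: real) \<partial>points n) = (\<integral>x. indicator ?S x \<partial>points n)"
  proof (intro Bochner_Integration.integral_cong refl)
    fix x assume x: "x \<in> space (points n)"
    have "x \<in> ?S \<longleftrightarrow> (\<forall>t<n. \<pi> (x t) = 1)"
      using x space_pointsD[OF x] by (auto simp: fiber_def)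
    then show "(if \<forall>t<n. \<pi> (x t) = 1 then 1 else 0) = (indicator ?S x :: real)" by (simp only: indicator_def of_bool_def)
  qed
  also have "\<dots> = measure (points n) (?S \<inter> space (points n))" by (rule Bochner_Integration.integral_indicator)
  also have "?S \<inter> space (points n) = ?S" by blast
  finally show ?thesis using ms by simp
qed

lemma core_at_label: "core_at i j (stepg \<pi> (AK K)) x = (if \<pi> (x i) = 1 \<and> \<pi> (x j) = 1 then core_val else 0)"
  unfolding core_at_def deg_stepg cod_stepg by (rule core_label)

lemma all_2: "(\<forall>t<2. P t) \<longleftrightarrow> P 0 \<and> P (1::nat)"
  and all_3: "(\<forall>t<3. P t) \<longleftrightarrow> P 0 \<and> P (1::nat) \<and> P 2"
  and all_4: "(\<forall>t<4. P t) \<longleftrightarrow> P 0 \<and> P (1::nat) \<and> P 2 \<and> P 3"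
  by (auto simp: eval_nat_numeral less_Suc_eq)

lemma core_stats:
  "stat 2 {} (core_at 0 1) (stepg \<pi> (AK K)) = core_val / 4"
  "stat 3 {} (\<lambda>W x. core_at 0 1 W x * core_at 0 2 W x) (stepg \<pi> (AK K)) = core_val\<^sup>2 / 8"
  "stat 4 {} (\<lambda>W x. core_at 0 1 W x * core_at 0 2 W x * core_at 0 3 W x) (stepg \<pi> (AK K)) = core_val ^ 3 / 16"
  "stat 2 {(0, 1)} (core_at 0 1) (stepg \<pi> (AK K)) = core_val / 8"
proof -
  have *: "(\<integral>x. k * (if \<forall>t<n. \<pi> (x t) = 1 then 1 else 0) \<partial>points n) = k * (1/2) ^ n" for k :: real and n
    unfolding integral_mult_right_zero C_moment ..
  have "stat 2 {} (core_at 0 1) (stepg \<pi> (AK K)) = (\<integral>x. core_val * (if \<forall>t<2. \<pi> (x t) = 1 then 1 else 0) \<partial>points 2)"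
    unfolding stat_def core_at_label all_2 by (intro Bochner_Integration.integral_cong refl) auto
  then show "stat 2 {} (core_at 0 1) (stepg \<pi> (AK K)) = core_val / 4" unfolding * by (simp add: power2_eq_square)
  have "stat 3 {} (\<lambda>W x. core_at 0 1 W x * core_at 0 2 W x) (stepg \<pi> (AK K)) =
      (\<integral>x. core_val\<^sup>2 * (if \<forall>t<3. \<pi> (x t) = 1 then 1 else 0) \<partial>points 3)"
    unfolding stat_def core_at_label all_3 by (intro Bochner_Integration.integral_cong refl) (auto simp: power2_eq_square)
  then show "stat 3 {} (\<lambda>W x. core_at 0 1 W x * core_at 0 2 W x) (stepg \<pi> (AK K)) = core_val\<^sup>2 / 8"
    unfolding * by (simp add: power3_eq_cube)
  have "stat 4 {} (\<lambda>W x. core_at 0 1 W x * core_at 0 2 W x * core_at 0 3 W x) (stepg \<pi> (AK K)) =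
      (\<integral>x. core_val ^ 3 * (if \<forall>t<4. \<pi> (x t) = 1 then 1 else 0) \<partial>points 4)"
    unfolding stat_def core_at_label all_4 by (intro Bochner_Integration.integral_cong refl) (auto simp: power3_eq_cube)
  then show "stat 4 {} (\<lambda>W x. core_at 0 1 W x * core_at 0 2 W x * core_at 0 3 W x) (stepg \<pi> (AK K)) = core_val ^ 3 / 16"
    unfolding * by (simp add: power4_eq_xxxx)
  have "AK K 1 1 = 1/2" unfolding AK_C by simp
  then have l: "AK K i j * (if i = 1 \<and> j = 1 then core_val else 0) = core_val / 2 * (if i = 1 \<and> j = 1 then 1 else 0)" for i j
    by (cases "i = 1 \<and> j = 1") (auto simp only: simp_thms if_True if_False mult_1_right mult_zero_right mult.commute times_divide_eq_right)
  have "stat 2 {(0, 1)} (core_at 0 1) (stepg \<pi> (AK K)) = (\<integral>x. core_val / 2 * (if \<forall>t<2. \<pi> (x t) = 1 then 1 else 0) \<partial>points 2)"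
    unfolding stat_def core_at_label all_2
  proof (intro Bochner_Integration.integral_cong refl)
    fix x :: "nat \<Rightarrow> real"
    have "(\<Prod>(u, v)\<in>{(0::nat, 1::nat)}. stepg \<pi> (AK K) (x u) (x v)) = AK K (\<pi> (x 0)) (\<pi> (x 1))" by (simp add: stepg_def)
    then show "(\<Prod>(u, v)\<in>{(0, 1)}. stepg \<pi> (AK K) (x u) (x v)) * (if \<pi> (x 0) = 1 \<and> \<pi> (x 1) = 1 then core_val else 0) =
      core_val / 2 * (if \<pi> (x 0) = 1 \<and> \<pi> (x 1) = 1 then 1 else 0)" by (simp only: l)
  qed
  then show "stat 2 {(0, 1)} (core_at 0 1) (stepg \<pi> (AK K)) = core_val / 8" unfolding * by (simp add: power2_eq_square)
qed

text \<open>If the path meets the block at \<open>z\<close>, the block factor vanishes. Otherwise it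
  stays in one cycle: turning back makes a twin factor vanish, and going on in either direction
  gives an admissible window or the reverse of one.\<close>

lemma path_zero:
  "AK K x z * AK K z y * AK K y t * win_poly (U x y) (U z t) (d x) (d z) (d y) (d t) = 0"
proof (rule ccontr)
  assume ne: "\<not> ?thesis"
  then have a: "AK K x z \<noteq> 0" "AK K z y \<noteq> 0" "AK K y t \<noteq> 0" and w: "win_poly (U x y) (U z t) (d x) (d z) (d y) (d t) \<noteq> 0"
    unfolding mult_eq_0_iff by blast+
  have w': "\<not> (U x y = d x \<and> U x y = d y)" "\<not> (U z t = d z \<and> U z t = d t)" "\<not> (U x y = 1/8 \<and> d x = 1/4 \<and> d y = 1/4)"
    "\<not> okwin (d z - U z t) (U x y) (U z t) (d y - U x y)" using w unfolding win_poly_eq_0 by blast+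
  show False
  proof (cases "z = 1")
    case True
    have "x = 1" "y = 1" using a(1,2) AK_C[of K x] AK_C[of K y] unfolding True AK_sym[of K x] by (metis (no_types))+
    then show False using w'(3) by (simp only: U_CC d_C simp_thms)
  next
    case False
    have "adjc K z x" "adjc K z y" using AK_ne_0[OF a(1)] AK_ne_0[OF a(2)] False adjc_sym by blast+
    then obtain c p where c: "c \<in> K" "p < 4*c+18" and z: "z = enc c p" and xy: "x \<in> {enc c (pv c p), enc c (nx c p)}" "y \<in> {enc c (pv c p), enc c (nx c p)}"
      using adjc_act[of K z x] adjc_enc unfolding act_def by blast
    note l = pv_less[OF c(2)] nx_less[OF c(2)]
    have ya: "adjc K y t"
    proof -
      have "y \<noteq> 1" using act_ne_1[OF adjc_act[OF adjc_sym[OF \<open>adjc K z y\<close>]]] .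
      then show ?thesis using AK_ne_0[OF a(3)] by blast
    qed
    from xy consider "x = y" | "x = enc c (pv c p)" "y = enc c (nx c p)" | "x = enc c (nx c p)" "y = enc c (pv c p)" by blast
    then show False
    proof cases
      case 1
      have "U y y = d y" using xy(2) U_self[OF c(1) l(1)] U_self[OF c(1) l(2)] by blast
      then show False using w'(1) unfolding 1 by blast
    next
      case 2
      have "t \<in> {enc c p, enc c (nx c (nx c p))}" using ya unfolding 2(2) adjc_enc[OF c(1) l(2)] pv_nx[OF c(2)] .
      then consider "t = z" | "t = enc c (nx c (nx c p))" unfolding z by blast
      then show False
      proof cases
        case 1 then show False using w'(2) U_self[OF c] unfolding 1 z by blast
      next
        case t: 2
        have "U x y = cW c p" using U_two[OF c(1) l(1)] unfolding 2 nx_pv[OF c(2)] .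
        moreover have "U z t = cW c (nx c p)" unfolding z t by (rule U_two[OF c])
        moreover have "d z = cW c (pv c p) + cW c (nx c p)" unfolding z by (rule d_act[OF c])
        moreover have "d y = cW c p + cW c (nx c (nx c p))" using d_act[OF c(1) l(2)] unfolding 2 pv_nx[OF c(2)] .
        moreover have "okwin (cW c (pv c p)) (cW c p) (cW c (nx c p)) (cW c (nx c (nx c p)))"
          using cW_window[OF l(1)] unfolding nx_pv[OF c(2)] .
        ultimately show False using w'(4) by simp
      qed
    next
      case 2: 3
      have "t \<in> {enc c (pv c (pv c p)), enc c p}" using ya unfolding 2(2) adjc_enc[OF c(1) l(1)] nx_pv[OF c(2)] .
      then consider "t = z" | "t = enc c (pv c (pv c p))" unfolding z by blast
      then show False
      proof cases
        case 1 then show False using w'(2) U_self[OF c] unfolding 1 z by blast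
      next
        case t: 2
        note ll = pv_less[OF l(1)]
        have "U x y = cW c p" using U_two[OF c(1) l(1)] unfolding 2 nx_pv[OF c(2)] lcod_sym[of \<pi> "AK K" "enc c (nx c p)"] .
        moreover have "U z t = cW c (pv c p)"
          using U_two[OF c(1) ll] unfolding z t nx_pv[OF l(1)] nx_pv[OF c(2)] lcod_sym[of \<pi> "AK K" "enc c p"] .
        moreover have "d z = cW c (pv c p) + cW c (nx c p)" unfolding z by (rule d_act[OF c])
        moreover have "d y = cW c (pv c (pv c p)) + cW c p" using d_act[OF c(1) l(1)] unfolding 2 nx_pv[OF c(2)] .
        moreover have "okwin (cW c (nx c p)) (cW c p) (cW c (pv c p)) (cW c (pv c (pv c p)))"
          using okwin_reverse[OF cW_window[OF ll]] unfolding nx_pv[OF l(1)] nx_pv[OF c(2)] .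
        ultimately show False using w'(4) by simp
      qed
    qed
  qed
qed

definition rest :: "nat \<Rightarrow> nat \<Rightarrow> nat \<Rightarrow> nat \<Rightarrow> real" where
  "rest x z y t = AK K x z * AK K z y * AK K y t * win_rest (U x y) (U z t) (d x) (d z) (d y) (d t)"

lemma at_path_label: "(\<Prod>(u, v)\<in>path_edges. stepg \<pi> (AK K) (x u) (x v)) * at_path F (stepg \<pi> (AK K)) x =
    AK K (\<pi> (x 0)) (\<pi> (x 1)) * AK K (\<pi> (x 1)) (\<pi> (x 2)) * AK K (\<pi> (x 2)) (\<pi> (x 3)) *
    F (U (\<pi> (x 0)) (\<pi> (x 2))) (U (\<pi> (x 1)) (\<pi> (x 3))) (d (\<pi> (x 0))) (d (\<pi> (x 1))) (d (\<pi> (x 2))) (d (\<pi> (x 3)))"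
  by (simp add: at_path_def deg_stepg cod_stepg stepg_def path_edges_def mult_ac)

lemma forced_cycles:
  assumes "stat 4 path_edges (at_path win_rest) (stepg \<pi> (AK K)) \<notin> \<rat>"
  shows "forced (stepg \<pi> (AK K))"
  unfolding forced_def
proof (intro conjI graphon_step core_stats assms)
  show "stat 2 {} pair_at (stepg \<pi> (AK K)) = 0"
    unfolding stat_def pair_at_def core_at_def deg_stepg cod_stepg pair_zero by simp
  show "stat 4 path_edges (at_path win_poly) (stepg \<pi> (AK K)) = 0"
    unfolding stat_def at_path_label path_zero by simp
qed

end

section \<open>An irrational statistic by counting\<close>

text \<open>A nonzero contribution involves only labels of selected cycles, and their degrees and
  codegrees do not change when further cycles are selected.\<close>

lemma rest_mono:
  assumes 1: "cycles \<pi>" and 2: "cycles \<pi>" and sub: "K \<subseteq> L" and ne: "cycles.rest \<pi> K x z y t \<noteq> 0"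
  shows "cycles.rest \<pi> L x z y t = cycles.rest \<pi> K x z y t"
proof -
  interpret k: cycles \<pi> K by (rule 1)
  interpret L: cycles \<pi> L by (rule 2)
  have a: "AK K x z \<noteq> 0" "AK K z y \<noteq> 0" "AK K y t \<noteq> 0" and w: "win_rest (k.U x y) (k.U z t) (k.d x) (k.d z) (k.d y) (k.d t) \<noteq> 0"
    using ne unfolding k.rest_def mult_eq_0_iff by blast+
  have z1: "z \<noteq> 1"
  proof
    assume z: "z = 1"
    have "x = 1" "y = 1" using a(1,2) AK_C[of K x] AK_C[of K y] unfolding z AK_sym[of K x] by (metis (no_types))+
    then show False using w unfolding win_rest_eq_0 by (simp only: k.U_CC k.d_C simp_thms)
  qed
  have xz: "adjc K x z" and zy: "adjc K z y" using AK_ne_0[OF a(1)] AK_ne_0[OF a(2)] z1 by blast+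
  have "y \<noteq> 1" using act_ne_1[OF adjc_act[OF adjc_sym[OF zy]]] .
  then have yt: "adjc K y t" using AK_ne_0[OF a(3)] by blast
  have mono: "adjc L i j" if "adjc K i j" for i j using that sub unfolding adjc_def by blast
  have act: "act K x" "act K z" "act K y" "act K t"
    using adjc_act[OF xz] adjc_act[OF zy] adjc_act[OF yt] adjc_act[OF adjc_sym[OF yt]] .
  have de: "L.d i = k.d i" and Ue: "L.U i j = k.U i j" if "act K i" for i j
  proof -
    from that obtain c p where c: "c \<in> K" "p < 4*c+18" and i: "i = enc c p" unfolding act_def by blast
    have cL: "c \<in> L" using c sub by blast
    show "L.d i = k.d i" unfolding i k.d_act[OF c] L.d_act[OF cL c(2)] ..
    show "L.U i j = k.U i j" unfolding i k.U_act[OF c] L.U_act[OF cL c(2)] ..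
  qed
  show ?thesis unfolding k.rest_def L.rest_def de[OF act(1)] de[OF act(2)] de[OF act(3)] de[OF act(4)] Ue[OF act(1)] Ue[OF act(2)]
      AK_adjc[OF xz] AK_adjc[OF zy] AK_adjc[OF yt] AK_adjc[OF mono[OF xz]] AK_adjc[OF mono[OF zy]] AK_adjc[OF mono[OF yt]] ..
qed

lemma (in cycles) rest_left_turn:
  assumes c: "c \<in> K"
  shows "rest (enc c (4*c+16)) (enc c (4*c+17)) (enc c 0) (enc c 1) \<noteq> 0"
proof -
  let ?x = "enc c (4*c+16)" and ?z = "enc c (4*c+17)" and ?y = "enc c 0" and ?t = "enc c 1"
  have n: "nx c (4*c+16) = 4*c+17" "nx c (4*c+17) = 0" "nx c 0 = 1" "pv c 0 = 4*c+17" "pv c (4*c+17) = 4*c+16"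
    by (auto simp: nx_def pv_def)
  have l: "4*c+16 < 4*c+18" "4*c+17 < 4*c+18" "0 < 4*c+18" by auto
  have adj: "adjc K ?x ?z" "adjc K ?z ?y" "adjc K ?y ?t"
    unfolding adjc_enc[OF c l(1)] adjc_enc[OF c l(2)] adjc_enc[OF c l(3)] n by blast+
  define a b e f where "a = cW c (4*c+16)" and "b = cW c (4*c+17)" and "e = cW c 0" and "f = cW c 1"
  have U1: "U ?x ?y = b" using U_two[OF c l(1)] unfolding n b_def .
  have U2: "U ?z ?t = e" using U_two[OF c l(2)] unfolding n e_def .
  have d1: "d ?z = a + e" using d_act[OF c l(2)] unfolding n a_def e_def .
  have d2: "d ?y = b + f" using d_act[OF c l(3)] unfolding n b_def f_def .
  have pos: "0 < a" "0 < b" "0 < e" "0 < f" unfolding a_def b_def e_def f_def by (rule cW_pos)+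
  have R: "cR c (4*c+16) = 2" "cR c (4*c+17) = 25"
  proof -
    have e: "4*c+16 = 2*(2*c+8)" "4*c+17 = 2*(2*c+8)+1" by auto
    show "cR c (4*c+16) = 2" unfolding e(1) cR_even by (simp add: eR_def)
    show "cR c (4*c+17) = 25" unfolding e(2) cR_odd by (simp add: oR_def)
  qed
  have s: "e = 2 * a" "f = 25 * b" using cW_step[OF l(1)] cW_step[OF l(2)] unfolding n R a_def b_def e_def f_def .
  have b8: "b \<noteq> 1/8"
  proof -
    have "((1::real)/10) ^ (c+6) \<le> (1/10) ^ 6" by (intro power_decreasing) auto
    moreover have "((1::real)/10) ^ 6 < 1/16" by (simp add: power_divide)
    ultimately show ?thesis using cW_le[OF l(2)] unfolding b_def by linarith
  qed
  have other: "wcase w a b e f \<noteq> 0" if "w \<in> set other_windows" for w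
    using that pos unfolding other_windows_def s by (auto simp: wcase_eq_0)
  have "win_rest (U ?x ?y) (U ?z ?t) (d ?x) (d ?z) (d ?y) (d ?t) \<noteq> 0"
    unfolding win_rest_eq_0 U1 U2 d1 d2 using pos b8 other by auto
  then show ?thesis unfolding rest_def AK_adjc[OF adj(1)] AK_adjc[OF adj(2)] AK_adjc[OF adj(3)] by simp
qed

text \<open>Contributions are nonnegative, old ones are kept, and the left turn of the new cycle
  adds a positive one. Its four labels have positive mass for every choice of cycles, so the
  integral grows strictly.\<close>

lemma rest_stat_neq:
  assumes 1: "cycles \<pi>" and 2: "cycles \<pi>" and sub: "K \<subseteq> L" and c: "c \<in> L" "c \<notin> K"
  shows "stat 4 path_edges (at_path win_rest) (stepg \<pi> (AK K)) \<noteq> stat 4 path_edges (at_path win_rest) (stepg \<pi> (AK L))"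
proof
  assume eq: "stat 4 path_edges (at_path win_rest) (stepg \<pi> (AK K)) = stat 4 path_edges (at_path win_rest) (stepg \<pi> (AK L))"
  interpret k: cycles \<pi> K by (rule 1)
  interpret L: cycles \<pi> L by (rule 2)
  let ?g = "\<lambda>r x. r (\<pi> (x 0)) (\<pi> (x 1)) (\<pi> (x 2)) (\<pi> (x (3::nat))) :: real"
  have sk: "(\<Prod>(u, v)\<in>path_edges. stepg \<pi> (AK K) (x u) (x v)) * at_path win_rest (stepg \<pi> (AK K)) x = ?g k.rest x" for x
    unfolding k.at_path_label k.rest_def ..
  have sL: "(\<Prod>(u, v)\<in>path_edges. stepg \<pi> (AK L) (x u) (x v)) * at_path win_rest (stepg \<pi> (AK L)) x = ?g L.rest x" for x
    unfolding L.at_path_label L.rest_def ..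
  have ik: "integrable (points 4) (?g k.rest)" and iL: "integrable (points 4) (?g L.rest)"
    using stat_integrable[OF star_poly_win_rest k.graphon_step path_edges] stat_integrable[OF star_poly_win_rest L.graphon_step path_edges]
    unfolding sk sL by blast+
  have nnL: "0 \<le> L.rest x z y t" for x z y t
    unfolding L.rest_def using L.A01 by (intro mult_nonneg_nonneg win_rest_nonneg) auto
  have le: "0 \<le> L.rest x z y t - k.rest x z y t" for x z y t
  proof (cases "k.rest x z y t = 0")
    case True then show ?thesis using nnL[of x z y t] by simp
  next
    case False from rest_mono[OF 1 2 sub this] show ?thesis by simp
  qed
  have "(\<integral>x. ?g L.rest x - ?g k.rest x \<partial>points 4) = 0"
    using eq unfolding stat_def sk sL by (subst Bochner_Integration.integral_diff[OF iL ik]) simp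
  then have AE: "AE x in points 4. ?g L.rest x - ?g k.rest x = 0"
    using integral_nonneg_eq_0_iff_AE[OF Bochner_Integration.integrable_diff[OF iL ik]] le by simp
  define \<phi> where "\<phi> n = (if n = 0 then enc c (4*c+16) else if n = 1 then enc c (4*c+17) else if n = 2 then enc c 0 else enc c 1)" for n :: nat
  have pos: "lmass \<pi> (\<phi> n) > 0" for n
    unfolding \<phi>_def using k.mE[of "4*c+16" c] k.mE[of "4*c+17" c] k.mE[of 0 c] k.mE[of 1 c] cW_pos by simp
  obtain x where x: "\<forall>n<4. \<pi> (x n) = \<phi> n" "?g L.rest x - ?g k.rest x = 0"
    using AE_points_labels[OF L.pm0 AE, of \<phi>, OF pos] by blast
  have xe: "\<pi> (x 0) = enc c (4*c+16)" "\<pi> (x 1) = enc c (4*c+17)" "\<pi> (x 2) = enc c 0" "\<pi> (x 3) = enc c 1"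
    using x(1) by (simp_all add: \<phi>_def)
  have "\<not> adjc K (enc c (4*c+16)) (enc c (4*c+17))" unfolding adjc_def enc_eq using c(2) by blast
  then have "AK K (enc c (4*c+16)) (enc c (4*c+17)) = 0" using AK_ne_0 enc_ne_1 by blast
  then have "?g k.rest x = 0" unfolding xe k.rest_def by simp
  then show False using x(2) L.rest_left_turn[OF c(1)] unfolding xe by simp
qed

text \<open>Lower cuts of the rationals form an uncountable chain of subsets of a countable set.
  Along a chain the statistic is injective, so its values cannot all lie in the countable set of
  rationals.\<close>

theorem forced_exists: "\<exists>W. forced W"
proof -
  obtain \<pi> where \<pi>: "\<pi> \<in> unit_space \<rightarrow>\<^sub>M count_space UNIV" "lmass \<pi> 1 = 1/2"
    "\<forall>c p. p < 4*c+18 \<longrightarrow> lmass \<pi> (enc c p) = cW c p" by (rule cycle_labels)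
  have cyc: "cycles \<pi>" by unfold_locales (use \<pi> in auto)
  define s where "s K = stat 4 path_edges (at_path win_rest) (stepg \<pi> (AK K))" for K
  \<comment> \<open>Cycle numbers enumerate the rationals, and a rational between \<open>x\<close>
    and \<open>y\<close> gives a cycle that belongs to the larger set only.\<close>
  define C where "C x = {c. real_of_rat (nat_to_rat_surj c) < x}" for x
  have ne: "s (C x) \<noteq> s (C y)" if xy: "x < y" for x y
  proof -
    obtain q where q: "x < real_of_rat q" "real_of_rat q < y" using of_rat_dense[OF xy] by blast
    obtain c where c: "nat_to_rat_surj c = q" using surj_nat_to_rat_surj by (metis surjD)
    show ?thesis unfolding s_def
      by (rule rest_stat_neq[OF cyc cyc, of _ _ c]) (use q c xy in \<open>auto simp: C_def\<close>)
  qed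
  have inj: "inj (\<lambda>x. s (C x))"
    by (rule linorder_injI) (use ne in blast)
  have "\<exists>K. s K \<notin> \<rat>"
  proof (rule ccontr)
    assume "\<nexists>K. s K \<notin> \<rat>"
    then have "range (\<lambda>x. s (C x)) \<subseteq> \<rat>" by blast
    then have "countable (range (\<lambda>x. s (C x)))" using countable_rat countable_subset by blast
    then have "countable (UNIV :: real set)" using countable_image_inj_on[OF _ inj] by blast
    then show False using uncountable_UNIV_real by blast
  qed
  then obtain K where "s K \<notin> \<rat>" by blast
  then have "forced (stepg \<pi> (AK K))" using cycles.forced_cycles[OF cyc] unfolding s_def by blast
  then show ?thesis by blast
qed

section \<open>Transfer to arbitrary forced graphons and conclusion\<close>

theorem forced_entropy_forcibility:
  assumes f: "forced W"
  shows "graphon_entropy W = - (ln 2) / 4 \<and> \<not> finitely_forcible W"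
proof -
  have W: "graphon W" using f by (simp add: forced_def)
  show ?thesis
  proof (rule graphon_discretization[OF W forced_pairs_twins[OF forced_imp_forced_pairs[OF f]]])
    fix \<pi> :: "real \<Rightarrow> nat" and A
    assume p: "\<pi> \<in> unit_space \<rightarrow>\<^sub>M count_space UNIV"
      and As: "\<And>i j. A i j = A j i" and Ab: "\<And>i j. 0 \<le> A i j \<and> A i j \<le> (1::real)"
      and eq: "AE p in usq. W (fst p) (snd p) = A (\<pi> (fst p)) (\<pi> (snd p))"
      and tf: "\<And>i j. lmass \<pi> i > 0 \<Longrightarrow> lmass \<pi> j > 0 \<Longrightarrow> (\<And>k. lmass \<pi> k > 0 \<Longrightarrow> A i k = A j k) \<Longrightarrow> i = j"
    \<comment> \<open>Entries at null labels are reset to 0. This changes the step graphon on a null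
      set only and supplies the exact rows used for crossing over.\<close>
    define B where "B i j = (if lmass \<pi> i = 0 \<or> lmass \<pi> j = 0 then 0 else A i j)" for i j
    have Bs: "B i j = B j i" for i j unfolding B_def using As[of i j] by (simp add: disj_commute)
    have Bb: "0 \<le> B i j \<and> B i j \<le> 1" for i j unfolding B_def using Ab[of i j] by simp
    have BA: "B i j = A i j" if "lmass \<pi> i > 0" "lmass \<pi> j > 0" for i j using that by (simp add: B_def)
    interpret s: step_graph \<pi> B by unfold_locales (rule p, rule Bs, rule Bb)
    have mm: "Measurable.pred unit_space (\<lambda>a. lmass \<pi> (\<pi> a) > 0)" by (rule measurable_compose[OF p]) simp
    have eqB: "AE q in usq. W (fst q) (snd q) = stepg \<pi> B (fst q) (snd q)"
      using eq AE_usq_fst[OF s.AE_label_pos mm] AE_usq_snd[OF s.AE_label_pos mm]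
      by eventually_elim (simp only: stepg_def BA)
    have dens: "graph_density H W = graph_density H (stepg \<pi> B)" for H
      by (rule graph_density_cong_AE[OF W s.graphon_step eqB])
    have fB: "forced (stepg \<pi> B)"
    proof -
      obtain M where M: "\<forall>W W'. graphon W \<longrightarrow> graphon W' \<longrightarrow> agree M W W' \<longrightarrow> forced W' \<longrightarrow> forced W"
        using forced_determined by (elim exE)
      have "agree M (stepg \<pi> B) W" by (simp add: agree_def dens)
      then show ?thesis using M[rule_format, OF s.graphon_step W] f by simp
    qed
    interpret F: forced_step \<pi> B
    proof (unfold_locales, rule fB)
      fix i j assume pos: "lmass \<pi> i > 0" "lmass \<pi> j > 0" and r: "\<And>k. lmass \<pi> k > 0 \<Longrightarrow> B i k = B j k"
      show "i = j"
      proof (rule tf[OF pos])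
        fix k assume k: "lmass \<pi> k > 0"
        show "A i k = A j k" using r[OF k] unfolding BA[OF pos(1) k] BA[OF pos(2) k] .
      qed
    qed
    have "graphon_entropy W = graphon_entropy (stepg \<pi> B)"
      unfolding graphon_entropy_def case_prod_unfold
    proof (rule integral_cong_AE)
      note [measurable] = graphon_measurable[OF W] graphon_measurable[OF s.graphon_step]
      show "(\<lambda>p. W (fst p) (snd p) * ln (W (fst p) (snd p)) + (1 - W (fst p) (snd p)) * ln (1 - W (fst p) (snd p)))
          \<in> borel_measurable usq" by measurable
      show "(\<lambda>p. stepg \<pi> B (fst p) (snd p) * ln (stepg \<pi> B (fst p) (snd p)) +
          (1 - stepg \<pi> B (fst p) (snd p)) * ln (1 - stepg \<pi> B (fst p) (snd p))) \<in> borel_measurable usq" by measurable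
      show "AE p in usq. W (fst p) (snd p) * ln (W (fst p) (snd p)) + (1 - W (fst p) (snd p)) * ln (1 - W (fst p) (snd p)) =
          stepg \<pi> B (fst p) (snd p) * ln (stepg \<pi> B (fst p) (snd p)) +
          (1 - stepg \<pi> B (fst p) (snd p)) * ln (1 - stepg \<pi> B (fst p) (snd p))"
        using eqB by eventually_elim simp
    qed
    \<comment> \<open>Forcibility depends on a graphon only through its densities.\<close>
    moreover have "finitely_forcible W = finitely_forcible (stepg \<pi> B)"
      unfolding finitely_forcible_def weakly_isomorphic_def dens ..
    moreover have "\<not> finitely_forcible (stepg \<pi> B)"
      by (rule F.not_finitely_forcible) (simp add: B_def)
    ultimately show ?thesis using F.entropy by simp
  qed
qed

theorem theorem29:
  shows "\<exists>(\<W> :: (real \<Rightarrow> real \<Rightarrow> real) set) (l :: nat) (H :: nat \<Rightarrow> fgraph) (d :: nat \<Rightarrow> real).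
    \<W> \<noteq> {} \<and> (\<forall>W\<in>\<W>. graphon W) \<and> (\<forall>i\<in>{1..l}. finite_graph (H i)) \<and>
    (\<forall>W. graphon W \<longrightarrow>
       ((\<exists>W'\<in>\<W>. weakly_isomorphic W W') \<longleftrightarrow> (\<forall>i\<in>{1..l}. graph_density (H i) W = d i))) \<and>
    (\<exists>h. h \<noteq> 0 \<and> (\<forall>W\<in>\<W>. graphon_entropy W = h)) \<and>
    (\<forall>W\<in>\<W>. \<not> finitely_forcible W)"
proof -
  obtain W0 where f0: "forced W0" using forced_exists by (elim exE)
  have g0: "graphon W0" using f0 by (simp add: forced_def)
  obtain M where M: "\<forall>W W'. graphon W \<longrightarrow> graphon W' \<longrightarrow> agree M W W' \<longrightarrow> forced W' \<longrightarrow> forced W"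
    using forced_determined by (elim exE)
  \<comment> \<open>Taking all graphons with the prescribed densities makes one direction of (i)
    trivial, with the graphon itself as witness, and the other immediate, since weak isomorphism
    preserves densities.\<close>
  define \<W> where "\<W> = {W. graphon W \<and> agree M W W0}"
  define S where "S = (\<Union>n\<in>{..M}. std_graph n ` Pow (vpairs n))"
  have "finite S" unfolding S_def by (intro finite_UN_I finite_imageI) auto
  then obtain H where H: "bij_betw H {1..card S} S" using ex_bij_betw_nat_finite_1 by blast
  have HS: "H ` {1..card S} = S" by (rule bij_betw_imp_surj_on[OF H])
  have fg: "finite_graph F" if FS: "F \<in> S" for F
  proof -
    obtain n E where F: "F = std_graph n E" and E: "E \<in> Pow (vpairs n)" using FS unfolding S_def by blast
    show ?thesis unfolding F using E by (auto simp: finite_graph_def std_graph_def vpairs_def)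
  qed
  have ag: "agree M W W0 \<longleftrightarrow> (\<forall>i\<in>{1..card S}. graph_density (H i) W = graph_density (H i) W0)" for W
  proof -
    have "agree M W W0 \<longleftrightarrow> (\<forall>F\<in>H ` {1..card S}. graph_density F W = graph_density F W0)"
      unfolding HS by (auto simp: agree_def S_def)
    also have "\<dots> \<longleftrightarrow> (\<forall>i\<in>{1..card S}. graph_density (H i) W = graph_density (H i) W0)" by blast
    finally show ?thesis .
  qed
  have fW: "forced W" if "W \<in> \<W>" for W
    using M[rule_format, of W W0] that g0 f0 unfolding \<W>_def by blast
  have W0: "W0 \<in> \<W>" using g0 by (simp add: \<W>_def agree_def)
  show ?thesis
  proof (intro exI[of _ \<W>] exI[of _ "card S"] exI[of _ H] exI[of _ "\<lambda>i. graph_density (H i) W0"] conjI)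
    show "\<W> \<noteq> {}" using W0 by blast
    show "\<forall>W\<in>\<W>. graphon W" by (simp add: \<W>_def)
    show "\<forall>i\<in>{1..card S}. finite_graph (H i)" using fg HS by blast
    show "\<forall>W. graphon W \<longrightarrow> ((\<exists>W'\<in>\<W>. weakly_isomorphic W W') \<longleftrightarrow>
        (\<forall>i\<in>{1..card S}. graph_density (H i) W = graph_density (H i) W0))"
    proof (intro allI impI)
      fix W assume W: "graphon W"
      show "(\<exists>W'\<in>\<W>. weakly_isomorphic W W') \<longleftrightarrow> (\<forall>i\<in>{1..card S}. graph_density (H i) W = graph_density (H i) W0)"
        unfolding ag[symmetric]
      proof
        assume "\<exists>W'\<in>\<W>. weakly_isomorphic W W'"
        then obtain W' where W': "W' \<in> \<W>" "weakly_isomorphic W W'" by blast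
        have "agree M W W'" by (rule weakly_isomorphic_agree[OF W'(2)])
        moreover have "agree M W' W0" using W'(1) by (simp add: \<W>_def)
        ultimately show "agree M W W0" by (simp add: agree_def)
      next
        assume "agree M W W0"
        then have "W \<in> \<W>" using W by (simp add: \<W>_def)
        moreover have "weakly_isomorphic W W" by (simp add: weakly_isomorphic_def)
        ultimately show "\<exists>W'\<in>\<W>. weakly_isomorphic W W'" by blast
      qed
    qed
    show "\<exists>h. h \<noteq> 0 \<and> (\<forall>W\<in>\<W>. graphon_entropy W = h)"
    proof (intro exI[of _ "- (ln 2) / 4"] conjI ballI)
      show "- (ln 2) / 4 \<noteq> (0::real)" by simp
      show "graphon_entropy W = - (ln 2) / 4" if "W \<in> \<W>" for W
        using forced_entropy_forcibility[OF fW[OF that]] by (rule conjunct1)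
    qed
    show "\<forall>W\<in>\<W>. \<not> finitely_forcible W"
    proof
      fix W assume "W \<in> \<W>"
      from forced_entropy_forcibility[OF fW[OF this]] show "\<not> finitely_forcible W" by (rule conjunct2)
    qed
  qed
qed

end
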